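(* Let $q$ be a prime power, let $m$ and $j$ be fixed positive integers, and let $\epsilon=\pm$. Suppose that $$N \geq \max\bigl( 3j^2+j +2m+10,\;2j^2+4m+5\bigr),$$ that $\chi$ is an irreducible complex character of $G=\mathrm{GL}^\epsilon_N(q)$ of true level $j$, and that $g\in G$ has support $m$ and primary eigenvalue $\lambda$. Then $$\Bigl|\frac{(\epsilon q)^{mj}\chi(g)}{\chi(1)}\cdot \frac{\overline{\chi(\lambda \cdot \mathrm{Id}_V)}}{\chi(1)}-1\Bigr| < q^{-N/2},$$ where $V$ is the natural module of $G$.
   Context: $\mathrm{GL}^{+}_N(q)=\mathrm{GL}(N,\mathbb{F}_q)$ with natural module $V=\mathbb{F}_q^N$, and $\mathrm{GL}^{-}_N(q)=\mathrm{GU}_N(q)=\mathrm{GU}(N,\mathbb{F}_{q^2})$, the general unitary group, with natural module $V=\mathbb{F}_{q^2}^N$. In formulas the sign $\epsilon$ is interpreted as $\pm1$. True level: let $\tau$ be the (reducible Weil) character of $G=\mathrm{GL}^\epsilon_N(q)$ given by $\tau(g)=\epsilon^N(\epsilon q)^{\dim\ker(g-1)}$ (kernel taken on $V$). The true level of $\chi\in\mathrm{Irr}(G)$ is the smallest integer $j\ge 0$ such that $\chi$ is an irreducible constituent of $\tau^j$. Support: for an $N\times N$ matrix $g$ over a field $\mathbb{F}$, the support of $g$ is the codimension of its largest eigenspace over $\overline{\mathbb{F}}$. When the support of $g$ is less than $N/2$, there is a unique eigenvalue $\lambda$ whose eigenspace has dimension $N$ minus the support of $g$; it is called the primary eigenvalue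 of $g$. (For $g\in \mathrm{GL}^\epsilon_N(q)$ it satisfies $\lambda^{q-\epsilon}=1$, so $\lambda\cdot\mathrm{Id}_V\in G$.) *)

theory Defs
  imports
    Complex_Main
    "HOL-Library.Cardinality"
    "HOL-Algebra.Algebraic_Closure_Type"
    "HOL-Number_Theory.Prime_Powers"
    "Jordan_Normal_Form.Matrix_Kernel"
begin

definition GL_mat :: "nat \<Rightarrow> 'a::field mat monoid" where
  "GL_mat n = \<lparr>carrier = {A \<in> carrier_mat n n. invertible_mat A}, monoid.mult = (*), one = 1\<^sub>m n\<rparr>"

text \<open>
  The unitary group of the standard Hermitian form
  \<open>h(u, v) = (\<Sum>i<n. u\<^sub>i * v\<^sub>i ^ q)\<close> on column vectors over the field with \<open>q\<^sup>2\<close> elements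
  (all nondegenerate Hermitian forms of rank \<open>n\<close> over this field are equivalent):
  \<open>h(A u, A v) = h(u, v)\<close> for all \<open>u\<close>, \<open>v\<close> is the stated matrix identity.
\<close>

definition GU_mat :: "nat \<Rightarrow> nat \<Rightarrow> 'a::field mat monoid" where
  "GU_mat q n = (GL_mat n)\<lparr>carrier :=
     {A \<in> carrier (GL_mat n). transpose_mat A * map_mat (\<lambda>x. x ^ q) A = 1\<^sub>m n}\<rparr>"

text \<open>
  The group \<open>GL\<^sup>\<epsilon>(n, q)\<close> for \<open>\<epsilon> = 1\<close> or \<open>\<epsilon> = -1\<close>. The type \<open>'a\<close> is the field of matrix entries and is
  meant to have \<open>q\<close> elements if \<open>\<epsilon> = 1\<close> and \<open>q\<^sup>2\<close> elements if \<open>\<epsilon> = -1\<close>.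
\<close>

definition GL_eps :: "int \<Rightarrow> nat \<Rightarrow> nat \<Rightarrow> 'a::field mat monoid" where
  "GL_eps \<epsilon> q n = (if \<epsilon> = 1 then GL_mat n else GU_mat q n)"


definition mat_trace :: "'a::comm_monoid_add mat \<Rightarrow> 'a" where
  "mat_trace A = (\<Sum>i<dim_row A. A $$ (i, i))"

definition complex_rep :: "('g, 'b) monoid_scheme \<Rightarrow> nat \<Rightarrow> ('g \<Rightarrow> complex mat) \<Rightarrow> bool" where
  "complex_rep G d \<rho> \<longleftrightarrow> \<rho> \<in> hom G (GL_mat d)"

definition irreducible_rep :: "('g, 'b) monoid_scheme \<Rightarrow> nat \<Rightarrow> ('g \<Rightarrow> complex mat) \<Rightarrow> bool" where
  "irreducible_rep G d \<rho> \<longleftrightarrow> complex_rep G d \<rho> \<and> d > 0 \<and>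
     (\<forall>W. VectorSpace.subspace class_ring W (module_vec TYPE(complex) d) \<and>
          (\<forall>g\<in>carrier G. \<forall>w\<in>W. \<rho> g *\<^sub>v w \<in> W)
          \<longrightarrow> W = {0\<^sub>v d} \<or> W = carrier_vec d)"

text \<open>Class functions are total functions; only their values on the carrier of the group matter.\<close>

definition irreducible_character :: "('g, 'b) monoid_scheme \<Rightarrow> ('g \<Rightarrow> complex) \<Rightarrow> bool" where
  "irreducible_character G \<chi> \<longleftrightarrow>
     (\<exists>d \<rho>. irreducible_rep G d \<rho> \<and> (\<forall>g\<in>carrier G. \<chi> g = mat_trace (\<rho> g)))"

definition char_inner ::
  "('g, 'b) monoid_scheme \<Rightarrow> ('g \<Rightarrow> complex) \<Rightarrow> ('g \<Rightarrow> complex) \<Rightarrow> complex" where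
  "char_inner G \<theta> \<chi> = (\<Sum>g\<in>carrier G. \<theta> g * cnj (\<chi> g)) / of_nat (Coset.order G)"

definition irreducible_constituent ::
  "('g, 'b) monoid_scheme \<Rightarrow> ('g \<Rightarrow> complex) \<Rightarrow> ('g \<Rightarrow> complex) \<Rightarrow> bool" where
  "irreducible_constituent G \<chi> \<theta> \<longleftrightarrow> irreducible_character G \<chi> \<and> char_inner G \<theta> \<chi> \<noteq> 0"


definition weil_char :: "int \<Rightarrow> nat \<Rightarrow> nat \<Rightarrow> 'a::field mat \<Rightarrow> complex" where
  "weil_char \<epsilon> q n g = of_int \<epsilon> ^ n * of_int (\<epsilon> * int q) ^ kernel_dim (g - 1\<^sub>m n)"

definition has_true_level :: "int \<Rightarrow> nat \<Rightarrow> nat \<Rightarrow> ('a::field mat \<Rightarrow> complex) \<Rightarrow> nat \<Rightarrow> bool" where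
  "has_true_level \<epsilon> q n \<chi> j \<longleftrightarrow>
     irreducible_constituent (GL_eps \<epsilon> q n) \<chi> (\<lambda>g. weil_char \<epsilon> q n g ^ j) \<and>
     (\<forall>i<j. \<not> irreducible_constituent (GL_eps \<epsilon> q n) \<chi> (\<lambda>g. weil_char \<epsilon> q n g ^ i))"


definition eigenspace_dim :: "'a::field mat \<Rightarrow> 'a alg_closure \<Rightarrow> nat" where
  "eigenspace_dim A c = kernel_dim (map_mat to_ac A - c \<cdot>\<^sub>m 1\<^sub>m (dim_row A))"

definition mat_support :: "'a::field mat \<Rightarrow> nat" where
  "mat_support A = dim_row A - Max (range (eigenspace_dim A))"

definition primary_eigenvalue :: "'a::field mat \<Rightarrow> 'a alg_closure \<Rightarrow> bool" where
  "primary_eigenvalue A c \<longleftrightarrow>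
     2 * mat_support A < dim_row A \<and> eigenspace_dim A c = dim_row A - mat_support A"

end

theory Submission
  imports Defs "Jordan_Normal_Form.Spectral_Radius" "HOL-Library.Function_Algebras" "HOL-Number_Theory.Residues"
begin

text \<open>
  After division by the primary eigenvalue, \<open>g\<close> fixes a subspace of codimension \<open>m\<close>, and the claim is that
  \<open>(\<epsilon> q)\<^sup>m\<^sup>j \<chi>(g)/\<chi>(1)\<close> is close to one. Put \<open>c = (\<Sum>x. cnj (\<chi> x) x)\<close>.

  For \<open>\<epsilon> = 1\<close> let \<open>c\<close> act on the functions on \<open>V\<^sup>j\<close>. Its matrix vanishes on the diagonal at dependent tuples,
  is constant on the diagonal at independent ones, and decays with the number of vectors of \<open>X'\<close> that leave
  the span of \<open>X\<close>, because \<open>\<chi>\<close> does not occur in \<open>\<tau>\<^sup>j\<^sup>-\<^sup>1\<close>. The trace of \<open>c g\<close> is \<open>\<chi>(g)/\<chi>(1)\<close> times that of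
  \<open>c\<close>, and is dominated by the tuples fixed by \<open>g\<close>.

  For \<open>\<epsilon> = -1\<close> the Weil representation lives in the twisted group algebra of \<open>V\<^sup>j\<close>, where \<open>x\<close> becomes a
  function supported on \<open>((x - 1)V)\<^sup>j\<close>. Now \<open>\<chi>(g)/\<chi>(1)\<close> is a signed power of \<open>q\<close> times a sum of \<open>c(X)/c(0)\<close>
  with unimodular weights over \<open>((g - 1)V)\<^sup>j\<close>, and \<open>X = 0\<close> contributes the main term. As \<open>\<chi>\<close> does not occur
  in \<open>\<tau>\<^sup>j\<^sup>-\<^sup>2\<close>, the element \<open>c\<close> is annihilated by the idempotents of isotropic lines. This bounds the sums of \<open>c\<close>
  over tuples with given row space and Gram matrix by square root cancellation, and Witt's theorem turns
  this into a bound for \<open>c(X)\<close> that decays exponentially in the rank of \<open>X\<close>.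
\<close>

section \<open>Characters of finite groups\<close>

text \<open>Only for \<epsilon> = 1 is tau a permutation character. For \<epsilon> = -1 its values
  are signed powers of q and merely tau^2 is the permutation character of V, so odd powers of tau
  have no permutation model; the signs have to come out of Gauss sums, which leads to the twisted
  group algebra. There an isotropic direction in F^j uses up two Weil factors, because the
  normalised trace w(x) of a Weil operator satisfies w(x)^2 |(x - 1)V| = 1; hence tau^(j-2) takes
  the place of tau^(j-1). Neither \<chi>(1) nor any norm of c is ever computed: everything is
  measured against a diagonal entry of c or its coefficient at zero, and positivity and
  Cauchy-Schwarz bounds come from c being self-adjoint with c c = \<kappa> c. In both cases the
  leading error term is 2 q^(2m+2j-N). It is at most 72/100 q^(-N/2) once 4m + 4j + 3 \<le> N, which
  follows from the second bound on N by 2j \<le> j^2 + 1. The quadratic terms of the first bound pay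
  for the loss q^(r^2+r) in unitary orbit sizes and for the tuples of lower rank in the induction on
  the rank.\<close>

lemma det_nonzero_inverse:
  assumes "A \<in> carrier_mat n n" "det (A :: 'a::field mat) \<noteq> 0"
  obtains B where "B \<in> carrier_mat n n" "A * B = 1\<^sub>m n" "B * A = 1\<^sub>m n"
proof -
  have "A \<in> Units (ring_mat TYPE('a) n ())" using det_non_zero_imp_unit[OF assms] .
  then have "\<exists>B\<in>carrier_mat n n. B * A = 1\<^sub>m n \<and> A * B = 1\<^sub>m n"
    by (simp add: Units_def ring_mat_def)
  then show ?thesis using that by blast
qed

lemma carrier_GL_mat:
  "A \<in> carrier (GL_mat n) \<longleftrightarrow> A \<in> carrier_mat n n \<and> det (A :: 'a::field mat) \<noteq> 0"
proof
  assume "A \<in> carrier (GL_mat n)"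
  then have A: "A \<in> carrier_mat n n" and "invertible_mat A" by (auto simp: GL_mat_def)
  then obtain B where "inverts_mat A B" "inverts_mat B A" unfolding invertible_mat_def by blast
  then have B: "A * B = 1\<^sub>m n" "B * A = 1\<^sub>m (dim_row B)" using A by (simp_all add: inverts_mat_def)
  have dB: "B \<in> carrier_mat n n"
    using A arg_cong[OF B(1), of dim_col] arg_cong[OF B(2), of dim_col] by (intro carrier_matI) auto
  have "det A * det B = 1" using det_mult[OF A dB] B(1) by simp
  then show "A \<in> carrier_mat n n \<and> det A \<noteq> 0" using A by auto
next
  assume A: "A \<in> carrier_mat n n \<and> det A \<noteq> 0"
  then obtain B where B: "B \<in> carrier_mat n n" "A * B = 1\<^sub>m n" "B * A = 1\<^sub>m n"
    using det_nonzero_inverse by blast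
  then have "inverts_mat A B \<and> inverts_mat B A" using A by (auto simp: inverts_mat_def)
  then show "A \<in> carrier (GL_mat n)"
    using A unfolding GL_mat_def invertible_mat_def by (auto intro!: exI[of _ B])
qed

lemma GL_mat_inverse:
  assumes "A \<in> carrier (GL_mat n :: 'a::field mat monoid)"
  obtains B where "B \<in> carrier (GL_mat n)" "A * B = 1\<^sub>m n" "B * A = 1\<^sub>m n"
proof -
  have A: "A \<in> carrier_mat n n" "det A \<noteq> 0" using assms by (auto simp: carrier_GL_mat)
  then obtain B where B: "B \<in> carrier_mat n n" "A * B = 1\<^sub>m n" "B * A = 1\<^sub>m n"
    using det_nonzero_inverse by blast
  moreover have "det B \<noteq> 0" using det_mult[OF A(1) B(1)] B(2) by auto
  ultimately show ?thesis using that by (auto simp: carrier_GL_mat)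
qed

lemma GL_mat_simps [simp]:
  "A \<otimes>\<^bsub>GL_mat n\<^esub> B = A * B" "\<one>\<^bsub>GL_mat n\<^esub> = 1\<^sub>m n"
  by (simp_all add: GL_mat_def)

lemma group_GL_mat: "group (GL_mat n :: 'a::field mat monoid)"
proof (rule groupI)
  fix A :: "'a mat" assume "A \<in> carrier (GL_mat n)"
  then show "\<exists>B\<in>carrier (GL_mat n). B \<otimes>\<^bsub>GL_mat n\<^esub> A = \<one>\<^bsub>GL_mat n\<^esub>"
    by (rule GL_mat_inverse) (rule bexI, simp_all)
  show "\<one>\<^bsub>GL_mat n\<^esub> \<otimes>\<^bsub>GL_mat n\<^esub> A = A"
    using \<open>A \<in> carrier (GL_mat n)\<close> by (auto simp: carrier_GL_mat)
next
  fix A B :: "'a mat" assume "A \<in> carrier (GL_mat n)" "B \<in> carrier (GL_mat n)"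
  then show "A \<otimes>\<^bsub>GL_mat n\<^esub> B \<in> carrier (GL_mat n)"
    by (auto simp: carrier_GL_mat det_mult[of A n B])
next
  fix A B C :: "'a mat"
  assume "A \<in> carrier (GL_mat n)" "B \<in> carrier (GL_mat n)" "C \<in> carrier (GL_mat n)"
  then show "A \<otimes>\<^bsub>GL_mat n\<^esub> B \<otimes>\<^bsub>GL_mat n\<^esub> C = A \<otimes>\<^bsub>GL_mat n\<^esub> (B \<otimes>\<^bsub>GL_mat n\<^esub> C)"
    by (simp add: carrier_GL_mat assoc_mult_mat[of A n n B n C n])
qed (simp add: carrier_GL_mat)

lemma mat_trace_mult_commute:
  fixes A B :: "'a::comm_semiring_0 mat"
  assumes "A \<in> carrier_mat n n" "B \<in> carrier_mat n n"
  shows "mat_trace (A * B) = mat_trace (B * A)"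
proof -
  have "mat_trace (A * B) = (\<Sum>i<n. \<Sum>k<n. A $$ (i, k) * B $$ (k, i))"
    using assms by (simp add: mat_trace_def scalar_prod_def atLeast0LessThan)
  also have "\<dots> = (\<Sum>k<n. \<Sum>i<n. B $$ (k, i) * A $$ (i, k))"
    by (subst sum.swap) (simp add: mult.commute)
  also have "\<dots> = mat_trace (B * A)"
    using assms by (simp add: mat_trace_def scalar_prod_def atLeast0LessThan)
  finally show ?thesis .
qed

lemma sum_swap3:
  "(\<Sum>i\<in>A. \<Sum>g\<in>C. \<Sum>k\<in>D. f i g k) = (\<Sum>g\<in>C. \<Sum>k\<in>D. \<Sum>i\<in>A. f i g k)"
proof -
  have "(\<Sum>i\<in>A. \<Sum>g\<in>C. \<Sum>k\<in>D. f i g k) = (\<Sum>g\<in>C. \<Sum>i\<in>A. \<Sum>k\<in>D. f i g k)"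
    by (rule sum.swap)
  also have "\<dots> = (\<Sum>g\<in>C. \<Sum>k\<in>D. \<Sum>i\<in>A. f i g k)"
    by (intro sum.cong refl sum.swap)
  finally show ?thesis .
qed

section \<open>Irreducible matrix representations\<close>

locale irrep =
  fixes G :: "('g, 'b) monoid_scheme" (structure) and d :: nat and \<rho> :: "'g \<Rightarrow> complex mat"
  assumes group: "group G" and fin: "finite (carrier G)" and irr: "irreducible_rep G d \<rho>"
begin

sublocale group G by (rule group)

lemma d_pos: "d > 0" using irr by (simp add: irreducible_rep_def)

lemma rho_hom: "\<rho> \<in> hom G (GL_mat d)"
  using irr by (simp add: irreducible_rep_def complex_rep_def)

lemma rho_carrier [simp]: "g \<in> carrier G \<Longrightarrow> \<rho> g \<in> carrier_mat d d"
  using rho_hom by (auto simp: hom_def GL_mat_def)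

lemma rho_dim [simp]: "g \<in> carrier G \<Longrightarrow> dim_row (\<rho> g) = d" "g \<in> carrier G \<Longrightarrow> dim_col (\<rho> g) = d"
  using rho_carrier[of g] by (auto simp del: rho_carrier)

lemma rho_mult: "g \<in> carrier G \<Longrightarrow> h \<in> carrier G \<Longrightarrow> \<rho> (g \<otimes> h) = \<rho> g * \<rho> h"
  using rho_hom by (auto simp: hom_def GL_mat_def)

lemma rho_one: "\<rho> \<one> = 1\<^sub>m d"
proof -
  interpret group_hom G "GL_mat d" \<rho>
    by (simp add: group_hom_def group_hom_axioms_def group rho_hom group_GL_mat)
  show ?thesis using hom_one by (simp add: GL_mat_def)
qed

lemma rho_mult_index:
  assumes "g \<in> carrier G" "h \<in> carrier G" "i < d" "j < d"
  shows "\<rho> (g \<otimes> h) $$ (i, j) = (\<Sum>k<d. \<rho> g $$ (i, k) * \<rho> h $$ (k, j))"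
  using assms by (simp add: rho_mult scalar_prod_def atLeast0LessThan)

abbreviation \<chi> where "\<chi> g \<equiv> mat_trace (\<rho> g)"

lemma chi_one: "\<chi> \<one> = of_nat d"
  by (simp add: rho_one mat_trace_def)

lemma chi_class: "g \<in> carrier G \<Longrightarrow> h \<in> carrier G \<Longrightarrow> \<chi> (g \<otimes> h) = \<chi> (h \<otimes> g)"
  unfolding rho_mult by (rule mat_trace_mult_commute) auto

lemma schur:
  assumes A: "A \<in> carrier_mat d d" and comm: "\<And>g. g \<in> carrier G \<Longrightarrow> A * \<rho> g = \<rho> g * A"
  obtains c where "A = c \<cdot>\<^sub>m 1\<^sub>m d"
proof -
  have "spectrum A \<noteq> {}" using spectrum_non_empty[OF A d_pos] .
  then obtain c where "eigenvalue A c" by (auto simp: spectrum_def)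
  then obtain v where v: "v \<in> carrier_vec d" "v \<noteq> 0\<^sub>v d" "A *\<^sub>v v = c \<cdot>\<^sub>v v"
    using A by (auto simp: eigenvalue_def eigenvector_def)
  define W where "W = {v \<in> carrier_vec d. A *\<^sub>v v = c \<cdot>\<^sub>v v}"
  have "VectorSpace.subspace class_ring W (module_vec TYPE(complex) d)"
  proof (unfold subspace_def, intro conjI)
    show "vectorspace class_ring (module_vec TYPE(complex) d)"
      by (rule vec_vs)
    have m: "module class_ring (module_vec TYPE(complex) d)"
      by (rule vec_module)
    show "submodule class_ring W (module_vec TYPE(complex) d)"
    proof (rule submodule.intro[OF m])
      show "W \<subseteq> carrier (module_vec TYPE(complex) d)" by (auto simp: W_def module_vec_simps)
      show "\<zero>\<^bsub>module_vec TYPE(complex) d\<^esub> \<in> W" using A by (auto simp: W_def module_vec_simps intro!: eq_vecI)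
      fix v w assume "v \<in> W" "w \<in> W"
      then show "v \<oplus>\<^bsub>module_vec TYPE(complex) d\<^esub> w \<in> W"
        using mult_add_distrib_mat_vec[OF A, of v w] smult_add_distrib_vec[of v d w c]
        by (simp add: W_def module_vec_simps)
    next
      fix a v assume "v \<in> W"
      then show "a \<odot>\<^bsub>module_vec TYPE(complex) d\<^esub> v \<in> W"
        using mult_mat_vec[OF A, of v a] by (simp add: W_def module_vec_simps smult_smult_assoc mult.commute)
    qed
  qed
  moreover have "\<rho> g *\<^sub>v w \<in> W" if "g \<in> carrier G" "w \<in> W" for g w
  proof -
    have w: "w \<in> carrier_vec d" "A *\<^sub>v w = c \<cdot>\<^sub>v w" using that by (auto simp: W_def)
    have "A *\<^sub>v (\<rho> g *\<^sub>v w) = (A * \<rho> g) *\<^sub>v w"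
      using A that(1) w(1) by (simp add: assoc_mult_mat_vec[OF A rho_carrier])
    also have "\<dots> = \<rho> g *\<^sub>v (A *\<^sub>v w)"
      using A that(1) w(1) by (simp add: comm assoc_mult_mat_vec[OF rho_carrier A])
    also have "\<dots> = c \<cdot>\<^sub>v (\<rho> g *\<^sub>v w)"
      using w that(1) by (simp add: mult_mat_vec[OF rho_carrier])
    finally show ?thesis using w that(1) mult_mat_vec_carrier[OF rho_carrier w(1)] by (simp add: W_def)
  qed
  ultimately have "W = {0\<^sub>v d} \<or> W = carrier_vec d"
    using irr by (simp add: irreducible_rep_def)
  moreover have "v \<in> W" using v by (simp add: W_def)
  ultimately have W: "W = carrier_vec d" using v by auto
  have "A = c \<cdot>\<^sub>m 1\<^sub>m d"
  proof (rule eq_matI)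
    fix i j assume "i < dim_row (c \<cdot>\<^sub>m 1\<^sub>m d)" "j < dim_col (c \<cdot>\<^sub>m 1\<^sub>m d)"
    then have ij: "i < d" "j < d" by auto
    have "unit_vec d j \<in> W" using W by simp
    then have "(A *\<^sub>v unit_vec d j) $ i = (c \<cdot>\<^sub>v unit_vec d j) $ i" by (simp add: W_def)
    then show "A $$ (i, j) = (c \<cdot>\<^sub>m 1\<^sub>m d) $$ (i, j)"
      using A ij by simp
  qed (use A in auto)
  then show ?thesis by (rule that)
qed

definition msum :: "('g \<Rightarrow> complex) \<Rightarrow> complex mat" where
  "msum f = mat d d (\<lambda>(i, j). \<Sum>g\<in>carrier G. f g * \<rho> g $$ (i, j))"

lemma msum_carrier [simp]: "msum f \<in> carrier_mat d d" "dim_row (msum f) = d" "dim_col (msum f) = d"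
  by (simp_all add: msum_def)

lemma msum_mult_index:
  assumes "h \<in> carrier G" "i < d" "j < d"
  shows "(msum f * \<rho> h) $$ (i, j) = (\<Sum>g\<in>carrier G. f g * \<rho> (g \<otimes> h) $$ (i, j))"
    and "(\<rho> h * msum f) $$ (i, j) = (\<Sum>g\<in>carrier G. f g * \<rho> (h \<otimes> g) $$ (i, j))"
proof -
  have "(msum f * \<rho> h) $$ (i, j) = (\<Sum>k<d. \<Sum>g\<in>carrier G. f g * \<rho> g $$ (i, k) * \<rho> h $$ (k, j))"
    using assms by (simp add: scalar_prod_def atLeast0LessThan msum_def sum_distrib_right)
  also have "\<dots> = (\<Sum>g\<in>carrier G. f g * \<rho> (g \<otimes> h) $$ (i, j))"
    using assms by (subst sum.swap) (simp add: rho_mult_index sum_distrib_left mult.assoc)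
  finally show "(msum f * \<rho> h) $$ (i, j) = \<dots>" .
  have "(\<rho> h * msum f) $$ (i, j) = (\<Sum>k<d. \<Sum>g\<in>carrier G. f g * (\<rho> h $$ (i, k) * \<rho> g $$ (k, j)))"
    using assms by (simp add: scalar_prod_def atLeast0LessThan msum_def sum_distrib_left mult.left_commute)
  also have "\<dots> = (\<Sum>g\<in>carrier G. f g * \<rho> (h \<otimes> g) $$ (i, j))"
    using assms by (subst sum.swap) (simp add: rho_mult_index sum_distrib_left)
  finally show "(\<rho> h * msum f) $$ (i, j) = \<dots>" .
qed

lemma sum_reindex_left:
  assumes "h \<in> carrier G"
  shows "(\<Sum>g\<in>carrier G. F (h \<otimes> g)) = (\<Sum>g\<in>carrier G. F g)"
  by (rule sum.reindex_bij_witness[of _ "\<lambda>g. inv h \<otimes> g" "\<lambda>g. h \<otimes> g"])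
    (use assms in \<open>auto simp: m_assoc[symmetric]\<close>)

lemma sum_reindex_right:
  assumes "h \<in> carrier G"
  shows "(\<Sum>g\<in>carrier G. F (g \<otimes> h)) = (\<Sum>g\<in>carrier G. F g)"
  by (rule sum.reindex_bij_witness[of _ "\<lambda>g. g \<otimes> inv h" "\<lambda>g. g \<otimes> h"])
    (use assms in \<open>auto simp: m_assoc\<close>)

text \<open>The operator \<open>msum f\<close> of a class function commutes with the representation,
  so it is a scalar by \<open>schur\<close>; the two sides arise by taking its trace against
  \<rho>(h) and against the identity.\<close>

lemma class_conv_chi:
  assumes cls: "\<And>x y. x \<in> carrier G \<Longrightarrow> y \<in> carrier G \<Longrightarrow> f (x \<otimes> y) = f (y \<otimes> x)"
    and h: "h \<in> carrier G"
  shows "(\<Sum>g\<in>carrier G. f g * \<chi> (g \<otimes> h)) * of_nat d = (\<Sum>g\<in>carrier G. f g * \<chi> g) * \<chi> h"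
proof -
  have "msum f * \<rho> k = \<rho> k * msum f" if k: "k \<in> carrier G" for k
  proof (rule eq_matI)
    fix i j assume "i < dim_row (\<rho> k * msum f)" "j < dim_col (\<rho> k * msum f)"
    then have ij: "i < d" "j < d" using k by auto
    have "(msum f * \<rho> k) $$ (i, j) = (\<Sum>g\<in>carrier G. f g * \<rho> (g \<otimes> k) $$ (i, j))"
      using k ij by (rule msum_mult_index)
    also have "\<dots> = (\<Sum>g\<in>carrier G. f (g \<otimes> inv k) * \<rho> g $$ (i, j))"
      using k by (subst sum_reindex_right[of k, symmetric]) (auto simp: m_assoc intro!: sum.cong)
    also have "\<dots> = (\<Sum>g\<in>carrier G. f (inv k \<otimes> g) * \<rho> g $$ (i, j))"
      using k by (auto simp: cls intro!: sum.cong)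
    also have "\<dots> = (\<Sum>g\<in>carrier G. f g * \<rho> (k \<otimes> g) $$ (i, j))"
      using k by (subst sum_reindex_left[of k, symmetric]) (auto simp: m_assoc[symmetric] intro!: sum.cong)
    also have "\<dots> = (\<rho> k * msum f) $$ (i, j)"
      using k ij by (rule msum_mult_index(2)[symmetric])
    finally show "(msum f * \<rho> k) $$ (i, j) = (\<rho> k * msum f) $$ (i, j)" .
  qed (use k in auto)
  then obtain c where c: "msum f = c \<cdot>\<^sub>m 1\<^sub>m d" using schur[of "msum f"] by auto
  have tr: "(\<Sum>g\<in>carrier G. f g * \<chi> (g \<otimes> k)) = c * \<chi> k" if k: "k \<in> carrier G" for k
  proof -
    have "(\<Sum>g\<in>carrier G. f g * \<chi> (g \<otimes> k)) = (\<Sum>i<d. \<Sum>g\<in>carrier G. f g * \<rho> (g \<otimes> k) $$ (i, i))"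
      using k by (subst sum.swap) (simp add: mat_trace_def sum_distrib_left)
    also have "\<dots> = (\<Sum>i<d. (msum f * \<rho> k) $$ (i, i))"
      using k by (intro sum.cong refl, subst msum_mult_index) auto
    also have "\<dots> = (\<Sum>i<d. (c \<cdot>\<^sub>m \<rho> k) $$ (i, i))"
      unfolding c using k by (simp add: mult_smult_assoc_mat[of "1\<^sub>m d" d d "\<rho> k" d])
    also have "\<dots> = c * \<chi> k"
      using k by (simp add: mat_trace_def sum_distrib_left)
    finally show ?thesis .
  qed
  have "(\<Sum>g\<in>carrier G. f g * \<chi> g) = c * of_nat d"
    using tr[of \<one>] by (simp add: chi_one)
  then show ?thesis using tr[OF h] by simp
qed

text \<open>Unitarian trick without an orthonormal basis: let \<open>H\<close> be the sum over g of
  the adjoint of \<rho>(g) times \<rho>(g), and \<open>R\<close> the adjoint of \<rho>(inv h). Then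
  H \<rho>(h) = R H with H invertible, so \<rho>(h) and R have the same trace.\<close>

lemma chi_inv:
  assumes h: "h \<in> carrier G"
  shows "\<chi> (inv h) = cnj (\<chi> h)"
proof -
  define H where "H = mat d d (\<lambda>(i, j). \<Sum>g\<in>carrier G. \<Sum>k<d. cnj (\<rho> g $$ (k, i)) * \<rho> g $$ (k, j))"
  define R where "R = mat d d (\<lambda>(i, j). cnj (\<rho> (inv h) $$ (j, i)))"
  have H: "H \<in> carrier_mat d d" and R: "R \<in> carrier_mat d d" by (auto simp: H_def R_def)
  have eq: "H * \<rho> h = R * H"
  proof (rule eq_matI)
    fix i j assume "i < dim_row (R * H)" "j < dim_col (R * H)"
    then have ij: "i < d" "j < d" using R H by auto
    have "(H * \<rho> h) $$ (i, j) = (\<Sum>l<d. (\<Sum>g\<in>carrier G. \<Sum>k<d. cnj (\<rho> g $$ (k, i)) * \<rho> g $$ (k, l)) * \<rho> h $$ (l, j))"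
      using ij h by (simp add: scalar_prod_def atLeast0LessThan H_def)
    also have "\<dots> = (\<Sum>g\<in>carrier G. \<Sum>k<d. \<Sum>l<d. cnj (\<rho> g $$ (k, i)) * (\<rho> g $$ (k, l) * \<rho> h $$ (l, j)))"
      by (simp only: sum_distrib_right sum_swap3[of _ "{..<d}" "carrier G"] mult.assoc)
    also have "\<dots> = (\<Sum>g\<in>carrier G. \<Sum>k<d. cnj (\<rho> g $$ (k, i)) * \<rho> (g \<otimes> h) $$ (k, j))"
      using h ij by (simp add: rho_mult_index sum_distrib_left)
    also have "\<dots> = (\<Sum>g\<in>carrier G. \<Sum>k<d. cnj (\<rho> (g \<otimes> inv h) $$ (k, i)) * \<rho> g $$ (k, j))"
      using h by (subst sum_reindex_right[of h, symmetric]) (auto simp: m_assoc intro!: sum.cong)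
    also have "\<dots> = (\<Sum>g\<in>carrier G. \<Sum>k<d. \<Sum>l<d. cnj (\<rho> (inv h) $$ (l, i)) * (cnj (\<rho> g $$ (k, l)) * \<rho> g $$ (k, j)))"
      using h ij by (simp add: rho_mult_index sum_distrib_right sum_distrib_left mult_ac)
    also have "\<dots> = (\<Sum>l<d. cnj (\<rho> (inv h) $$ (l, i)) * (\<Sum>g\<in>carrier G. \<Sum>k<d. cnj (\<rho> g $$ (k, l)) * \<rho> g $$ (k, j)))"
      by (simp only: sum_distrib_left sum_swap3[of _ "{..<d}" "carrier G"])
    also have "\<dots> = (R * H) $$ (i, j)"
      using ij h by (simp add: scalar_prod_def atLeast0LessThan H_def R_def)
    finally show "(H * \<rho> h) $$ (i, j) = (R * H) $$ (i, j)" .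
  qed (use H R h in auto)
  \<comment> \<open>A null vector \<open>v\<close> would make the Hermitian form of \<open>H\<close>
    vanish at \<open>v\<close>; this value is a sum of squares whose part at the identity is the
    squared norm of \<open>v\<close>.\<close>
  have "det H \<noteq> 0"
  proof
    assume "det H = 0"
    then obtain v where v: "v \<in> carrier_vec d" "v \<noteq> 0\<^sub>v d" "H *\<^sub>v v = 0\<^sub>v d"
      using det_0_iff_vec_prod_zero_field[OF H] by auto
    define w where "w g k = (\<Sum>j<d. \<rho> g $$ (k, j) * v $ j)" for g k
    have "0 = (\<Sum>i<d. cnj (v $ i) * (H *\<^sub>v v) $ i)" using v by simp
    also have "\<dots> = (\<Sum>i<d. cnj (v $ i) * (\<Sum>j<d. (\<Sum>g\<in>carrier G. \<Sum>k<d. cnj (\<rho> g $$ (k, i)) * \<rho> g $$ (k, j)) * v $ j))"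
      using v(1) by (intro sum.cong refl) (simp add: scalar_prod_def atLeast0LessThan H_def)
    also have "\<dots> = (\<Sum>i<d. \<Sum>j<d. \<Sum>g\<in>carrier G. \<Sum>k<d. cnj (\<rho> g $$ (k, i) * v $ i) * (\<rho> g $$ (k, j) * v $ j))"
      by (simp add: sum_distrib_left sum_distrib_right mult_ac)
    also have "\<dots> = (\<Sum>g\<in>carrier G. \<Sum>k<d. \<Sum>i<d. \<Sum>j<d. cnj (\<rho> g $$ (k, i) * v $ i) * (\<rho> g $$ (k, j) * v $ j))"
      by (simp only: sum_swap3[of _ "{..<d}" "carrier G"])
    also have "\<dots> = (\<Sum>g\<in>carrier G. \<Sum>k<d. cnj (w g k) * w g k)"
      by (simp only: w_def cnj_sum sum_product)
    also have "\<dots> = of_real (\<Sum>g\<in>carrier G. \<Sum>k<d. (cmod (w g k))\<^sup>2)"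
      unfolding of_real_sum complex_norm_square by (simp only: mult.commute)
    finally have "(\<Sum>g\<in>carrier G. \<Sum>k<d. (cmod (w g k))\<^sup>2) = 0"
      by (metis of_real_eq_0_iff)
    then have "\<forall>g\<in>carrier G. (\<Sum>k<d. (cmod (w g k))\<^sup>2) = 0"
      using fin by (subst (asm) sum_nonneg_eq_0_iff) (auto intro: sum_nonneg)
    then have "(\<Sum>k<d. (cmod (w \<one> k))\<^sup>2) = 0" by auto
    then have "\<forall>k<d. w \<one> k = 0"
      by (subst (asm) sum_nonneg_eq_0_iff) auto
    moreover have "w \<one> k = v $ k" if "k < d" for k
      using that by (simp add: w_def rho_one mult_delta_left)
    ultimately have "v = 0\<^sub>v d" using v(1) by auto
    with v show False by simp
  qed
  then obtain K where K: "K \<in> carrier_mat d d" "H * K = 1\<^sub>m d" "K * H = 1\<^sub>m d"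
    by (rule det_nonzero_inverse[OF H])
  have "\<rho> h = K * H * \<rho> h" using K h by simp
  also have "\<dots> = K * (R * H)" unfolding eq[symmetric] by (rule assoc_mult_mat[OF K(1) H rho_carrier[OF h]])
  finally have "\<chi> h = mat_trace (K * (R * H))" by simp
  also have "\<dots> = mat_trace (R * H * K)"
    using K R H by (intro mat_trace_mult_commute) auto
  also have "R * H * K = R" using K R H by (simp add: assoc_mult_mat[OF R H K(1)])
  also have "mat_trace R = cnj (\<chi> (inv h))"
    using h by (simp add: mat_trace_def R_def)
  finally show ?thesis by simp
qed

lemma chi_central:
  assumes z: "z \<in> carrier G" and cen: "\<And>g. g \<in> carrier G \<Longrightarrow> z \<otimes> g = g \<otimes> z"
  obtains c where "cmod c = 1" "\<chi> z = c * of_nat d" "\<And>g. g \<in> carrier G \<Longrightarrow> \<chi> (z \<otimes> g) = c * \<chi> g"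
proof -
  have "\<rho> z * \<rho> g = \<rho> g * \<rho> z" if "g \<in> carrier G" for g
    using z that cen[OF that] by (metis rho_mult)
  then obtain c where c: "\<rho> z = c \<cdot>\<^sub>m 1\<^sub>m d" using schur[of "\<rho> z"] z by auto
  have m: "\<chi> (z \<otimes> g) = c * \<chi> g" if "g \<in> carrier G" for g
    using z that by (simp add: rho_mult c mult_smult_assoc_mat[of "1\<^sub>m d" d d "\<rho> g" d] mat_trace_def sum_distrib_left)
  have one: "\<chi> z = c * of_nat d" using m[of \<one>] z by (simp add: chi_one)
  have "of_nat d = c * \<chi> (inv z)" using m[of "inv z"] z by (simp add: chi_one)
  also have "\<dots> = c * cnj c * of_nat d" using z by (simp add: chi_inv one)
  finally have "c * cnj c = 1" using d_pos by simp
  then have "complex_of_real ((cmod c)\<^sup>2) = 1" by (simp only: complex_norm_square)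
  then have "(cmod c)\<^sup>2 = 1\<^sup>2" by (metis of_real_eq_1_iff one_power2)
  then have "cmod c = 1" by (rule power2_eq_imp_eq) auto
  then show ?thesis using one m that by blast
qed

end

section \<open>Irreducible characters without reference to a representation\<close>

locale irr_char =
  fixes G :: "('g, 'b) monoid_scheme" (structure) and \<chi> :: "'g \<Rightarrow> complex"
  assumes group: "group G" and fin: "finite (carrier G)" and irr: "irreducible_character G \<chi>"
begin

sublocale group G by (rule group)

lemma obtain_rep:
  obtains d \<rho> where "irrep G d \<rho>" "\<And>g. g \<in> carrier G \<Longrightarrow> \<chi> g = mat_trace (\<rho> g)"
proof -
  obtain d \<rho> where "irreducible_rep G d \<rho>" "\<forall>g\<in>carrier G. \<chi> g = mat_trace (\<rho> g)"
    using irr unfolding irreducible_character_def by blast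
  then show ?thesis using that[of d \<rho>] group fin by (simp add: irrep_def)
qed

text \<open>With \<open>c = (\<Sum>x. cnj (\<chi> x) x)\<close> in the group algebra, \<open>c c = \<kappa> c\<close>.\<close>

definition \<kappa> :: real where
  "\<kappa> = (\<Sum>x\<in>carrier G. (cmod (\<chi> x))\<^sup>2) / Re (\<chi> \<one>)"

lemma chi_one: "\<chi> \<one> = of_real (Re (\<chi> \<one>))" "Re (\<chi> \<one>) > 0"
proof -
  obtain d \<rho> where r: "irrep G d \<rho>" and c: "\<And>g. g \<in> carrier G \<Longrightarrow> \<chi> g = mat_trace (\<rho> g)"
    using obtain_rep by blast
  interpret irrep G d \<rho> by (rule r)
  have "\<chi> \<one> = of_nat d" using c[of \<one>] irrep.chi_one[OF r] by simp
  then show "\<chi> \<one> = of_real (Re (\<chi> \<one>))" "Re (\<chi> \<one>) > 0" using d_pos by simp_all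
qed

lemma chi_one_nonzero: "\<chi> \<one> \<noteq> 0"
  using chi_one by auto

lemma chi_inv: "g \<in> carrier G \<Longrightarrow> \<chi> (inv g) = cnj (\<chi> g)"
  by (rule obtain_rep) (metis inv_closed irrep.chi_inv)

lemma chi_class: "g \<in> carrier G \<Longrightarrow> h \<in> carrier G \<Longrightarrow> \<chi> (g \<otimes> h) = \<chi> (h \<otimes> g)"
  by (rule obtain_rep) (metis m_closed irrep.chi_class)

lemma chi_conj:
  assumes "g \<in> carrier G" "x \<in> carrier G"
  shows "\<chi> (g \<otimes> x \<otimes> inv g) = \<chi> x"
  using assms chi_class[of "g \<otimes> x" "inv g"] by (simp add: m_assoc[symmetric])

lemma sum_left: "h \<in> carrier G \<Longrightarrow> (\<Sum>g\<in>carrier G. F (h \<otimes> g)) = (\<Sum>g\<in>carrier G. F g)"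
  by (rule sum.reindex_bij_witness[of _ "\<lambda>g. inv h \<otimes> g" "\<lambda>g. h \<otimes> g"]) (auto simp: m_assoc[symmetric])

lemma sum_right: "h \<in> carrier G \<Longrightarrow> (\<Sum>g\<in>carrier G. F (g \<otimes> h)) = (\<Sum>g\<in>carrier G. F g)"
  by (rule sum.reindex_bij_witness[of _ "\<lambda>g. g \<otimes> inv h" "\<lambda>g. g \<otimes> h"]) (auto simp: m_assoc)

lemma sum_inv: "(\<Sum>g\<in>carrier G. F (inv g)) = (\<Sum>g\<in>carrier G. F g)"
  by (rule sum.reindex_bij_witness[of _ "\<lambda>g. inv g" "\<lambda>g. inv g"]) auto

lemma class_conv_chi:
  assumes cls: "\<And>x y. x \<in> carrier G \<Longrightarrow> y \<in> carrier G \<Longrightarrow> f (x \<otimes> y) = f (y \<otimes> x)"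
    and h: "h \<in> carrier G"
  shows "(\<Sum>g\<in>carrier G. f g * \<chi> (g \<otimes> h)) * \<chi> \<one> = (\<Sum>g\<in>carrier G. f g * \<chi> g) * \<chi> h"
proof -
  obtain d \<rho> where r: "irrep G d \<rho>" and c: "\<And>g. g \<in> carrier G \<Longrightarrow> \<chi> g = mat_trace (\<rho> g)"
    using obtain_rep by blast
  have "\<chi> \<one> = of_nat d" using c[of \<one>] irrep.chi_one[OF r] by simp
  moreover have "(\<Sum>g\<in>carrier G. f g * \<chi> (g \<otimes> h)) = (\<Sum>g\<in>carrier G. f g * mat_trace (\<rho> (g \<otimes> h)))"
    "(\<Sum>g\<in>carrier G. f g * \<chi> g) = (\<Sum>g\<in>carrier G. f g * mat_trace (\<rho> g))"
    using h by (auto intro!: sum.cong simp: c)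
  ultimately show ?thesis
    using irrep.class_conv_chi[OF r, of f h] cls h c[OF h] by simp
qed

lemma kappa_pos: "\<kappa> > 0"
proof -
  have "(\<Sum>x\<in>carrier G. (cmod (\<chi> x))\<^sup>2) > 0"
    by (rule sum_pos2[OF fin one_closed]) (use chi_one_nonzero in auto)
  then show ?thesis using chi_one(2) by (simp add: \<kappa>_def)
qed

lemma chi_conv:
  assumes "h \<in> carrier G"
  shows "(\<Sum>x\<in>carrier G. cnj (\<chi> x) * cnj (\<chi> (inv x \<otimes> h))) = of_real \<kappa> * cnj (\<chi> h)"
proof -
  have "(\<Sum>g\<in>carrier G. \<chi> (inv g) * \<chi> (g \<otimes> h)) * \<chi> \<one> = (\<Sum>g\<in>carrier G. \<chi> (inv g) * \<chi> g) * \<chi> h"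
    by (rule class_conv_chi) (use assms chi_class in \<open>auto simp: inv_mult_group\<close>)
  moreover have "(\<Sum>g\<in>carrier G. \<chi> (inv g) * \<chi> g) = of_real (\<kappa>) * \<chi> \<one>"
  proof -
    have "(\<Sum>g\<in>carrier G. \<chi> (inv g) * \<chi> g) = (\<Sum>g\<in>carrier G. of_real ((cmod (\<chi> g))\<^sup>2))"
      unfolding complex_norm_square by (intro sum.cong refl) (simp add: chi_inv)
    also have "\<dots> = of_real (\<kappa> * Re (\<chi> \<one>))" using chi_one(2) by (simp add: \<kappa>_def)
    finally show ?thesis using chi_one(1) by simp
  qed
  ultimately have "(\<Sum>g\<in>carrier G. \<chi> (inv g) * \<chi> (g \<otimes> h)) = of_real \<kappa> * \<chi> h"
    using chi_one_nonzero by simp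
  then have "(\<Sum>g\<in>carrier G. \<chi> g * \<chi> (inv g \<otimes> h)) = of_real \<kappa> * \<chi> h"
    using sum_inv[of "\<lambda>g. \<chi> g * \<chi> (inv g \<otimes> h)"] by simp
  then have "cnj (\<Sum>g\<in>carrier G. \<chi> g * \<chi> (inv g \<otimes> h)) = cnj (of_real \<kappa> * \<chi> h)" by simp
  then show ?thesis by simp
qed

text \<open>The source of the character ratio: right translation by \<open>h\<close> acts on the
  \<chi>-component of a class function through \<chi>(h)/\<chi>(1). For \<open>f\<close> the trace
  of a representation this compares tr(c h) with tr(c).\<close>

lemma chi_shift:
  assumes cls: "\<And>x y. x \<in> carrier G \<Longrightarrow> y \<in> carrier G \<Longrightarrow> f (x \<otimes> y) = f (y \<otimes> x)"
    and h: "h \<in> carrier G"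
  shows "(\<Sum>x\<in>carrier G. cnj (\<chi> x) * f (x \<otimes> h)) = \<chi> h / \<chi> \<one> * (\<Sum>x\<in>carrier G. cnj (\<chi> x) * f x)"
proof -
  have "(\<Sum>x\<in>carrier G. cnj (\<chi> x) * f (x \<otimes> h)) = (\<Sum>x\<in>carrier G. cnj (\<chi> (x \<otimes> inv h)) * f x)"
    by (subst sum_right[of h, symmetric]) (use h in \<open>auto intro!: sum.cong simp: m_assoc\<close>)
  also have "\<dots> = (\<Sum>x\<in>carrier G. \<chi> (h \<otimes> inv x) * f x)"
    using h by (auto intro!: sum.cong simp: inv_mult_group simp flip: chi_inv)
  also have "\<dots> = (\<Sum>x\<in>carrier G. f (inv x) * \<chi> (x \<otimes> h))"
    by (subst sum_inv[symmetric]) (use h in \<open>auto intro!: sum.cong simp: chi_class\<close>)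
  finally have "(\<Sum>x\<in>carrier G. cnj (\<chi> x) * f (x \<otimes> h)) * \<chi> \<one> = (\<Sum>x\<in>carrier G. f (inv x) * \<chi> (x \<otimes> h)) * \<chi> \<one>"
    by simp
  also have "\<dots> = (\<Sum>x\<in>carrier G. f (inv x) * \<chi> x) * \<chi> h"
    by (rule class_conv_chi) (use h cls in \<open>auto simp: inv_mult_group\<close>)
  also have "(\<Sum>x\<in>carrier G. f (inv x) * \<chi> x) = (\<Sum>x\<in>carrier G. cnj (\<chi> x) * f x)"
    by (subst sum_inv[symmetric]) (auto intro!: sum.cong simp: chi_inv)
  finally show ?thesis using chi_one_nonzero by (simp add: field_simps)
qed

text \<open>A central \<open>z\<close> acts by a scalar of modulus one, so the factor cnj (\<chi> z)
  / \<chi>(1) amounts to replacing \<open>g\<close> by its product with the inverse of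
  \<open>z\<close>. This is how the primary eigenvalue gets removed.\<close>

lemma chi_central:
  assumes z: "z \<in> carrier G" and cen: "\<And>g. g \<in> carrier G \<Longrightarrow> z \<otimes> g = g \<otimes> z"
    and g: "g \<in> carrier G"
  shows "\<chi> g / \<chi> \<one> * (cnj (\<chi> z) / \<chi> \<one>) = \<chi> (inv z \<otimes> g) / \<chi> \<one>"
proof -
  obtain d \<rho> where r: "irrep G d \<rho>" and c: "\<And>g. g \<in> carrier G \<Longrightarrow> \<chi> g = mat_trace (\<rho> g)"
    using obtain_rep by blast
  have d: "\<chi> \<one> = of_nat d" using c[of \<one>] irrep.chi_one[OF r] by simp
  obtain w where w: "cmod w = 1" "mat_trace (\<rho> z) = w * of_nat d"
    "\<And>g. g \<in> carrier G \<Longrightarrow> mat_trace (\<rho> (z \<otimes> g)) = w * mat_trace (\<rho> g)"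
    using irrep.chi_central[OF r z cen] by blast
  have "z \<otimes> (inv z \<otimes> g) = g" using z g by (simp add: m_assoc[symmetric])
  then have "\<chi> g = w * \<chi> (inv z \<otimes> g)" using w(3)[of "inv z \<otimes> g"] z g c by simp
  moreover have "w * cnj w = 1" using w(1) by (simp add: complex_norm_square[symmetric])
  ultimately show ?thesis
    using chi_one_nonzero w(2) c[OF z] d by (simp add: field_simps)
qed

end

section \<open>Rank factorizations and eigenvalues\<close>

text \<open>Rank at most \<open>r\<close>, encoded by an explicit factorization: in this form it
  passes to sums, left multiples, transposes and images under field homomorphisms without dimension
  theory.\<close>

definition factors_through :: "nat \<Rightarrow> 'a::field mat \<Rightarrow> nat \<Rightarrow> bool" where
  "factors_through n A r \<longleftrightarrow>
     (\<exists>Y Z. \<forall>i<n. \<forall>j<n. A $$ (i, j) = (\<Sum>k<r. Y i k * Z k j))"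

lemma row_echelon_factorization:
  fixes A :: "'a::field mat"
  assumes A: "A \<in> carrier_mat n n"
  obtains E P Q where "E \<in> carrier_mat n n" "P \<in> carrier_mat n n" "Q \<in> carrier_mat n n"
    "E = P * A" "A = Q * E" "Q * P = 1\<^sub>m n" "row_echelon_form E"
    "kernel_dim A = n - card {i. i < n \<and> row E i \<noteq> 0\<^sub>v n}"
proof -
  let ?E = "gauss_jordan_single A"
  from gauss_jordan_single[OF A refl]
  obtain P Q where PQ: "?E = P * A" "P \<in> carrier_mat n n" "Q \<in> carrier_mat n n"
    "Q * P = 1\<^sub>m n" and E: "?E \<in> carrier_mat n n" "row_echelon_form ?E" by auto
  have "Q * ?E = Q * P * A" unfolding PQ(1) by (rule assoc_mult_mat[symmetric, OF PQ(3,2) A])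
  then have "A = Q * ?E" using PQ A by simp
  moreover have "kernel_dim A = kernel.dim n ?E"
    using mat_kernel_mult_eq[OF A PQ(2,3,4)] A PQ(1) by (simp add: kernel_dim_def)
  ultimately show ?thesis
    using that[of ?E P Q] E PQ find_base_vectors(6)[OF E(2,1)] by simp
qed

lemma factors_through_kernel_dim:
  fixes A :: "'a::field mat"
  assumes A: "A \<in> carrier_mat n n"
  shows "factors_through n A (n - kernel_dim A)"
proof -
  obtain E P Q where E: "E \<in> carrier_mat n n" "Q \<in> carrier_mat n n" "A = Q * E"
    and k: "kernel_dim A = n - card {i. i < n \<and> row E i \<noteq> 0\<^sub>v n}"
    by (rule row_echelon_factorization[OF A]) blast
  let ?S = "{i. i < n \<and> row E i \<noteq> 0\<^sub>v n}"
  have fin: "finite ?S" by simp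
  have "card ?S \<le> card {..<n}" by (rule card_mono) auto
  then have r: "n - kernel_dim A = card ?S" using k by simp
  obtain f where f: "bij_betw f {..<card ?S} ?S"
    using ex_bij_betw_nat_finite[OF fin] by (auto simp: atLeast0LessThan)
  have "A $$ (i, j) = (\<Sum>k<card ?S. Q $$ (i, f k) * E $$ (f k, j))" if "i < n" "j < n" for i j
  proof -
    have "A $$ (i, j) = (\<Sum>k<n. Q $$ (i, k) * E $$ (k, j))"
      using E that by (simp add: scalar_prod_def atLeast0LessThan)
    also have "\<dots> = (\<Sum>k\<in>?S. Q $$ (i, k) * E $$ (k, j))"
    proof (rule sum.mono_neutral_right)
      show "\<forall>k\<in>{..<n} - ?S. Q $$ (i, k) * E $$ (k, j) = 0"
      proof
        fix k assume "k \<in> {..<n} - ?S"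
        then have "row E k $ j = 0" "k < n" using that by auto
        then show "Q $$ (i, k) * E $$ (k, j) = 0" using E that by simp
      qed
    qed auto
    also have "\<dots> = (\<Sum>k<card ?S. Q $$ (i, f k) * E $$ (f k, j))"
      by (rule sum.reindex_bij_betw[OF f, symmetric])
    finally show ?thesis .
  qed
  then show ?thesis unfolding factors_through_def r
    by (intro exI[of _ "\<lambda>i k. Q $$ (i, f k)"] exI[of _ "\<lambda>k j. E $$ (f k, j)"]) simp
qed

lemma factors_through_det:
  fixes A :: "'a::field mat"
  assumes A: "A \<in> carrier_mat n n" and f: "factors_through n A r" and r: "r < n"
  shows "det A = 0"
proof -
  obtain Y Z where YZ: "\<And>i j. i < n \<Longrightarrow> j < n \<Longrightarrow> A $$ (i, j) = (\<Sum>k<r. Y i k * Z k j)"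
    using f unfolding factors_through_def by blast
  define M where "M = mat n n (\<lambda>(k, j). if k < r then Z k j else 0)"
  define L where "L = mat n n (\<lambda>(i, k). if k < r then Y i k else 0)"
  have M: "M \<in> carrier_mat n n" and L: "L \<in> carrier_mat n n" by (auto simp: M_def L_def)
  have "A = L * M"
  proof (rule eq_matI)
    fix i j assume "i < dim_row (L * M)" "j < dim_col (L * M)"
    then have ij: "i < n" "j < n" using L M by auto
    have "(L * M) $$ (i, j) = (\<Sum>k<n. if k < r then Y i k * Z k j else 0)"
      using ij by (auto simp: L_def M_def scalar_prod_def atLeast0LessThan intro!: sum.cong)
    also have "\<dots> = (\<Sum>k<r. Y i k * Z k j)"
      using r by (intro sum.mono_neutral_cong_right) auto
    finally show "A $$ (i, j) = (L * M) $$ (i, j)" using YZ ij by simp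
  qed (use A L M in auto)
  moreover have "det M = 0"
  proof -
    have "transpose_mat M *\<^sub>v unit_vec n (n - 1) = 0\<^sub>v n"
      using r by (intro eq_vecI) (auto simp: M_def)
    moreover have "unit_vec n (n - 1) \<noteq> (0\<^sub>v n :: 'a vec)"
      using r by (intro unit_vec_nonzero) auto
    ultimately have "det (transpose_mat M) = 0"
      using det_0_iff_vec_prod_zero_field[of "transpose_mat M" n] M
      by (auto intro!: exI[of _ "unit_vec n (n - 1)"])
    then show ?thesis using det_transpose[OF M] by simp
  qed
  ultimately show ?thesis using det_mult[OF L M] by simp
qed

text \<open>Ranks add up: the difference has rank at most r + s < n, whereas a nonzero scalar matrix
  is invertible.\<close>

lemma factors_through_scalar_diff:
  fixes A B :: "'a::field mat"
  assumes A: "A \<in> carrier_mat n n" and B: "B \<in> carrier_mat n n"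
    and fA: "factors_through n A r" and fB: "factors_through n B s"
    and eq: "A - B = c \<cdot>\<^sub>m 1\<^sub>m n" and lt: "r + s < n"
  shows "c = 0"
proof -
  obtain Y Z where YZ: "\<And>i j. i < n \<Longrightarrow> j < n \<Longrightarrow> A $$ (i, j) = (\<Sum>k<r. Y i k * Z k j)"
    using fA unfolding factors_through_def by blast
  obtain Y' Z' where YZ': "\<And>i j. i < n \<Longrightarrow> j < n \<Longrightarrow> B $$ (i, j) = (\<Sum>k<s. Y' i k * Z' k j)"
    using fB unfolding factors_through_def by blast
  define U where "U i k = (if k < r then Y i k else - Y' i (k - r))" for i k
  define V where "V k j = (if k < r then Z k j else Z' (k - r) j)" for k j
  have "(A - B) $$ (i, j) = (\<Sum>k<r+s. U i k * V k j)" if ij: "i < n" "j < n" for i j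
  proof -
    have "(\<Sum>k<r+s. U i k * V k j) = (\<Sum>k<r. U i k * V k j) + (\<Sum>k=r..<r+s. U i k * V k j)"
      using sum.atLeastLessThan_concat[of 0 r "r+s" "\<lambda>k. U i k * V k j"] by (simp add: atLeast0LessThan)
    also have "(\<Sum>k=r..<r+s. U i k * V k j) = (\<Sum>k<s. U i (k + r) * V (k + r) j)"
      using sum.shift_bounds_nat_ivl[of "\<lambda>k. U i k * V k j" 0 r s] by (simp add: atLeast0LessThan add.commute)
    finally show ?thesis using ij A B YZ YZ' by (simp add: U_def V_def sum_negf)
  qed
  then have "factors_through n (A - B) (r + s)" unfolding factors_through_def by blast
  then have "det (c \<cdot>\<^sub>m 1\<^sub>m n :: 'a mat) = 0"
    using factors_through_det[of "A - B" n "r + s"] A B lt eq by auto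
  then show ?thesis by (simp add: det_smult)
qed

lemma factors_through_map:
  assumes "factors_through n A r" "A \<in> carrier_mat n n"
    and "h 0 = 0" "\<And>x y. h (x + y) = h x + h y" "\<And>x y. h (x * y) = h x * h y"
  shows "factors_through n (map_mat h A) r"
proof -
  obtain Y Z where YZ: "\<And>i j. i < n \<Longrightarrow> j < n \<Longrightarrow> A $$ (i, j) = (\<Sum>k<r. Y i k * Z k j)"
    using assms(1) unfolding factors_through_def by blast
  have hs: "h (sum f S) = (\<Sum>x\<in>S. h (f x))" for f and S :: "nat set"
    by (induction S rule: infinite_finite_induct) (auto simp: assms(3,4))
  have "map_mat h A $$ (i, j) = (\<Sum>k<r. h (Y i k) * h (Z k j))" if "i < n" "j < n" for i j
    using that assms(2) YZ by (simp add: hs assms(5))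
  then show ?thesis unfolding factors_through_def
    by (intro exI[of _ "\<lambda>i k. h (Y i k)"] exI[of _ "\<lambda>k j. h (Z k j)"]) simp
qed

lemma factors_through_transpose:
  assumes "factors_through n A r" "A \<in> carrier_mat n n"
  shows "factors_through n (transpose_mat A) r"
proof -
  obtain Y Z where YZ: "\<And>i j. i < n \<Longrightarrow> j < n \<Longrightarrow> A $$ (i, j) = (\<Sum>k<r. Y i k * Z k j)"
    using assms(1) unfolding factors_through_def by blast
  then show ?thesis unfolding factors_through_def using assms(2)
    by (intro exI[of _ "\<lambda>i k. Z k i"] exI[of _ "\<lambda>k j. Y j k"]) (simp add: mult.commute)
qed

lemma factors_through_mult_left:
  assumes "factors_through n A r" "A \<in> carrier_mat n n" "B \<in> carrier_mat n n"
  shows "factors_through n (B * A) r"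
proof -
  obtain Y Z where YZ: "\<And>i j. i < n \<Longrightarrow> j < n \<Longrightarrow> A $$ (i, j) = (\<Sum>k<r. Y i k * Z k j)"
    using assms(1) unfolding factors_through_def by blast
  have "(B * A) $$ (i, j) = (\<Sum>k<r. (\<Sum>l<n. B $$ (i, l) * Y l k) * Z k j)" if "i < n" "j < n" for i j
  proof -
    have "(B * A) $$ (i, j) = (\<Sum>l<n. \<Sum>k<r. B $$ (i, l) * Y l k * Z k j)"
      using that assms YZ by (simp add: scalar_prod_def atLeast0LessThan sum_distrib_left mult.assoc)
    also have "\<dots> = (\<Sum>k<r. (\<Sum>l<n. B $$ (i, l) * Y l k) * Z k j)"
      by (subst sum.swap) (simp add: sum_distrib_right)
    finally show ?thesis .
  qed
  then show ?thesis unfolding factors_through_def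
    by (intro exI[of _ "\<lambda>i k. \<Sum>l<n. B $$ (i, l) * Y l k"] exI[of _ Z]) simp
qed

text \<open>A row echelon form remains one over the larger field, with the same number of nonzero
  rows.\<close>

lemma kernel_dim_to_ac:
  fixes A :: "'a::field mat"
  assumes A: "A \<in> carrier_mat n n"
  shows "kernel_dim (map_mat to_ac A) = kernel_dim A"
proof -
  interpret semiring_hom "to_ac :: 'a \<Rightarrow> 'a alg_closure" by unfold_locales auto
  obtain E P Q where E: "E \<in> carrier_mat n n" "P \<in> carrier_mat n n" "Q \<in> carrier_mat n n"
    "E = P * A" "Q * P = 1\<^sub>m n" "row_echelon_form E"
    and k: "kernel_dim A = n - card {i. i < n \<and> row E i \<noteq> 0\<^sub>v n}"
    by (rule row_echelon_factorization[OF A]) blast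
  let ?h = "map_mat to_ac :: 'a mat \<Rightarrow> _"
  have "mat_kernel (?h P * ?h A) = mat_kernel (?h A)"
    by (rule mat_kernel_mult_eq[of _ n n _ "?h Q"])
      (use A E in \<open>auto simp: mat_hom_mult[symmetric] mat_hom_one\<close>)
  then have "kernel_dim (?h A) = kernel.dim n (?h E)"
    using A E by (simp add: kernel_dim_def mat_hom_mult)
  moreover have "row_echelon_form (?h E)"
  proof -
    obtain f where f: "pivot_fun E f n" using E(1,6) unfolding row_echelon_form_def by auto
    have d: "dim_row E = n" "dim_col E = n" using E(1) by auto
    have "pivot_fun (?h E) f n"
    proof (rule pivot_funI)
      fix i assume i: "i < dim_row E"
      show "f i \<le> n" using pivot_funD(1)[OF refl f i] .
      show "?h E $$ (i, j) = 0" if "j < f i" for j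
        using pivot_funD(2)[OF refl f i that] \<open>f i \<le> n\<close> that i d by simp
      show "Suc i < dim_row E \<Longrightarrow> f i < f (Suc i) \<or> f (Suc i) = n"
        using pivot_funD(3)[OF refl f i] by auto
      show "?h E $$ (i, f i) = 1" if "f i < n"
        using pivot_funD(4)[OF refl f i that] that i d by simp
      show "?h E $$ (i', f i) = 0" if "f i < n" "i' < dim_row E" "i' \<noteq> i" for i'
        using pivot_funD(5)[OF refl f i that] that i d by simp
    qed simp
    then show ?thesis using E(1) unfolding row_echelon_form_def by auto
  qed
  then have "kernel.dim n (?h E) = n - card {i. i < n \<and> row (?h E) i \<noteq> 0\<^sub>v n}"
    using E by (intro find_base_vectors(6)) auto
  moreover have "{i. i < n \<and> row (?h E) i \<noteq> 0\<^sub>v n} = {i. i < n \<and> row E i \<noteq> 0\<^sub>v n}"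
    using E(1) by (auto simp: vec_eq_iff)
  ultimately show ?thesis using k by simp
qed

lemma card_kernel:
  fixes A :: "'a::{field,finite} mat"
  assumes A: "A \<in> carrier_mat n n"
  shows "card {v \<in> carrier_vec n. A *\<^sub>v v = 0\<^sub>v n} = CARD('a) ^ kernel_dim A"
proof -
  interpret kernel n n A by unfold_locales (rule A)
  obtain B where B: "finite B" "basis B" using kernel_basis_exists[OF A] by auto
  have ker: "{v \<in> carrier_vec n. A *\<^sub>v v = 0\<^sub>v n} = mat_kernel A" using mat_kernel[OF A] by auto
  have sub: "B \<subseteq> mat_kernel A" using B(2) unfolding Ker.basis_def by auto
  have uniq: "\<forall>v. v \<in> mat_kernel A \<longrightarrow> (\<exists>!a. a \<in> B \<rightarrow>\<^sub>E UNIV \<and> lincomb a B = v)"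
    using Ker.basis_criterion[OF B(1)] B(2) sub by simp
  have "bij_betw (\<lambda>a. lincomb a B) (B \<rightarrow>\<^sub>E UNIV) (mat_kernel A)"
  proof (rule bij_betwI')
    fix a assume "a \<in> B \<rightarrow>\<^sub>E (UNIV :: 'a set)"
    show "lincomb a B \<in> mat_kernel A"
      using Ker.lincomb_closed[of B a] sub by auto
  next
    fix a b :: "'a vec \<Rightarrow> 'a" assume ab: "a \<in> B \<rightarrow>\<^sub>E UNIV" "b \<in> B \<rightarrow>\<^sub>E UNIV"
    have "lincomb a B \<in> mat_kernel A"
      using Ker.lincomb_closed[of B a] sub by auto
    then show "(lincomb a B = lincomb b B) = (a = b)" using uniq ab by metis
  next
    fix v assume "v \<in> mat_kernel A"
    then show "\<exists>a\<in>B \<rightarrow>\<^sub>E UNIV. v = lincomb a B" using uniq by metis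
  qed
  then have "card (mat_kernel A) = card (B \<rightarrow>\<^sub>E (UNIV :: 'a set))"
    by (simp add: bij_betw_same_card)
  also have "\<dots> = CARD('a) ^ card B" using B(1) by (simp add: card_PiE)
  also have "card B = kernel_dim A" using Ker.dim_basis[OF B] by simp
  finally show ?thesis by (simp add: ker)
qed

section \<open>Frobenius maps and eigenvalues of large multiplicity\<close>

lemma finite_field_pow_card:
  fixes x :: "'a::{field,finite}"
  shows "x ^ CARD('a) = x"
proof (cases "x = 0")
  case False
  let ?U = "UNIV - {0 :: 'a}"
  have "(\<Prod>y\<in>?U. x * y) = (\<Prod>y\<in>?U. y)"
    by (rule prod.reindex_bij_witness[of _ "\<lambda>y. y / x" "\<lambda>y. x * y"]) (use False in auto)
  then have "x ^ card ?U * (\<Prod>y\<in>?U. y) = 1 * (\<Prod>y\<in>?U. y)"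
    by (simp add: prod.distrib)
  moreover have "(\<Prod>y\<in>?U. y) \<noteq> 0" by simp
  ultimately have "x ^ card ?U = 1" by (metis mult_right_cancel)
  moreover have "Suc (card ?U) = CARD('a)"
    by (simp add: card_Suc_Diff1)
  ultimately show ?thesis by (metis mult.right_neutral power_Suc)
qed auto

lemma CHAR_eq_of_card:
  assumes "CARD('a::{field,finite}) = p ^ k" "prime p"
  shows "CHAR('a) = p"
proof -
  have "CHAR('a) dvd p ^ k" using CHAR_dvd_CARD[where 'a = 'a] assms(1) by simp
  moreover have "prime CHAR('a)" by (rule prime_CHAR_semidom) (simp add: finite_imp_CHAR_pos)
  ultimately show ?thesis using assms(2) by (metis prime_dvd_power primes_dvd_imp_eq)
qed

lemma prime_CHAR_finite: "prime CHAR('a::{field,finite})"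
  by (rule prime_CHAR_semidom) (simp add: finite_imp_CHAR_pos)

lemma frobenius_add:
  fixes x y :: "'a::field"
  assumes "prime CHAR('a)" "q = CHAR('a) ^ e"
  shows "(x + y) ^ q = x ^ q + y ^ q"
  by (rule freshmans_dream'[OF assms])

lemma frobenius_minus:
  fixes x y :: "'a::field"
  assumes "prime CHAR('a)" "q = CHAR('a) ^ e"
  shows "(x - y) ^ q = x ^ q - y ^ q"
  using frobenius_add[OF assms, of "x - y" y] by simp

lemma power_fixed_points:
  assumes "n > 1"
  shows "finite {x::'a::field. x ^ n = x}" and "card {x::'a. x ^ n = x} \<le> n"
proof -
  define p where "p = monom 1 n - monom (1 :: 'a) 1"
  have "coeff p n = 1" using assms by (simp add: p_def)
  then have p0: "p \<noteq> 0" by auto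
  have "degree p \<le> n" unfolding p_def using assms
    by (intro degree_diff_le) (auto simp: degree_monom_eq)
  then have "card {x. poly p x = 0} \<le> n" using card_poly_roots_bound[OF p0] by linarith
  moreover have "{x. poly p x = 0} = {x. x ^ n = x}" by (auto simp: p_def poly_monom)
  ultimately show "finite {x::'a. x ^ n = x}" "card {x::'a. x ^ n = x} \<le> n"
    using poly_roots_finite[OF p0] by simp_all
qed

text \<open>With Q the order of the base field, x^Q = x has at most Q solutions, and the base field
  already supplies Q of them.\<close>

lemma fixed_by_frobenius_in_base:
  fixes z :: "'a::{field,finite} alg_closure"
  assumes z: "z ^ CARD('a) = z"
  shows "z \<in> range to_ac"
proof -
  let ?Q = "CARD('a)"
  have Q: "?Q > 1" using card_mono[of UNIV "{0, 1 :: 'a}"] by simp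
  note fp = power_fixed_points[OF Q, where 'a = "'a alg_closure"]
  have sub: "range (to_ac :: 'a \<Rightarrow> _) \<subseteq> {x. x ^ ?Q = x}"
    by (auto simp: finite_field_pow_card simp flip: to_ac_power)
  have "card (range (to_ac :: 'a \<Rightarrow> _)) = ?Q"
    by (rule card_image) (auto intro: injI)
  then have "range (to_ac :: 'a \<Rightarrow> _) = {x. x ^ ?Q = x}"
    using sub fp by (intro card_subset_eq) (auto dest: card_mono[rotated])
  then show ?thesis using z by simp
qed

text \<open>Raising entries to the power Q = |F| fixes \<open>g\<close> and turns g - lam into g -
  lam^Q, again of rank at most m. As 2m < N, the two matrices can only differ by the zero scalar, so
  \<open>lam\<close> is fixed by Frobenius.\<close>

lemma large_eigenvalue_in_base:
  fixes g :: "'a::{field,finite} mat"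
  assumes g: "g \<in> carrier_mat N N" and card: "CARD('a) = CHAR('a) ^ k"
    and dim: "eigenspace_dim g lam = N - m" and m: "2 * m < N"
  obtains l where "to_ac l = lam" "kernel_dim (g - l \<cdot>\<^sub>m 1\<^sub>m N) = N - m"
proof -
  let ?A = "map_mat to_ac g"
  let ?h = "\<lambda>x :: 'a alg_closure. x ^ CARD('a)"
  have A: "?A \<in> carrier_mat N N" using g by simp
  have pr: "prime CHAR('a alg_closure)" "CARD('a) = CHAR('a alg_closure) ^ k"
    using card prime_CHAR_finite[where 'a = 'a] by simp_all
  have kd: "kernel_dim (?A - lam \<cdot>\<^sub>m 1\<^sub>m N) = N - m"
    using dim g by (simp add: eigenspace_dim_def)
  have B: "?A - lam \<cdot>\<^sub>m 1\<^sub>m N \<in> carrier_mat N N" by (rule minus_carrier_mat) simp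
  have f: "factors_through N (?A - lam \<cdot>\<^sub>m 1\<^sub>m N) m"
    using factors_through_kernel_dim[OF B] kd m by simp
  have "factors_through N (map_mat ?h (?A - lam \<cdot>\<^sub>m 1\<^sub>m N)) m"
    by (rule factors_through_map[OF f B])
      (simp_all only: frobenius_add[OF pr] power_mult_distrib, simp)
  also have "map_mat ?h (?A - lam \<cdot>\<^sub>m 1\<^sub>m N) = ?A - (lam ^ CARD('a)) \<cdot>\<^sub>m 1\<^sub>m N"
    using g by (intro eq_matI)
      (auto simp: frobenius_minus[OF pr] finite_field_pow_card simp flip: to_ac_power)
  finally have f': "factors_through N (?A - (lam ^ CARD('a)) \<cdot>\<^sub>m 1\<^sub>m N) m" .
  have "lam ^ CARD('a) - lam = 0"
  proof (rule factors_through_scalar_diff[OF B _ f f'])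
    show "?A - lam ^ CARD('a) \<cdot>\<^sub>m 1\<^sub>m N \<in> carrier_mat N N" by (rule minus_carrier_mat) simp
    show "?A - lam \<cdot>\<^sub>m 1\<^sub>m N - (?A - lam ^ CARD('a) \<cdot>\<^sub>m 1\<^sub>m N) = (lam ^ CARD('a) - lam) \<cdot>\<^sub>m 1\<^sub>m N"
      using g by (intro eq_matI) (auto simp: algebra_simps)
  qed (use m in auto)
  then obtain l where l: "to_ac l = lam" using fixed_by_frobenius_in_base[of lam] by auto
  have "map_mat to_ac (g - l \<cdot>\<^sub>m 1\<^sub>m N) = ?A - lam \<cdot>\<^sub>m 1\<^sub>m N"
    using g by (intro eq_matI) (auto simp flip: l)
  then have "kernel_dim (g - l \<cdot>\<^sub>m 1\<^sub>m N) = N - m"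
    using kernel_dim_to_ac[OF minus_carrier_mat, of "l \<cdot>\<^sub>m 1\<^sub>m N" N g] kd by simp
  then show ?thesis using that l by blast
qed

lemma large_eigenvalue_nonzero:
  fixes g :: "'a::field mat"
  assumes g: "g \<in> carrier (GL_mat N)" and dim: "kernel_dim (g - l \<cdot>\<^sub>m 1\<^sub>m N) = N - m" and m: "m < N"
  shows "l \<noteq> 0"
proof
  assume l: "l = 0"
  have gc: "g \<in> carrier_mat N N" "det g \<noteq> 0" using g by (auto simp: carrier_GL_mat)
  have "g - l \<cdot>\<^sub>m 1\<^sub>m N = g" using gc l by (intro eq_matI) auto
  then have "factors_through N g m" using factors_through_kernel_dim[OF gc(1)] dim m by simp
  then show False using factors_through_det[OF gc(1)] m gc(2) by blast
qed

lemma kernel_dim_smult: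
  fixes A :: "'a::field mat"
  assumes A: "A \<in> carrier_mat n n" and c: "c \<noteq> 0"
  shows "kernel_dim (c \<cdot>\<^sub>m A) = kernel_dim A"
proof -
  have "mat_kernel (c \<cdot>\<^sub>m 1\<^sub>m n * A) = mat_kernel A"
    by (rule mat_kernel_mult_eq[of _ n n _ "inverse c \<cdot>\<^sub>m 1\<^sub>m n"])
      (use A c in \<open>auto simp: mult_smult_assoc_mat[of "1\<^sub>m n" n n "c \<cdot>\<^sub>m 1\<^sub>m n" n] intro!: eq_matI\<close>)
  moreover have "c \<cdot>\<^sub>m 1\<^sub>m n * A = c \<cdot>\<^sub>m A"
    using A by (simp add: mult_smult_assoc_mat[of "1\<^sub>m n" n n A n])
  ultimately show ?thesis using A by (simp add: kernel_dim_def)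
qed

section \<open>Vectors and tuples over a finite field\<close>

no_notation Polynomials.var (\<open>X\<index>\<close>)

text \<open>Vectors of \<open>F\<^sup>N\<close> are functions vanishing from \<open>N\<close> on. A tuple \<open>X\<close> of \<open>j\<close> vectors stands for
  the \<open>N \<times> j\<close> matrix with columns \<open>X a\<close>, that is, for the linear map \<open>b \<mapsto> lc j X b\<close> from \<open>F\<^sup>j\<close> to \<open>F\<^sup>N\<close>.\<close>

definition vecs :: "nat \<Rightarrow> (nat \<Rightarrow> 'a::zero) set" where
  "vecs N = {v. \<forall>i\<ge>N. v i = 0}"

definition tuples :: "nat \<Rightarrow> nat \<Rightarrow> (nat \<Rightarrow> nat \<Rightarrow> 'a::zero) set" where
  "tuples N j = {X. (\<forall>a. X a \<in> vecs N) \<and> (\<forall>a\<ge>j. X a = (\<lambda>_. 0))}"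

definition mv :: "'a::field mat \<Rightarrow> (nat \<Rightarrow> 'a) \<Rightarrow> nat \<Rightarrow> 'a" where
  "mv g v = (\<lambda>i. if i < dim_row g then \<Sum>k<dim_col g. g $$ (i, k) * v k else 0)"

definition act :: "'a::field mat \<Rightarrow> (nat \<Rightarrow> nat \<Rightarrow> 'a) \<Rightarrow> nat \<Rightarrow> nat \<Rightarrow> 'a" where
  "act g X = (\<lambda>a. mv g (X a))"

definition dot :: "nat \<Rightarrow> (nat \<Rightarrow> 'a::field) \<Rightarrow> (nat \<Rightarrow> 'a) \<Rightarrow> 'a" where
  "dot N u v = (\<Sum>i<N. u i * v i)"

definition lc :: "nat \<Rightarrow> (nat \<Rightarrow> nat \<Rightarrow> 'a::field) \<Rightarrow> (nat \<Rightarrow> 'a) \<Rightarrow> nat \<Rightarrow> 'a" where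
  "lc k X b = (\<lambda>i. \<Sum>a<k. b a * X a i)"

definition smul :: "'a::field \<Rightarrow> (nat \<Rightarrow> 'a) \<Rightarrow> nat \<Rightarrow> 'a" where
  "smul c v = (\<lambda>i. c * v i)"

lemma vecs_0 [simp]: "0 \<in> vecs N" "(\<lambda>_. 0) \<in> vecs N" by (auto simp: vecs_def)
lemma vecs_add [intro]: "u \<in> vecs N \<Longrightarrow> v \<in> vecs N \<Longrightarrow> u + v \<in> vecs N" for u v :: "nat \<Rightarrow> 'a::field"
  by (auto simp: vecs_def)
lemma vecs_diff [intro]: "u \<in> vecs N \<Longrightarrow> v \<in> vecs N \<Longrightarrow> u - v \<in> vecs N" for u v :: "nat \<Rightarrow> 'a::field"
  by (auto simp: vecs_def)
lemma vecs_uminus [intro]: "u \<in> vecs N \<Longrightarrow> - u \<in> vecs N" for u :: "nat \<Rightarrow> 'a::field"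
  by (auto simp: vecs_def)
lemma vecs_smul [intro]: "u \<in> vecs N \<Longrightarrow> smul c u \<in> vecs N"
  by (auto simp: vecs_def smul_def)
lemma vecs_lc [intro]: "(\<And>a. a < k \<Longrightarrow> X a \<in> vecs N) \<Longrightarrow> lc k X b \<in> vecs N"
  by (auto simp: vecs_def lc_def)
lemma vecs_mv [intro]: "g \<in> carrier_mat N n \<Longrightarrow> mv g u \<in> vecs N"
  by (auto simp: vecs_def mv_def)

lemma vecs_eqI: "u \<in> vecs N \<Longrightarrow> v \<in> vecs N \<Longrightarrow> (\<And>i. i < N \<Longrightarrow> u i = v i) \<Longrightarrow> u = v"
  unfolding vecs_def by (rule ext) (metis (mono_tags) mem_Collect_eq not_less)

lemma card_vecs:
  "finite (vecs N :: (nat \<Rightarrow> 'a::{field,finite}) set)" "card (vecs N :: (nat \<Rightarrow> 'a) set) = CARD('a) ^ N"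
proof -
  have b: "bij_betw (\<lambda>v. restrict v {..<N}) (vecs N :: (nat \<Rightarrow> 'a) set) ({..<N} \<rightarrow>\<^sub>E UNIV)"
    by (rule bij_betwI[of _ _ _ "\<lambda>f i. if i < N then f i else 0"])
      (auto simp: vecs_def fun_eq_iff not_less PiE_def extensional_def)
  show "finite (vecs N :: (nat \<Rightarrow> 'a) set)"
    using bij_betw_finite[OF b] by (simp add: finite_PiE)
  show "card (vecs N :: (nat \<Rightarrow> 'a) set) = CARD('a) ^ N"
    using bij_betw_same_card[OF b] by (simp add: card_PiE)
qed

lemma tuplesD: "X \<in> tuples N j \<Longrightarrow> X a \<in> vecs N" "X \<in> tuples N j \<Longrightarrow> a \<ge> j \<Longrightarrow> X a = (\<lambda>_. 0)"
  by (auto simp: tuples_def)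

lemma tuples_0 [simp]: "0 \<in> tuples N j" by (auto simp: tuples_def zero_fun_def)
lemma tuples_add [intro]: "X \<in> tuples N j \<Longrightarrow> Y \<in> tuples N j \<Longrightarrow> X + Y \<in> tuples N j"
  for X Y :: "nat \<Rightarrow> nat \<Rightarrow> 'a::field"
  by (auto simp: tuples_def vecs_def fun_eq_iff)
lemma tuples_diff [intro]: "X \<in> tuples N j \<Longrightarrow> Y \<in> tuples N j \<Longrightarrow> X - Y \<in> tuples N j"
  for X Y :: "nat \<Rightarrow> nat \<Rightarrow> 'a::field"
  by (auto simp: tuples_def vecs_def fun_eq_iff)
lemma tuples_uminus [intro]: "X \<in> tuples N j \<Longrightarrow> - X \<in> tuples N j"
  for X :: "nat \<Rightarrow> nat \<Rightarrow> 'a::field"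
  by (auto simp: tuples_def vecs_def fun_eq_iff)
lemma tuples_act [intro]: "g \<in> carrier_mat N N \<Longrightarrow> X \<in> tuples N j \<Longrightarrow> act g X \<in> tuples N j"
  by (auto simp: tuples_def act_def vecs_def mv_def fun_eq_iff)

lemma card_PiE_vecs_like:
  fixes S :: "(nat \<Rightarrow> 'a::zero) set"
  assumes "finite S"
  shows "finite {X. (\<forall>a<j. X a \<in> S) \<and> (\<forall>a\<ge>j. X a = (\<lambda>_. 0))}"
    and "card {X. (\<forall>a<j. X a \<in> S) \<and> (\<forall>a\<ge>j. X a = (\<lambda>_. 0))} = card S ^ j"
proof -
  let ?T = "{X. (\<forall>a<j. X a \<in> S) \<and> (\<forall>a\<ge>j. X a = (\<lambda>_. 0))}"
  have b: "bij_betw (\<lambda>v. restrict v {..<j}) ?T ({..<j} \<rightarrow>\<^sub>E S)"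
    by (rule bij_betwI[of _ _ _ "\<lambda>f i. if i < j then f i else (\<lambda>_. 0)"])
      (auto simp: fun_eq_iff not_less PiE_def extensional_def Pi_def)
  show "finite ?T" using bij_betw_finite[OF b] assms by (simp add: finite_PiE)
  show "card ?T = card S ^ j" using bij_betw_same_card[OF b] by (simp add: card_PiE)
qed

lemma tuples_alt: "tuples N j = {X. (\<forall>a<j. X a \<in> vecs N) \<and> (\<forall>a\<ge>j. X a = (\<lambda>_. 0))}"
  unfolding tuples_def by (metis not_less vecs_0(2))

lemma card_tuples:
  "finite (tuples N j :: (nat \<Rightarrow> nat \<Rightarrow> 'a::{field,finite}) set)"
  "card (tuples N j :: (nat \<Rightarrow> nat \<Rightarrow> 'a) set) = CARD('a) ^ (N * j)"
  unfolding tuples_alt using card_PiE_vecs_like[where S = "vecs N :: (nat \<Rightarrow> 'a) set" and j = j, OF card_vecs(1)]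
  by (simp_all add: card_vecs power_mult)

lemma mv_add: "mv g (u + v) = mv g u + mv g v"
  by (auto simp: mv_def fun_eq_iff sum.distrib algebra_simps)
lemma mv_diff: "mv g (u - v) = mv g u - mv g v"
  by (auto simp: mv_def fun_eq_iff sum_subtractf algebra_simps)
lemma mv_0 [simp]: "mv g 0 = 0" "mv g (\<lambda>_. 0) = 0"
  by (auto simp: mv_def fun_eq_iff)
lemma mv_smul: "mv g (smul c u) = smul c (mv g u)"
  by (auto simp: mv_def smul_def fun_eq_iff sum_distrib_left mult_ac)
lemma mv_lc: "mv g (lc k X b) = lc k (act g X) b"
proof
  fix i
  show "mv g (lc k X b) i = lc k (act g X) b i"
    by (simp add: mv_def lc_def act_def sum_distrib_left)
      (subst sum.swap, simp add: mult_ac)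
qed
lemma mv_mult:
  assumes "g \<in> carrier_mat n m" "h \<in> carrier_mat m l"
  shows "mv (g * h) v = mv g (mv h v)"
proof
  fix i
  show "mv (g * h) v i = mv g (mv h v) i"
  proof (cases "i < n")
    case True
    have "mv (g * h) v i = (\<Sum>k<l. (\<Sum>p<m. g $$ (i, p) * h $$ (p, k)) * v k)"
      using assms True by (simp add: mv_def scalar_prod_def atLeast0LessThan)
    also have "\<dots> = (\<Sum>p<m. g $$ (i, p) * (\<Sum>k<l. h $$ (p, k) * v k))"
      by (simp add: sum_distrib_left sum_distrib_right mult.assoc) (rule sum.swap)
    also have "\<dots> = mv g (mv h v) i" using assms True by (simp add: mv_def)
    finally show ?thesis .
  qed (use assms in \<open>simp add: mv_def\<close>)
qed
lemma mv_one: "v \<in> vecs N \<Longrightarrow> mv (1\<^sub>m N) v = v"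
  by (auto simp: mv_def vecs_def fun_eq_iff mult_delta_left not_less)

lemma act_one: "X \<in> tuples N j \<Longrightarrow> act (1\<^sub>m N) X = X"
  by (simp add: act_def mv_one tuplesD)
lemma act_add: "act g (X + Y) = act g X + act g Y"
  by (simp add: act_def mv_add fun_eq_iff)
lemma act_diff: "act g (X - Y) = act g X - act g Y"
  by (simp add: act_def mv_diff fun_eq_iff)

lemma lc_add: "lc k X (b + c) = lc k X b + lc k X c"
  by (auto simp: lc_def fun_eq_iff sum.distrib algebra_simps)
lemma lc_diff: "lc k X (b - c) = lc k X b - lc k X c"
  by (auto simp: lc_def fun_eq_iff sum_subtractf algebra_simps)
lemma lc_smul: "lc k X (smul c b) = smul c (lc k X b)"
  by (auto simp: lc_def smul_def fun_eq_iff sum_distrib_left mult_ac)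
lemma lc_0 [simp]: "lc k X 0 = 0" "lc k X (\<lambda>_. 0) = 0" by (auto simp: lc_def fun_eq_iff)
lemma lc_cong: "(\<And>a. a < k \<Longrightarrow> X a = Y a) \<Longrightarrow> (\<And>a. a < k \<Longrightarrow> b a = c a) \<Longrightarrow> lc k X b = lc k Y c"
  by (auto simp: lc_def fun_eq_iff)

lemma lc_extend:
  assumes "n < k"
  shows "lc k X (\<lambda>a. if a < n then b a else if a = n then c else 0) = lc n X b + smul c (X n)"
proof
  fix i
  let ?b = "\<lambda>a. if a < n then b a else if a = n then c else 0"
  have "(\<Sum>a<k. ?b a * X a i) = (\<Sum>a<Suc n. ?b a * X a i)"
    using assms by (intro sum.mono_neutral_right) auto
  also have "\<dots> = (\<Sum>a<n. b a * X a i) + c * X n i" by simp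
  finally show "lc k X ?b i = (lc n X b + smul c (X n)) i" by (simp add: lc_def smul_def)
qed

lemma mv_eq_mult_mat_vec:
  assumes "A \<in> carrier_mat n m"
  shows "A *\<^sub>v vec m v = vec n (mv A v)"
  using assms by (intro eq_vecI) (auto simp: mv_def scalar_prod_def atLeast0LessThan)

lemma GL_matI:
  assumes A: "A \<in> carrier_mat N N" and inj: "\<And>x. x \<in> vecs N \<Longrightarrow> mv A x = 0 \<Longrightarrow> x = 0"
  shows "A \<in> carrier (GL_mat N)"
proof -
  have "det A \<noteq> 0"
  proof
    assume "det A = 0"
    then obtain v where v: "v \<in> carrier_vec N" "v \<noteq> 0\<^sub>v N" "A *\<^sub>v v = 0\<^sub>v N"
      using det_0_iff_vec_prod_zero_field[OF A] by auto
    define x where "x i = (if i < N then v $ i else 0)" for i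
    have "vec N x = v" using v(1) by (auto simp: x_def)
    then have "vec N (mv A x) = 0\<^sub>v N" using mv_eq_mult_mat_vec[OF A, of x] v(3) by simp
    from arg_cong[OF this, of "\<lambda>w. vec_index w i" for i]
    have vi: "vec_index (vec N (mv A x)) i = vec_index (0\<^sub>v N) i" for i .
    have "mv A x i = 0" if "i < N" for i
      using that vi[of i] by (simp only: index_vec index_zero_vec)
    then have "mv A x = 0" using A by (auto simp: fun_eq_iff mv_def)
    then have "x = 0" using inj[of x] by (simp add: vecs_def x_def)
    then have "v = 0\<^sub>v N" using \<open>vec N x = v\<close> by auto
    with v(2) show False by simp
  qed
  then show ?thesis using A by (simp add: carrier_GL_mat)
qed

lemma GL_mv_inj:
  assumes "A \<in> carrier (GL_mat N)" "x \<in> vecs N" "y \<in> vecs N" "mv A x = mv A y"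
  shows "x = y"
proof -
  obtain B where B: "B \<in> carrier (GL_mat N)" "B * A = 1\<^sub>m N"
    using GL_mat_inverse[OF assms(1)] by blast
  have "mv B (mv A x) = mv B (mv A y)" using assms by simp
  moreover have "mv B (mv A z) = z" if "z \<in> vecs N" for z
    using B assms(1) that by (simp add: carrier_GL_mat mv_one flip: mv_mult[of B N N A N])
  ultimately show ?thesis using assms by metis
qed

lemma card_fix:
  fixes g :: "'a::{field,finite} mat"
  assumes g: "g \<in> carrier_mat N N"
  shows "card {v \<in> vecs N. mv g v = v} = CARD('a) ^ kernel_dim (g - 1\<^sub>m N)"
proof -
  have c: "g - 1\<^sub>m N \<in> carrier_mat N N" by (rule minus_carrier_mat) simp
  have e: "(g - 1\<^sub>m N) *\<^sub>v vec N v = vec N (mv g v - v)" for v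
  proof -
    have "mv (g - 1\<^sub>m N) v i = (mv g v - v) i" if "i < N" for i
      using g that by (simp add: mv_def algebra_simps sum_subtractf mult_delta_right)
    then show ?thesis using mv_eq_mult_mat_vec[OF c, of v] by auto
  qed
  have "bij_betw (\<lambda>v. vec N v) {v \<in> vecs N. mv g v = v} {v \<in> carrier_vec N. (g - 1\<^sub>m N) *\<^sub>v v = 0\<^sub>v N}"
  proof (rule bij_betwI[of _ _ _ "\<lambda>(v :: 'a vec) i. if i < N then v $ i else 0"])
    show "(\<lambda>v. vec N v) \<in> {v \<in> vecs N. mv g v = v} \<rightarrow> {v \<in> carrier_vec N. (g - 1\<^sub>m N) *\<^sub>v v = 0\<^sub>v N}"
      by (auto simp: e)
    show "(\<lambda>(v :: 'a vec) i. if i < N then v $ i else 0) \<in> {v \<in> carrier_vec N. (g - 1\<^sub>m N) *\<^sub>v v = 0\<^sub>v N} \<rightarrow> {v \<in> vecs N. mv g v = v}"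
    proof
      fix v assume "v \<in> {v \<in> carrier_vec N. (g - 1\<^sub>m N) *\<^sub>v v = 0\<^sub>v N}"
      then have v: "v \<in> carrier_vec N" "(g - 1\<^sub>m N) *\<^sub>v v = 0\<^sub>v N" by auto
      let ?x = "\<lambda>i. if i < N then v $ i else 0"
      have "vec N ?x = v" using v by auto
      then have "vec N (mv g ?x - ?x) = 0\<^sub>v N" using e[of ?x] v by simp
      from arg_cong[OF this, of "\<lambda>w. vec_index w i" for i]
      have vi: "vec_index (vec N (mv g ?x - ?x)) i = vec_index (0\<^sub>v N) i" for i .
      have "(mv g ?x - ?x) i = 0" if "i < N" for i
        using that vi[of i] by (simp only: index_vec index_zero_vec)
      then have "mv g ?x = ?x" using g by (intro vecs_eqI[of _ N]) (auto simp: vecs_def mv_def)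
      then show "?x \<in> {v \<in> vecs N. mv g v = v}" by (auto simp: vecs_def)
    qed
  qed (auto simp: vecs_def fun_eq_iff)
  then show ?thesis using card_kernel[OF c] by (simp add: bij_betw_same_card)
qed

lemma dot_add: "dot N (u + v) w = dot N u w + dot N v w" "dot N w (u + v) = dot N w u + dot N w v"
  by (simp_all add: dot_def sum.distrib algebra_simps)
lemma dot_diff: "dot N (u - v) w = dot N u w - dot N v w" "dot N w (u - v) = dot N w u - dot N w v"
  by (simp_all add: dot_def sum_subtractf algebra_simps)
lemma dot_smul: "dot N (smul c u) w = c * dot N u w" "dot N w (smul c u) = c * dot N w u"
  by (simp_all add: dot_def smul_def sum_distrib_left mult_ac)
lemma dot_lc: "dot N (lc k X b) w = (\<Sum>a<k. b a * dot N (X a) w)"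
  unfolding dot_def lc_def by (simp add: sum_distrib_right sum_distrib_left mult.assoc) (rule sum.swap)

text \<open>Induction on \<open>k\<close>. If some functional killing the earlier vectors is nonzero
  on \<open>y k\<close>, it is normalised to \<open>f0\<close> and the \<open>y k\<close>-component
  of \<open>u\<close> that it measures is subtracted; otherwise \<open>y k\<close> imposes no
  further condition.\<close>

lemma in_span_if_dual:
  assumes "u \<in> vecs N" "\<And>a. a < k \<Longrightarrow> y a \<in> vecs N"
    and "\<And>f. f \<in> vecs N \<Longrightarrow> (\<And>a. a < k \<Longrightarrow> dot N (y a) f = 0) \<Longrightarrow> dot N u f = 0"
  shows "\<exists>b. u = lc k y b"
  using assms
proof (induction k arbitrary: u)
  case 0
  have "u i = 0" for i
  proof (cases "i < N")
    case True
    have "dot N u (\<lambda>k. if k = i then 1 else 0) = 0" using 0 True by (intro 0(3)) (auto simp: vecs_def)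
    then show ?thesis using True by (simp add: dot_def mult_delta_right)
  qed (use 0 in \<open>simp add: vecs_def\<close>)
  then show ?case by (auto simp: lc_def fun_eq_iff)
next
  case (Suc k)
  let ?Y = "{f \<in> vecs N. \<forall>a<k. dot N (y a) f = 0}"
  show ?case
  proof (cases "\<exists>f0\<in>?Y. dot N (y k) f0 \<noteq> 0")
    case False
    then have "\<exists>b. u = lc k y b"
      using Suc.prems by (intro Suc.IH) (auto simp: less_Suc_eq)
    then obtain b where "u = lc k y b" by blast
    then show ?thesis
      by (intro exI[of _ "\<lambda>a. if a < k then b a else 0"]) (simp add: lc_def)
  next
    case True
    then obtain f1 where f1: "f1 \<in> ?Y" "dot N (y k) f1 \<noteq> 0" by blast
    define f0 where "f0 = smul (inverse (dot N (y k) f1)) f1"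
    have f0: "f0 \<in> vecs N" "\<And>a. a < k \<Longrightarrow> dot N (y a) f0 = 0" "dot N (y k) f0 = 1"
      using f1 by (auto simp: f0_def dot_smul)
    define c where "c = dot N u f0"
    have "\<exists>b. u - smul c (y k) = lc k y b"
    proof (rule Suc.IH)
      show "u - smul c (y k) \<in> vecs N" using Suc.prems by auto
      fix f assume f: "f \<in> vecs N" "\<And>a. a < k \<Longrightarrow> dot N (y a) f = 0"
      have "dot N u (f - smul (dot N (y k) f) f0) = 0"
      proof (rule Suc.prems(3))
        show "f - smul (dot N (y k) f) f0 \<in> vecs N" using f f0 by (intro vecs_diff vecs_smul)
        show "dot N (y a) (f - smul (dot N (y k) f) f0) = 0" if "a < Suc k" for a
          using f f0 that by (simp only: dot_diff dot_smul) (auto simp: less_Suc_eq)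
      qed
      then show "dot N (u - smul c (y k)) f = 0"
        by (simp add: dot_diff dot_smul c_def mult.commute)
    qed (use Suc.prems in auto)
    then obtain b where b: "u - smul c (y k) = lc k y b" by blast
    then have "u = lc k y b + smul c (y k)" by (metis diff_add_cancel)
    also have "\<dots> = lc (Suc k) y (\<lambda>a. if a < k then b a else if a = k then c else 0)"
      by (rule lc_extend[symmetric]) simp
    finally show ?thesis by blast
  qed
qed

text \<open>A group is not the union of two proper subgroups: if neither \<open>u\<close> nor
  \<open>v\<close> will do, their sum does.\<close>

lemma two_functionals:
  fixes \<phi> \<psi> :: "'v::ab_group_add \<Rightarrow> 'b::ab_group_add"
  assumes Y: "\<And>u v. u \<in> Y \<Longrightarrow> v \<in> Y \<Longrightarrow> u + v \<in> Y"
    and add: "\<And>u v. \<phi> (u + v) = \<phi> u + \<phi> v" "\<And>u v. \<psi> (u + v) = \<psi> u + \<psi> v"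
    and "u \<in> Y" "\<phi> u \<noteq> 0" "v \<in> Y" "\<psi> v \<noteq> 0"
  obtains w where "w \<in> Y" "\<phi> w \<noteq> 0" "\<psi> w \<noteq> 0"
proof (cases "\<psi> u \<noteq> 0 \<or> \<phi> v \<noteq> 0")
  case True
  then show ?thesis using that assms by blast
next
  case False
  then show ?thesis using that[of "u + v"] assms by auto
qed

text \<open>Common skeleton of the transitivity of GL and of Witt's theorem: columns are matched one
  at a time. A column in the span of the earlier ones is matched automatically, because X and Y
  satisfy the same linear relations; so \<open>step\<close> only has to move one vector outside the
  span to another one outside it.\<close>

lemma columnwise_transitive:
  fixes X Y :: "nat \<Rightarrow> nat \<Rightarrow> 'a::field"
  assumes XY: "\<And>a. a < k \<Longrightarrow> X a \<in> vecs N" "\<And>a. a < k \<Longrightarrow> Y a \<in> vecs N"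
    and ker: "\<And>b. lc k X b = 0 \<longleftrightarrow> lc k Y b = 0"
    and \<G>: "\<G> \<subseteq> carrier (GL_mat N)" "\<And>g h. g \<in> \<G> \<Longrightarrow> h \<in> \<G> \<Longrightarrow> g * h \<in> \<G>" "1\<^sub>m N \<in> \<G>"
    and step: "\<And>n g. \<lbrakk>n < k; g \<in> \<G>; \<And>a. a < n \<Longrightarrow> mv g (X a) = Y a;
        \<nexists>b. mv g (X n) = lc n Y b; \<nexists>b. Y n = lc n Y b\<rbrakk>
      \<Longrightarrow> \<exists>g'\<in>\<G>. (\<forall>a<n. mv g' (Y a) = Y a) \<and> mv g' (mv g (X n)) = Y n"
  shows "\<exists>g\<in>\<G>. \<forall>a<k. mv g (X a) = Y a"
proof -
  have "\<exists>g\<in>\<G>. \<forall>a<n. mv g (X a) = Y a" if "n \<le> k" for n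
    using that
  proof (induction n)
    case 0
    then show ?case using \<G> by auto
  next
    case (Suc n)
    then obtain g where g: "g \<in> \<G>" "\<forall>a<n. mv g (X a) = Y a" by auto
    have n: "n < k" using Suc by simp
    have gc: "g \<in> carrier_mat N N" using g(1) \<G>(1) by (auto simp: carrier_GL_mat)
    have rel: "mv g (X n) = lc n Y b \<longleftrightarrow> Y n = lc n Y b" for b
    proof -
      \<comment> \<open>The coefficient -1 at position \<open>n\<close> turns a dependence of column
        \<open>n\<close> on its predecessors into a linear relation, to which \<open>ker\<close>
        applies.\<close>
      let ?b = "\<lambda>a. if a < n then b a else if a = n then - 1 else 0"
      have r: "lc k Z ?b = lc n Z b - Z n" for Z
        using lc_extend[OF n, of Z b "- 1"] by (simp add: smul_def fun_eq_iff)
      have "mv g (X n) = lc n Y b \<longleftrightarrow> mv g (X n) = mv g (lc n X b)"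
        using g(2) by (simp add: mv_lc act_def cong: lc_cong)
      also have "\<dots> \<longleftrightarrow> X n = lc n X b"
      proof
        assume eq: "mv g (X n) = mv g (lc n X b)"
        have "X n \<in> vecs N" "lc n X b \<in> vecs N" using XY n by (auto intro!: vecs_lc)
        then show "X n = lc n X b" using GL_mv_inj[of g N, OF _ _ _ eq] g(1) \<G>(1) by auto
      qed simp
      also have "\<dots> \<longleftrightarrow> Y n = lc n Y b"
        using ker[of ?b] r[of X] r[of Y] by (metis eq_iff_diff_eq_0)
      finally show ?thesis .
    qed
    show ?case
    proof (cases "\<exists>b. Y n = lc n Y b")
      case True
      then have "mv g (X n) = Y n" using rel by metis
      then show ?thesis using g less_Suc_eq by auto
    next
      case False
      then obtain g' where g': "g' \<in> \<G>" "\<forall>a<n. mv g' (Y a) = Y a" "mv g' (mv g (X n)) = Y n"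
        using step[OF n g(1)] g(2) rel by blast
      have "g' \<in> carrier_mat N N" using g'(1) \<G>(1) by (auto simp: carrier_GL_mat)
      then have "\<forall>a<Suc n. mv (g' * g) (X a) = Y a"
        using g(2) g' gc by (auto simp: mv_mult less_Suc_eq)
      then show ?thesis using \<G>(2)[OF g'(1) g(1)] by blast
    qed
  qed
  then show ?thesis by auto
qed

section \<open>Subspaces, spans and counting\<close>

definition is_subspace :: "(nat \<Rightarrow> 'a::field) set \<Rightarrow> bool" where
  "is_subspace W \<longleftrightarrow> 0 \<in> W \<and> (\<forall>u\<in>W. \<forall>v\<in>W. u + v \<in> W) \<and> (\<forall>c. \<forall>u\<in>W. smul c u \<in> W)"

definition lspan :: "nat \<Rightarrow> (nat \<Rightarrow> nat \<Rightarrow> 'a::field) \<Rightarrow> (nat \<Rightarrow> 'a) set" where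
  "lspan k X = lc k X ` vecs k"

definition indep :: "nat \<Rightarrow> (nat \<Rightarrow> nat \<Rightarrow> 'a::field) \<Rightarrow> bool" where
  "indep k X \<longleftrightarrow> (\<forall>b\<in>vecs k. lc k X b = 0 \<longrightarrow> b = 0)"

lemma card_field_gt_1: "CARD('a::{field,finite}) > 1"
  using card_mono[of UNIV "{0, 1 :: 'a}"] by simp

lemma smul_simps [simp]: "smul 0 u = 0" "smul 1 u = u" "smul c 0 = 0" "smul c (\<lambda>_. 0) = 0"
  by (auto simp: smul_def fun_eq_iff)

lemma smul_smul [simp]: "smul c (smul d u) = smul (c * d) u"
  by (simp add: smul_def mult.assoc)

lemma smul_minus_one: "smul (- 1) u = - u"
  by (simp add: smul_def fun_eq_iff)

lemma smul_add: "smul c (u + v) = smul c u + smul c v" "smul (c + d) u = smul c u + smul d u"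
  by (auto simp: smul_def fun_eq_iff algebra_simps)

lemma smul_diff: "smul c (u - v) = smul c u - smul c v" "smul (c - d) u = smul c u - smul d u"
  by (auto simp: smul_def fun_eq_iff algebra_simps)

lemma smul_eq_0_iff: "smul c u = 0 \<longleftrightarrow> c = 0 \<or> u = 0"
  by (auto simp: smul_def fun_eq_iff)

lemma is_subspaceD:
  assumes "is_subspace W"
  shows "0 \<in> W" "u \<in> W \<Longrightarrow> v \<in> W \<Longrightarrow> u + v \<in> W" "u \<in> W \<Longrightarrow> smul c u \<in> W"
    "u \<in> W \<Longrightarrow> - u \<in> W" "u \<in> W \<Longrightarrow> v \<in> W \<Longrightarrow> u - v \<in> W"
proof -
  show 1: "0 \<in> W" "u \<in> W \<Longrightarrow> v \<in> W \<Longrightarrow> u + v \<in> W" "u \<in> W \<Longrightarrow> smul c u \<in> W" for u v c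
    using assms by (auto simp: is_subspace_def)
  show 2: "- u \<in> W" if "u \<in> W" for u
    using 1(3)[OF that, of "- 1"] by (simp add: smul_minus_one)
  show "u \<in> W \<Longrightarrow> v \<in> W \<Longrightarrow> u - v \<in> W"
    using 1(2)[OF _ 2, of u v] by simp
qed

lemma is_subspace_lc:
  assumes "is_subspace W" "\<And>a. a < k \<Longrightarrow> X a \<in> W"
  shows "lc k X b \<in> W"
  using assms(2)
proof (induction k)
  case 0
  then show ?case using is_subspaceD(1)[OF assms(1)] by (simp add: lc_def zero_fun_def)
next
  case (Suc k)
  have "lc (Suc k) X b = lc k X b + smul (b k) (X k)"
    by (simp add: lc_def smul_def fun_eq_iff)
  moreover have "lc k X b \<in> W" "smul (b k) (X k) \<in> W"
    using Suc is_subspaceD(3)[OF assms(1)] by simp_all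
  ultimately show ?case using is_subspaceD(2)[OF assms(1)] by metis
qed

lemma lspan_iff: "u \<in> lspan k X \<longleftrightarrow> (\<exists>b. u = lc k X b)"
proof
  assume "\<exists>b. u = lc k X b"
  then obtain b where "u = lc k X b" by blast
  then have "u = lc k X (\<lambda>a. if a < k then b a else 0)" by (simp cong: lc_cong)
  moreover have "(\<lambda>a. if a < k then b a else 0) \<in> vecs k" by (simp add: vecs_def)
  from imageI[OF this, of "lc k X"] have "lc k X (\<lambda>a. if a < k then b a else 0) \<in> lspan k X"
    unfolding lspan_def .
  ultimately show "u \<in> lspan k X" by simp
qed (auto simp: lspan_def)

lemma is_subspace_lspan: "is_subspace (lspan k X)"
  unfolding is_subspace_def lspan_iff
proof (intro conjI ballI allI)
  show "\<exists>b. 0 = lc k X b" by (rule exI[of _ 0]) simp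
next
  fix u v assume "u \<in> lspan k X" "v \<in> lspan k X"
  then show "\<exists>b. u + v = lc k X b" unfolding lspan_iff by (metis lc_add)
next
  fix c u assume "u \<in> lspan k X"
  then show "\<exists>b. smul c u = lc k X b" unfolding lspan_iff by (metis lc_smul)
qed

lemma is_subspace_vecs: "is_subspace (vecs N)"
  by (auto simp: is_subspace_def)

lemma lspan_member: "a < k \<Longrightarrow> X a \<in> lspan k X"
  unfolding lspan_iff
  by (rule exI[of _ "\<lambda>i. if i = a then 1 else 0"]) (simp add: lc_def mult_delta_left fun_eq_iff)

lemma lspan_vecs: "(\<And>a. a < k \<Longrightarrow> X a \<in> vecs N) \<Longrightarrow> lspan k X \<subseteq> vecs N"
  by (auto simp: lspan_def intro!: vecs_lc)

lemma indep_inj: "indep k X \<Longrightarrow> inj_on (lc k X) (vecs k)"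
proof (rule inj_onI)
  fix b c assume i: "indep k X" and "b \<in> vecs k" "c \<in> vecs k" "lc k X b = lc k X c"
  then have "lc k X (b - c) = 0" "b - c \<in> vecs k" by (auto simp: lc_diff)
  then show "b = c" using i by (metis indep_def eq_iff_diff_eq_0)
qed

lemma card_lspan_indep:
  fixes X :: "nat \<Rightarrow> nat \<Rightarrow> 'a::{field,finite}"
  shows "indep k X \<Longrightarrow> card (lspan k X) = CARD('a) ^ k"
  unfolding lspan_def using card_image[OF indep_inj] by (metis card_vecs(2))

lemma card_hom:
  fixes \<phi> :: "'v::ab_group_add \<Rightarrow> 'w::ab_group_add"
  assumes fin: "finite A" and A: "\<And>u v. u \<in> A \<Longrightarrow> v \<in> A \<Longrightarrow> u + v \<in> A" "\<And>u v. u \<in> A \<Longrightarrow> v \<in> A \<Longrightarrow> u - v \<in> A"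
    and add: "\<And>u v. u \<in> A \<Longrightarrow> v \<in> A \<Longrightarrow> \<phi> (u - v) = \<phi> u - \<phi> v"
  shows "card A = card (\<phi> ` A) * card {x \<in> A. \<phi> x = 0}"
proof -
  let ?K = "{x \<in> A. \<phi> x = 0}"
  have fib: "card {x \<in> A. \<phi> x = w} = card ?K" if w: "w \<in> \<phi> ` A" for w
  proof -
    obtain u where u: "u \<in> A" "\<phi> u = w" using w by auto
    have p: "\<phi> (u + x) = \<phi> u + \<phi> x" if "x \<in> A" for x
      using add[OF A(1)[OF u(1) that] that] by (simp add: algebra_simps)
    have "bij_betw (\<lambda>x. u + x) ?K {x \<in> A. \<phi> x = w}"
      by (rule bij_betwI[of _ _ _ "\<lambda>x. x - u"]) (use u A add p in auto)
    then show ?thesis by (rule bij_betw_same_card[symmetric])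
  qed
  have "card A = card (\<Union>w\<in>\<phi> ` A. {x \<in> A. \<phi> x = w})" by (rule arg_cong[of _ _ card]) auto
  also have "\<dots> = (\<Sum>w\<in>\<phi> ` A. card {x \<in> A. \<phi> x = w})"
    by (rule card_UN_disjoint) (use fin in auto)
  also have "\<dots> = (\<Sum>w\<in>\<phi> ` A. card ?K)" using fib by (intro sum.cong) auto
  finally show ?thesis by simp
qed

lemma is_subspace_closed:
  assumes "is_subspace W"
  shows "\<And>u v. u \<in> W \<Longrightarrow> v \<in> W \<Longrightarrow> u + v \<in> W" "\<And>u v. u \<in> W \<Longrightarrow> v \<in> W \<Longrightarrow> u - v \<in> W"
  using is_subspaceD[OF assms] by auto

lemma dot_hom_surj:
  fixes f :: "nat \<Rightarrow> 'a::field"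
  assumes W: "is_subspace W" and "w \<in> W" "dot N w f \<noteq> 0"
  shows "(\<lambda>k. dot N k f) ` W = UNIV"
proof -
  have "\<exists>k\<in>W. x = dot N k f" for x
    using assms by (intro bexI[of _ "smul (x / dot N w f) w"]) (auto simp: dot_smul intro: is_subspaceD)
  then show ?thesis by auto
qed

lemma card_hyperplane:
  fixes f :: "nat \<Rightarrow> 'a::{field,finite}"
  assumes W: "is_subspace W" "finite W" and w: "w \<in> W" "dot N w f \<noteq> 0"
  shows "card W = CARD('a) * card {k \<in> W. dot N k f = 0}"
  using card_hom[of W "\<lambda>k. dot N k f", OF W(2) is_subspace_closed[OF W(1)]]
    dot_hom_surj[OF W(1) w] by (simp add: dot_diff)

lemma indep_extend:
  assumes ind: "indep n X" and u: "u \<notin> lspan n X"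
  shows "indep (Suc n) (X(n := u))"
  unfolding indep_def
proof (intro ballI impI)
  fix b assume b: "b \<in> vecs (Suc n)" "lc (Suc n) (X(n := u)) b = 0"
  have "lc (Suc n) (X(n := u)) b = lc n X b + smul (b n) u"
    by (simp add: lc_def smul_def fun_eq_iff)
  then have eq: "lc n X b + smul (b n) u = 0" using b by simp
  have "b n = 0"
  proof (rule ccontr)
    assume bn: "b n \<noteq> 0"
    have "u = smul (- inverse (b n)) (lc n X b)"
      using eq bn by (simp add: smul_def fun_eq_iff field_simps) (metis add.commute add.inverse_unique mult.commute)
    then show False using u unfolding lspan_iff by (metis lc_smul)
  qed
  moreover from this have "lc n X b = 0" using eq by simp
  moreover from calculation have "b \<in> vecs n" using b(1) by (auto simp: vecs_def le_Suc_eq) (metis le_antisym not_less_eq_eq)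
  ultimately show "b = 0" using ind by (simp add: indep_def)
qed

text \<open>Take \<open>k\<close> maximal, which is possible because an independent family in
  \<open>W\<close> has length k < 2^k \<le> |W|.\<close>

lemma basis_extend:
  fixes y :: "nat \<Rightarrow> nat \<Rightarrow> 'a::{field,finite}"
  assumes W: "is_subspace W" "finite W" and ind: "indep d y" and yW: "\<And>a. a < d \<Longrightarrow> y a \<in> W"
  obtains k y' where "d \<le> k" "indep k y'" "\<And>a. a < d \<Longrightarrow> y' a = y a" "lspan k y' = W"
proof -
  let ?P = "\<lambda>k. d \<le> k \<and> (\<exists>y'. indep k y' \<and> (\<forall>a<d. y' a = y a) \<and> lspan k y' \<subseteq> W)"
  have sub: "lspan k y' \<subseteq> W" if "\<And>a. a < k \<Longrightarrow> y' a \<in> W" for k y'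
    using that by (auto simp: lspan_def intro: is_subspace_lc[OF W(1)])
  have Pd: "?P d" using ind sub[OF yW] by (intro conjI exI[of _ y]) simp_all
  have bound: "k \<le> card W" if "?P k" for k
  proof -
    obtain y' where y': "indep k y'" "lspan k y' \<subseteq> W" using \<open>?P k\<close> by blast
    have "k < 2 ^ k" by (rule less_exp)
    also have "(2::nat) ^ k \<le> CARD('a) ^ k"
      using card_field_gt_1[where 'a = 'a] by (intro power_mono) auto
    also have "\<dots> \<le> card W"
      using card_lspan_indep[OF y'(1)] card_mono[OF W(2) y'(2)] by simp
    finally show ?thesis by simp
  qed
  then obtain k where k: "?P k" "\<And>k'. ?P k' \<Longrightarrow> k' \<le> k"
    using Nat.ex_has_greatest_nat[of ?P d "card W"] Pd by blast
  then obtain y' where y': "indep k y'" "\<forall>a<d. y' a = y a" "lspan k y' \<subseteq> W" by blast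
  have "W \<subseteq> lspan k y'"
  proof (rule ccontr)
    assume "\<not> W \<subseteq> lspan k y'"
    then obtain u where u: "u \<in> W" "u \<notin> lspan k y'" by blast
    have "indep (Suc k) (y'(k := u))" by (rule indep_extend[OF y'(1) u(2)])
    moreover have "(y'(k := u)) a \<in> W" if "a < Suc k" for a
      using that u y'(3) lspan_member[of a k y'] by (auto simp: less_Suc_eq)
    ultimately have "?P (Suc k)" using k(1) y'(2) sub[of "Suc k" "y'(k := u)"]
      by (intro conjI exI[of _ "y'(k := u)"]) auto
    then show False using k(2)[of "Suc k"] by simp
  qed
  then show ?thesis using that[of k y'] k(1) y' by blast
qed

lemma indep_0 [simp]: "indep 0 X"
  by (auto simp: indep_def vecs_def fun_eq_iff)

lemma subspace_basis:
  fixes W :: "(nat \<Rightarrow> 'a::{field,finite}) set"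
  assumes "is_subspace W" "finite W"
  obtains k y where "indep k y" "lspan k y = W"
  using basis_extend[OF assms indep_0] by (metis less_zeroE)

text \<open>Complete \<open>B\<close> to a basis of F^j. A tuple, seen as a linear map on F^j, is
  determined by its values on that basis, and the values on the first \<open>d\<close> basis vectors
  are zero.\<close>

lemma card_annihilating_tuples:
  fixes S :: "(nat \<Rightarrow> 'a::{field,finite}) set"
  assumes S: "is_subspace S" "S \<subseteq> vecs N"
    and B: "indep d B" "\<And>i. i < d \<Longrightarrow> B i \<in> vecs j"
  shows "card {X \<in> tuples N j. (\<forall>a<j. X a \<in> S) \<and> (\<forall>i<d. lc j X (B i) = 0)} \<le> card S ^ (j - d)"
    and "d \<le> j"
proof -
  have finS: "finite S" using S(2) card_vecs(1) by (rule finite_subset)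
  obtain k B' where B': "d \<le> k" "indep k B'" "\<And>i. i < d \<Longrightarrow> B' i = B i" "lspan k B' = vecs j"
    using basis_extend[OF is_subspace_vecs card_vecs(1) B] by blast
  have "CARD('a) ^ k = CARD('a) ^ j" using card_lspan_indep[OF B'(2)] B'(4) card_vecs(2) by metis
  then have [simp]: "k = j" using card_field_gt_1[where 'a = 'a] by (simp add: power_inject_exp)
  show "d \<le> j" using B'(1) by simp
  let ?A = "{X \<in> tuples N j. (\<forall>a<j. X a \<in> S) \<and> (\<forall>i<d. lc j X (B i) = 0)}"
  define \<Phi> where "\<Phi> X = (\<lambda>a. if a < j - d then lc j X (B' (a + d)) else (\<lambda>_. 0))" for X
  let ?T = "{X. (\<forall>a<j - d. X a \<in> S) \<and> (\<forall>a\<ge>j - d. X a = (\<lambda>_. 0))}"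
  have "inj_on \<Phi> ?A"
  proof (rule inj_onI)
    fix X Y assume X: "X \<in> ?A" and Y: "Y \<in> ?A" and eq: "\<Phi> X = \<Phi> Y"
    have e: "lc j X (B' i) = lc j Y (B' i)" if "i < j" for i
    proof (cases "i < d")
      case True
      then show ?thesis using X Y B'(3) by auto
    next
      case False
      then have "i - d < j - d" "i - d + d = i" using that by auto
      then show ?thesis using fun_cong[OF eq, of "i - d"] by (simp add: \<Phi>_def)
    qed
    have l: "lc j X (lc j B' c) = lc j Y (lc j B' c)" for c
    proof
      fix i
      have x: "lc j Z (lc j B' c) i = (\<Sum>b<j. c b * lc j Z (B' b) i)" for Z
        unfolding lc_def by (simp add: sum_distrib_left sum_distrib_right mult.assoc) (rule sum.swap)
      show "lc j X (lc j B' c) i = lc j Y (lc j B' c) i"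
        unfolding x using e by (intro sum.cong refl) simp
    qed
    have "X a = Y a" if "a < j" for a
    proof -
      have "(\<lambda>i. if i = a then 1 else 0) \<in> vecs j" using that by (auto simp: vecs_def)
      then obtain c where c: "(\<lambda>i. if i = a then 1 else 0) = lc j B' c"
        using B'(4) unfolding \<open>k = j\<close> by (metis lspan_iff)
      have z: "lc j Z (\<lambda>i. if i = a then 1 else 0) = Z a" for Z :: "nat \<Rightarrow> nat \<Rightarrow> 'a"
        using that by (simp add: lc_def mult_delta_left)
      show ?thesis using l[of c] unfolding c[symmetric] z .
    qed
    moreover have "X a = Y a" if "a \<ge> j" for a
      using X Y tuplesD(2)[of X N j, OF _ that] tuplesD(2)[of Y N j, OF _ that] by simp
    ultimately show "X = Y" by (metis ext not_less)
  qed
  moreover have "\<Phi> ` ?A \<subseteq> ?T"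
    by (auto simp: \<Phi>_def intro!: is_subspace_lc[OF S(1)])
  ultimately have "card ?A \<le> card ?T"
    using card_PiE_vecs_like(1)[OF finS] by (intro card_inj_on_le)
  then show "card ?A \<le> card S ^ (j - d)" using card_PiE_vecs_like(2)[OF finS] by simp
qed

section \<open>The permutation kernel for the general linear group\<close>

declare GL_mat_simps [simp del]

locale mat_irr_char = irr_char G \<chi>
  for G :: "'a::{field,finite} mat monoid" (structure) and \<chi> +
  fixes N :: nat
  assumes sub_GL: "carrier G \<subseteq> carrier (GL_mat N)"
    and mult_eq: "x \<otimes> y = x * y" and one_eq: "\<one> = 1\<^sub>m N"
begin

lemma sum_conj:
  assumes "g \<in> carrier G"
  shows "(\<Sum>x\<in>carrier G. F (g \<otimes> x \<otimes> inv g)) = (\<Sum>x\<in>carrier G. F x)"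
  using sum_left[of g "\<lambda>x. F (x \<otimes> inv g)"] sum_right[of "inv g" F] assms by simp

lemma carrier_matG: "x \<in> carrier G \<Longrightarrow> x \<in> carrier_mat N N"
  using sub_GL by (auto simp: carrier_GL_mat)

lemma mvG_in [intro]: "x \<in> carrier G \<Longrightarrow> mv x v \<in> vecs N"
  using carrier_matG by blast

lemma mvG_mult: "x \<in> carrier G \<Longrightarrow> y \<in> carrier G \<Longrightarrow> mv (x \<otimes> y) v = mv x (mv y v)"
  unfolding mult_eq using carrier_matG by (blast intro: mv_mult)

lemma mvG_one: "v \<in> vecs N \<Longrightarrow> mv \<one> v = v"
  unfolding one_eq by (rule mv_one)

lemma mvG_inv:
  assumes "x \<in> carrier G" "v \<in> vecs N"
  shows "mv (inv x) (mv x v) = v" "mv x (mv (inv x) v) = v"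
  using assms mvG_mult[of "inv x" x v] mvG_mult[of x "inv x" v] mvG_one by simp_all

lemma actG_in [intro]: "x \<in> carrier G \<Longrightarrow> X \<in> tuples N j \<Longrightarrow> act x X \<in> tuples N j"
  using carrier_matG by blast

lemma actG_mult: "x \<in> carrier G \<Longrightarrow> y \<in> carrier G \<Longrightarrow> act (x \<otimes> y) X = act x (act y X)"
  by (simp add: act_def mvG_mult)

lemma actG_one: "X \<in> tuples N j \<Longrightarrow> act \<one> X = X"
  unfolding one_eq by (rule act_one)

lemma actG_inv:
  assumes "x \<in> carrier G" "X \<in> tuples N j"
  shows "act (inv x) (act x X) = X" "act x (act (inv x) X) = X"
  using assms actG_mult[of "inv x" x X] actG_mult[of x "inv x" X] actG_one by simp_all

lemma actG_bij:
  assumes "x \<in> carrier G"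
  shows "bij_betw (act x) (tuples N j) (tuples N j)"
  by (rule bij_betwI[of _ _ _ "act (inv x)"]) (use assms actG_inv in auto)

text \<open>The permutation character on V; it equals tau for GL and tau^2 for GU.\<close>

definition fixn :: "'a mat \<Rightarrow> nat" where "fixn x = card {v \<in> vecs N. mv x v = v}"

lemma fixn_power:
  assumes "x \<in> carrier G"
  shows "fixn x = CARD('a) ^ kernel_dim (x - 1\<^sub>m N)"
  unfolding fixn_def by (rule card_fix) (rule carrier_matG[OF assms])

lemma fixn_class:
  assumes "x \<in> carrier G" "y \<in> carrier G"
  shows "fixn (x \<otimes> y) = fixn (y \<otimes> x)"
  unfolding fixn_def
proof (rule bij_betw_same_card, rule bij_betwI[of _ _ _ "mv x"])
  show "mv y \<in> {v \<in> vecs N. mv (x \<otimes> y) v = v} \<rightarrow> {v \<in> vecs N. mv (y \<otimes> x) v = v}"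
    using assms by (auto simp: mvG_mult)
  show "mv x \<in> {v \<in> vecs N. mv (y \<otimes> x) v = v} \<rightarrow> {v \<in> vecs N. mv (x \<otimes> y) v = v}"
    using assms by (auto simp: mvG_mult)
qed (use assms in \<open>auto simp: mvG_mult\<close>)

lemma card_fixed_tuples: "card {X \<in> tuples N j. act x X = X} = fixn x ^ j"
proof -
  have "{X \<in> tuples N j. act x X = X} =
      {X. (\<forall>a<j. X a \<in> {v \<in> vecs N. mv x v = v}) \<and> (\<forall>a\<ge>j. X a = (\<lambda>_. 0))}"
  proof (rule Set.set_eqI, rule iffI)
    fix X assume "X \<in> {X \<in> tuples N j. act x X = X}"
    then have X: "X \<in> tuples N j" "act x X = X" by auto
    have "mv x (X a) = X a" for a using fun_cong[OF X(2), of a] by (simp add: act_def)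
    then show "X \<in> {X. (\<forall>a<j. X a \<in> {v \<in> vecs N. mv x v = v}) \<and> (\<forall>a\<ge>j. X a = (\<lambda>_. 0))}"
      using X(1) by (simp add: tuples_alt)
  next
    fix X assume X: "X \<in> {X. (\<forall>a<j. X a \<in> {v \<in> vecs N. mv x v = v}) \<and> (\<forall>a\<ge>j. X a = (\<lambda>_. 0))}"
    have "mv x (X a) = X a" for a using X by (cases "a < j") auto
    then have "act x X = X" unfolding act_def by (rule ext)
    then show "X \<in> {X \<in> tuples N j. act x X = X}" using X by (simp add: tuples_alt)
  qed
  moreover have "finite {v \<in> vecs N. mv x v = v}" using card_vecs(1) by (rule rev_finite_subset) auto
  ultimately show ?thesis
    using card_PiE_vecs_like(2)[of "{v \<in> vecs N. mv x v = v}" j] unfolding fixn_def by metis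
qed

lemma fixed_iff_inv_fixed:
  assumes "x \<in> carrier G" "X \<in> tuples N j" "Y \<in> tuples N j"
  shows "act x X = Y \<longleftrightarrow> act (inv x) Y = X"
  using actG_inv[OF assms(1)] assms by metis

end

locale GL_level = mat_irr_char "GL_mat N" \<chi> N
  for \<chi> :: "'a::{field,finite} mat \<Rightarrow> complex" and N :: nat +
  fixes j :: nat
  assumes j_pos: "j > 0"
    and level_nonzero: "(\<Sum>x\<in>carrier (GL_mat N). cnj (\<chi> x) * of_nat (fixn x ^ j)) \<noteq> 0"
    and level_below: "(\<Sum>x\<in>carrier (GL_mat N). cnj (\<chi> x) * of_nat (fixn x ^ (j - 1))) = 0"
begin

abbreviation "GG \<equiv> GL_mat N :: 'a mat monoid"
abbreviation "VV \<equiv> tuples N j :: (nat \<Rightarrow> nat \<Rightarrow> 'a) set"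
lemma finVV: "finite VV" by (rule card_tuples(1))


text \<open>Up to a factor, the kernel of the projection of the functions on \<open>V\<^sup>j\<close> onto their \<open>\<chi>\<close>-isotypic part.\<close>

definition KK :: "(nat \<Rightarrow> nat \<Rightarrow> 'a) \<Rightarrow> (nat \<Rightarrow> nat \<Rightarrow> 'a) \<Rightarrow> complex" where
  "KK X X' = (\<Sum>x\<in>carrier GG. if act x X' = X then cnj (\<chi> x) else 0)"

lemma KK_nonzeroD:
  assumes "KK X Y \<noteq> 0"
  shows "\<exists>x\<in>carrier GG. act x Y = X"
proof (rule ccontr)
  assume "\<not> ?thesis"
  then have "KK X Y = 0" unfolding KK_def by (intro sum.neutral) auto
  then show False using assms by simp
qed

lemma KK_act:
  assumes g: "g \<in> carrier GG" and X: "X \<in> VV" "X' \<in> VV"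
  shows "KK (act g X) (act g X') = KK X X'"
proof -
  have "KK (act g X) (act g X') = (\<Sum>x\<in>carrier GG. if act (g \<otimes>\<^bsub>GG\<^esub> x \<otimes>\<^bsub>GG\<^esub> inv\<^bsub>GG\<^esub> g) (act g X') = act g X then cnj (\<chi> (g \<otimes>\<^bsub>GG\<^esub> x \<otimes>\<^bsub>GG\<^esub> inv\<^bsub>GG\<^esub> g)) else 0)"
    unfolding KK_def by (rule sum_conj[OF g, symmetric])
  also have "\<dots> = KK X X'"
    unfolding KK_def
  proof (intro sum.cong refl)
    fix x assume x: "x \<in> carrier GG"
    have "act (g \<otimes>\<^bsub>GG\<^esub> x \<otimes>\<^bsub>GG\<^esub> inv\<^bsub>GG\<^esub> g) (act g X') = act g (act x X')"
      using x g X by (simp only: actG_mult actG_inv m_closed inv_closed)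
    moreover have "act g (act x X') = act g X \<longleftrightarrow> act x X' = X"
      using actG_bij[OF g, of j] x X by (metis actG_in bij_betw_inv_into_left)
    ultimately show "(if act (g \<otimes>\<^bsub>GG\<^esub> x \<otimes>\<^bsub>GG\<^esub> inv\<^bsub>GG\<^esub> g) (act g X') = act g X then cnj (\<chi> (g \<otimes>\<^bsub>GG\<^esub> x \<otimes>\<^bsub>GG\<^esub> inv\<^bsub>GG\<^esub> g)) else 0) = (if act x X' = X then cnj (\<chi> x) else 0)"
      using chi_conj[OF g x] by simp
  qed
  finally show ?thesis .
qed

lemma KK_hermitian:
  assumes X: "X \<in> VV" "X' \<in> VV"
  shows "KK X' X = cnj (KK X X')"
proof -
  have "KK X' X = (\<Sum>x\<in>carrier GG. if act (inv\<^bsub>GG\<^esub> x) X = X' then cnj (\<chi> (inv\<^bsub>GG\<^esub> x)) else 0)"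
    unfolding KK_def by (rule sum_inv[symmetric])
  also have "\<dots> = cnj (KK X X')"
    unfolding KK_def cnj_sum
  proof (intro sum.cong refl)
    fix x assume x: "x \<in> carrier GG"
    show "(if act (inv\<^bsub>GG\<^esub> x) X = X' then cnj (\<chi> (inv\<^bsub>GG\<^esub> x)) else 0) = cnj (if act x X' = X then cnj (\<chi> x) else 0)"
      using fixed_iff_inv_fixed[OF x X(2,1)] chi_inv[OF x] by simp
  qed
  finally show ?thesis .
qed

text \<open>This is c c = \<kappa> c, read off entrywise.\<close>

lemma KK_comp:
  assumes X: "X \<in> VV" "X'' \<in> VV"
  shows "(\<Sum>X'\<in>VV. KK X X' * KK X' X'') = of_real \<kappa> * KK X X''"
proof -
  have "(\<Sum>X'\<in>VV. KK X X' * KK X' X'') = (\<Sum>X'\<in>VV. \<Sum>x\<in>carrier GG. \<Sum>y\<in>carrier GG.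
      if act y X'' = X' then (if act x X' = X then cnj (\<chi> x) * cnj (\<chi> y) else 0) else 0)"
    unfolding KK_def sum_product by (intro sum.cong refl) auto
  also have "\<dots> = (\<Sum>x\<in>carrier GG. \<Sum>y\<in>carrier GG. \<Sum>X'\<in>VV.
      if act y X'' = X' then (if act x X' = X then cnj (\<chi> x) * cnj (\<chi> y) else 0) else 0)"
    by (rule sum_swap3)
  also have "\<dots> = (\<Sum>x\<in>carrier GG. \<Sum>y\<in>carrier GG. if act x (act y X'') = X then cnj (\<chi> x) * cnj (\<chi> y) else 0)"
  proof (intro sum.cong refl)
    fix x y assume "x \<in> carrier GG" "y \<in> carrier GG"
    then show "(\<Sum>X'\<in>VV. if act y X'' = X' then (if act x X' = X then cnj (\<chi> x) * cnj (\<chi> y) else 0) else 0)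
      = (if act x (act y X'') = X then cnj (\<chi> x) * cnj (\<chi> y) else 0)"
      using actG_in[OF _ X(2)] by (simp add: sum.delta' finVV)
  qed
  also have "\<dots> = (\<Sum>x\<in>carrier GG. \<Sum>z\<in>carrier GG. if act z X'' = X then cnj (\<chi> x) * cnj (\<chi> (inv\<^bsub>GG\<^esub> x \<otimes>\<^bsub>GG\<^esub> z)) else 0)"
  proof (rule sum.cong[OF refl])
    fix x assume x: "x \<in> carrier GG"
    have "(\<Sum>y\<in>carrier GG. if act x (act y X'') = X then cnj (\<chi> x) * cnj (\<chi> y) else 0)
      = (\<Sum>z\<in>carrier GG. if act x (act (inv\<^bsub>GG\<^esub> x \<otimes>\<^bsub>GG\<^esub> z) X'') = X then cnj (\<chi> x) * cnj (\<chi> (inv\<^bsub>GG\<^esub> x \<otimes>\<^bsub>GG\<^esub> z)) else 0)"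
      using x by (intro sum_left[symmetric]) simp
    also have "\<dots> = (\<Sum>z\<in>carrier GG. if act z X'' = X then cnj (\<chi> x) * cnj (\<chi> (inv\<^bsub>GG\<^esub> x \<otimes>\<^bsub>GG\<^esub> z)) else 0)"
    proof (intro sum.cong refl)
      fix z assume z: "z \<in> carrier GG"
      have "act x (act (inv\<^bsub>GG\<^esub> x \<otimes>\<^bsub>GG\<^esub> z) X'') = act z X''"
        using x z X actG_in[OF z X(2)] by (simp only: actG_mult actG_inv inv_closed)
      then show "(if act x (act (inv\<^bsub>GG\<^esub> x \<otimes>\<^bsub>GG\<^esub> z) X'') = X then cnj (\<chi> x) * cnj (\<chi> (inv\<^bsub>GG\<^esub> x \<otimes>\<^bsub>GG\<^esub> z)) else 0)
        = (if act z X'' = X then cnj (\<chi> x) * cnj (\<chi> (inv\<^bsub>GG\<^esub> x \<otimes>\<^bsub>GG\<^esub> z)) else 0)" by simp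
    qed
    finally show "(\<Sum>y\<in>carrier GG. if act x (act y X'') = X then cnj (\<chi> x) * cnj (\<chi> y) else 0) = \<dots>" .
  qed
  also have "\<dots> = (\<Sum>z\<in>carrier GG. if act z X'' = X then (\<Sum>x\<in>carrier GG. cnj (\<chi> x) * cnj (\<chi> (inv\<^bsub>GG\<^esub> x \<otimes>\<^bsub>GG\<^esub> z))) else 0)"
    by (subst sum.swap) (intro sum.cong refl, simp)
  also have "\<dots> = of_real \<kappa> * KK X X''"
    unfolding KK_def sum_distrib_left by (intro sum.cong refl) (simp add: chi_conv)
  finally show ?thesis .
qed

text \<open>The trace on the left is the sum of cnj (\<chi> x) times \<open>fixn\<close> of x h to
  the power j, so \<open>chi_shift\<close> applies to the j-th power of \<open>fixn\<close>.\<close>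

lemma KK_trace:
  assumes h: "h \<in> carrier GG"
  shows "(\<Sum>X\<in>VV. KK X (act h X)) = \<chi> h / \<chi> (1\<^sub>m N) * (\<Sum>X\<in>VV. KK X X)"
proof -
  have tr: "(\<Sum>X\<in>VV. KK X (act k X)) = (\<Sum>x\<in>carrier GG. cnj (\<chi> x) * of_nat (fixn (x \<otimes>\<^bsub>GG\<^esub> k) ^ j))"
    if k: "k \<in> carrier GG" for k
  proof -
    have "(\<Sum>X\<in>VV. KK X (act k X)) = (\<Sum>x\<in>carrier GG. \<Sum>X\<in>VV. if act (x \<otimes>\<^bsub>GG\<^esub> k) X = X then cnj (\<chi> x) else 0)"
      unfolding KK_def by (subst sum.swap) (intro sum.cong refl, simp only: actG_mult[OF _ k])
    also have "\<dots> = (\<Sum>x\<in>carrier GG. cnj (\<chi> x) * of_nat (fixn (x \<otimes>\<^bsub>GG\<^esub> k) ^ j))"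
      by (intro sum.cong refl) (simp add: sum.If_cases finVV Int_def card_fixed_tuples mult.commute)
    finally show ?thesis .
  qed
  have "(\<Sum>X\<in>VV. KK X X) = (\<Sum>X\<in>VV. KK X (act \<one>\<^bsub>GG\<^esub> X))"
    by (intro sum.cong refl) (simp only: actG_one)
  also have "\<dots> = (\<Sum>x\<in>carrier GG. cnj (\<chi> x) * of_nat (fixn x ^ j))"
    using tr[OF one_closed] by (simp only: r_one cong: sum.cong)
  finally show ?thesis
    using chi_shift[of "\<lambda>x. of_nat (fixn x ^ j)" h] tr[OF h] h fixn_class by (simp add: one_eq)
qed

lemma KK_trace_nonzero: "(\<Sum>X\<in>VV. KK X X) \<noteq> 0"
proof -
  have "(\<Sum>X\<in>VV. KK X X) = (\<Sum>x\<in>carrier GG. \<Sum>X\<in>VV. if act x X = X then cnj (\<chi> x) else 0)"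
    unfolding KK_def by (rule sum.swap)
  also have "\<dots> = (\<Sum>x\<in>carrier GG. cnj (\<chi> x) * of_nat (fixn x ^ j))"
    by (intro sum.cong refl) (simp add: sum.If_cases finVV Int_def card_fixed_tuples mult.commute)
  finally show ?thesis using level_nonzero by simp
qed

end

text \<open>The rank one N x j matrix with column vector y and row vector f; adding it to X changes
  X b by (f . b) y.\<close>

definition tens :: "(nat \<Rightarrow> 'a::field) \<Rightarrow> (nat \<Rightarrow> 'a) \<Rightarrow> nat \<Rightarrow> nat \<Rightarrow> 'a" where
  "tens y f = (\<lambda>a. smul (f a) y)"

lemma tens_in [intro]: "y \<in> vecs N \<Longrightarrow> f \<in> vecs j \<Longrightarrow> tens y f \<in> tuples N j"
  by (auto simp: tens_def tuples_def vecs_def smul_def)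

lemma tens_add: "tens (y + y') f = tens y f + tens y' f"
  by (simp add: tens_def smul_add fun_eq_iff)

lemma tens_diff: "tens (y - y') f = tens y f - tens y' f"
  by (simp add: tens_def smul_diff fun_eq_iff)

lemma tens_0 [simp]: "tens 0 f = 0"
  by (simp add: tens_def fun_eq_iff)

lemma act_tens: "act g (tens y f) = tens (mv g y) f"
  by (simp add: act_def tens_def mv_smul)

lemma lc_tuple_add: "lc k (X + Y) b = lc k X b + lc k Y b"
  by (auto simp: lc_def fun_eq_iff sum.distrib algebra_simps)

lemma lc_tuple_diff: "lc k (X - Y) b = lc k X b - lc k Y b"
  by (auto simp: lc_def fun_eq_iff sum_subtractf algebra_simps)

lemma lc_tens: "lc k (tens y f) b = smul (dot k b f) y"
  by (auto simp: lc_def tens_def smul_def dot_def fun_eq_iff sum_distrib_right sum_distrib_left mult_ac)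

lemma sum_translate:
  fixes F :: "'v::ab_group_add \<Rightarrow> 'w::comm_monoid_add"
  assumes "\<And>u v. u \<in> S \<Longrightarrow> v \<in> S \<Longrightarrow> u + v \<in> S" "\<And>u v. u \<in> S \<Longrightarrow> v \<in> S \<Longrightarrow> u - v \<in> S" "s \<in> S"
  shows "(\<Sum>y\<in>S. F (y + s)) = (\<Sum>y\<in>S. F y)"
  by (rule sum.reindex_bij_witness[of _ "\<lambda>y. y - s" "\<lambda>y. y + s"]) (use assms in auto)

context mat_irr_char
begin

text \<open>The image of 1 - x. Its size is |V| / \<open>fixn x\<close>, so summing over it lowers
  the power of \<open>fixn x\<close>.\<close>

definition imn :: "'a mat \<Rightarrow> (nat \<Rightarrow> 'a) set" where
  "imn x = (\<lambda>v. v - mv x v) ` vecs N"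

lemma imnI: "v \<in> vecs N \<Longrightarrow> v - mv x v \<in> imn x"
  by (simp add: imn_def)

lemma imn_sub: "x \<in> carrier G \<Longrightarrow> imn x \<subseteq> vecs N"
  by (auto simp: imn_def)

lemma card_imn:
  assumes "x \<in> carrier G"
  shows "card (imn x) * fixn x = CARD('a) ^ N"
proof -
  have "card (vecs N :: (nat \<Rightarrow> 'a) set) = card ((\<lambda>v. v - mv x v) ` vecs N) * card {v \<in> vecs N. v - mv x v = 0}"
    by (rule card_hom) (auto simp: card_vecs mv_diff)
  moreover have "{v \<in> vecs N. v - mv x v = 0} = {v \<in> vecs N. mv x v = v}" by auto
  ultimately show ?thesis by (simp add: card_vecs fixn_def imn_def)
qed

lemma is_subspace_imn: "is_subspace (imn x)"
  unfolding is_subspace_def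
proof (intro conjI ballI allI)
  show "0 \<in> imn x" using imnI[of 0 x] by simp
next
  fix u v assume "u \<in> imn x" "v \<in> imn x"
  then obtain a b where "a \<in> vecs N" "u = a - mv x a" "b \<in> vecs N" "v = b - mv x b"
    by (auto simp: imn_def)
  then have "u + v = (a + b) - mv x (a + b)" "a + b \<in> vecs N" by (auto simp: mv_add)
  then show "u + v \<in> imn x" using imnI[of "a + b" x] by simp
next
  fix c u assume "u \<in> imn x"
  then obtain a where "a \<in> vecs N" "u = a - mv x a" by (auto simp: imn_def)
  then have "smul c u = smul c a - mv x (smul c a)" "smul c a \<in> vecs N"
    by (auto simp: smul_diff mv_smul)
  then show "smul c u \<in> imn x" using imnI[of "smul c a" x] by simp
qed

lemma card_coset_tuples:
  assumes x: "x \<in> carrier G" and W0: "W0 \<in> tuples N j"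
  shows "card {W \<in> tuples N j. W - act x W = W0 - act x W0} = fixn x ^ j"
proof -
  have "bij_betw (\<lambda>T. T + W0) {X \<in> tuples N j. act x X = X} {W \<in> tuples N j. W - act x W = W0 - act x W0}"
    by (rule bij_betwI[of _ _ _ "\<lambda>W. W - W0"])
      (use W0 in \<open>auto simp: act_add act_diff algebra_simps intro!: tuples_add tuples_diff\<close>)
  from bij_betw_same_card[OF this] show ?thesis by (simp only: card_fixed_tuples)
qed

text \<open>For a single y the equation W - x W = y \<otimes> f is solvable exactly when y lies in
  the image of 1 - x: a coordinate where f is nonzero gives necessity, and u \<otimes> f with y = u
  - x u is a solution. The solutions form a coset of the fixed tuples.\<close>

lemma card_tens_coset:
  assumes x: "x \<in> carrier G" and f: "f \<in> vecs j" "f a0 \<noteq> 0"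
  shows "(\<Sum>y\<in>vecs N. card {W \<in> tuples N j. W - act x W = tens y f}) = card (imn x) * fixn x ^ j"
proof -
  have "card {W \<in> tuples N j. W - act x W = tens y f} = (if y \<in> imn x then fixn x ^ j else 0)"
    if y: "y \<in> vecs N" for y
  proof (cases "y \<in> imn x")
    case True
    then obtain u where u: "u \<in> vecs N" "y = u - mv x u" by (auto simp: imn_def)
    have "tens u f - act x (tens u f) = tens y f" using u by (simp add: act_tens tens_diff)
    then show ?thesis using card_coset_tuples[OF x tens_in[OF u(1) f(1)]] True by simp
  next
    case False
    have "W - act x W \<noteq> tens y f" if W: "W \<in> tuples N j" for W
    proof
      assume eq: "W - act x W = tens y f"
      have "W a0 - mv x (W a0) = smul (f a0) y"
        using fun_cong[OF eq, of a0] by (simp add: act_def tens_def)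
      then have "smul (f a0) y \<in> imn x" using imnI[OF tuplesD(1)[OF W, of a0], of x] by simp
      then have "smul (inverse (f a0)) (smul (f a0) y) \<in> imn x"
        by (rule is_subspaceD(3)[OF is_subspace_imn])
      then show False using False f(2) by simp
    qed
    then have e: "{W \<in> tuples N j. W - act x W = tens y f} = {}" by blast
    show ?thesis unfolding e using False by simp
  qed
  then have "(\<Sum>y\<in>vecs N. card {W \<in> tuples N j. W - act x W = tens y f}) = (\<Sum>y\<in>vecs N. if y \<in> imn x then fixn x ^ j else 0)"
    by (rule sum.cong[OF refl])
  also have "\<dots> = card (vecs N \<inter> imn x) * fixn x ^ j"
    by (subst sum.inter_restrict[symmetric]) (simp_all add: card_vecs)
  also have "vecs N \<inter> imn x = imn x" using imn_sub[OF x] by auto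
  finally show ?thesis .
qed

end

context GL_level
begin

text \<open>The squared norm of the left hand side, summed over all \<open>X\<close> and \<open>X'\<close>, is a multiple of the inner
  product of \<open>\<tau>\<^sup>j\<^sup>-\<^sup>1\<close> and \<open>\<chi>\<close>.\<close>

lemma KK_level:
  assumes X: "X \<in> VV" "X' \<in> VV" and f: "f \<in> vecs j" "f \<noteq> 0"
  shows "(\<Sum>y\<in>vecs N. KK X (X' + tens y f)) = 0"
proof -
  obtain a0 where a0: "f a0 \<noteq> 0" using f(2) by (auto simp: fun_eq_iff)
  have vt: "(\<Sum>Z\<in>VV. F (Z + T)) = (\<Sum>Z\<in>VV. F Z)" if "T \<in> VV" for T and F :: "_ \<Rightarrow> complex"
    using that by (intro sum_translate) auto
  have vv: "(\<Sum>y\<in>vecs N. F (y + s)) = (\<Sum>y\<in>vecs N. F y)" if "s \<in> vecs N"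
    for s :: "nat \<Rightarrow> 'a" and F :: "_ \<Rightarrow> complex"
    using that by (intro sum_translate) auto
  have "(\<Sum>Z\<in>VV. \<Sum>y\<in>vecs N. KK Z (Z + tens y f)) = (\<Sum>y\<in>vecs N. \<Sum>Z\<in>VV. KK Z (Z + tens y f))"
    by (rule sum.swap)
  also have "\<dots> = (\<Sum>y\<in>vecs N. \<Sum>W\<in>VV. KK (W - tens y f) W)"
  proof (rule sum.cong[OF refl])
    fix y :: "nat \<Rightarrow> 'a" assume "y \<in> vecs N"
    then show "(\<Sum>Z\<in>VV. KK Z (Z + tens y f)) = (\<Sum>W\<in>VV. KK (W - tens y f) W)"
      using vt[of "tens y f" "\<lambda>W. KK (W - tens y f) W"] f(1) by (simp add: tens_in)
  qed
  also have "\<dots> = (\<Sum>y\<in>vecs N. \<Sum>x\<in>carrier GG. \<Sum>W\<in>VV. if act x W = W - tens y f then cnj (\<chi> x) else 0)"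
    unfolding KK_def by (intro sum.cong refl sum.swap)
  also have "\<dots> = (\<Sum>x\<in>carrier GG. \<Sum>y\<in>vecs N. \<Sum>W\<in>VV. if act x W = W - tens y f then cnj (\<chi> x) else 0)"
    by (rule sum.swap)
  also have "\<dots> = (\<Sum>x\<in>carrier GG. cnj (\<chi> x) * of_nat (\<Sum>y\<in>vecs N. card {W \<in> VV. W - act x W = tens y f}))"
  proof (rule sum.cong[OF refl])
    fix x assume x: "x \<in> carrier GG"
    have "(\<Sum>W\<in>VV. if act x W = W - tens y f then cnj (\<chi> x) else 0) = cnj (\<chi> x) * of_nat (card {W \<in> VV. W - act x W = tens y f})" for y
    proof -
      have "VV \<inter> {W. act x W = W - tens y f} = {W \<in> VV. W - act x W = tens y f}"
        by (auto simp: algebra_simps)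
      then show ?thesis by (simp add: sum.If_cases finVV mult.commute)
    qed
    then show "(\<Sum>y\<in>vecs N. \<Sum>W\<in>VV. if act x W = W - tens y f then cnj (\<chi> x) else 0) = cnj (\<chi> x) * of_nat (\<Sum>y\<in>vecs N. card {W \<in> VV. W - act x W = tens y f})"
      by (simp add: sum_distrib_left)
  qed
  \<comment> \<open>Here the level drops: the size of the image of 1 - x cancels one factor
    \<open>fixn x\<close> and leaves |V|.\<close>
  also have "\<dots> = (\<Sum>x\<in>carrier GG. of_nat (CARD('a) ^ N) * (cnj (\<chi> x) * of_nat (fixn x ^ (j - 1))))"
  proof (rule sum.cong[OF refl])
    fix x assume x: "x \<in> carrier GG"
    have "card (imn x) * fixn x ^ j = CARD('a) ^ N * fixn x ^ (j - 1)"
      using card_imn[OF x] j_pos by (cases j) (auto simp: mult.assoc[symmetric])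
    then show "cnj (\<chi> x) * of_nat (\<Sum>y\<in>vecs N. card {W \<in> VV. W - act x W = tens y f}) = of_nat (CARD('a) ^ N) * (cnj (\<chi> x) * of_nat (fixn x ^ (j - 1)))"
      unfolding card_tens_coset[OF x f(1) a0] by (simp only: of_nat_mult mult_ac)
  qed
  also have "\<dots> = 0" by (simp only: sum_distrib_left[symmetric] level_below mult_zero_right)
  finally have zero: "(\<Sum>Z\<in>VV. \<Sum>y\<in>vecs N. KK Z (Z + tens y f)) = 0" .
  define A where "A Z Z' = (\<Sum>y\<in>vecs N. KK Z (Z' + tens y f))" for Z Z'
  have inner: "(\<Sum>Z\<in>VV. A Z Z' * cnj (A Z Z')) = of_real \<kappa> * (\<Sum>y'\<in>vecs N. \<Sum>y\<in>vecs N. KK (Z' + tens y' f) (Z' + tens y f))"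
    if Z': "Z' \<in> VV" for Z'
  proof -
    have m: "Z' + tens y f \<in> VV" if "y \<in> vecs N" for y using that Z' f(1) by auto
    have "(\<Sum>Z\<in>VV. A Z Z' * cnj (A Z Z')) = (\<Sum>Z\<in>VV. \<Sum>y'\<in>vecs N. \<Sum>y\<in>vecs N. KK (Z' + tens y' f) Z * KK Z (Z' + tens y f))"
    proof (rule sum.cong[OF refl])
      fix Z assume Z: "Z \<in> VV"
      have e: "cnj (A Z Z') = (\<Sum>y'\<in>vecs N. KK (Z' + tens y' f) Z)"
        unfolding A_def cnj_sum by (intro sum.cong refl KK_hermitian[OF Z m, symmetric])
      show "A Z Z' * cnj (A Z Z') = (\<Sum>y'\<in>vecs N. \<Sum>y\<in>vecs N. KK (Z' + tens y' f) Z * KK Z (Z' + tens y f))"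
        by (subst mult.commute, subst e, subst A_def[of Z Z'], rule sum_product)
    qed
    also have "\<dots> = (\<Sum>y'\<in>vecs N. \<Sum>y\<in>vecs N. \<Sum>Z\<in>VV. KK (Z' + tens y' f) Z * KK Z (Z' + tens y f))"
      by (rule sum_swap3)
    also have "\<dots> = (\<Sum>y'\<in>vecs N. \<Sum>y\<in>vecs N. of_real \<kappa> * KK (Z' + tens y' f) (Z' + tens y f))"
      by (intro sum.cong refl KK_comp m)
    finally show ?thesis by (simp add: sum_distrib_left)
  qed
  have "(\<Sum>Z'\<in>VV. \<Sum>Z\<in>VV. A Z Z' * cnj (A Z Z')) = of_real \<kappa> * (\<Sum>Z'\<in>VV. \<Sum>y'\<in>vecs N. \<Sum>y\<in>vecs N. KK (Z' + tens y' f) (Z' + tens y f))"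
    by (simp add: inner sum_distrib_left)
  also have "(\<Sum>Z'\<in>VV. \<Sum>y'\<in>vecs N. \<Sum>y\<in>vecs N. KK (Z' + tens y' f) (Z' + tens y f)) =
      (\<Sum>y'\<in>vecs N. \<Sum>Z'\<in>VV. \<Sum>y\<in>vecs N. KK (Z' + tens y' f) (Z' + tens y f))"
    by (rule sum.swap)
  \<comment> \<open>Translating Z' by y' \<otimes> f absorbs y' and leaves the sum already known to
    vanish.\<close>
  also have "\<dots> = (\<Sum>y'\<in>(vecs N :: (nat \<Rightarrow> 'a) set). 0)"
  proof (rule sum.cong[OF refl])
    fix y' :: "nat \<Rightarrow> 'a" assume y': "y' \<in> vecs N"
    have "(\<Sum>Z'\<in>VV. \<Sum>y\<in>vecs N. KK (Z' + tens y' f) (Z' + tens y f)) = (\<Sum>Z'\<in>VV. \<Sum>y\<in>vecs N. KK (Z' + tens y' f) (Z' + tens (y + y') f))"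
      by (rule sum.cong[OF refl], rule vv[OF y', symmetric])
    also have "\<dots> = (\<Sum>Z'\<in>VV. \<Sum>y\<in>vecs N. KK (Z' + tens y' f) (Z' + tens y' f + tens y f))"
      by (simp add: tens_add add_ac)
    also have "\<dots> = (\<Sum>Z'\<in>VV. \<Sum>y\<in>vecs N. KK Z' (Z' + tens y f))"
      using vt[of "tens y' f" "\<lambda>Z'. \<Sum>y\<in>vecs N. KK Z' (Z' + tens y f)"] y' f(1) by (simp add: tens_in)
    finally show "(\<Sum>Z'\<in>VV. \<Sum>y\<in>vecs N. KK (Z' + tens y' f) (Z' + tens y f)) = 0" using zero by simp
  qed
  finally have "(\<Sum>Z'\<in>VV. \<Sum>Z\<in>VV. A Z Z' * cnj (A Z Z')) = 0" by simp
  then have "complex_of_real (\<Sum>Z'\<in>VV. \<Sum>Z\<in>VV. (cmod (A Z Z'))\<^sup>2) = 0"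
    by (simp only: of_real_sum complex_norm_square)
  then have "(\<Sum>Z'\<in>VV. \<Sum>Z\<in>VV. (cmod (A Z Z'))\<^sup>2) = 0" by (simp only: of_real_eq_0_iff)
  then have "\<forall>Z'\<in>VV. (\<Sum>Z\<in>VV. (cmod (A Z Z'))\<^sup>2) = 0"
    by (subst (asm) sum_nonneg_eq_0_iff) (auto simp: finVV intro: sum_nonneg)
  then have "(\<Sum>Z\<in>VV. (cmod (A Z X'))\<^sup>2) = 0" using X by blast
  then have "\<forall>Z\<in>VV. (cmod (A Z X'))\<^sup>2 = 0"
    by (subst (asm) sum_nonneg_eq_0_iff) (auto simp: finVV)
  then show ?thesis using X unfolding A_def by simp
qed

text \<open>A nonzero \<open>KK X Y\<close> forces X and Y to satisfy the same linear relations. If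
  X' satisfies the relation b and f . b is nonzero, then X' + y \<otimes> f violates it for every
  nonzero y, so the vanishing sum of \<open>KK_level\<close> reduces to its term at y = 0.\<close>

lemma KK_dependent:
  assumes X: "X \<in> VV" "X' \<in> VV" and dep: "\<not> indep j X'"
  shows "KK X X' = 0"
proof (rule ccontr)
  assume nz: "KK X X' \<noteq> 0"
  obtain b where b: "b \<in> vecs j" "b \<noteq> 0" "lc j X' b = 0" using dep by (auto simp: indep_def)
  obtain a0 where a0: "b a0 \<noteq> 0" using b(2) by (auto simp: fun_eq_iff)
  then have a0j: "a0 < j" using b(1) by (auto simp: vecs_def not_le[symmetric])
  have ker: "lc j X b = 0" if Y: "KK X Y \<noteq> 0" "lc j Y b = 0" for Y
  proof -
    obtain x where "act x Y = X" using KK_nonzeroD[OF Y(1)] by blast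
    then show ?thesis using Y(2) mv_lc[of x j Y b] by simp
  qed
  have kerY: "lc j Y b = 0" if Y: "KK X Y \<noteq> 0" "Y \<in> VV" for Y
  proof -
    have Xb: "lc j X b = 0" using ker[OF nz b(3)] .
    obtain x where x: "x \<in> carrier GG" "act x Y = X"
      using KK_nonzeroD[OF Y(1)] by blast
    have "mv x (lc j Y b) = mv x 0" using x(2) Xb mv_lc[of x j Y b] by simp
    then show ?thesis using GL_mv_inj[OF x(1), of "lc j Y b" 0] tuplesD(1)[OF Y(2)] by auto
  qed
  define f :: "nat \<Rightarrow> 'a" where "f = (\<lambda>i. if i = a0 then 1 else 0)"
  have f: "f \<in> vecs j" "f \<noteq> 0" using a0j by (auto simp: f_def vecs_def fun_eq_iff)
  have fb: "dot j b f \<noteq> 0" using a0 a0j by (simp add: dot_def f_def mult_delta_right)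
  have "KK X (X' + tens y f) = 0" if y: "y \<in> vecs N - {0}" for y
  proof (rule ccontr)
    assume "KK X (X' + tens y f) \<noteq> 0"
    then have "lc j (X' + tens y f) b = 0" using kerY X y f by auto
    then have "smul (dot j b f) y = 0" using b(3) by (simp add: lc_tuple_add lc_tens)
    then show False using fb y by (simp add: smul_eq_0_iff)
  qed
  then have "(\<Sum>y\<in>vecs N. KK X (X' + tens y f)) = (\<Sum>y\<in>{0}. KK X (X' + tens y f))"
    by (intro sum.mono_neutral_right) (auto simp: card_vecs)
  then show False using KK_level[OF X f] nz by simp
qed

end

section \<open>Transitivity of the general linear group on tuples\<close>

lemma not_in_span_functional:
  assumes "u \<in> vecs N" "\<And>a. a < n \<Longrightarrow> y a \<in> vecs N" "\<nexists>b. u = lc n y b"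
  obtains f where "f \<in> vecs N" "\<And>a. a < n \<Longrightarrow> dot N (y a) f = 0" "dot N u f \<noteq> 0"
proof -
  have "\<exists>f\<in>vecs N. (\<forall>a<n. dot N (y a) f = 0) \<and> dot N u f \<noteq> 0"
  proof (rule ccontr)
    assume c: "\<not> ?thesis"
    have "\<exists>b. u = lc n y b"
    proof (rule in_span_if_dual[OF assms(1)])
      show "y a \<in> vecs N" if "a < n" for a using assms(2)[OF that] .
      show "dot N u f = 0" if "f \<in> vecs N" "\<And>a. a < n \<Longrightarrow> dot N (y a) f = 0" for f
        using c that by blast
    qed
    then show False using assms(3) by simp
  qed
  then show ?thesis using that by blast
qed

lemma dot_commute: "dot N u v = dot N v u"
  by (simp add: dot_def mult.commute)

text \<open>The map is x + f(x)(v - u), for a functional f that vanishes on the vectors y a and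
  satisfies f(u) = 1 and f(v) nonzero; since f(g x) = f(v) f(x), it is injective.\<close>

lemma GL_step:
  fixes u v :: "nat \<Rightarrow> 'a::field"
  assumes y: "\<And>a. a < n \<Longrightarrow> y a \<in> vecs N" and uv: "u \<in> vecs N" "v \<in> vecs N"
    and u: "\<nexists>b. u = lc n y b" and v: "\<nexists>b. v = lc n y b"
  shows "\<exists>g\<in>carrier (GL_mat N). (\<forall>a<n. mv g (y a) = y a) \<and> mv g u = v"
proof -
  let ?Y = "{f \<in> vecs N. \<forall>a<n. dot N (y a) f = 0}"
  obtain f1 where f1: "f1 \<in> ?Y" "dot N u f1 \<noteq> 0"
    using not_in_span_functional[OF uv(1) y u] by blast
  obtain f2 where f2: "f2 \<in> ?Y" "dot N v f2 \<noteq> 0"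
    using not_in_span_functional[OF uv(2) y v] by blast
  obtain f0 where f0: "f0 \<in> ?Y" "dot N u f0 \<noteq> 0" "dot N v f0 \<noteq> 0"
  proof (rule two_functionals[of ?Y "dot N u" "dot N v" f1 f2])
    show "w \<in> ?Y \<Longrightarrow> w' \<in> ?Y \<Longrightarrow> w + w' \<in> ?Y" for w w'
      using vecs_add[of w N w'] by (simp add: dot_add)
  qed (use f1 f2 in \<open>auto simp: dot_add\<close>)
  define f where "f = smul (inverse (dot N u f0)) f0"
  have f: "f \<in> vecs N" "\<And>a. a < n \<Longrightarrow> dot N (y a) f = 0" "dot N u f = 1" "dot N v f \<noteq> 0"
    using f0 by (auto simp: f_def dot_smul)
  define g where "g = mat N N (\<lambda>(i, k). (if i = k then 1 else 0) + (v i - u i) * f k)"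
  have gc: "g \<in> carrier_mat N N" by (simp add: g_def)
  have mvg: "mv g x = x + smul (dot N x f) (v - u)" if x: "x \<in> vecs N" for x
  proof (rule vecs_eqI)
    show "mv g x \<in> vecs N" using gc by blast
    show "x + smul (dot N x f) (v - u) \<in> vecs N" using x uv by (intro vecs_add vecs_smul vecs_diff)
    fix i assume i: "i < N"
    have "mv g x i = (\<Sum>k<N. (if i = k then x k else 0) + (v i - u i) * (f k * x k))"
      using i by (auto simp: mv_def g_def algebra_simps intro!: sum.cong)
    also have "\<dots> = x i + (v i - u i) * dot N x f"
      using i by (simp add: sum.distrib dot_def sum_distrib_left mult.commute)
    finally show "mv g x i = (x + smul (dot N x f) (v - u)) i" by (simp add: smul_def mult.commute)
  qed
  have "g \<in> carrier (GL_mat N)"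
  proof (rule GL_matI[OF gc])
    fix x assume x: "x \<in> vecs N" "mv g x = 0"
    have "dot N (mv g x) f = dot N x f + dot N x f * (dot N v f - dot N u f)"
      using x(1) by (simp add: mvg dot_add dot_smul dot_diff)
    then have "dot N x f = 0" using x(2) f by (simp add: dot_def[of _ 0] algebra_simps)
    then show "x = 0" using x by (simp add: mvg)
  qed
  moreover have "\<forall>a<n. mv g (y a) = y a" using f y by (simp add: mvg)
  moreover have "mv g u = v" using f uv by (simp add: mvg)
  ultimately show ?thesis by blast
qed

lemma GL_transitive:
  fixes X Y :: "nat \<Rightarrow> nat \<Rightarrow> 'a::field"
  assumes XY: "\<And>a. a < k \<Longrightarrow> X a \<in> vecs N" "\<And>a. a < k \<Longrightarrow> Y a \<in> vecs N"
    and ker: "\<And>b. lc k X b = 0 \<longleftrightarrow> lc k Y b = 0"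
  shows "\<exists>g\<in>carrier (GL_mat N). \<forall>a<k. mv g (X a) = Y a"
proof (rule columnwise_transitive[OF XY ker])
  interpret group "GL_mat N :: 'a mat monoid" by (rule group_GL_mat)
  show "1\<^sub>m N \<in> carrier (GL_mat N :: 'a mat monoid)" using one_closed by (simp add: GL_mat_simps)
  show "g * h \<in> carrier (GL_mat N)" if "g \<in> carrier (GL_mat N)" "h \<in> carrier (GL_mat N)" for g h :: "'a mat"
    using m_closed[OF that] by (simp add: GL_mat_simps)
  fix n g assume *: "n < k" "g \<in> carrier (GL_mat N)" "\<And>a. a < n \<Longrightarrow> mv g (X a) = Y a"
    "\<nexists>b. mv g (X n) = lc n Y b" "\<nexists>b. Y n = lc n Y b"
  show "\<exists>g'\<in>carrier (GL_mat N). (\<forall>a<n. mv g' (Y a) = Y a) \<and> mv g' (mv g (X n)) = Y n"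
  proof (rule GL_step)
    show "Y a \<in> vecs N" if "a < n" for a using XY(2) that *(1) by simp
    show "mv g (X n) \<in> vecs N" using *(2) by (auto simp: carrier_GL_mat)
    show "Y n \<in> vecs N" using XY(2) *(1) by simp
  qed (use * in blast)+
qed auto

context GL_level
begin

text \<open>\<open>KK\<close> is Hermitian and its square is \<kappa> \<open>KK\<close>, so a
  diagonal entry is a sum of squares along its row.\<close>

lemma KK_diag:
  assumes X: "X \<in> VV"
  shows "of_real \<kappa> * KK X X = of_real (\<Sum>X'\<in>VV. (cmod (KK X X'))\<^sup>2)"
proof -
  have "of_real \<kappa> * KK X X = (\<Sum>X'\<in>VV. KK X X' * KK X' X)" using KK_comp[OF X X] by simp
  also have "\<dots> = (\<Sum>X'\<in>VV. KK X X' * cnj (KK X X'))"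
    using KK_hermitian[OF X] by (intro sum.cong refl) simp
  finally show ?thesis by (simp only: of_real_sum complex_norm_square)
qed

lemma KK_diag_real:
  assumes X: "X \<in> VV"
  shows "KK X X = of_real (Re (KK X X))" "Re (KK X X) \<ge> 0"
    "(\<Sum>X'\<in>VV. (cmod (KK X X'))\<^sup>2) = \<kappa> * Re (KK X X)"
proof -
  have "KK X X = of_real ((\<Sum>X'\<in>VV. (cmod (KK X X'))\<^sup>2) / \<kappa>)"
    using KK_diag[OF X] kappa_pos by (simp add: field_simps)
  then have r: "Re (KK X X) = (\<Sum>X'\<in>VV. (cmod (KK X X'))\<^sup>2) / \<kappa>" "KK X X = of_real (Re (KK X X))"
    by simp_all
  then show "KK X X = of_real (Re (KK X X))" by simp
  show "Re (KK X X) \<ge> 0" unfolding r(1) using kappa_pos by (intro divide_nonneg_pos sum_nonneg) auto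
  show "(\<Sum>X'\<in>VV. (cmod (KK X X'))\<^sup>2) = \<kappa> * Re (KK X X)" using r(1) kappa_pos by simp
qed

lemma indep_transitive:
  assumes "X \<in> VV" "Y \<in> VV" "indep j X" "indep j Y"
  obtains g where "g \<in> carrier GG" "act g X = Y"
proof -
  have k0: "lc j Z b = 0 \<longleftrightarrow> (\<forall>a<j. b a = 0)" if "indep j Z"
    for Z :: "nat \<Rightarrow> nat \<Rightarrow> 'a" and b
  proof
    assume "lc j Z b = 0"
    moreover have "lc j Z b = lc j Z (\<lambda>a. if a < j then b a else 0)" by (simp cong: lc_cong)
    moreover have "(\<lambda>a. if a < j then b a else 0) \<in> vecs j" by (simp add: vecs_def)
    ultimately have "(\<lambda>a. if a < j then b a else 0) = 0" using that by (simp add: indep_def)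
    from fun_cong[OF this] have "(if a < j then b a else 0) = 0" for a by simp
    then show "\<forall>a<j. b a = 0" by presburger
  next
    assume "\<forall>a<j. b a = 0"
    then show "lc j Z b = 0" by (simp add: lc_def zero_fun_def)
  qed
  obtain g where g: "g \<in> carrier GG" "\<forall>a<j. mv g (X a) = Y a"
    using GL_transitive[of j X N Y] assms k0 by (auto simp: tuplesD)
  have "act g X a = Y a" for a
    using g assms(1,2) by (cases "a < j") (simp_all add: act_def tuplesD zero_fun_def)
  then show ?thesis using that g(1) by blast
qed

text \<open>Independent tuples form a single orbit, so the choice is immaterial
  (\<open>KK_diag_cc\<close>).\<close>

definition cc :: real where
  "cc = Re (KK (SOME X. X \<in> VV \<and> indep j X) (SOME X. X \<in> VV \<and> indep j X))"

lemma KK_diag_cc: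
  assumes X: "X \<in> VV" "indep j X"
  shows "KK X X = of_real cc"
proof -
  let ?X = "SOME X. X \<in> VV \<and> indep j X"
  have s: "?X \<in> VV \<and> indep j ?X" using X by (intro someI[of "\<lambda>X. X \<in> VV \<and> indep j X"]) simp
  obtain g where g: "g \<in> carrier GG" "act g ?X = X"
    using indep_transitive[of ?X X] s X by blast
  have "KK X X = KK ?X ?X" using KK_act[of g ?X ?X] g s by simp
  then show ?thesis using KK_diag_real(1)[of ?X] s by (simp add: cc_def)
qed

lemma exists_indep: "\<exists>X\<in>VV. indep j X"
proof (rule ccontr)
  assume "\<not> ?thesis"
  then have "(\<Sum>X\<in>VV. KK X X) = 0" using KK_dependent by (intro sum.neutral) blast
  then show False using KK_trace_nonzero by simp
qed

lemma cc_nonneg: "cc \<ge> 0"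
  using exists_indep KK_diag_cc KK_diag_real(2) by fastforce

text \<open>Up to the factor \<kappa> the entry is an inner product of two rows, and the squared
  norm of a row is \<kappa> times its diagonal entry, which is \<open>cc\<close> or zero.\<close>

lemma KK_le_cc:
  assumes X: "X \<in> VV" "Y \<in> VV"
  shows "cmod (KK X Y) \<le> cc"
proof -
  have le: "Re (KK Z Z) \<le> cc" if "Z \<in> VV" for Z
    using KK_diag_cc[OF that] KK_dependent[OF that that] cc_nonneg by (cases "indep j Z") auto
  have "\<kappa> * cmod (KK X Y) = cmod (\<Sum>Z\<in>VV. KK X Z * KK Z Y)"
    using KK_comp[OF X] kappa_pos by (simp add: norm_mult)
  also have "\<dots> \<le> (\<Sum>Z\<in>VV. cmod (KK X Z) * cmod (KK Z Y))"
    by (rule order_trans[OF norm_sum]) (simp add: norm_mult)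
  also have "\<dots> = (\<Sum>Z\<in>VV. cmod (KK X Z) * cmod (KK Y Z))"
    using KK_hermitian[OF X(2)] by (intro sum.cong refl) (simp add: X)
  also have "\<dots> \<le> (\<Sum>Z\<in>VV. ((cmod (KK X Z))\<^sup>2 + (cmod (KK Y Z))\<^sup>2) / 2)"
  proof (rule sum_mono)
    fix Z
    show "cmod (KK X Z) * cmod (KK Y Z) \<le> ((cmod (KK X Z))\<^sup>2 + (cmod (KK Y Z))\<^sup>2) / 2"
      using sum_squares_bound[of "cmod (KK X Z)" "cmod (KK Y Z)"] by simp
  qed
  also have "\<dots> = (\<kappa> * Re (KK X X) + \<kappa> * Re (KK Y Y)) / 2"
    using KK_diag_real(3)[OF X(1)] KK_diag_real(3)[OF X(2)]
    by (simp add: sum.distrib flip: sum_divide_distrib)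
  also have "\<dots> \<le> \<kappa> * cc"
  proof -
    have "\<kappa> * Re (KK X X) \<le> \<kappa> * cc" "\<kappa> * Re (KK Y Y) \<le> \<kappa> * cc"
      by (intro mult_left_mono le X; use kappa_pos in simp)+
    moreover have "(a + b) / 2 \<le> c" if "a \<le> c" "b \<le> c" for a b c :: real
      using add_mono[OF that] by simp
    ultimately show ?thesis by blast
  qed
  finally show ?thesis using kappa_pos by simp
qed

lemma cc_pos: "cc > 0"
proof -
  have "cc \<noteq> 0"
  proof
    assume "cc = 0"
    then have "KK X X = 0" if "X \<in> VV" for X using KK_le_cc[OF that that] by simp
    then have "(\<Sum>X\<in>VV. KK X X) = 0" by simp
    then show False using KK_trace_nonzero by simp
  qed
  then show ?thesis using cc_nonneg by simp
qed

end

section \<open>Decay of the permutation kernel\<close>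

definition cut :: "nat \<Rightarrow> (nat \<Rightarrow> 'a::zero) \<Rightarrow> nat \<Rightarrow> 'a" where
  "cut k b = (\<lambda>a. if a < k then b a else 0)"

lemma cut_in [simp, intro]: "cut k b \<in> vecs k"
  by (simp add: cut_def vecs_def)

lemma lc_cut [simp]: "lc k X (cut k b) = lc k X b"
  by (simp add: cut_def cong: lc_cong)

lemma dot_cut [simp]: "dot k (cut k b) f = dot k b f" "dot k f (cut k b) = dot k f b"
  by (simp_all add: cut_def dot_def)

lemma lc_lc: "lc j X (lc k B c) = lc k (\<lambda>b. lc j X (B b)) c"
proof
  fix i
  show "lc j X (lc k B c) i = lc k (\<lambda>b. lc j X (B b)) c i"
    unfolding lc_def by (simp add: sum_distrib_left sum_distrib_right mult.assoc) (rule sum.swap)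
qed

lemma lc_append:
  "lc (j + k) (\<lambda>a. if a < j then X a else Y (a - j)) b = lc j X b + lc k Y (\<lambda>a. b (a + j))"
proof
  fix i
  let ?Z = "\<lambda>a. if a < j then X a else Y (a - j)"
  have "(\<Sum>a<j+k. b a * ?Z a i) = (\<Sum>a<j. b a * ?Z a i) + (\<Sum>a=j..<j+k. b a * ?Z a i)"
    using sum.atLeastLessThan_concat[of 0 j "j+k" "\<lambda>a. b a * ?Z a i"] by (simp add: atLeast0LessThan)
  also have "(\<Sum>a=j..<j+k. b a * ?Z a i) = (\<Sum>a<k. b (a + j) * ?Z (a + j) i)"
    using sum.shift_bounds_nat_ivl[of "\<lambda>a. b a * ?Z a i" 0 j k] by (simp add: atLeast0LessThan add.commute)
  finally show "lc (j + k) ?Z b i = (lc j X b + lc k Y (\<lambda>a. b (a + j))) i"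
    by (simp add: lc_def)
qed

lemma finite_subspace: "W \<subseteq> vecs N \<Longrightarrow> finite (W :: (nat \<Rightarrow> 'a::{field,finite}) set)"
  using card_vecs(1) by (rule rev_finite_subset)

lemma is_subspace_preimage:
  assumes "is_subspace W"
  shows "is_subspace {b \<in> vecs j. lc j X b \<in> W}"
  using is_subspaceD[OF assms] by (auto simp: is_subspace_def lc_add lc_smul)

context GL_level
begin

text \<open>Choose a functional \<open>f\<close> vanishing on those \<open>b\<close> with \<open>X' b\<close> in the span of \<open>X\<close>. The sum of
  \<open>KK X (X' + y \<otimes> f)\<close> over all \<open>y\<close> is zero; for most \<open>y\<close> the summand equals \<open>KK X X'\<close> by transitivity,
  and for the few others the induction hypothesis applies.\<close>

lemma KK_bound_step:
  assumes jN: "2 * j \<le> N" and X: "X \<in> VV" "indep j X" and X': "X' \<in> VV"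
    and card: "card {b \<in> vecs j. lc j X' b \<in> lspan j X} * CARD('a) ^ Suc r = CARD('a) ^ j"
    and IH: "\<And>Y. Y \<in> VV \<Longrightarrow> card {b \<in> vecs j. lc j Y b \<in> lspan j X} * CARD('a) ^ r = CARD('a) ^ j \<Longrightarrow>
      cmod (KK X Y) \<le> C"
  shows "cmod (KK X X') \<le> C * (real (CARD('a) ^ (2 * j)) / real (CARD('a) ^ N))"
proof -
  let ?q = "CARD('a)"
  have q: "?q > 1" by (rule card_field_gt_1)
  let ?K = "{b \<in> vecs j. lc j X' b \<in> lspan j X}"
  have finK: "finite ?K" by (rule finite_subspace[of _ j]) auto
  have "card ?K < card (vecs j :: (nat \<Rightarrow> 'a) set)"
  proof -
    have "card ?K > 0" using card q by (metis mult_0 neq0_conv power_not_zero not_less0)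
    then have "card ?K * 1 < card ?K * ?q ^ Suc r"
      using q by (intro mult_strict_left_mono one_less_power) auto
    then show ?thesis by (simp only: card card_vecs(2) mult_1_right)
  qed
  then have "?K \<noteq> vecs j" by (metis less_irrefl)
  then obtain b1 where b1: "b1 \<in> vecs j" "lc j X' b1 \<notin> lspan j X" by blast
  have Xv: "X a \<in> vecs N" and X'v: "X' a \<in> vecs N" for a using X X' by (auto simp: tuplesD)
  obtain \<phi> where \<phi>: "\<phi> \<in> vecs N" "\<And>a. a < j \<Longrightarrow> dot N (X a) \<phi> = 0" "dot N (lc j X' b1) \<phi> \<noteq> 0"
    using not_in_span_functional[of "lc j X' b1" N j X] b1(2) Xv X'v vecs_lc[of j X' N]
    unfolding lspan_iff by metis
  \<comment> \<open>The pullback along X' of a functional \<phi> that vanishes on the span of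
    X.\<close>
  define f where "f = cut j (\<lambda>a. dot N (X' a) \<phi>)"
  have df: "dot j b f = dot N (lc j X' b) \<phi>" for b
    unfolding f_def by (simp add: dot_lc) (simp add: dot_def)
  have fin: "f \<in> vecs j" unfolding f_def by simp
  have d1: "dot j b1 f \<noteq> 0" using \<phi>(3) df by simp
  then have f0: "f \<noteq> 0" by (auto simp: dot_def)
  define b0 where "b0 = smul (inverse (dot j b1 f)) b1"
  have b0: "b0 \<in> vecs j" "dot j b0 f = 1" using b1(1) d1 by (auto simp: b0_def dot_smul)
  have Xf: "dot N (lc j X b) \<phi> = 0" for b using \<phi>(2) by (simp add: dot_lc)
  have Kf: "dot j b f = 0" if "lc j X' b \<in> lspan j X" for b
    using that Xf unfolding df lspan_iff by auto
  define H where "H = {k \<in> vecs j. dot j k f = 0}"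
  have cH: "?q ^ j = ?q * card H"
    using card_hyperplane[OF is_subspace_vecs card_vecs(1) b0(1), of j f] b0(2) by (simp add: H_def card_vecs)
  \<comment> \<open>Adding y \<otimes> f only affects b outside the kernel of f. Hence the relations
    between the columns of X and of X' change only if U + y lies in \<open>T\<close>, the span of X
    and of X' applied to that kernel. The missing dimension gives |F| |T| \<le> |F|^(2j), which
    leaves room for the factor 2 below.\<close>
  define T where "T = (\<lambda>(b, k). lc j X b + lc j X' k) ` (vecs j \<times> H)"
  have TI: "lc j X b + lc j X' k \<in> T" if "dot j k f = 0" for b k
  proof -
    have "lc j X b + lc j X' k = (\<lambda>(b, k). lc j X b + lc j X' k) (cut j b, cut j k)" by simp
    moreover have "(cut j b, cut j k) \<in> vecs j \<times> H" using that by (simp add: H_def)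
    ultimately show ?thesis unfolding T_def by (rule image_eqI)
  qed
  have finH: "finite H" unfolding H_def by (rule finite_subspace[of _ j]) auto
  have cT: "card T * ?q \<le> ?q ^ (2 * j)"
  proof -
    have "card T \<le> card ((vecs j :: (nat \<Rightarrow> 'a) set) \<times> H)" unfolding T_def by (rule card_image_le) (simp add: finH card_vecs)
    then have "card T * ?q \<le> ?q ^ j * card H * ?q"
      by (intro mult_right_mono) (simp_all add: card_cartesian_product card_vecs)
    also have "\<dots> = ?q ^ j * ?q ^ j" using cH by (simp add: mult_ac)
    finally show ?thesis by (simp add: mult_2 power_add)
  qed
  have finT: "finite T" unfolding T_def by (simp add: finH card_vecs)
  define U where "U = lc j X' b0"
  have U: "U \<in> vecs N" unfolding U_def using X'v by (intro vecs_lc)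
  have UT: "U \<notin> T"
  proof
    assume "U \<in> T"
    then have "dot N U \<phi> = 0" using Xf df[symmetric] unfolding T_def H_def by (auto simp: dot_add)
    then show False using df[of b0] b0(2) by (simp add: U_def)
  qed
  define bad where "bad = {y \<in> vecs N. U + y \<in> T}"
  have finbad: "finite bad" unfolding bad_def by (rule finite_subspace[of _ N]) auto
  have cbad: "card bad \<le> card T"
    by (rule card_inj_on_le[of "\<lambda>y. U + y"]) (auto simp: bad_def finT inj_on_def)
  have good: "KK X (X' + tens y f) = KK X X'" if y: "y \<in> vecs N - bad" for y
  proof -
    have yN: "y \<in> vecs N" "U + y \<notin> T" using y by (auto simp: bad_def)
    let ?Z = "\<lambda>a. if a < j then X a else X' (a - j)"
    let ?W = "\<lambda>a. if a < j then X a else (X' + tens y f) (a - j)"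
    have key: "lc j X b + lc j X' k + smul (dot j k f) w \<noteq> 0"
      if "dot j k f \<noteq> 0" and w: "U + w \<notin> T" for b k w
    proof
      assume z: "lc j X b + lc j X' k + smul (dot j k f) w = 0"
      define c where "c = dot j k f"
      have c: "c \<noteq> 0" using that by (simp add: c_def)
      define k' where "k' = k - smul c b0"
      have k': "dot j k' f = 0" by (simp add: k'_def dot_diff dot_smul b0(2) c_def)
      have "lc j X b + lc j X' k' + smul c (U + w) = 0"
        using z by (simp add: k'_def lc_diff lc_smul U_def smul_add c_def algebra_simps)
      then have "smul c (U + w) = - (lc j X b + lc j X' k')" by (metis add_eq_0_iff)
      then have e: "smul c (U + w) = smul (- 1) (lc j X b + lc j X' k')" by (simp only: smul_minus_one)
      have "U + w = smul (inverse c) (smul c (U + w))" using c by simp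
      also have "\<dots> = smul (- inverse c) (lc j X b + lc j X' k')" unfolding e by simp
      also have "\<dots> = lc j X (smul (- inverse c) b) + lc j X' (smul (- inverse c) k')"
        by (simp only: smul_add lc_smul)
      finally have "U + w = lc j X (smul (- inverse c) b) + lc j X' (smul (- inverse c) k')" .
      then show False using TI[of "smul (- inverse c) k'" "smul (- inverse c) b"] k' w by (simp add: dot_smul)
    qed
    have ker: "lc (j + j) ?Z b = 0 \<longleftrightarrow> lc (j + j) ?W b = 0" for b
    proof -
      let ?k = "\<lambda>a. b (a + j)"
      have Z: "lc (j + j) ?Z b = lc j X b + lc j X' ?k" by (rule lc_append)
      have W: "lc (j + j) ?W b = lc j X b + lc j X' ?k + smul (dot j ?k f) y"
        by (subst lc_append) (simp only: lc_tuple_add lc_tens add.assoc)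
      show ?thesis
      proof (cases "dot j ?k f = 0")
        case True
        then show ?thesis unfolding Z W by simp
      next
        case False
        have "U + 0 \<notin> T" using UT by simp
        then show ?thesis unfolding Z W using key[OF False, of 0 b] key[OF False yN(2), of b] by simp
      qed
    qed
    have tin: "X' + tens y f \<in> VV" using X' yN(1) fin by auto
    obtain g where g: "g \<in> carrier GG" "\<forall>a<j+j. mv g (?Z a) = ?W a"
    proof -
      have "\<exists>g\<in>carrier (GL_mat N). \<forall>a<j+j. mv g (?Z a) = ?W a"
        by (rule GL_transitive[OF _ _ ker]) (use Xv X'v tuplesD(1)[OF tin] in auto)
      then show ?thesis using that by blast
    qed
    have "act g X a = X a" for a
      using g(2)[rule_format, of a] X(1) by (cases "a < j") (auto simp: act_def tuplesD zero_fun_def)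
    then have gX: "act g X = X" by (rule ext)
    have "act g X' a = (X' + tens y f) a" for a
    proof (cases "a < j")
      case True
      then show ?thesis using g(2)[rule_format, of "a + j"] by (simp add: act_def)
    next
      case False
      then show ?thesis using tuplesD(2)[OF X', of a] tuplesD(2)[OF tin, of a] by (simp add: act_def zero_fun_def)
    qed
    then have "act g X' = X' + tens y f" by (rule ext)
    then show ?thesis using KK_act[OF g(1) X(1) X'] gX by simp
  qed
  \<comment> \<open>For bad \<open>y\<close> the vector b0 - k is mapped into the span of X, so the
    space of such vectors grows by exactly one dimension and \<open>IH\<close> applies.\<close>
  have badbound: "cmod (KK X (X' + tens y f)) \<le> C" if y: "y \<in> bad" for y
  proof (rule IH)
    have yN: "y \<in> vecs N" "U + y \<in> T" using y by (auto simp: bad_def)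
    show "X' + tens y f \<in> VV" using X' yN(1) fin by auto
    obtain b k where bk: "U + y = lc j X b + lc j X' k" "k \<in> vecs j" "dot j k f = 0"
      using yN(2) unfolding T_def H_def by auto
    let ?K'' = "{b \<in> vecs j. lc j (X' + tens y f) b \<in> lspan j X}"
    have l: "lc j (X' + tens y f) k = lc j X' k + smul (dot j k f) y" for k
      by (simp add: lc_tuple_add lc_tens)
    have "lc j (X' + tens y f) (b0 - k) = lc j X b"
    proof -
      have "lc j (X' + tens y f) (b0 - k) = U - lc j X' k + y"
        unfolding l by (simp add: dot_diff b0(2) bk(3) lc_diff U_def)
      also have "\<dots> = lc j X b" using bk(1) by (simp add: algebra_simps)
      finally show ?thesis .
    qed
    then have m: "b0 - k \<in> ?K''" using vecs_diff[OF b0(1) bk(2)] unfolding lspan_iff by blast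
    have d: "dot j (b0 - k) f \<noteq> 0" by (simp add: dot_diff b0(2) bk(3))
    have "card ?K'' = ?q * card {k \<in> ?K''. dot j k f = 0}"
      by (rule card_hyperplane[OF is_subspace_preimage[OF is_subspace_lspan] _ m d]) (rule finite_subspace[of _ j], auto)
    also have "{k \<in> ?K''. dot j k f = 0} = ?K" using Kf l by auto
    finally have e: "card ?K'' = ?q * card ?K" .
    show "card ?K'' * ?q ^ r = ?q ^ j" unfolding e using card by (simp only: power_Suc mult_ac)
  qed
  have C0: "C \<ge> 0 \<or> bad = {}" using badbound by (metis all_not_in_conv norm_ge_zero order_trans)
  let ?t = "card bad" and ?Q = "?q ^ N"
  have t2: "2 * ?t \<le> ?q ^ (2 * j)"
  proof -
    have "2 * ?t \<le> card T * ?q" using mult_mono[OF cbad, of 2 ?q] q by (simp add: mult.commute)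
    then show ?thesis using cT by linarith
  qed
  have Qj: "?q ^ (2 * j) \<le> ?Q" using jN q by (intro power_increasing) auto
  have "0 = (\<Sum>y\<in>vecs N. KK X (X' + tens y f))" using KK_level[OF X(1) X' fin f0] by simp
  also have "\<dots> = (\<Sum>y\<in>vecs N - bad. KK X (X' + tens y f)) + (\<Sum>y\<in>bad. KK X (X' + tens y f))"
    by (rule sum.subset_diff) (auto simp: bad_def card_vecs)
  also have "(\<Sum>y\<in>vecs N - bad. KK X (X' + tens y f)) = of_nat (?Q - ?t) * KK X X'"
  proof -
    have "card (vecs N - bad) = ?Q - ?t"
      using finbad by (subst card_Diff_subset) (auto simp: bad_def card_vecs)
    then show ?thesis using good by simp
  qed
  finally have "of_nat (?Q - ?t) * KK X X' = - (\<Sum>y\<in>bad. KK X (X' + tens y f))"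
    by (rule eq_neg_iff_add_eq_0[THEN iffD2, OF sym])
  then have "cmod (of_nat (?Q - ?t) * KK X X') = cmod (\<Sum>y\<in>bad. KK X (X' + tens y f))" by simp
  then have "real (?Q - ?t) * cmod (KK X X') = cmod (\<Sum>y\<in>bad. KK X (X' + tens y f))"
    by (simp add: norm_mult)
  also have "\<dots> \<le> (\<Sum>y\<in>bad. C)" by (rule sum_norm_le) (rule badbound)
  finally have main: "(real ?Q - real ?t) * cmod (KK X X') \<le> real ?t * C"
    using t2 Qj by (simp add: of_nat_diff)
  have tC: "real ?t * C \<ge> 0" using C0 by auto
  have Qt: "2 * real ?t \<le> real (?q ^ (2 * j))" using t2 by (metis of_nat_le_iff of_nat_mult of_nat_numeral)
  have QjR: "real (?q ^ (2 * j)) \<le> real ?Q" using Qj by (simp only: of_nat_le_iff)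
  have Q0: "real ?Q > 0" using q by simp
  show ?thesis
  proof (cases "bad = {}")
    case True
    \<comment> \<open>The bad set always contains -U, so this case is void and C is
      nonnegative.\<close>
    have "0 \<in> T" using TI[of 0 0] by (simp add: dot_def)
    moreover have "- U \<in> vecs N" using U by blast
    ultimately have "- U \<in> bad" by (simp add: bad_def)
    then show ?thesis using True by simp
  next
    case False
    then have C: "C \<ge> 0" using C0 by simp
    have "(real ?Q / 2) * cmod (KK X X') \<le> (real ?Q - real ?t) * cmod (KK X X')"
      using Qt QjR by (intro mult_right_mono) auto
    also have "\<dots> \<le> real ?t * C" by (rule main)
    finally have "real ?Q * cmod (KK X X') \<le> (2 * real ?t) * C" by simp
    also have "\<dots> \<le> real (?q ^ (2 * j)) * C" using Qt C by (rule mult_right_mono)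
    finally show ?thesis using Q0 by (simp add: field_simps)
  qed
qed

lemma KK_bound:
  assumes jN: "2 * j \<le> N" and X: "X \<in> VV" "indep j X"
  shows "Y \<in> VV \<Longrightarrow> card {b \<in> vecs j. lc j Y b \<in> lspan j X} * CARD('a) ^ r = CARD('a) ^ j \<Longrightarrow>
    cmod (KK X Y) \<le> cc * (real (CARD('a) ^ (2 * j)) / real (CARD('a) ^ N)) ^ r"
proof (induction r arbitrary: Y)
  case 0
  then show ?case using KK_le_cc[OF X(1)] by simp
next
  case (Suc r)
  from KK_bound_step[OF jN X Suc.prems Suc.IH] show ?case by (simp add: mult_ac)
qed

end

section \<open>Counting the tuples moved by a group element\<close>

definition tups :: "(nat \<Rightarrow> 'a::zero) set \<Rightarrow> nat \<Rightarrow> (nat \<Rightarrow> nat \<Rightarrow> 'a) set" where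
  "tups S k = {X. (\<forall>a<k. X a \<in> S) \<and> (\<forall>a\<ge>k. X a = (\<lambda>_. 0))}"

lemma lspan_subset:
  assumes "is_subspace W" "\<And>a. a < k \<Longrightarrow> X a \<in> W"
  shows "lspan k X \<subseteq> W"
  using assms by (auto simp: lspan_def intro: is_subspace_lc)

lemma vecs_mono: "d \<le> k \<Longrightarrow> b \<in> vecs d \<Longrightarrow> b \<in> vecs k"
  by (auto simp: vecs_def)

lemma lc_vecs_mono:
  assumes "d \<le> k" "b \<in> vecs d"
  shows "lc k X b = lc d X b"
proof
  fix i
  show "lc k X b i = lc d X b i"
    unfolding lc_def using assms by (intro sum.mono_neutral_right) (auto simp: vecs_def)
qed

text \<open>A rank factorization L = Y Z in which the basis Y of the column span starts with a basis
  of its intersection with \<open>S\<close>. Then k - d is the codimension of the space of b with L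
  b in S, and b -> (b . Z_i) is onto F^k because Y is a basis of the image of L.\<close>

lemma adapted_factorization:
  fixes L :: "nat \<Rightarrow> nat \<Rightarrow> 'a::{field,finite}"
  assumes L: "\<And>a. a < j \<Longrightarrow> L a \<in> vecs N" and S: "is_subspace S"
  obtains k d Y Z where "d \<le> k" "k \<le> j" "indep k Y" "\<And>i. i < k \<Longrightarrow> Y i \<in> lspan j L"
    "\<And>i. i < d \<Longrightarrow> Y i \<in> S" "\<And>i. i < k \<Longrightarrow> Z i \<in> vecs j"
    "\<And>a. a < j \<Longrightarrow> L a = lc k Y (\<lambda>i. Z i a)"
    "\<And>c. c \<in> vecs k \<Longrightarrow> \<exists>b\<in>vecs j. \<forall>i<k. dot j b (Z i) = c i"
    "card {b \<in> vecs j. lc j L b \<in> S} * CARD('a) ^ (k - d) = CARD('a) ^ j"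
proof -
  let ?SL = "lspan j L"
  have SL: "is_subspace ?SL" "finite ?SL"
    using lspan_vecs[of j L N] L by (auto intro: is_subspace_lspan finite_subspace[of _ N])
  have S0: "is_subspace (?SL \<inter> S)" "finite (?SL \<inter> S)"
    using is_subspaceD[OF SL(1)] is_subspaceD[OF S] SL(2) by (auto simp: is_subspace_def)
  obtain d y where y: "indep d y" "lspan d y = ?SL \<inter> S" by (rule subspace_basis[OF S0])
  have yin: "y i \<in> ?SL" "y i \<in> S" if "i < d" for i using lspan_member[OF that, of y] y(2) by auto
  obtain k Y where Y: "d \<le> k" "indep k Y" "\<And>i. i < d \<Longrightarrow> Y i = y i" "lspan k Y = ?SL"
    using basis_extend[OF SL y(1)] yin(1) by blast
  have Yin: "Y i \<in> ?SL" if "i < k" for i using lspan_member[OF that, of Y] Y(4) by simp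
  have "\<exists>c. c \<in> vecs k \<and> L a = lc k Y c" if "a < j" for a
  proof -
    have "L a \<in> lspan k Y" using lspan_member[OF that, of L] Y(4) by simp
    then show ?thesis by (auto simp: lspan_def)
  qed
  then obtain z where z: "\<And>a. a < j \<Longrightarrow> z a \<in> vecs k" "\<And>a. a < j \<Longrightarrow> L a = lc k Y (z a)" by metis
  define Z where "Z i = cut j (\<lambda>a. z a i)" for i
  define \<phi> where "\<phi> b = cut k (\<lambda>i. dot j b (Z i))" for b
  have Lb: "lc j L b = lc k Y (\<phi> b)" for b
  proof -
    have "lc j L b = lc j (\<lambda>a. lc k Y (z a)) b" using z(2) by (simp cong: lc_cong)
    also have "\<dots> = lc k Y (lc j z b)" by (rule lc_lc[symmetric])
    also have "\<dots> = lc k Y (\<phi> b)"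
      by (rule lc_cong) (auto simp: \<phi>_def cut_def Z_def lc_def dot_def intro!: sum.cong)
    finally show ?thesis .
  qed
  have inj: "c = c'" if "c \<in> vecs k" "c' \<in> vecs k" "lc k Y c = lc k Y c'" for c c'
    using indep_inj[OF Y(2)] that by (auto dest: inj_onD)
  have surj: "\<exists>b\<in>vecs j. \<phi> b = c" if c: "c \<in> vecs k" for c
  proof -
    have "lc k Y c \<in> ?SL" unfolding Y(4)[symmetric] lspan_iff by blast
    then obtain b where b: "b \<in> vecs j" "lc k Y c = lc j L b" by (auto simp: lspan_def)
    have "\<phi> b = c" by (rule inj) (use b(2) c in \<open>simp_all add: Lb \<phi>_def\<close>)
    then show ?thesis using b(1) by blast
  qed
  have \<phi>_diff: "\<phi> (u - v) = \<phi> u - \<phi> v" for u v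
    by (simp add: \<phi>_def cut_def dot_diff fun_eq_iff)
  let ?K = "{b \<in> vecs j. lc j L b \<in> S}" and ?Ker = "{b \<in> vecs j. \<phi> b = 0}"
  have im1: "\<phi> ` vecs j = vecs k" using surj by (auto simp: \<phi>_def)
  have c1: "card (vecs j :: (nat \<Rightarrow> 'a) set) = card (\<phi> ` vecs j) * card ?Ker"
    by (rule card_hom) (auto simp: card_vecs \<phi>_diff)
  have K: "is_subspace ?K" by (rule is_subspace_preimage[OF S])
  have finK: "finite ?K" by (rule finite_subspace[of _ j]) auto
  have "\<phi> ` ?K = vecs d"
  proof
    show "\<phi> ` ?K \<subseteq> vecs d"
    proof
      fix c assume "c \<in> \<phi> ` ?K"
      then obtain b where b: "b \<in> vecs j" "lc j L b \<in> S" "c = \<phi> b" by auto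
      have "lc j L b \<in> ?SL" unfolding lspan_iff by blast
      then have "lc j L b \<in> lspan d y" using b(2) y(2) by auto
      then obtain c' where c': "c' \<in> vecs d" "lc j L b = lc d y c'" by (auto simp: lspan_def)
      have "lc d y c' = lc k Y c'"
        using Y(3) by (simp add: lc_vecs_mono[OF Y(1) c'(1)] cong: lc_cong)
      then have "\<phi> b = c'"
        using inj[of "\<phi> b" c'] vecs_mono[OF Y(1) c'(1)] c'(2) Lb[of b] by (simp add: \<phi>_def)
      then show "c \<in> vecs d" using b(3) c'(1) by simp
    qed
    show "vecs d \<subseteq> \<phi> ` ?K"
    proof
      fix c :: "nat \<Rightarrow> 'a" assume c: "c \<in> vecs d"
      obtain b where b: "b \<in> vecs j" "\<phi> b = c" using surj[OF vecs_mono[OF Y(1) c]] by blast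
      have "lc j L b = lc d y c"
        using Y(3) by (simp add: Lb b(2) lc_vecs_mono[OF Y(1) c] cong: lc_cong)
      then have "lc j L b \<in> S" using y(2) unfolding set_eq_iff lspan_iff by blast
      then show "c \<in> \<phi> ` ?K" using b by blast
    qed
  qed
  moreover have "card ?K = card (\<phi> ` ?K) * card {b \<in> ?K. \<phi> b = 0}"
    by (rule card_hom[OF finK is_subspace_closed[OF K]]) (auto simp: \<phi>_diff)
  moreover have "{b \<in> ?K. \<phi> b = 0} = ?Ker" using is_subspaceD(1)[OF S] by (auto simp: Lb)
  ultimately have c2: "card ?K = CARD('a) ^ d * card ?Ker" by (simp add: card_vecs)
  have c1': "CARD('a) ^ j = CARD('a) ^ k * card ?Ker" using c1 im1 by (simp add: card_vecs)
  have fin: "card ?K * CARD('a) ^ (k - d) = CARD('a) ^ j"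
  proof -
    have "CARD('a) ^ d * CARD('a) ^ (k - d) = CARD('a) ^ k" using Y(1) by (simp flip: power_add)
    moreover have "card ?K * CARD('a) ^ (k - d) = (CARD('a) ^ d * CARD('a) ^ (k - d)) * card ?Ker"
      unfolding c2 by (simp only: mult_ac)
    ultimately show ?thesis unfolding c1' by (simp only:)
  qed
  have kj: "k \<le> j"
  proof -
    have "card ?Ker > 0" using c1' card_field_gt_1[where 'a = 'a] by (cases "card ?Ker") auto
    then have "CARD('a) ^ k \<le> CARD('a) ^ j" using c1' by simp
    then show ?thesis using card_field_gt_1[where 'a = 'a] by simp
  qed
  show ?thesis
  proof (rule that[of d k Y Z])
    show "L a = lc k Y (\<lambda>i. Z i a)" if "a < j" for a
      using z(2)[OF that] that by (simp add: Z_def cut_def)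
    show "\<exists>b\<in>vecs j. \<forall>i<k. dot j b (Z i) = c i" if c: "c \<in> vecs k" for c
    proof -
      obtain b where "b \<in> vecs j" "\<phi> b = c" using surj[OF c] by blast
      then show ?thesis by (intro bexI[of _ b]) (auto simp: \<phi>_def cut_def)
    qed
  qed (use Y yin Yin kj fin in \<open>auto simp: Z_def\<close>)
qed

text \<open>Union bound over the nonzero relations b, each of which leaves only j - 1 free
  columns.\<close>

lemma card_dependent_tuples:
  fixes S :: "(nat \<Rightarrow> 'a::{field,finite}) set"
  assumes S: "is_subspace S" "S \<subseteq> vecs N"
  shows "card {X \<in> tups S j. \<not> indep j X} \<le> CARD('a) ^ j * card S ^ (j - 1)"
proof -
  let ?A = "\<lambda>b. {X \<in> tups S j. lc j X b = 0}"
  have finS: "finite S" using finite_subspace[OF S(2)] .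
  have finT: "finite (tups S j)" unfolding tups_def by (rule card_PiE_vecs_like[OF finS])
  have "card (?A b) \<le> card S ^ (j - 1)" if b: "b \<in> vecs j - {0}" for b
  proof -
    have "indep 1 (\<lambda>_. b)"
    proof (unfold indep_def, intro ballI impI)
      fix c :: "nat \<Rightarrow> 'a" assume c: "c \<in> vecs 1" "lc 1 (\<lambda>_. b) c = 0"
      have "smul (c 0) b = 0" using c(2) by (simp add: lc_def smul_def)
      then have "c 0 = 0" using b by (simp add: smul_eq_0_iff)
      then show "c = 0" using c(1) by (intro vecs_eqI[of _ 1]) auto
    qed
    then have "card {X \<in> tuples N j. (\<forall>a<j. X a \<in> S) \<and> (\<forall>i<(1::nat). lc j X b = 0)} \<le> card S ^ (j - 1)"
      using b by (intro card_annihilating_tuples(1)[OF S]) auto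
    moreover have "?A b = {X \<in> tuples N j. (\<forall>a<j. X a \<in> S) \<and> (\<forall>i<(1::nat). lc j X b = 0)}"
      using S(2) by (auto simp: tups_def tuples_alt)
    ultimately show ?thesis by simp
  qed
  then have "(\<Sum>b\<in>vecs j - {0}. card (?A b)) \<le> (\<Sum>b\<in>vecs j - {0 :: nat \<Rightarrow> 'a}. card S ^ (j - 1))"
    by (rule sum_mono)
  moreover have "card (\<Union>b\<in>vecs j - {0}. ?A b) \<le> (\<Sum>b\<in>vecs j - {0}. card (?A b))"
    by (rule card_UN_le) (simp add: card_vecs)
  moreover have "{X \<in> tups S j. \<not> indep j X} \<subseteq> (\<Union>b\<in>vecs j - {0}. ?A b)"
    by (auto simp: indep_def)
  then have "card {X \<in> tups S j. \<not> indep j X} \<le> card (\<Union>b\<in>vecs j - {0}. ?A b)"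
    by (rule card_mono[rotated]) (simp add: card_vecs finT)
  ultimately have "card {X \<in> tups S j. \<not> indep j X} \<le> card (vecs j - {0 :: nat \<Rightarrow> 'a}) * card S ^ (j - 1)"
    by simp
  also have "\<dots> \<le> CARD('a) ^ j * card S ^ (j - 1)"
    by (intro mult_right_mono) (simp_all add: card_Diff_subset card_vecs)
  finally show ?thesis .
qed

lemma card_UN_le_const:
  assumes "finite I" "\<And>i. i \<in> I \<Longrightarrow> card (F i) \<le> c"
  shows "card (\<Union>i\<in>I. F i) \<le> card I * c"
proof -
  have "card (\<Union>i\<in>I. F i) \<le> (\<Sum>i\<in>I. card (F i))" by (rule card_UN_le[OF assms(1)])
  also have "\<dots> \<le> (\<Sum>i\<in>I. c)" by (rule sum_mono) (rule assms(2))
  finally show ?thesis by simp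
qed

text \<open>Compare with the binomial expansion, whose coefficients are at least one.\<close>

lemma sum_prod_powers_le:
  fixes A B :: real
  assumes "A \<ge> 0" "B \<ge> 0"
  shows "(\<Sum>d\<le>k. A ^ d * B ^ (k - d)) \<le> (A + B) ^ k"
proof -
  have "A ^ d * B ^ (k - d) \<le> real (k choose d) * A ^ d * B ^ (k - d)" if "d \<le> k" for d
  proof -
    have "1 * (A ^ d * B ^ (k - d)) \<le> real (k choose d) * (A ^ d * B ^ (k - d))"
      using assms that binomial_eq_0_iff[of k d] by (intro mult_right_mono) (auto simp: Suc_le_eq)
    then show ?thesis by (simp add: mult.assoc)
  qed
  then have "(\<Sum>d\<le>k. A ^ d * B ^ (k - d)) \<le> (\<Sum>d\<le>k. real (k choose d) * A ^ d * B ^ (k - d))"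
    by (intro sum_mono) auto
  then show ?thesis by (simp add: binomial_ring)
qed

lemma sum_powers_le:
  fixes x :: real
  assumes "0 \<le> x" "2 * x \<le> 1"
  shows "(\<Sum>k=1..j. x ^ k) \<le> 2 * x"
proof -
  have "(\<Sum>k=1..j. x ^ k) \<le> 2 * x - x ^ j * (2 * x) "
  proof (induction j)
    case (Suc j)
    have "x ^ j * (2 * x) * x \<le> x ^ j * x"
      using assms mult_left_mono[of "2 * x" 1 "x ^ j * x"] by (simp add: mult_ac)
    then show ?case using Suc by (simp add: algebra_simps)
  qed simp
  also have "\<dots> \<le> 2 * x" using assms by simp
  finally show ?thesis .
qed

context GL_level
begin

text \<open>Apply \<open>adapted_factorization\<close> to L = X - h X and the span of X. Of the k
  independent displacement vectors, d stay in the span of X and are recorded by their coefficient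
  vectors B; the other k - d leave it, and each of them gains a factor |F|^(2j-N) from
  \<open>KK_bound\<close>.\<close>

lemma nonfixed_data:
  assumes jN: "2 * j \<le> N" and h: "h \<in> carrier GG" and X: "X \<in> VV" "indep j X" and nf: "act h X \<noteq> X"
  shows "\<exists>k d. 1 \<le> k \<and> k \<le> j \<and> d \<le> k \<and>
    cmod (KK X (act h X)) \<le> cc * (real (CARD('a) ^ (2 * j)) / real (CARD('a) ^ N)) ^ (k - d) \<and>
    (\<exists>Y\<in>tups (imn h) k. \<exists>Z\<in>tups (vecs j) k. \<exists>B\<in>tups (vecs j) d. indep d B \<and>
      (\<forall>a<j. X a - mv h (X a) = lc k Y (\<lambda>i. Z i a)) \<and> (\<forall>i<d. lc j X (B i) = Y i))"
proof -
  define L where "L a = X a - mv h (X a)" for a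
  have Lv: "L a \<in> vecs N" for a unfolding L_def using tuplesD(1)[OF X(1)] mvG_in[OF h] by (intro vecs_diff)
  have Li: "L a \<in> imn h" for a unfolding L_def by (intro imnI tuplesD(1)[OF X(1)])
  obtain k d Y Z where D: "d \<le> k" "k \<le> j" "indep k Y" "\<And>i. i < k \<Longrightarrow> Y i \<in> lspan j L"
    "\<And>i. i < d \<Longrightarrow> Y i \<in> lspan j X" "\<And>i. i < k \<Longrightarrow> Z i \<in> vecs j"
    "\<And>a. a < j \<Longrightarrow> L a = lc k Y (\<lambda>i. Z i a)"
    "\<And>c. c \<in> vecs k \<Longrightarrow> \<exists>b\<in>vecs j. \<forall>i<k. dot j b (Z i) = c i"
    "card {b \<in> vecs j. lc j L b \<in> lspan j X} * CARD('a) ^ (k - d) = CARD('a) ^ j"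
    by (rule adapted_factorization[of j L N "lspan j X", OF Lv is_subspace_lspan]) (rule that)
  have Yi: "Y i \<in> imn h" if "i < k" for i
    using lspan_subset[where k = j and X = L, OF is_subspace_imn Li] D(4)[OF that] by blast
  have k1: "1 \<le> k"
  proof (rule ccontr)
    assume "\<not> 1 \<le> k"
    then have "k = 0" by simp
    then have "L a = 0" if "a < j" for a using D(7)[OF that] by (simp add: lc_def zero_fun_def)
    then have "X a - mv h (X a) = 0" if "a < j" for a using that by (simp only: L_def)
    then have "act h X a = X a" for a
      using tuplesD(2)[OF X(1), of a] by (cases "a < j") (simp_all add: act_def zero_fun_def[symmetric])
    then have "act h X = X" by (rule ext)
    then show False using nf by simp
  qed
  have lch: "lc j (act h X) b = lc j X b - lc j L b" for b
  proof -
    have "lc j L b = lc j (X - act h X) b" by (rule lc_cong) (auto simp: L_def act_def)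
    then show ?thesis by (simp add: lc_tuple_diff)
  qed
  have "{b \<in> vecs j. lc j (act h X) b \<in> lspan j X} = {b \<in> vecs j. lc j L b \<in> lspan j X}"
  proof -
    have "lc j (act h X) b \<in> lspan j X \<longleftrightarrow> lc j L b \<in> lspan j X" for b
    proof -
      have x: "lc j X b \<in> lspan j X" unfolding lspan_iff by blast
      have e: "lc j L b = lc j X b - lc j (act h X) b" by (simp add: lch)
      show ?thesis
      proof
        assume "lc j (act h X) b \<in> lspan j X"
        then show "lc j L b \<in> lspan j X" unfolding e by (rule is_subspaceD(5)[OF is_subspace_lspan x])
      next
        assume "lc j L b \<in> lspan j X"
        then show "lc j (act h X) b \<in> lspan j X" unfolding lch by (rule is_subspaceD(5)[OF is_subspace_lspan x])
      qed
    qed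
    then show ?thesis by simp
  qed
  then have bound: "cmod (KK X (act h X)) \<le> cc * (real (CARD('a) ^ (2 * j)) / real (CARD('a) ^ N)) ^ (k - d)"
    using KK_bound[OF jN X actG_in[OF h X(1)], of "k - d"] D(9) by simp
  have "\<exists>b. b \<in> vecs j \<and> lc j X b = Y i" if "i < d" for i
    using D(5)[OF that] unfolding lspan_def by auto
  then obtain B where B: "\<And>i. i < d \<Longrightarrow> B i \<in> vecs j" "\<And>i. i < d \<Longrightarrow> lc j X (B i) = Y i" by metis
  have indB: "indep d B"
    unfolding indep_def
  proof (intro ballI impI)
    fix c assume c: "c \<in> vecs d" "lc d B c = 0"
    have "lc j X (lc d B c) = lc d Y c" unfolding lc_lc using B(2) by (simp cong: lc_cong)
    then have "lc k Y c = 0" using c by (simp add: lc_vecs_mono[OF D(1) c(1)])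
    then show "c = 0" using D(3) vecs_mono[OF D(1) c(1)] by (simp add: indep_def)
  qed
  let ?c = "\<lambda>n (W :: nat \<Rightarrow> nat \<Rightarrow> 'a) a. if a < n then W a else (\<lambda>_. 0)"
  have "indep d (?c d B)"
    using indB unfolding indep_def by (simp cong: lc_cong)
  moreover have "\<forall>a<j. X a - mv h (X a) = lc k (?c k Y) (\<lambda>i. ?c k Z i a)"
    using D(7) unfolding L_def by (simp cong: lc_cong)
  moreover have "\<forall>i<d. lc j X (?c d B i) = ?c k Y i" using B(2) D(1) by simp
  moreover have "?c k Y \<in> tups (imn h) k" "?c k Z \<in> tups (vecs j) k" "?c d B \<in> tups (vecs j) d"
    using Yi D(6) B(1) by (auto simp: tups_def)
  ultimately show ?thesis using k1 D(1,2) bound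
    by (intro exI[of _ k] exI[of _ d] conjI bexI[of _ "?c k Y"] bexI[of _ "?c k Z"] bexI[of _ "?c d B"])
qed

definition stratum :: "'a mat \<Rightarrow> nat \<Rightarrow> nat \<Rightarrow> (nat \<Rightarrow> nat \<Rightarrow> 'a) set" where
  "stratum h k d = {X \<in> VV.
    cmod (KK X (act h X)) \<le> cc * (real (CARD('a) ^ (2 * j)) / real (CARD('a) ^ N)) ^ (k - d) \<and>
    (\<exists>Y\<in>tups (imn h) k. \<exists>Z\<in>tups (vecs j) k. \<exists>B\<in>tups (vecs j) d. indep d B \<and>
      (\<forall>a<j. X a - mv h (X a) = lc k Y (\<lambda>i. Z i a)) \<and> (\<forall>i<d. lc j X (B i) = Y i))}"

lemma is_subspace_fix: "is_subspace {v \<in> vecs N. mv h v = v}"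
  by (auto simp: is_subspace_def mv_add mv_smul)

text \<open>Choose Y, Z and B. Two tuples with the same data differ by a tuple that is fixed by
  \<open>h\<close> and kills the independent vectors B, which leaves j - d free columns among the
  fixed vectors.\<close>

lemma card_stratum:
  assumes h: "h \<in> carrier GG"
  shows "card (stratum h k d) \<le> card (imn h) ^ k * (CARD('a) ^ j) ^ k * (CARD('a) ^ j) ^ d * fixn h ^ (j - d)"
proof -
  define D where "D = tups (imn h) k \<times> tups (vecs j :: (nat \<Rightarrow> 'a) set) k \<times> {B \<in> tups (vecs j :: (nat \<Rightarrow> 'a) set) d. indep d B}"
  define F where "F = (\<lambda>(Y, Z, B). {X \<in> VV. (\<forall>a<j. X a - mv h (X a) = lc k Y (\<lambda>i. Z i a)) \<and> (\<forall>i<d. lc j X (B i) = Y i)})"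
  have fi: "finite (imn h)" using imn_sub[OF h] by (rule finite_subspace)
  have finT: "finite (tups S n)" "card (tups S n) = card S ^ n" if "finite S" for S :: "(nat \<Rightarrow> 'a) set" and n
    unfolding tups_def using card_PiE_vecs_like[OF that] by blast+
  have finB: "finite {B \<in> tups (vecs j :: (nat \<Rightarrow> 'a) set) d. indep d B}"
    by (rule finite_subset[OF _ finT(1)[OF card_vecs(1)[of j]], of _ d]) blast
  have finD: "finite D" unfolding D_def by (intro finite_cartesian_product finT fi card_vecs finB)
  have cD: "card D \<le> card (imn h) ^ k * (CARD('a) ^ j) ^ k * (CARD('a) ^ j) ^ d"
  proof -
    have "card {B \<in> tups (vecs j :: (nat \<Rightarrow> 'a) set) d. indep d B} \<le> card (tups (vecs j :: (nat \<Rightarrow> 'a) set) d)"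
      by (rule card_mono) (auto simp: finT card_vecs)
    then show ?thesis
      unfolding D_def card_cartesian_product by (simp add: finT fi card_vecs mult.assoc)
  qed
  have "card (F p) \<le> fixn h ^ (j - d)" if "p \<in> D" for p
  proof (cases "F p = {}")
    case True
    then show ?thesis by simp
  next
    case False
    obtain Y Z B where p: "p = (Y, Z, B)" "B \<in> tups (vecs j) d" "indep d B"
      using \<open>p \<in> D\<close> unfolding D_def by auto
    obtain X0 where X0: "X0 \<in> F p" using False by blast
    let ?A = "{X \<in> tuples N j. (\<forall>a<j. X a \<in> {v \<in> vecs N. mv h v = v}) \<and> (\<forall>i<d. lc j X (B i) = 0)}"
    have finA: "finite ?A" by (rule rev_finite_subset[OF finVV]) auto
    have "card (F p) \<le> card ?A"
    proof (rule card_inj_on_le[of "\<lambda>X. X - X0"])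
      show "(\<lambda>X. X - X0) ` F p \<subseteq> ?A"
      proof
        fix T assume "T \<in> (\<lambda>X. X - X0) ` F p"
        then obtain X where X: "X \<in> F p" "T = X - X0" by auto
        have V: "X \<in> VV" "X0 \<in> VV" using X(1) X0 by (auto simp: F_def p(1))
        have "mv h (T a) = T a" if "a < j" for a
        proof -
          have "X a - mv h (X a) = X0 a - mv h (X0 a)" using X(1) X0 that by (auto simp: F_def p(1))
          then have e: "X a - X0 a = mv h (X a) - mv h (X0 a)" by (simp add: algebra_simps)
          have t: "T a = X a - X0 a" unfolding X(2) by (rule minus_apply)
          show ?thesis unfolding t mv_diff by (rule e[symmetric])
        qed
        moreover have "lc j T (B i) = 0" if "i < d" for i
          using X(1) X0 that by (simp add: F_def p(1) X(2) lc_tuple_diff)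
        moreover have "T \<in> VV" unfolding X(2) using V by blast
        ultimately show "T \<in> ?A" by (auto simp: tuplesD)
      qed
    qed (use finA in \<open>auto simp: inj_on_def\<close>)
    also have "card ?A \<le> card {v \<in> vecs N. mv h v = v} ^ (j - d)"
      by (rule card_annihilating_tuples(1)[OF is_subspace_fix _ p(3)]) (use p(2) in \<open>auto simp: tups_def\<close>)
    finally show ?thesis by (simp add: fixn_def)
  qed
  then have "card (\<Union>p\<in>D. F p) \<le> card D * fixn h ^ (j - d)" by (rule card_UN_le_const[OF finD])
  moreover have "card (stratum h k d) \<le> card (\<Union>p\<in>D. F p)"
  proof (rule card_mono)
    show "finite (\<Union>p\<in>D. F p)" using finD finVV by (auto simp: F_def)
    show "stratum h k d \<subseteq> (\<Union>p\<in>D. F p)"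
    proof
      fix X assume "X \<in> stratum h k d"
      then obtain Y Z B where "X \<in> VV" "Y \<in> tups (imn h) k" "Z \<in> tups (vecs j) k" "B \<in> tups (vecs j) d" "indep d B"
        "\<forall>a<j. X a - mv h (X a) = lc k Y (\<lambda>i. Z i a)" "\<forall>i<d. lc j X (B i) = Y i"
        unfolding stratum_def by blast
      then have "(Y, Z, B) \<in> D" "X \<in> F (Y, Z, B)" by (auto simp: D_def F_def)
      then show "X \<in> (\<Union>p\<in>D. F p)" by blast
    qed
  qed
  ultimately show ?thesis using mult_right_mono[OF cD, of "fixn h ^ (j - d)"] by linarith
qed

lemma indep_act:
  assumes h: "h \<in> carrier GG" and X: "X \<in> VV"
  shows "KK X (act h X) = 0 \<or> indep j X"
proof (cases "indep j X")
  case False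
  have "KK (act h X) X = 0" by (rule KK_dependent[OF actG_in[OF h X] X False])
  then show ?thesis using KK_hermitian[OF actG_in[OF h X] X] by simp
qed simp

text \<open>Relative to the q^((N-m)j) fixed tuples, q = |F|, a displacement inside the span of X
  contributes A: a factor q^m for Y, q^j each for Z and for B, and one lost column of fixed vectors,
  q^(m-N). A displacement leaving the span contributes B: q^m for Y, q^j for Z and the decay
  q^(2j-N).\<close>

lemma nonfixed_sum:
  assumes jN: "2 * j \<le> N" and h: "h \<in> carrier GG" and fx: "fixn h = CARD('a) ^ (N - m)" and mN: "m \<le> N"
  defines "A \<equiv> real (CARD('a) ^ (2 * m + 2 * j)) / real (CARD('a) ^ N)"
    and "B \<equiv> real (CARD('a) ^ (m + 3 * j)) / real (CARD('a) ^ N)"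
  assumes AB: "2 * (A + B) \<le> 1"
  shows "(\<Sum>X\<in>{X \<in> VV. indep j X \<and> act h X \<noteq> X}. cmod (KK X (act h X))) \<le>
     cc * real (CARD('a) ^ ((N - m) * j)) * (2 * (A + B))"
proof -
  let ?q = "real CARD('a)"
  have q: "?q > 1" using card_field_gt_1[where 'a = 'a] by simp
  define P where "P = (SIGMA k:{1..j}. {..k})"
  have finP: "finite P" by (simp add: P_def)
  let ?Bad = "{X \<in> VV. indep j X \<and> act h X \<noteq> X}"
  have fB: "finite ?Bad" using finVV by auto
  have fS: "finite (stratum h k d)" for k d by (rule rev_finite_subset[OF finVV]) (auto simp: stratum_def)
  have ci: "card (imn h) = CARD('a) ^ m"
  proof -
    have "CARD('a) ^ N = CARD('a) ^ m * CARD('a) ^ (N - m)" using mN by (simp flip: power_add)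
    then show ?thesis using card_imn[OF h] q unfolding fx by simp
  qed
  have stratum_bound: "(\<Sum>X\<in>stratum h k d. cmod (KK X (act h X))) \<le>
      cc * real (CARD('a) ^ ((N - m) * j)) * (A ^ d * B ^ (k - d))" if kd: "k \<le> j" "d \<le> k" for k d
  proof -
    let ?\<theta> = "real (CARD('a) ^ (2 * j)) / real (CARD('a) ^ N)"
    have "(\<Sum>X\<in>stratum h k d. cmod (KK X (act h X))) \<le> (\<Sum>X\<in>stratum h k d. cc * ?\<theta> ^ (k - d))"
      by (rule sum_mono) (auto simp: stratum_def)
    also have "\<dots> = real (card (stratum h k d)) * (cc * ?\<theta> ^ (k - d))" by simp
    also have "\<dots> \<le> real (card (imn h) ^ k * (CARD('a) ^ j) ^ k * (CARD('a) ^ j) ^ d * fixn h ^ (j - d)) * (cc * ?\<theta> ^ (k - d))"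
      by (intro mult_right_mono) (use card_stratum[OF h] cc_nonneg in \<open>simp_all only: of_nat_le_iff\<close>, simp)
    also have "real (card (imn h) ^ k * (CARD('a) ^ j) ^ k * (CARD('a) ^ j) ^ d * fixn h ^ (j - d)) * (cc * ?\<theta> ^ (k - d))
       = cc * (?q ^ (m * k + j * k + j * d + (N - m) * (j - d)) * (?q ^ (2 * j) / ?q ^ N) ^ (k - d))"
      unfolding ci fx by (simp add: power_add power_mult)
    also have "?q ^ (m * k + j * k + j * d + (N - m) * (j - d)) * (?q ^ (2 * j) / ?q ^ N) ^ (k - d)
       = ?q ^ ((N - m) * j) * (A ^ d * B ^ (k - d))"
    proof -
      have "?q ^ (m * k + j * k + j * d + (N - m) * (j - d)) * (?q ^ (2 * j)) ^ (k - d) * (?q ^ N) ^ d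
        = ?q ^ ((N - m) * j) * (?q ^ (2 * m + 2 * j)) ^ d * (?q ^ (m + 3 * j)) ^ (k - d)"
      proof -
        obtain r where k: "k = d + r" using kd(2) le_Suc_ex by blast
        obtain t where j: "j = k + t" using kd(1) le_Suc_ex by blast
        obtain n where N: "N = m + n" using mN le_Suc_ex by blast
        show ?thesis unfolding power_mult[symmetric] power_add[symmetric]
          by (rule arg_cong[of _ _ "power ?q"]) (simp add: k j N algebra_simps)
      qed
      moreover have "M * (C / E) = R * ((a / D) * (b / E))" if "M * C * D = R * a * b" "D \<noteq> 0" "E \<noteq> 0"
        for M C E R a b D :: real using that by (simp add: field_simps)
      ultimately show ?thesis using q unfolding A_def B_def of_nat_power power_divide by simp
    qed
    finally show ?thesis by simp
  qed
  have "(\<Sum>X\<in>?Bad. cmod (KK X (act h X))) \<le> (\<Sum>X\<in>?Bad. \<Sum>p\<in>P. if X \<in> stratum h (fst p) (snd p) then cmod (KK X (act h X)) else 0)"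
  proof (rule sum_mono)
    fix X assume X: "X \<in> ?Bad"
    then obtain k d where kd: "1 \<le> k" "k \<le> j" "d \<le> k" "X \<in> stratum h k d"
      using nonfixed_data[OF jN h, of X] unfolding stratum_def by blast
    have p: "(k, d) \<in> P" using kd by (auto simp: P_def)
    have "(if X \<in> stratum h (fst (k, d)) (snd (k, d)) then cmod (KK X (act h X)) else 0) \<le>
      (\<Sum>p\<in>P. if X \<in> stratum h (fst p) (snd p) then cmod (KK X (act h X)) else 0)"
      by (rule member_le_sum[OF p]) (auto simp: finP)
    then show "cmod (KK X (act h X)) \<le> (\<Sum>p\<in>P. if X \<in> stratum h (fst p) (snd p) then cmod (KK X (act h X)) else 0)"
      using kd(4) by simp
  qed
  also have "\<dots> = (\<Sum>p\<in>P. \<Sum>X\<in>?Bad. if X \<in> stratum h (fst p) (snd p) then cmod (KK X (act h X)) else 0)"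
    by (rule sum.swap)
  also have "\<dots> \<le> (\<Sum>p\<in>P. cc * real (CARD('a) ^ ((N - m) * j)) * (A ^ snd p * B ^ (fst p - snd p)))"
  proof (rule sum_mono)
    fix p assume "p \<in> P"
    then have p: "fst p \<le> j" "snd p \<le> fst p" by (auto simp: P_def)
    have "(\<Sum>X\<in>?Bad. if X \<in> stratum h (fst p) (snd p) then cmod (KK X (act h X)) else 0)
      = (\<Sum>X\<in>?Bad \<inter> stratum h (fst p) (snd p). cmod (KK X (act h X)))"
      by (rule sum.inter_restrict[OF fB, symmetric])
    also have "\<dots> \<le> (\<Sum>X\<in>stratum h (fst p) (snd p). cmod (KK X (act h X)))"
      by (rule sum_mono2[OF fS]) auto
    also have "\<dots> \<le> cc * real (CARD('a) ^ ((N - m) * j)) * (A ^ snd p * B ^ (fst p - snd p))"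
      by (rule stratum_bound[OF p])
    finally show "(\<Sum>X\<in>?Bad. if X \<in> stratum h (fst p) (snd p) then cmod (KK X (act h X)) else 0) \<le> \<dots>" .
  qed
  also have "\<dots> = cc * real (CARD('a) ^ ((N - m) * j)) * (\<Sum>k=1..j. \<Sum>d\<le>k. A ^ d * B ^ (k - d))"
    unfolding P_def sum_distrib_left[symmetric] by (subst sum.Sigma) (auto intro!: sum.cong)
  also have "\<dots> \<le> cc * real (CARD('a) ^ ((N - m) * j)) * (2 * (A + B))"
  proof (rule mult_left_mono)
    have AB0: "A \<ge> 0" "B \<ge> 0" by (simp_all add: A_def B_def)
    have "(\<Sum>k=1..j. \<Sum>d\<le>k. A ^ d * B ^ (k - d)) \<le> (\<Sum>k=1..j. (A + B) ^ k)"
      by (intro sum_mono sum_prod_powers_le AB0)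
    also have "\<dots> \<le> 2 * (A + B)" using AB0 AB by (intro sum_powers_le) auto
    finally show "(\<Sum>k=1..j. \<Sum>d\<le>k. A ^ d * B ^ (k - d)) \<le> 2 * (A + B)" .
  qed (use cc_nonneg in auto)
  finally show ?thesis .
qed

end

text \<open>Squaring avoids half-integral exponents of q; the c spare factors q \<ge> 2 become the
  constant 2^-c.\<close>

lemma power_ratio_le:
  fixes q :: nat and a b c N :: nat
  assumes q: "q \<ge> 2" and le: "2 * a + c \<le> N"
  shows "(real (q ^ a) / real (q ^ N))\<^sup>2 \<le> (1 / 2 ^ c) * (1 / real (q ^ N))"
proof -
  have "(2::real) ^ c \<le> real q ^ c" using q by (intro power_mono) auto
  then have "real q ^ (2 * a) * 2 ^ c \<le> real q ^ (2 * a) * real q ^ c"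
    by (intro mult_left_mono) auto
  also have "\<dots> \<le> real q ^ N" unfolding power_add[symmetric] using q le by (intro power_increasing) auto
  finally have "real q ^ (2 * a) * 2 ^ c \<le> real q ^ N" .
  then have "real q ^ (2 * a) \<le> real q ^ N / 2 ^ c" by (simp add: field_simps)
  then have "real q ^ (2 * a) / (real q ^ N * real q ^ N) \<le> (real q ^ N / 2 ^ c) / (real q ^ N * real q ^ N)"
    by (rule divide_right_mono) simp
  also have "\<dots> = (1 / 2 ^ c) * (1 / real (q ^ N))" using q by simp
  also have "real q ^ (2 * a) / (real q ^ N * real q ^ N) = (real (q ^ a) / real (q ^ N))\<^sup>2"
    by (simp add: power_divide power2_eq_square mult_2 power_add)
  finally show ?thesis .
qed

lemma le_from_squares:
  fixes x s c :: real
  assumes "x\<^sup>2 \<le> d * s\<^sup>2" "s \<ge> 0" "c \<ge> 0" "d \<le> c\<^sup>2"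
  shows "x \<le> c * s"
proof -
  have "x\<^sup>2 \<le> (c * s)\<^sup>2"
    using assms(1) mult_right_mono[OF assms(4), of "s\<^sup>2"] by (simp add: power_mult_distrib)
  then show ?thesis by (rule power2_le_imp_le) (use assms in simp)
qed

lemma powr_neg_half_square:
  assumes "q \<ge> (2::nat)"
  shows "(real q powr (- (real N / 2)))\<^sup>2 = 1 / real (q ^ N)"
proof -
  have "(real q powr (- (real N / 2)))\<^sup>2 = real q powr (- real N)"
    using assms by (simp add: power2_eq_square flip: powr_add)
  also have "\<dots> = 1 / real (q ^ N)" using assms by (simp add: powr_minus powr_realpow field_simps)
  finally show ?thesis .
qed

context GL_level
begin

text \<open>Among independent tuples, q^(mj) times the number of fixed ones and the number of all of
  them are both |V|^j up to a relative error \<open>e\<close>; the moved tuples are bounded by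
  \<open>nonfixed_sum\<close>. In units of q^(-N/2) the budget is e + 2(A + B) \<le> 1/16 + 2(36/100
  + 1/16) < 91/100, which stays below one after division by 1 - e \<ge> 99/100.\<close>

lemma GL_estimate:
  assumes h: "h \<in> carrier GG" and fx: "fixn h = CARD('a) ^ (N - m)" and m: "m > 0"
    and N: "N \<ge> 3 * j\<^sup>2 + j + 2 * m + 10" "N \<ge> 2 * j\<^sup>2 + 4 * m + 5"
  shows "cmod (of_nat (CARD('a) ^ (m * j)) * (\<chi> h / \<chi> (1\<^sub>m N)) - 1) < real CARD('a) powr (- (real N / 2))"
proof -
  let ?q = "CARD('a)"
  have q: "?q \<ge> 2" using card_field_gt_1[where 'a = 'a] by simp
  have jj: "j \<le> j\<^sup>2" using j_pos by (simp add: power2_eq_square)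
  have jj2: "2 * j \<le> j\<^sup>2 + 1"
  proof -
    have "int (2 * j) \<le> int (j\<^sup>2 + 1)"
      using zero_le_power2[of "int j - 1"] by (simp add: power2_eq_square algebra_simps)
    then show ?thesis by (simp only: of_nat_le_iff)
  qed
  have jj3: "5 * j \<le> 3 * j\<^sup>2 + 2"
  proof -
    have "int j * 5 \<le> 3 * (int j * int j) + 2"
    proof (cases "j = 1")
      case False
      then have "2 \<le> int j" using j_pos by simp
      then have "0 \<le> (3 * int j - 2) * (int j - 1)" by simp
      then show ?thesis by (simp add: algebra_simps)
    qed simp
    then have "int (5 * j) \<le> int (3 * j\<^sup>2 + 2)" by (simp add: power2_eq_square)
    then show ?thesis by (simp only: of_nat_le_iff)
  qed
  have mN: "m \<le> N" and jN: "2 * j \<le> N" using N(1) jj by linarith+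
  define s where "s = real ?q powr (- (real N / 2))"
  have s0: "s > 0" using q by (simp add: s_def)
  have s2: "s\<^sup>2 = 1 / real (?q ^ N)" unfolding s_def by (rule powr_neg_half_square[OF q])
  define A where "A = real (?q ^ (2 * m + 2 * j)) / real (?q ^ N)"
  define B where "B = real (?q ^ (m + 3 * j)) / real (?q ^ N)"
  \<comment> \<open>Bounds the share of dependent tuples, both among all tuples and among those
    fixed by \<open>h\<close>; the latter live in dimension N - m.\<close>
  define e where "e = real (?q ^ (m + j)) / real (?q ^ N)"
  \<comment> \<open>As 1/8 < (36/100)^2, three spare powers of q suffice. The condition 2(2m + 2j) +
    3 \<le> N is exactly what the second bound on \<open>N\<close> yields through 2j \<le> j^2 +
    1.\<close>
  have A: "A \<le> 36 / 100 * s"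
  proof (rule le_from_squares)
    show "A\<^sup>2 \<le> 1 / 2 ^ 3 * s\<^sup>2" unfolding A_def s2
      by (rule power_ratio_le[OF q]) (use N(2) jj2 in \<open>simp add: algebra_simps\<close>)
  qed (use s0 in \<open>auto simp: power2_eq_square\<close>)
  have B: "B \<le> 1 / 16 * s"
  proof (rule le_from_squares)
    show "B\<^sup>2 \<le> 1 / 2 ^ 8 * s\<^sup>2" unfolding B_def s2
      by (rule power_ratio_le[OF q]) (use N(1) jj3 in \<open>simp add: algebra_simps\<close>)
  qed (use s0 in \<open>auto simp: power2_eq_square\<close>)
  have e: "e \<le> 1 / 16 * s"
  proof (rule le_from_squares)
    show "e\<^sup>2 \<le> 1 / 2 ^ 8 * s\<^sup>2" unfolding e_def s2
      by (rule power_ratio_le[OF q]) (use N(1) jj3 in \<open>simp add: algebra_simps\<close>)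
  qed (use s0 in \<open>auto simp: power2_eq_square\<close>)
  have s16: "s \<le> 1 / 16 * 1"
  proof (rule le_from_squares)
    have "(2::real) ^ 8 \<le> real ?q ^ 8" using q by (intro power_mono) auto
    also have "\<dots> \<le> real ?q ^ N" using q N(1) by (intro power_increasing) auto
    finally show "s\<^sup>2 \<le> 1 / 2 ^ 8 * 1\<^sup>2" unfolding s2 by (simp add: field_simps)
  qed (auto simp: power2_eq_square)
  have nn: "A \<ge> 0" "B \<ge> 0" "e \<ge> 0" by (simp_all add: A_def B_def e_def)
  have AB: "2 * (A + B) \<le> 1" using A B s16 by argo
  define ind where "ind = {X \<in> VV. indep j X}"
  define fixd where "fixd = {X \<in> VV. indep j X \<and> act h X = X}"
  define Bad where "Bad = {X \<in> VV. indep j X \<and> act h X \<noteq> X}"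
  have fin: "finite ind" "finite fixd" "finite Bad" using finVV by (auto simp: ind_def fixd_def Bad_def)
  define P where "P = real (?q ^ (N * j))"
  have P0: "P > 0" using q by (simp add: P_def)
  have Pm: "P = real (?q ^ (m * j)) * real (?q ^ ((N - m) * j))"
  proof -
    have "m * j + (N - m) * j = N * j" using mN by (simp flip: add_mult_distrib)
    then show ?thesis unfolding P_def by (metis of_nat_mult power_add)
  qed
  have tv: "tups (vecs N) j = VV" by (simp add: tups_def tuples_alt)
  have n0: "real (card ind) \<le> P" "real (card ind) \<ge> P * (1 - e)"
  proof -
    show "real (card ind) \<le> P"
      unfolding P_def of_nat_le_iff card_tuples(2)[symmetric] ind_def by (rule card_mono[OF finVV]) auto
    have "card VV = card ind + card {X \<in> VV. \<not> indep j X}"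
      unfolding ind_def using finVV by (subst card_Un_disjoint[symmetric]) (auto intro!: arg_cong[of _ _ card])
    moreover have "card {X \<in> VV. \<not> indep j X} \<le> ?q ^ j * (?q ^ N) ^ (j - 1)"
      using card_dependent_tuples[where S = "vecs N :: (nat \<Rightarrow> 'a) set" and N = N and j = j, OF is_subspace_vecs subset_refl] unfolding tv card_vecs .
    ultimately have "?q ^ (N * j) \<le> card ind + ?q ^ j * (?q ^ N) ^ (j - 1)" by (simp add: card_tuples)
    then have "P \<le> real (card ind) + real (?q ^ j * (?q ^ N) ^ (j - 1))"
      unfolding P_def by (metis of_nat_add of_nat_le_iff)
    moreover have "real (?q ^ j * (?q ^ N) ^ (j - 1)) \<le> P * e"
    proof -
      have "N * (j - 1) + N = N * j" using j_pos by (cases j) simp_all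
      then have "(?q ^ N) ^ (j - 1) * ?q ^ N = ?q ^ (N * j)"
        by (simp only: power_mult[symmetric] power_add[symmetric])
      then have "real (?q ^ j * (?q ^ N) ^ (j - 1)) * real (?q ^ N) = real (?q ^ j) * P"
        unfolding P_def by (metis mult.assoc of_nat_mult)
      also have "\<dots> \<le> real (?q ^ (m + j)) * P"
        using q P0 by (intro mult_right_mono) (auto simp: power_add)
      finally show ?thesis unfolding e_def using q by (simp add: field_simps)
    qed
    ultimately show "real (card ind) \<ge> P * (1 - e)" by (simp add: algebra_simps)
  qed
  have n1: "real (?q ^ (m * j)) * real (card fixd) \<le> P" "real (?q ^ (m * j)) * real (card fixd) \<ge> P * (1 - e)"
  proof -
    define R where "R = real (?q ^ ((N - m) * j))"
    let ?F = "{v \<in> vecs N. mv h v = v}"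
    have cF: "card ?F = ?q ^ (N - m)" using fx by (simp add: fixn_def)
    have finF: "finite ?F" by (rule finite_subspace[of _ N]) auto
    have tF: "tups ?F j = {X \<in> VV. act h X = X}"
    proof (rule Set.set_eqI, rule iffI)
      fix X assume X: "X \<in> tups ?F j"
      have "act h X a = X a" for a using X by (cases "a < j") (auto simp: tups_def act_def zero_fun_def)
      then have "act h X = X" by (rule ext)
      then show "X \<in> {X \<in> VV. act h X = X}" using X by (auto simp: tups_def tuples_alt)
    next
      fix X assume X: "X \<in> {X \<in> VV. act h X = X}"
      then have "act h X a = X a" for a by simp
      then show "X \<in> tups ?F j" using X by (auto simp: tups_def tuples_alt act_def)
    qed
    have fd: "fixd = {X \<in> tups ?F j. indep j X}" unfolding tF fixd_def by auto
    have cT: "card (tups ?F j) = ?q ^ ((N - m) * j)" "finite (tups ?F j)"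
      unfolding tups_def using card_PiE_vecs_like[OF finF, of j] cF by (simp_all add: power_mult)
    have "card fixd \<le> ?q ^ ((N - m) * j)" unfolding fd cT(1)[symmetric] by (rule card_mono[OF cT(2)]) auto
    then have up: "real (card fixd) \<le> R" unfolding R_def by (simp only: of_nat_le_iff)
    then show "real (?q ^ (m * j)) * real (card fixd) \<le> P" unfolding Pm R_def[symmetric]
      by (intro mult_left_mono) auto
    have "card (tups ?F j) = card fixd + card {X \<in> tups ?F j. \<not> indep j X}"
      unfolding fd using cT(2) by (subst card_Un_disjoint[symmetric]) (auto intro!: arg_cong[of _ _ card])
    moreover have "card {X \<in> tups ?F j. \<not> indep j X} \<le> ?q ^ j * (?q ^ (N - m)) ^ (j - 1)"
      using card_dependent_tuples[where S = ?F and N = N and j = j, OF is_subspace_fix[of h]] unfolding cF by blast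
    ultimately have "?q ^ ((N - m) * j) \<le> card fixd + ?q ^ j * (?q ^ (N - m)) ^ (j - 1)" using cT(1) by simp
    then have "R \<le> real (card fixd) + real (?q ^ j * (?q ^ (N - m)) ^ (j - 1))"
      unfolding R_def by (metis of_nat_add of_nat_le_iff)
    moreover have "real (?q ^ j * (?q ^ (N - m)) ^ (j - 1)) = R * e"
    proof -
      have "?q ^ j * (?q ^ (N - m)) ^ (j - 1) * ?q ^ N = ?q ^ ((N - m) * j) * ?q ^ (m + j)"
      proof -
        have "j + (N - m) * (j - 1) + N = (N - m) * j + (m + j)"
        proof -
          obtain n where "N = m + n" using mN le_Suc_ex by blast
          then show ?thesis using j_pos by (cases j) (simp_all add: algebra_simps)
        qed
        then show ?thesis by (simp only: power_add[symmetric] power_mult[symmetric])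
      qed
      then have "real (?q ^ j * (?q ^ (N - m)) ^ (j - 1)) * real (?q ^ N) = R * real (?q ^ (m + j))"
        unfolding R_def by (metis of_nat_mult)
      then show ?thesis unfolding e_def using q by (simp add: field_simps)
    qed
    ultimately have "R * (1 - e) \<le> real (card fixd)" by (simp add: algebra_simps)
    then have "real (?q ^ (m * j)) * (R * (1 - e)) \<le> real (?q ^ (m * j)) * real (card fixd)"
      by (rule mult_left_mono) simp
    then show "real (?q ^ (m * j)) * real (card fixd) \<ge> P * (1 - e)"
      unfolding Pm R_def[symmetric] by (simp add: mult.assoc)
  qed
  define Err where "Err = (\<Sum>X\<in>Bad. KK X (act h X))"
  have Err: "cmod Err \<le> cc * real (?q ^ ((N - m) * j)) * (2 * (A + B))"
    using nonfixed_sum[OF jN h fx mN AB[unfolded A_def B_def]] norm_sum[of "\<lambda>X. KK X (act h X)" Bad]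
    unfolding Err_def Bad_def A_def B_def by linarith
  have T1: "(\<Sum>X\<in>VV. KK X X) = of_real (cc * real (card ind))"
  proof -
    have "(\<Sum>X\<in>VV. KK X X) = (\<Sum>X\<in>ind. KK X X)"
      unfolding ind_def using KK_dependent finVV by (intro sum.mono_neutral_right) auto
    also have "\<dots> = (\<Sum>X\<in>ind. of_real cc)" unfolding ind_def using KK_diag_cc by (intro sum.cong) auto
    finally show ?thesis by (simp add: mult.commute)
  qed
  have T2: "(\<Sum>X\<in>VV. KK X (act h X)) = of_real (cc * real (card fixd)) + Err"
  proof -
    have "(\<Sum>X\<in>VV. KK X (act h X)) = (\<Sum>X\<in>fixd \<union> Bad. KK X (act h X))"
      unfolding fixd_def Bad_def using indep_act[OF h] finVV by (intro sum.mono_neutral_right) auto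
    also have "\<dots> = (\<Sum>X\<in>fixd. KK X (act h X)) + Err"
      unfolding Err_def using fin by (intro sum.union_disjoint) (auto simp: fixd_def Bad_def)
    also have "(\<Sum>X\<in>fixd. KK X (act h X)) = (\<Sum>X\<in>fixd. of_real cc)"
      unfolding fixd_def using KK_diag_cc by (intro sum.cong) auto
    finally show ?thesis by (simp add: mult.commute)
  qed
  define x where "x = of_nat (?q ^ (m * j)) * (\<chi> h / \<chi> (1\<^sub>m N))"
  have n0pos: "real (card ind) > 0" 
  proof -
    have "P * (1 - e) > 0" using P0 e s16 by (intro mult_pos_pos) auto
    then show ?thesis using n0(2) by linarith
  qed
  have ccn: "cc * real (card ind) > 0" using cc_pos n0pos by simp
  define D where "D = real (?q ^ (m * j)) * real (card fixd) - real (card ind)"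
  have "x * of_real (cc * real (card ind)) = of_nat (?q ^ (m * j)) * (of_real (cc * real (card fixd)) + Err)"
    using KK_trace[OF h] unfolding T1 T2 x_def by simp
  then have "(x - 1) * of_real (cc * real (card ind)) = of_real (cc * D) + of_nat (?q ^ (m * j)) * Err"
    unfolding D_def by (simp add: algebra_simps)
  then have "cmod (x - 1) * (cc * real (card ind)) = cmod (of_real (cc * D) + of_nat (?q ^ (m * j)) * Err)"
    using ccn by (metis abs_of_pos norm_mult norm_of_real)
  also have "\<dots> \<le> cc * \<bar>D\<bar> + real (?q ^ (m * j)) * cmod Err"
  proof -
    have "cmod (of_real (cc * D)) = cc * \<bar>D\<bar>" unfolding norm_of_real using cc_nonneg by (simp add: abs_mult)
    moreover have "cmod (of_nat (?q ^ (m * j)) * Err) = real (?q ^ (m * j)) * cmod Err"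
      by (simp only: norm_mult norm_of_nat)
    ultimately show ?thesis by (metis norm_triangle_ineq)
  qed
  also have "\<dots> \<le> cc * (P * e) + cc * P * (2 * (A + B))"
  proof (rule add_mono)
    have "\<bar>D\<bar> \<le> P * e" unfolding D_def using n0 n1 by (simp add: abs_le_iff algebra_simps)
    then show "cc * \<bar>D\<bar> \<le> cc * (P * e)" using cc_nonneg by (rule mult_left_mono)
    show "real (?q ^ (m * j)) * cmod Err \<le> cc * P * (2 * (A + B))"
      using mult_left_mono[OF Err, of "real (?q ^ (m * j))"] unfolding Pm by (simp only: mult_ac of_nat_0_le_iff)
  qed
  finally have "cmod (x - 1) * (cc * real (card ind)) \<le> cc * (P * (e + 2 * (A + B)))" by (simp add: algebra_simps)
  moreover have "cmod (x - 1) * (cc * (P * (1 - e))) \<le> cmod (x - 1) * (cc * real (card ind))"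
    using n0(2) cc_nonneg by (intro mult_left_mono) auto
  ultimately have "cmod (x - 1) * (cc * (P * (1 - e))) \<le> cc * (P * (e + 2 * (A + B)))" by linarith
  then have "(cc * P) * (cmod (x - 1) * (1 - e)) \<le> (cc * P) * (e + 2 * (A + B))" by (simp add: algebra_simps)
  then have "cmod (x - 1) * (1 - e) \<le> e + 2 * (A + B)" using cc_pos P0 by (simp only: mult_le_cancel_left_pos mult_pos_pos)
  moreover have "e + 2 * (A + B) \<le> 91 / 100 * s" using A B e s0 by argo
  moreover have "cmod (x - 1) * (99 / 100) \<le> cmod (x - 1) * (1 - e)" using e s16 by (intro mult_left_mono) auto
  ultimately have "cmod (x - 1) < s" using s0 by linarith
  then show ?thesis unfolding x_def s_def .
qed

end

section \<open>Finite unitary groups\<close>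

definition herm :: "nat \<Rightarrow> nat \<Rightarrow> (nat \<Rightarrow> 'a::field) \<Rightarrow> (nat \<Rightarrow> 'a) \<Rightarrow> 'a" where
  "herm q N u v = (\<Sum>i<N. u i * (v i) ^ q)"

locale unitary_field =
  fixes q :: nat and field_type :: "'a::{field,finite} itself"
  assumes primepow_q: "primepow q" and card_field: "CARD('a) = q\<^sup>2"
begin

lemma q_gt_1: "q > 1"
  using primepow_gt_Suc_0[OF primepow_q] by simp

lemma q_CHAR: obtains e where "e > 0" "q = CHAR('a) ^ e" "CARD('a) = CHAR('a) ^ (2 * e)"
proof -
  obtain p e where pe: "prime p" "e > 0" "q = p ^ e"
    using primepow_q by (auto simp: primepow_def)
  have c: "CARD('a) = p ^ (2 * e)" using card_field pe by (simp add: power_mult power2_eq_square mult_2 power_add)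
  then have "CHAR('a) = p" using CHAR_eq_of_card pe(1) by blast
  then show ?thesis using that pe(2,3) c by simp
qed

lemma frob_add: "(x + y) ^ q = x ^ q + (y::'a) ^ q"
  by (rule q_CHAR) (rule frobenius_add[OF prime_CHAR_finite])

lemma frob_frob [simp]: "((x::'a) ^ q) ^ q = x"
  using finite_field_pow_card[of x] by (simp add: card_field power_mult[symmetric] power2_eq_square)

lemma frob_0 [simp]: "(0::'a) ^ q = 0"
  using q_gt_1 by simp

lemma frob_minus: "(- x :: 'a) ^ q = - (x ^ q)"
proof -
  have "(- x) ^ q + x ^ q = (- x + x) ^ q" by (rule frob_add[symmetric])
  also have "\<dots> = 0" by simp
  finally show ?thesis by (simp add: add_eq_0_iff)
qed

lemma frob_diff: "(x - y :: 'a) ^ q = x ^ q - y ^ q"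
  using frob_add[of x "- y"] by (simp add: frob_minus)

lemma frob_sum: "(sum f S :: 'a) ^ q = (\<Sum>x\<in>S. f x ^ q)"
  by (induction S rule: infinite_finite_induct) (auto simp: frob_add)

lemma frob_eq_0_iff [simp]: "(x::'a) ^ q = 0 \<longleftrightarrow> x = 0"
  using q_gt_1 by simp

lemma exists_non_fixed: "\<exists>\<gamma>::'a. \<gamma> ^ q \<noteq> \<gamma>"
proof (rule ccontr)
  assume "\<not> ?thesis"
  then have all: "x ^ q = x" for x :: 'a by simp
  have "card {x::'a. x ^ q = x} \<le> q" by (rule power_fixed_points(2)[OF q_gt_1])
  then have "q\<^sup>2 \<le> q" using all card_field by simp
  then show False using q_gt_1 by (simp add: power2_eq_square)
qed

text \<open>For \<gamma> not fixed by Frobenius, \<delta> = \<gamma> - \<gamma>^q is skew and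
  \<gamma>/\<delta> has trace one; this works in every characteristic.\<close>

lemma trace_one: "\<exists>\<theta>::'a. \<theta> + \<theta> ^ q = 1"
proof -
  obtain \<gamma> :: 'a where \<gamma>: "\<gamma> ^ q \<noteq> \<gamma>" using exists_non_fixed by blast
  define \<delta> where "\<delta> = \<gamma> - \<gamma> ^ q"
  have d0: "\<delta> \<noteq> 0" using \<gamma> by (simp add: \<delta>_def)
  have ds: "\<delta> ^ q = - \<delta>" by (simp add: \<delta>_def frob_diff)
  have "\<gamma> / \<delta> + (\<gamma> / \<delta>) ^ q = (\<gamma> - \<gamma> ^ q) / \<delta>"
    by (simp add: power_divide ds diff_divide_distrib)
  then show ?thesis using d0 by (intro exI[of _ "\<gamma> / \<delta>"]) (simp add: \<delta>_def)
qed

lemma skew_nonzero: "\<exists>\<delta>::'a. \<delta> \<noteq> 0 \<and> \<delta> ^ q = - \<delta>"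
proof -
  obtain \<gamma> :: 'a where \<gamma>: "\<gamma> ^ q \<noteq> \<gamma>" using exists_non_fixed by blast
  then show ?thesis by (intro exI[of _ "\<gamma> - \<gamma> ^ q"]) (simp add: frob_diff)
qed

abbreviation h where "h N \<equiv> herm q N :: (nat \<Rightarrow> 'a) \<Rightarrow> (nat \<Rightarrow> 'a) \<Rightarrow> 'a"

lemma h_add: "h N (u + v) w = h N u w + h N v w" "h N w (u + v) = h N w u + h N w v"
  by (simp_all add: herm_def frob_add sum.distrib algebra_simps)
lemma h_diff: "h N (u - v) w = h N u w - h N v w" "h N w (u - v) = h N w u - h N w v"
  by (simp_all add: herm_def frob_diff sum_subtractf algebra_simps)
lemma h_smul: "h N (smul c u) w = c * h N u w" "h N w (smul c u) = c ^ q * h N w u"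
  by (simp_all add: herm_def smul_def sum_distrib_left power_mult_distrib mult_ac)
lemma h_0 [simp]: "h N 0 w = 0" "h N w 0 = 0"
  by (simp_all add: herm_def)
lemma h_sym: "h N v u = (h N u v) ^ q"
  by (simp add: herm_def frob_sum power_mult_distrib mult.commute)
lemma h_self: "(h N u u) ^ q = h N u u"
  using h_sym[of N u u] by simp

lemma h_dot: "h N u (\<lambda>i. f i ^ q) = dot N u f"
  by (simp add: herm_def dot_def)

lemma frob_vecs: "f \<in> vecs N \<Longrightarrow> (\<lambda>i. (f i :: 'a) ^ q) \<in> vecs N"
  by (simp add: vecs_def)

lemma h_nondeg:
  assumes "u \<in> vecs N" "\<And>v. v \<in> vecs N \<Longrightarrow> h N u v = 0"
  shows "u = 0"
proof (rule vecs_eqI[OF assms(1)])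
  fix i assume i: "i < N"
  have "h N u (\<lambda>k. if k = i then 1 else 0) = 0" using i by (intro assms(2)) (auto simp: vecs_def)
  moreover have "h N u (\<lambda>k. if k = i then 1 else 0) = u i"
    using i by (simp add: herm_def if_distrib[of "\<lambda>x. x ^ q"] mult_delta_right cong: if_cong)
  ultimately show "u i = 0 i" by simp
qed simp

lemma carrier_GU:
  "g \<in> carrier (GU_mat q N) \<longleftrightarrow> g \<in> carrier (GL_mat N) \<and> transpose_mat g * map_mat (\<lambda>x. (x::'a) ^ q) g = 1\<^sub>m N"
  by (simp add: GU_mat_def)

lemma GU_simps: "A \<otimes>\<^bsub>GU_mat q N\<^esub> B = A * B" "\<one>\<^bsub>GU_mat q N\<^esub> = (1\<^sub>m N :: 'a mat)"
  by (simp_all add: GU_mat_def GL_mat_def)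

lemma gram_index:
  fixes g :: "'a mat"
  assumes "g \<in> carrier_mat N N" "i < N" "k < N"
  shows "(transpose_mat g * map_mat (\<lambda>x. x ^ q) g) $$ (i, k) = (\<Sum>l<N. g $$ (l, i) * (g $$ (l, k)) ^ q)"
  using assms by (simp add: scalar_prod_def atLeast0LessThan)

lemma GU_preserves:
  assumes g: "g \<in> carrier (GU_mat q N)"
  shows "h N (mv g u) (mv g v) = h N u v"
proof -
  have gc: "g \<in> carrier_mat N N" and eq: "transpose_mat g * map_mat (\<lambda>x. (x::'a) ^ q) g = 1\<^sub>m N"
    using g by (auto simp: carrier_GU carrier_GL_mat)
  have e: "(\<Sum>l<N. g $$ (l, i) * (g $$ (l, k)) ^ q) = (if i = k then 1 else 0)" if "i < N" "k < N" for i k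
    using gram_index[OF gc that] that unfolding eq by simp
  have "h N (mv g u) (mv g v) = (\<Sum>l<N. (\<Sum>i<N. g $$ (l, i) * u i) * (\<Sum>k<N. (g $$ (l, k)) ^ q * v k ^ q))"
    using gc by (simp add: herm_def mv_def frob_sum power_mult_distrib)
  also have "\<dots> = (\<Sum>l<N. \<Sum>i<N. \<Sum>k<N. (u i * v k ^ q) * (g $$ (l, i) * (g $$ (l, k)) ^ q))"
    by (simp add: sum_product mult_ac)
  also have "\<dots> = (\<Sum>i<N. \<Sum>k<N. \<Sum>l<N. (u i * v k ^ q) * (g $$ (l, i) * (g $$ (l, k)) ^ q))"
    by (rule sum_swap3)
  also have "\<dots> = (\<Sum>i<N. \<Sum>k<N. (u i * v k ^ q) * (if i = k then 1 else 0))"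
    by (intro sum.cong refl) (simp add: e flip: sum_distrib_left)
  also have "\<dots> = h N u v" by (simp add: herm_def mult_delta_right)
  finally show ?thesis .
qed

lemma GU_I:
  assumes gc: "g \<in> carrier_mat N N"
    and pres: "\<And>u v. u \<in> vecs N \<Longrightarrow> v \<in> vecs N \<Longrightarrow> h N (mv g u) (mv g v) = h N u v"
  shows "g \<in> carrier (GU_mat q N)"
proof -
  have GL: "g \<in> carrier (GL_mat N)"
  proof (rule GL_matI[OF gc])
    fix x assume x: "x \<in> vecs N" "mv g x = 0"
    show "x = 0" by (rule h_nondeg[OF x(1)]) (use pres[OF x(1)] x(2) in \<open>metis h_0(1)\<close>)
  qed
  define e where "e i = (\<lambda>k. if k = i then 1 else (0::'a))" for i :: nat
  have ge: "mv g (e i) l = (if l < N then g $$ (l, i) else 0)" if "i < N" for i l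
    using gc that by (simp add: mv_def e_def mult_delta_right)
  have "transpose_mat g * map_mat (\<lambda>x. x ^ q) g = 1\<^sub>m N"
  proof (rule eq_matI)
    fix i k assume "i < dim_row (1\<^sub>m N :: 'a mat)" "k < dim_col (1\<^sub>m N :: 'a mat)"
    then have ik: "i < N" "k < N" by auto
    have "(transpose_mat g * map_mat (\<lambda>x. x ^ q) g) $$ (i, k) = h N (mv g (e i)) (mv g (e k))"
      unfolding gram_index[OF gc ik] herm_def using ge[OF ik(1)] ge[OF ik(2)] by simp
    also have "\<dots> = h N (e i) (e k)" using ik by (intro pres) (auto simp: e_def vecs_def)
    also have "\<dots> = 1\<^sub>m N $$ (i, k)"
      using ik by (simp add: herm_def e_def if_distrib[of "\<lambda>x. x ^ q"] mult_delta_left cong: if_cong)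
    finally show "(transpose_mat g * map_mat (\<lambda>x. x ^ q) g) $$ (i, k) = 1\<^sub>m N $$ (i, k)" .
  qed (use gc in auto)
  then show ?thesis using GL by (simp add: carrier_GU)
qed

lemma GU_mult:
  assumes "g \<in> carrier (GU_mat q N)" "k \<in> carrier (GU_mat q N)"
  shows "g * k \<in> carrier (GU_mat q N :: 'a mat monoid)"
proof (rule GU_I)
  have c: "g \<in> carrier_mat N N" "k \<in> carrier_mat N N" using assms by (auto simp: carrier_GU carrier_GL_mat)
  then show "g * k \<in> carrier_mat N N" by simp
  fix u v
  show "h N (mv (g * k) u) (mv (g * k) v) = h N u v"
    using c assms by (simp add: mv_mult[of g N N k N] GU_preserves)
qed

lemma GU_one: "1\<^sub>m N \<in> carrier (GU_mat q N :: 'a mat monoid)"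
  by (rule GU_I) (simp_all add: mv_one)

lemma group_GU: "group (GU_mat q N :: 'a mat monoid)"
proof (rule groupI)
  fix x y z :: "'a mat" assume "x \<in> carrier (GU_mat q N)"
  then have x: "x \<in> carrier (GU_mat q N)" "x \<in> carrier (GL_mat N)" "x \<in> carrier_mat N N"
    by (auto simp: carrier_GU carrier_GL_mat)
  then show "\<one>\<^bsub>GU_mat q N\<^esub> \<otimes>\<^bsub>GU_mat q N\<^esub> x = x" by (simp add: GU_simps)
  obtain B where B: "B \<in> carrier (GL_mat N)" "x * B = 1\<^sub>m N" "B * x = 1\<^sub>m N"
    using GL_mat_inverse[OF x(2)] by blast
  have Bc: "B \<in> carrier_mat N N" using B(1) by (simp add: carrier_GL_mat)
  have "B \<in> carrier (GU_mat q N)"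
  proof (rule GU_I[OF Bc])
    fix u v :: "nat \<Rightarrow> 'a" assume uv: "u \<in> vecs N" "v \<in> vecs N"
    have "mv x (mv B w) = w" if "w \<in> vecs N" for w
      using that mv_mult[OF x(3) Bc, of w] B(2) by (simp add: mv_one)
    then show "h N (mv B u) (mv B v) = h N u v"
      using GU_preserves[OF x(1), of "mv B u" "mv B v"] uv by simp
  qed
  then show "\<exists>y\<in>carrier (GU_mat q N). y \<otimes>\<^bsub>GU_mat q N\<^esub> x = \<one>\<^bsub>GU_mat q N\<^esub>"
    using B(3) by (intro bexI[of _ B]) (simp add: GU_simps)
next
  fix x y z :: "'a mat"
  assume "x \<in> carrier (GU_mat q N)" "y \<in> carrier (GU_mat q N)" "z \<in> carrier (GU_mat q N)"
  then show "x \<otimes>\<^bsub>GU_mat q N\<^esub> y \<otimes>\<^bsub>GU_mat q N\<^esub> z = x \<otimes>\<^bsub>GU_mat q N\<^esub> (y \<otimes>\<^bsub>GU_mat q N\<^esub> z)"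
    by (simp add: GU_simps carrier_GU carrier_GL_mat assoc_mult_mat[of x N N y N z N])
qed (simp_all add: GU_simps GU_mult GU_one)

text \<open>The reflection along \<open>w\<close>; it is unitary exactly because \<open>c + c\<^sup>q = h(w, w)\<close>.\<close>

lemma reflection:
  assumes w: "w \<in> vecs N" and c: "c \<noteq> 0" "c + c ^ q = h N w w"
  obtains g where "g \<in> carrier (GU_mat q N)" "\<And>x. x \<in> vecs N \<Longrightarrow> mv g x = x - smul (h N x w / c) w"
proof -
  define g where "g = mat N N (\<lambda>(i, k). (if i = k then 1 else 0) - inverse c * w i * (w k) ^ q)"
  have gc: "g \<in> carrier_mat N N" by (simp add: g_def)
  have mvg: "mv g x = x - smul (h N x w / c) w" if x: "x \<in> vecs N" for x
  proof (rule vecs_eqI)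
    show "mv g x \<in> vecs N" using gc by blast
    show "x - smul (h N x w / c) w \<in> vecs N" using x w by (intro vecs_diff vecs_smul)
    fix i assume i: "i < N"
    have "mv g x i = (\<Sum>k<N. (if i = k then x k else 0) - inverse c * w i * (x k * (w k) ^ q))"
      using i by (auto simp: mv_def g_def algebra_simps intro!: sum.cong)
    also have "\<dots> = x i - inverse c * w i * h N x w"
      using i by (simp add: sum_subtractf herm_def sum_distrib_left)
    finally show "mv g x i = (x - smul (h N x w / c) w) i" by (simp add: smul_def field_simps)
  qed
  have "g \<in> carrier (GU_mat q N)"
  proof (rule GU_I[OF gc])
    fix u v :: "nat \<Rightarrow> 'a" assume uv: "u \<in> vecs N" "v \<in> vecs N"
    have vw: "(h N v w) ^ q = h N w v" by (rule h_sym[symmetric])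
    have cq: "c ^ q \<noteq> 0" using c(1) by simp
    have "h N (mv g u) (mv g v) = h N u v - (h N v w / c) ^ q * h N u w - h N u w / c * h N w v
        + h N u w / c * ((h N v w / c) ^ q * h N w w)"
      using uv by (simp add: mvg h_diff h_smul algebra_simps)
    also have "\<dots> = h N u v + h N u w * h N w v / (c * c ^ q) * (h N w w - (c + c ^ q))"
      using c(1) cq by (simp add: power_divide vw field_simps)
    finally show "h N (mv g u) (mv g v) = h N u v" using c(2) by simp
  qed
  then show ?thesis using that mvg by blast
qed

text \<open>Division by t t^q turns the equation into z + z^q = -n for z = a / t^q. A nonzero
  solution z is -n \<theta> with \<theta> of trace one, or a skew element if n = 0.\<close>

lemma norm_trace_solution:
  fixes a n :: 'a
  assumes "a \<noteq> 0" "n ^ q = n"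
  obtains t where "t \<noteq> 0" "t * t ^ q * n + t * a + (t * a) ^ q = 0"
proof -
  obtain \<theta> :: 'a where \<theta>: "\<theta> + \<theta> ^ q = 1" using trace_one by blast
  obtain \<delta> :: 'a where \<delta>: "\<delta> \<noteq> 0" "\<delta> ^ q = - \<delta>" using skew_nonzero by blast
  have "\<exists>z. z \<noteq> 0 \<and> z + z ^ q = - n"
  proof (cases "n = 0")
    case True
    then show ?thesis using \<delta> by (intro exI[of _ \<delta>]) simp
  next
    case False
    have "\<theta> \<noteq> 0" using \<theta> by auto
    moreover have "- n * \<theta> + (- n * \<theta>) ^ q = - n * (\<theta> + \<theta> ^ q)"
      using assms(2) by (simp add: power_mult_distrib frob_minus algebra_simps)
    ultimately show ?thesis using False \<theta> by (intro exI[of _ "- n * \<theta>"]) simp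
  qed
  then obtain z where z: "z \<noteq> 0" "z + z ^ q = - n" by blast
  define t where "t = a ^ q / z ^ q"
  have t: "t ^ q = a / z" by (simp add: t_def power_divide)
  have aq: "a ^ q \<noteq> 0" "z ^ q \<noteq> 0" using assms z by simp_all
  have "t * t ^ q * n + t * a + (t * a) ^ q = (a * a ^ q) / (z * z ^ q) * (n + (z + z ^ q))"
    unfolding power_mult_distrib t using aq z(1) by (simp add: t_def field_simps)
  then have "t * t ^ q * n + t * a + (t * a) ^ q = 0" using z(2) by simp
  moreover have "t \<noteq> 0" using aq by (simp add: t_def)
  ultimately show ?thesis using that by blast
qed

end

section \<open>Witt's theorem and lower bounds for orbits\<close>

context unitary_field
begin

abbreviation perp :: "nat \<Rightarrow> nat \<Rightarrow> (nat \<Rightarrow> nat \<Rightarrow> 'a) \<Rightarrow> (nat \<Rightarrow> 'a) set" where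
  "perp N n y \<equiv> {w \<in> vecs N. \<forall>a<n. h N w (y a) = 0}"

lemma h_minus: "h N (- u) w = - h N u w" "h N w (- u) = - h N w u"
  by (simp_all add: herm_def frob_minus sum_negf)

lemma is_subspace_perp: "is_subspace (perp N n y)"
  by (auto simp: is_subspace_def h_add h_smul)

lemma perp_detects:
  assumes "u \<in> vecs N" "\<And>a. a < n \<Longrightarrow> y a \<in> vecs N" "\<nexists>b. u = lc n y b"
  shows "\<exists>w\<in>perp N n y. h N w u \<noteq> 0"
proof -
  obtain f where f: "f \<in> vecs N" "\<And>a. a < n \<Longrightarrow> dot N (y a) f = 0" "dot N u f \<noteq> 0"
    using not_in_span_functional[of u N n y] assms by blast
  let ?w = "\<lambda>i. f i ^ q"
  have "h N ?w x = (dot N x f) ^ q" for x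
    using h_sym[of N ?w x] by (simp add: h_dot)
  then show ?thesis using f frob_vecs[OF f(1)] by (intro bexI[of _ ?w]) auto
qed

text \<open>Expanding the norm of u + t w0 gives the equation solved in
  \<open>norm_trace_solution\<close>.\<close>

lemma isotropic_move:
  assumes "h N w0 u \<noteq> 0"
  obtains t where "t \<noteq> 0" "h N (u + smul t w0) (u + smul t w0) = h N u u"
proof -
  obtain t where t: "t \<noteq> 0" "t * t ^ q * h N w0 w0 + t * h N w0 u + (t * h N w0 u) ^ q = 0"
    using norm_trace_solution[OF assms h_self] by blast
  have "h N u w0 = (h N w0 u) ^ q" by (rule h_sym)
  then have "h N (u + smul t w0) (u + smul t w0) = h N u u + (t * t ^ q * h N w0 w0 + t * h N w0 u + (t * h N w0 u) ^ q)"
    by (simp add: h_add h_smul power_mult_distrib algebra_simps)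
  then show ?thesis using that t by simp
qed

text \<open>For c = h(u, u - v), equality of the norms gives c + c^q = h(u - v, u - v), so the
  reflection along u - v with parameter c is unitary; it sends u to v.\<close>

lemma reflection_move:
  assumes uv: "u \<in> vecs N" "v \<in> vecs N" and eq: "h N u u = h N v v" and ne: "h N u u \<noteq> h N u v"
    and y: "\<And>a. a < n \<Longrightarrow> y a \<in> vecs N" "\<And>a. a < n \<Longrightarrow> h N (u - v) (y a) = 0"
  obtains g where "g \<in> carrier (GU_mat q N)" "\<And>a. a < n \<Longrightarrow> mv g (y a) = y a" "mv g u = v"
proof -
  have w: "u - v \<in> vecs N" using uv by blast
  have c: "h N u (u - v) \<noteq> 0" using ne by (simp add: h_diff)
  have "(h N u (u - v)) ^ q = h N (u - v) u" by (rule h_sym[symmetric])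
  then have "h N u (u - v) + (h N u (u - v)) ^ q = h N (u - v) (u - v)"
    using eq by (simp add: h_diff)
  then obtain g where g: "g \<in> carrier (GU_mat q N)"
    "\<And>x. x \<in> vecs N \<Longrightarrow> mv g x = x - smul (h N x (u - v) / h N u (u - v)) (u - v)"
    using reflection[OF w c] by blast
  have "mv g (y a) = y a" if "a < n" for a
  proof -
    have "h N (y a) (u - v) = 0" using h_sym[of N "y a" "u - v"] y(2)[OF that] by simp
    then show ?thesis using g(2)[OF y(1)[OF that]] by simp
  qed
  moreover have "mv g u = v" using g(2)[OF uv(1)] c by simp
  ultimately show ?thesis using that g(1) by blast
qed

text \<open>The reflection along u - v breaks down if h(u,u) = h(u,v). In that case pass through x =
  u + t w0 of the same norm, with w0 orthogonal to all y a but neither to u nor to v; both pairs u,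
  x and x, v are then related by a reflection.\<close>

lemma GU_step:
  assumes y: "\<And>a. a < n \<Longrightarrow> y a \<in> vecs N" and uv: "u \<in> vecs N" "v \<in> vecs N"
    and u: "\<nexists>b. u = lc n y b" and v: "\<nexists>b. v = lc n y b"
    and hy: "\<And>a. a < n \<Longrightarrow> h N u (y a) = h N v (y a)" and huv: "h N u u = h N v v"
  shows "\<exists>g\<in>carrier (GU_mat q N). (\<forall>a<n. mv g (y a) = y a) \<and> mv g u = v"
proof (cases "h N u u = h N u v")
  case False
  show ?thesis
    by (rule reflection_move[OF uv huv False y]) (use hy in \<open>auto simp: h_diff\<close>)
next
  case True
  obtain w1 where w1: "w1 \<in> perp N n y" "h N w1 u \<noteq> 0" using perp_detects[OF uv(1) y u] by blast
  obtain w2 where w2: "w2 \<in> perp N n y" "h N w2 v \<noteq> 0" using perp_detects[OF uv(2) y v] by blast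
  obtain w0 where w0: "w0 \<in> perp N n y" "h N w0 u \<noteq> 0" "h N w0 v \<noteq> 0"
  proof (rule two_functionals[of "perp N n y" "\<lambda>w. h N w u" "\<lambda>w. h N w v" w1 w2])
    show "w \<in> perp N n y \<Longrightarrow> w' \<in> perp N n y \<Longrightarrow> w + w' \<in> perp N n y" for w w'
      using is_subspaceD(2)[OF is_subspace_perp] by blast
  qed (use w1 w2 in \<open>simp_all add: h_add\<close>)
  obtain t where t: "t \<noteq> 0" "h N (u + smul t w0) (u + smul t w0) = h N u u"
    by (rule isotropic_move[OF w0(2)])
  define x where "x = u + smul t w0"
  have w0v: "w0 \<in> vecs N" "\<And>a. a < n \<Longrightarrow> h N w0 (y a) = 0" using w0(1) by auto
  have xv: "x \<in> vecs N" unfolding x_def using uv(1) w0v(1) by (intro vecs_add vecs_smul)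
  have uw: "h N u w0 \<noteq> 0" using h_sym[of N u w0] w0(2) by simp
  have "h N u u \<noteq> h N u x" using t(1) uw by (simp add: x_def h_add h_smul)
  then obtain g1 where g1: "g1 \<in> carrier (GU_mat q N)" "\<And>a. a < n \<Longrightarrow> mv g1 (y a) = y a" "mv g1 u = x"
    by (rule reflection_move[OF uv(1) xv t(2)[folded x_def, symmetric], of n y])
      (use y w0v in \<open>auto simp: x_def h_add h_diff h_smul h_minus\<close>)
  have nexv: "h N x x \<noteq> h N x v"
  proof -
    have "h N x v = h N u v + t * h N w0 v" by (simp add: x_def h_add h_smul)
    then show ?thesis using t w0(3) True unfolding x_def[symmetric] by simp
  qed
  have hxv: "h N x x = h N v v" using t(2) huv by (simp add: x_def)
  obtain g2 where g2: "g2 \<in> carrier (GU_mat q N)" "\<And>a. a < n \<Longrightarrow> mv g2 (y a) = y a" "mv g2 x = v"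
    by (rule reflection_move[OF xv uv(2) hxv nexv, of n y])
      (use y w0v hy in \<open>auto simp: x_def h_add h_diff h_smul h_minus\<close>)
  have c: "g1 \<in> carrier_mat N N" "g2 \<in> carrier_mat N N"
    using g1(1) g2(1) by (auto simp: carrier_GU carrier_GL_mat)
  show ?thesis
    using GU_mult[OF g2(1) g1(1)] g1 g2 by (intro bexI[of _ "g2 * g1"]) (simp_all add: mv_mult[OF c(2) c(1)])
qed

lemma witt:
  assumes XY: "\<And>a. a < k \<Longrightarrow> X a \<in> vecs N" "\<And>a. a < k \<Longrightarrow> Y a \<in> vecs N"
    and ker: "\<And>b. lc k X b = 0 \<longleftrightarrow> lc k Y b = 0"
    and gram: "\<And>a b. a < k \<Longrightarrow> b < k \<Longrightarrow> h N (X a) (X b) = h N (Y a) (Y b)"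
  shows "\<exists>g\<in>carrier (GU_mat q N). \<forall>a<k. mv g (X a) = Y a"
proof (rule columnwise_transitive[OF XY ker])
  show "carrier (GU_mat q N) \<subseteq> carrier (GL_mat N :: 'a mat monoid)" by (auto simp: carrier_GU)
  fix n g assume *: "n < k" "g \<in> carrier (GU_mat q N)" "\<And>a. a < n \<Longrightarrow> mv g (X a) = Y a"
    "\<nexists>b. mv g (X n) = lc n Y b" "\<nexists>b. Y n = lc n Y b"
  show "\<exists>g'\<in>carrier (GU_mat q N). (\<forall>a<n. mv g' (Y a) = Y a) \<and> mv g' (mv g (X n)) = Y n"
  proof (rule GU_step)
    show "Y a \<in> vecs N" if "a < n" for a using XY(2) that *(1) by simp
    show "mv g (X n) \<in> vecs N" using *(2) by (auto simp: carrier_GU carrier_GL_mat)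
    show "Y n \<in> vecs N" using XY(2) *(1) by simp
    show "h N (mv g (X n)) (Y a) = h N (Y n) (Y a)" if "a < n" for a
    proof -
      have "h N (mv g (X n)) (Y a) = h N (mv g (X n)) (mv g (X a))" using *(3)[OF that] by simp
      also have "\<dots> = h N (X n) (X a)" by (rule GU_preserves[OF *(2)])
      finally show ?thesis using gram *(1) that by simp
    qed
    show "h N (mv g (X n)) (mv g (X n)) = h N (Y n) (Y n)"
      using GU_preserves[OF *(2)] gram *(1) by simp
  qed (use * in blast)+
qed (auto simp: GU_mult GU_one)

lemma card_perp:
  "card (perp N n y) * (q\<^sup>2) ^ n \<ge> (q\<^sup>2) ^ N"
proof (induction n)
  case 0
  then show ?case by (simp add: card_vecs card_field)
next
  case (Suc n)
  have fin: "finite (perp N n y)" by (rule finite_subspace[of _ N]) auto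
  have "card (perp N n y) = card ((\<lambda>w. h N w (y n)) ` perp N n y) * card {w \<in> perp N n y. h N w (y n) = 0}"
    by (rule card_hom[OF fin is_subspace_closed[OF is_subspace_perp]]) (auto simp: h_diff)
  also have "{w \<in> perp N n y. h N w (y n) = 0} = perp N (Suc n) y" by (auto simp: less_Suc_eq)
  also have "card ((\<lambda>w. h N w (y n)) ` perp N n y) * card (perp N (Suc n) y) \<le> q\<^sup>2 * card (perp N (Suc n) y)"
    using card_mono[of UNIV "(\<lambda>w. h N w (y n)) ` perp N n y"] by (intro mult_right_mono) (simp_all add: card_field)
  finally have "card (perp N n y) * (q\<^sup>2) ^ n \<le> q\<^sup>2 * card (perp N (Suc n) y) * (q\<^sup>2) ^ n"
    by (rule mult_right_mono) simp
  with Suc have "(q\<^sup>2) ^ N \<le> q\<^sup>2 * card (perp N (Suc n) y) * (q\<^sup>2) ^ n" by (rule order_trans)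
  then show ?case by (simp only: power_Suc mult_ac)
qed

text \<open>Each w0 orthogonal to all y a but not to u yields an orbit point u + t w0, and is
  recovered from that point up to one of q^2 - 1 scalars. Such w0 make up a share 1 - q^-2 of the
  orthogonal complement, which has at least q^(2(N-n)) elements.\<close>

lemma card_step_orbit:
  fixes y :: "nat \<Rightarrow> nat \<Rightarrow> 'a"
  assumes y: "\<And>a. a < n \<Longrightarrow> y a \<in> vecs N" and u: "u \<in> vecs N" "\<nexists>b. u = lc n y b"
  shows "card {x. \<exists>g\<in>carrier (GU_mat q N). (\<forall>a<n. mv g (y a) = y a) \<and> mv g u = x} * (q\<^sup>2) ^ Suc n \<ge> (q\<^sup>2) ^ N"
proof -
  let ?E = "{x. \<exists>g\<in>carrier (GU_mat q N). (\<forall>a<n. mv g (y a) = y a) \<and> mv g u = x}"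
  let ?P = "perp N n y"
  let ?P1 = "{w \<in> ?P. h N w u \<noteq> 0}"
  have finP: "finite ?P" by (rule finite_subspace[of _ N]) auto
  have finE: "finite ?E"
    by (rule finite_subspace[of _ N]) (auto simp: carrier_GU carrier_GL_mat)
  have "?P1 \<subseteq> (\<lambda>(x, s). smul s (x - u)) ` (?E \<times> (UNIV - {0}))"
  proof
    fix w0 assume w0: "w0 \<in> ?P1"
    obtain t where t: "t \<noteq> 0" "h N (u + smul t w0) (u + smul t w0) = h N u u"
      using isotropic_move[of N w0 u] w0 by blast
    define x where "x = u + smul t w0"
    have w0v: "w0 \<in> vecs N" "\<And>a. a < n \<Longrightarrow> h N w0 (y a) = 0" using w0 by auto
    have xv: "x \<in> vecs N" unfolding x_def using u(1) w0v(1) by (intro vecs_add vecs_smul)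
    have "h N u w0 \<noteq> 0" using h_sym[of N u w0] w0 by simp
    then have ne: "h N u u \<noteq> h N u x" using t(1) by (simp add: x_def h_add h_smul)
    have "x \<in> ?E"
      by (rule reflection_move[OF u(1) xv t(2)[folded x_def, symmetric] ne, of n y])
        (use y w0v in \<open>auto simp: x_def h_add h_diff h_smul h_minus\<close>)
    moreover have "w0 = smul (inverse t) (x - u)" using t(1) by (simp add: x_def)
    ultimately show "w0 \<in> (\<lambda>(x, s). smul s (x - u)) ` (?E \<times> (UNIV - {0}))"
      using t(1) by (intro image_eqI[of _ _ "(x, inverse t)"]) auto
  qed
  then have "card ?P1 \<le> card ((\<lambda>(x, s). smul s (x - u)) ` (?E \<times> (UNIV - {0})))"
    by (rule card_mono[rotated]) (simp add: finE)
  also have "\<dots> \<le> card (?E \<times> (UNIV - {0::'a}))" by (rule card_image_le) (simp add: finE)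
  also have "\<dots> = card ?E * (q\<^sup>2 - 1)" by (simp add: card_cartesian_product card_Diff_subset card_field)
  finally have le: "card ?P1 \<le> card ?E * (q\<^sup>2 - 1)" .
  obtain w where w: "w \<in> ?P" "h N w u \<noteq> 0" using perp_detects[OF u(1) y u(2)] by blast
  have "card ?P = card ((\<lambda>w. h N w u) ` ?P) * card {w \<in> ?P. h N w u = 0}"
    by (rule card_hom[OF finP is_subspace_closed[OF is_subspace_perp]]) (auto simp: h_diff)
  moreover have "(\<lambda>w. h N w u) ` ?P = UNIV"
  proof -
    have "c \<in> (\<lambda>w. h N w u) ` ?P" for c
      using is_subspaceD(3)[OF is_subspace_perp w(1), of "c / h N w u"] w(2)
      by (intro image_eqI[of _ _ "smul (c / h N w u) w"]) (auto simp: h_smul)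
    then show ?thesis by blast
  qed
  ultimately have cP: "card ?P = q\<^sup>2 * card {w \<in> ?P. h N w u = 0}" by (simp add: card_field)
  have "card ?P = card ?P1 + card {w \<in> ?P. h N w u = 0}"
  proof -
    have "finite ?P1" "finite {w \<in> ?P. h N w u = 0}"
      by (rule finite_subset[OF _ finP], blast)+
    then have "card (?P1 \<union> {w \<in> ?P. h N w u = 0}) = card ?P1 + card {w \<in> ?P. h N w u = 0}"
      by (rule card_Un_disjoint) blast
    moreover have "?P1 \<union> {w \<in> ?P. h N w u = 0} = ?P" by blast
    ultimately show ?thesis by simp
  qed
  then have "card ?P1 + card {w \<in> ?P. h N w u = 0} = q\<^sup>2 * card {w \<in> ?P. h N w u = 0}" using cP by simp
  then have P1: "card ?P1 = (q\<^sup>2 - 1) * card {w \<in> ?P. h N w u = 0}" by (simp add: diff_mult_distrib)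
  have q2: "q\<^sup>2 - 1 > 0" using q_gt_1 by (simp add: power2_eq_square) (metis One_nat_def less_1_mult)
  have "card {w \<in> ?P. h N w u = 0} \<le> card ?E"
    using le q2 unfolding P1 by (simp add: mult.commute)
  then have "card ?P \<le> q\<^sup>2 * card ?E" unfolding cP by (rule mult_left_mono) simp
  then have "card ?P * (q\<^sup>2) ^ n \<le> q\<^sup>2 * card ?E * (q\<^sup>2) ^ n" by (rule mult_right_mono) simp
  with card_perp[of N n y] have "(q\<^sup>2) ^ N \<le> q\<^sup>2 * card ?E * (q\<^sup>2) ^ n" by (rule order_trans)
  then show ?thesis by (simp only: power_Suc mult_ac)
qed

text \<open>Orbit sizes multiply along the stabilizers of the initial columns, and the losses
  q^(2(i+1)) from \<open>card_step_orbit\<close> for i < n add up to q^(n^2+n).\<close>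

lemma card_orbit:
  fixes Y :: "nat \<Rightarrow> nat \<Rightarrow> 'a"
  assumes Y: "\<And>a. a < r \<Longrightarrow> Y a \<in> vecs N" "indep r Y"
  shows "n \<le> r \<Longrightarrow> card ((\<lambda>g a. if a < n then mv g (Y a) else (\<lambda>_. 0)) ` carrier (GU_mat q N)) * q ^ (n\<^sup>2 + n) \<ge> (q\<^sup>2) ^ (N * n)"
proof (induction n)
  case 0
  have "(\<lambda>g a. if a < 0 then mv g (Y a) else (\<lambda>_. 0)) ` carrier (GU_mat q N) = {\<lambda>_ _. 0}"
  proof -
    have "carrier (GU_mat q N :: 'a mat monoid) \<noteq> {}" using GU_one[of N] by (rule ex_in_conv[THEN iffD1, OF exI])
    then have "(\<lambda>g::'a mat. (\<lambda>_ _. 0) :: nat \<Rightarrow> nat \<Rightarrow> 'a) ` carrier (GU_mat q N) = {\<lambda>_ _. 0}"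
      by (rule image_constant_conv[THEN trans, OF if_not_P])
    then show ?thesis unfolding less_nat_zero_code if_False .
  qed
  then show ?case by simp
next
  case (Suc n)
  let ?G = "carrier (GU_mat q N :: 'a mat monoid)"
  let ?t = "\<lambda>n g a. if a < n then mv g (Y a) else (\<lambda>_. 0)"
  let ?O = "\<lambda>n. ?t n ` ?G"
  let ?E = "{x. \<exists>g\<in>?G. (\<forall>a<n. mv g (Y a) = Y a) \<and> mv g (Y n) = x}"
  have Gc: "g \<in> carrier_mat N N" "g \<in> carrier (GL_mat N)" if "g \<in> ?G" for g
    using that by (auto simp: carrier_GU carrier_GL_mat)
  have finO: "finite (?O k)" for k
    by (rule rev_finite_subset[OF card_tuples(1)[of N k]]) (auto simp: tuples_alt intro: vecs_mv[OF Gc(1)])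
  have finE: "finite ?E" by (rule finite_subspace[of _ N]) (auto intro: vecs_mv[OF Gc(1)])
  have nspan: "\<nexists>b. Y n = lc n Y b"
  proof
    assume "\<exists>b. Y n = lc n Y b"
    then obtain b where b: "Y n = lc n Y b" by blast
    let ?b = "\<lambda>a. if a < n then b a else if a = n then - 1 else 0"
    have "lc r Y ?b = lc n Y b + smul (- 1) (Y n)" by (rule lc_extend) (use Suc.prems in simp)
    then have "lc r Y ?b = 0" using b by (simp add: smul_minus_one)
    moreover have "?b \<in> vecs r" using Suc.prems by (auto simp: vecs_def)
    ultimately have "?b = 0" using Y(2) by (simp add: indep_def)
    from fun_cong[OF this, of n] show False by simp
  qed
  \<comment> \<open>An element carrying the first \<open>n\<close> columns to o'; it transports the
    stabilizer orbit of column \<open>n\<close> to the fibre over o'.\<close>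
  define pick where "pick o' = (SOME g. g \<in> ?G \<and> ?t n g = o')" for o'
  have pick: "pick o' \<in> ?G \<and> ?t n (pick o') = o'" if "o' \<in> ?O n" for o'
    unfolding pick_def by (rule someI_ex) (use that in auto)
  let ?\<Phi> = "\<lambda>(o', x) a. if a < n then o' a else if a = n then mv (pick o') x else (\<lambda>_. 0)"
  have "card (?O n \<times> ?E) \<le> card (?O (Suc n))"
  proof (rule card_inj_on_le[of ?\<Phi>])
    show "inj_on ?\<Phi> (?O n \<times> ?E)"
    proof (rule inj_onI)
      fix p p' assume p: "p \<in> ?O n \<times> ?E" "p' \<in> ?O n \<times> ?E" and eq: "?\<Phi> p = ?\<Phi> p'"
      obtain o1 x o2 x' where pp: "p = (o1, x)" "p' = (o2, x')" by (cases p, cases p')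
      have O: "o1 \<in> ?O n" "o2 \<in> ?O n" and E: "x \<in> ?E" "x' \<in> ?E" using p pp by auto
      have "o1 a = o2 a" for a
      proof (cases "a < n")
        case True
        then show ?thesis using fun_cong[OF eq, of a] by (simp add: pp)
      next
        case False
        then show ?thesis using O by auto
      qed
      then have oo: "o1 = o2" by (rule ext)
      have "mv (pick o1) x = mv (pick o1) x'" using fun_cong[OF eq, of n] by (simp add: pp oo)
      moreover have "x \<in> vecs N" "x' \<in> vecs N" using E by (auto intro: vecs_mv[OF Gc(1)])
      ultimately have "x = x'" using GL_mv_inj[OF Gc(2)] pick[OF O(1)] by blast
      then show "p = p'" using oo pp by simp
    qed
    show "?\<Phi> ` (?O n \<times> ?E) \<subseteq> ?O (Suc n)"
    proof
      fix z assume "z \<in> ?\<Phi> ` (?O n \<times> ?E)"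
      then obtain o' x where o': "o' \<in> ?O n" and x: "x \<in> ?E" and z: "z = ?\<Phi> (o', x)" by auto
      obtain g where g: "g \<in> ?G" "\<forall>a<n. mv g (Y a) = Y a" "mv g (Y n) = x" using x by auto
      have pk: "pick o' \<in> ?G" "?t n (pick o') = o'" using pick[OF o'] by auto
      have "?t (Suc n) (pick o' * g) a = z a" for a
      proof -
        have "mv (pick o' * g) v = mv (pick o') (mv g v)" for v
          by (rule mv_mult[OF Gc(1)[OF pk(1)] Gc(1)[OF g(1)]])
        then show ?thesis using g fun_cong[OF pk(2), of a] by (auto simp: z less_Suc_eq)
      qed
      then have "z = ?t (Suc n) (pick o' * g)" by (intro ext) simp
      then show "z \<in> ?O (Suc n)" using GU_mult[OF pk(1) g(1)] by blast
    qed
  qed (rule finO)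
  then have c1: "card (?O n) * card ?E \<le> card (?O (Suc n))" by (simp add: card_cartesian_product)
  have c2: "(q\<^sup>2) ^ N \<le> card ?E * (q\<^sup>2) ^ Suc n"
    by (rule card_step_orbit) (use Y(1) Suc.prems nspan in auto)
  have IH: "(q\<^sup>2) ^ (N * n) \<le> card (?O n) * q ^ (n\<^sup>2 + n)" using Suc by simp
  have "(q\<^sup>2) ^ (N * Suc n) = (q\<^sup>2) ^ (N * n) * (q\<^sup>2) ^ N" by (simp add: power_add mult.commute)
  also have "\<dots> \<le> (card (?O n) * q ^ (n\<^sup>2 + n)) * (card ?E * (q\<^sup>2) ^ Suc n)" by (rule mult_mono[OF IH c2]) auto
  also have "\<dots> = (card (?O n) * card ?E) * (q ^ (n\<^sup>2 + n) * (q\<^sup>2) ^ Suc n)" by (simp only: mult_ac)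
  also have "q ^ (n\<^sup>2 + n) * (q\<^sup>2) ^ Suc n = q ^ ((Suc n)\<^sup>2 + Suc n)"
    unfolding power_mult[symmetric] power_add[symmetric] by (rule arg_cong[of _ _ "power q"]) (simp add: power2_eq_square)
  also have "(card (?O n) * card ?E) * q ^ ((Suc n)\<^sup>2 + Suc n) \<le> card (?O (Suc n)) * q ^ ((Suc n)\<^sup>2 + Suc n)"
    using c1 by (rule mult_right_mono) simp
  finally show ?case .
qed

end

section \<open>Additive characters and Gauss sums\<close>

lemma prime_field_image:
  fixes y :: "'a::{field,finite}"
  assumes "y ^ CHAR('a) = y"
  shows "y \<in> range of_nat"
proof -
  let ?p = "CHAR('a)"
  have p: "prime ?p" by (rule prime_CHAR_finite)
  then have p1: "?p > 1" by (rule prime_gt_1_nat)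
  note fp = power_fixed_points[OF p1, where 'a = 'a]
  have pw: "(of_nat n :: 'a) ^ ?p = of_nat n" for n
  proof (induction n)
    case (Suc n)
    have "(1 + of_nat n :: 'a) ^ ?p = 1 + of_nat n"
      using frobenius_add[OF p, of ?p 1 1 "of_nat n"] Suc by simp
    then show ?case by simp
  qed (use p1 in simp)
  have sub: "of_nat ` {..<?p} \<subseteq> {x::'a. x ^ ?p = x}"
    using pw by auto
  have "inj_on (of_nat :: nat \<Rightarrow> 'a) {..<?p}"
  proof (rule inj_onI)
    fix m n assume "m \<in> {..<?p}" "n \<in> {..<?p}" "(of_nat m :: 'a) = of_nat n"
    then show "m = n" by (simp add: of_nat_eq_iff_cong_CHAR cong_def)
  qed
  then have "card ((of_nat :: nat \<Rightarrow> 'a) ` {..<?p}) = ?p" by (simp add: card_image)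
  then have "of_nat ` {..<?p} = {x::'a. x ^ ?p = x}"
    using sub fp by (intro card_subset_eq) (auto dest: card_mono[rotated])
  then show ?thesis using assms by blast
qed

text \<open>\<phi> is a p-th root of unity raised to the absolute trace \<open>T\<close>. The trace
  has values in the prime field, is invariant under Frobenius, and is not identically zero because
  it is a polynomial of degree p^(k-1) < |F|.\<close>

lemma additive_character:
  assumes card: "CARD('a::{field,finite}) = CHAR('a) ^ k"
  shows "\<exists>\<phi>::'a \<Rightarrow> complex. (\<forall>x y. \<phi> (x + y) = \<phi> x * \<phi> y) \<and> (\<forall>x. cmod (\<phi> x) = 1) \<and>
    (\<forall>x. \<phi> (x ^ CHAR('a)) = \<phi> x) \<and> (\<exists>x. \<phi> x \<noteq> 1)"
proof -
  let ?p = "CHAR('a)"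
  have p: "prime ?p" by (rule prime_CHAR_finite)
  then have p1: "?p > 1" by (rule prime_gt_1_nat)
  have k: "k > 0" using card card_field_gt_1[where 'a = 'a] by (cases k) auto
  define T where "T x = (\<Sum>i<k. x ^ (?p ^ i))" for x :: 'a
  have T_add: "T (x + y) = T x + T y" for x y
    unfolding T_def by (subst frobenius_add[OF p refl]) (rule sum.distrib)
  have T_frob: "T (x ^ ?p) = T x" for x
  proof -
    obtain k' where k': "k = Suc k'" using k by (cases k) auto
    have "T (x ^ ?p) = (\<Sum>i<Suc k'. x ^ (?p ^ Suc i))" by (simp add: T_def power_mult[symmetric] k')
    also have "\<dots> = (\<Sum>i<k'. x ^ (?p ^ Suc i)) + x ^ (?p ^ k)" by (simp add: k')
    also have "x ^ (?p ^ k) = x ^ (?p ^ 0)" using finite_field_pow_card[of x] by (simp add: card)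
    also have "(\<Sum>i<k'. x ^ (?p ^ Suc i)) + x ^ (?p ^ 0) = T x"
      unfolding T_def k' by (subst sum.lessThan_Suc_shift) (simp add: add.commute)
    finally show ?thesis .
  qed
  have T_pow: "T x ^ ?p = T x" for x
  proof -
    have s: "(\<Sum>i\<in>A. f i) ^ ?p = (\<Sum>i\<in>A. f i ^ ?p)" for f :: "nat \<Rightarrow> 'a" and A
      by (induction A rule: infinite_finite_induct) (use p1 frobenius_add[OF p, of ?p 1] in auto)
    have "T x ^ ?p = T (x ^ ?p)" unfolding T_def s by (simp add: power_mult[symmetric] mult.commute)
    then show ?thesis by (simp add: T_frob)
  qed
  define n where "n x = (SOME m. of_nat m = T x)" for x
  have n: "of_nat (n x) = T x" for x
    unfolding n_def by (rule someI_ex) (use prime_field_image[OF T_pow[of x]] in auto)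
  define \<phi> where "\<phi> x = cis (2 * pi * real (n x) / real ?p)" for x
  have cis_eq: "cis (2 * pi * real m / real ?p) = cis (2 * pi * real l / real ?p) \<longleftrightarrow> [m = l] (mod ?p)" for m l
  proof -
    have pp: "real ?p > 0" using p1 by simp
    have "cis (2 * pi * real m / real ?p) = cis (2 * pi * real l / real ?p) \<longleftrightarrow>
        cis (2 * pi * (real m - real l) / real ?p) = 1"
      by (simp add: right_diff_distrib diff_divide_distrib cis_divide[symmetric])
    also have "\<dots> \<longleftrightarrow> (\<exists>t::int. 2 * pi * (real m - real l) / real ?p = of_int t * 2 * pi)"
      unfolding cos_one_2pi_int[symmetric]
      by (auto simp: complex_eq_iff) (metis cos_one_sin_zero)
    also have "\<dots> \<longleftrightarrow> (\<exists>t::int. real_of_int (int m - int l) = real_of_int (int ?p * t))"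
    proof (intro arg_cong[of _ _ Ex] ext)
      fix t :: int
      have "2 * pi * (real m - real l) / real ?p = of_int t * 2 * pi \<longleftrightarrow> 2 * pi * ((real m - real l) / real ?p) = 2 * pi * of_int t"
        by (simp add: mult_ac)
      also have "\<dots> \<longleftrightarrow> (real m - real l) / real ?p = of_int t"
        by (subst mult_cancel_left) (use pi_gt_zero in auto)
      also have "\<dots> \<longleftrightarrow> real_of_int (int m - int l) = real_of_int (int ?p * t)"
        using pp by (simp add: divide_eq_eq mult.commute)
      finally show "2 * pi * (real m - real l) / real ?p = of_int t * 2 * pi \<longleftrightarrow> real_of_int (int m - int l) = real_of_int (int ?p * t)" .
    qed
    also have "\<dots> \<longleftrightarrow> int ?p dvd int m - int l" unfolding of_int_eq_iff dvd_def by simp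
    also have "\<dots> \<longleftrightarrow> [m = l] (mod ?p)" by (simp add: cong_iff_dvd_diff flip: cong_int_iff)
    finally show ?thesis .
  qed
  have "\<phi> (x + y) = \<phi> x * \<phi> y" for x y
  proof -
    have "(of_nat (n (x + y)) :: 'a) = of_nat (n x + n y)" by (simp add: n T_add)
    then have "[n (x + y) = n x + n y] (mod ?p)" unfolding of_nat_eq_iff_cong_CHAR .
    then have "\<phi> (x + y) = cis (2 * pi * real (n x + n y) / real ?p)" unfolding \<phi>_def cis_eq .
    then show ?thesis by (simp add: \<phi>_def cis_mult distrib_left add_divide_distrib)
  qed
  moreover have "\<phi> (x ^ ?p) = \<phi> x" for x by (simp add: \<phi>_def n_def T_frob)
  moreover have "\<exists>x. \<phi> x \<noteq> 1"
  proof (rule ccontr)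
    assume "\<not> ?thesis"
    then have one: "\<phi> x = 1" for x by blast
    have "T x = 0" for x
    proof -
      have "cis (2 * pi * real (n x) / real ?p) = cis (2 * pi * real 0 / real ?p)"
        using one[of x] by (simp add: \<phi>_def)
      then have "(of_nat (n x) :: 'a) = of_nat 0" unfolding cis_eq of_nat_eq_iff_cong_CHAR .
      then show ?thesis by (simp add: n)
    qed
    define P where "P = (\<Sum>i<k. monom (1::'a) (?p ^ i))"
    have "coeff P (?p ^ (k - 1)) = (\<Sum>i<k. if i = k - 1 then 1 else 0)"
      unfolding P_def coeff_sum coeff_monom using p1 by (intro sum.cong refl) (simp add: power_inject_exp)
    also have "\<dots> = 1" using k by simp
    finally have P0: "P \<noteq> 0" by auto
    have "degree P \<le> ?p ^ (k - 1)" unfolding P_def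
    proof (rule degree_sum_le)
      fix i assume "i \<in> {..<k}"
      then have "?p ^ i \<le> ?p ^ (k - 1)" using p1 by (intro power_increasing) auto
      then show "degree (monom (1::'a) (?p ^ i)) \<le> ?p ^ (k - 1)" by (simp add: degree_monom_eq)
    qed simp
    then have "card {x. poly P x = 0} \<le> ?p ^ (k - 1)" using card_poly_roots_bound[OF P0] by linarith
    moreover have "{x. poly P x = 0} = UNIV"
      using \<open>\<And>x. T x = 0\<close> by (auto simp: P_def poly_sum poly_monom T_def)
    ultimately have "?p ^ k \<le> ?p ^ (k - 1)" using card by simp
    then show False using p1 k by simp
  qed
  ultimately show ?thesis by (intro exI[of _ \<phi>]) (simp add: \<phi>_def)
qed

lemma sum_character_zero:
  fixes f :: "'v::ab_group_add \<Rightarrow> complex"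
  assumes A: "\<And>u v. u \<in> A \<Longrightarrow> v \<in> A \<Longrightarrow> u + v \<in> A" "\<And>u v. u \<in> A \<Longrightarrow> v \<in> A \<Longrightarrow> u - v \<in> A"
    and f: "\<And>u v. u \<in> A \<Longrightarrow> v \<in> A \<Longrightarrow> f (u + v) = f u * f v" and s: "s \<in> A" "f s \<noteq> 1"
  shows "(\<Sum>u\<in>A. f u) = 0"
proof -
  have "(\<Sum>u\<in>A. f u) = (\<Sum>u\<in>A. f (u + s))" by (rule sum_translate[symmetric]) (use A s in auto)
  also have "\<dots> = (\<Sum>u\<in>A. f u) * f s"
    unfolding sum_distrib_right using f s by (intro sum.cong refl) auto
  finally show ?thesis using s(2) by simp
qed

text \<open>Invariance under x -> x^q makes \<phi>(h(u,v)) symmetric in u and v, so this bicharacter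
  would give a commutative algebra. Multiplying the form by \<gamma> destroys the symmetry.\<close>

locale unitary_char = unitary_field q field_type
  for q :: nat and field_type :: "'a::{field,finite} itself" +
  fixes \<phi> :: "'a \<Rightarrow> complex" and \<gamma> :: 'a
  assumes phi_add: "\<phi> (x + y) = \<phi> x * \<phi> y" and phi_norm: "cmod (\<phi> x) = 1"
    and phi_frob: "\<phi> (x ^ q) = \<phi> x" and phi_nontrivial: "\<exists>x. \<phi> x \<noteq> 1"
    and gamma: "\<gamma> ^ q \<noteq> \<gamma>"

lemma (in unitary_field) unitary_char_exists: "\<exists>(\<phi> :: 'a \<Rightarrow> complex) \<gamma>. unitary_char q \<phi> \<gamma>"
proof -
  obtain e where e: "q = CHAR('a) ^ e" "CARD('a) = CHAR('a) ^ (2 * e)" by (rule q_CHAR)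
  obtain \<phi> :: "'a \<Rightarrow> complex" where \<phi>: "\<And>x y. \<phi> (x + y) = \<phi> x * \<phi> y" "\<And>x. cmod (\<phi> x) = 1"
    "\<And>x. \<phi> (x ^ CHAR('a)) = \<phi> x" "\<exists>x. \<phi> x \<noteq> 1"
    using additive_character[OF e(2)] by blast
  have it: "\<phi> (x ^ (CHAR('a) ^ i)) = \<phi> x" for x i
    by (induction i) (simp_all add: \<phi>(3) power_mult mult.commute[of "CHAR('a)"])
  obtain \<gamma> :: 'a where "\<gamma> ^ q \<noteq> \<gamma>" using exists_non_fixed by blast
  then have "unitary_char q \<phi> \<gamma>"
    using \<phi> it by unfold_locales (simp_all add: e(1))
  then show ?thesis by blast
qed

context unitary_char
begin

lemma phi_0 [simp]: "\<phi> 0 = 1"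
  using phi_add[of 0 0] phi_norm[of 0] by auto

lemma phi_nonzero [simp]: "\<phi> x \<noteq> 0"
  using phi_norm[of x] by auto

lemma phi_sum: "\<phi> (sum f A) = (\<Prod>a\<in>A. \<phi> (f a))"
  by (induction A rule: infinite_finite_induct) (auto simp: phi_add)

lemma phi_minus: "\<phi> (- x) = cnj (\<phi> x)"
proof -
  have "\<phi> x * \<phi> (- x) = 1" using phi_add[of x "- x"] by simp
  moreover have "\<phi> x * cnj (\<phi> x) = 1" using phi_norm[of x] by (simp add: complex_norm_square[symmetric])
  ultimately show ?thesis by (metis phi_nonzero mult_left_cancel)
qed

lemma phi_diff: "\<phi> (x - y) = \<phi> x * cnj (\<phi> y)"
  using phi_add[of x "- y"] by (simp add: phi_minus)

lemma phi_mult_cnj [simp]: "\<phi> x * cnj (\<phi> x) = 1" "cnj (\<phi> x) * \<phi> x = 1"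
  using phi_diff[of x x] by (simp_all add: mult.commute)

text \<open>The argument has the form z - z^q, with z = n d \<theta> and \<theta> of trace
  one.\<close>

lemma phi_skew:
  assumes "d ^ q = - d" "n ^ q = n"
  shows "\<phi> (n * d) = 1"
proof -
  obtain \<theta> :: 'a where \<theta>: "\<theta> + \<theta> ^ q = 1" using trace_one by blast
  have "(n * d * \<theta>) ^ q = - (n * d * \<theta> ^ q)" using assms by (simp add: power_mult_distrib)
  then have "n * d = n * d * \<theta> - (n * d * \<theta>) ^ q" using \<theta>
    by (metis (no_types, lifting) diff_minus_eq_add distrib_left mult.right_neutral)
  then have "\<phi> (n * d) = \<phi> (n * d * \<theta>) * cnj (\<phi> ((n * d * \<theta>) ^ q))" by (metis phi_diff)
  then show ?thesis by (simp add: phi_frob)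
qed

lemma phi_separates: "a \<noteq> 0 \<Longrightarrow> \<exists>z. \<phi> (a * z) \<noteq> 1"
proof -
  assume a: "a \<noteq> 0"
  obtain x where "\<phi> x \<noteq> 1" using phi_nontrivial by blast
  then show ?thesis using a by (intro exI[of _ "x / a"]) simp
qed

text \<open>This makes the commutator form of the twisted group algebra non-degenerate, as \<open>\<gamma> \<noteq> \<gamma>\<^sup>q\<close>.\<close>

lemma phi_gamma_sym: "\<phi> (\<gamma> * s - \<gamma> * s ^ q) = \<phi> ((\<gamma> - \<gamma> ^ q) * s)"
proof -
  have "(\<gamma> * s ^ q) ^ q = \<gamma> ^ q * s" by (simp add: power_mult_distrib)
  then have "\<phi> (\<gamma> * s ^ q) = \<phi> (\<gamma> ^ q * s)" using phi_frob[of "\<gamma> * s ^ q"] by simp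
  then show ?thesis by (simp add: phi_diff left_diff_distrib)
qed

lemma card_norm_fibre: "card {t::'a. t * t ^ q = c} \<le> q + 1"
proof -
  define P where "P = monom 1 (q + 1) - [:c:]"
  have "coeff P (q + 1) = 1" using q_gt_1 by (simp add: P_def coeff_pCons split: nat.split)
  then have P0: "P \<noteq> 0" by auto
  have "degree P \<le> q + 1" unfolding P_def
    by (intro degree_diff_le) (auto simp: degree_monom_eq)
  then have "card {x. poly P x = 0} \<le> q + 1" using card_poly_roots_bound[OF P0] by linarith
  moreover have "{x. poly P x = 0} = {t. t * t ^ q = c}" by (auto simp: P_def poly_monom)
  ultimately show ?thesis by simp
qed

text \<open>The norm t t^q is (q + 1)-to-one onto the nonzero elements fixed by Frobenius, and n ->
  \<phi>(\<gamma> n s) is a nontrivial character on the fixed elements; the sum is therefore 1 - (q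
  + 1).\<close>

lemma gauss_sum_line:
  assumes s: "s ^ q = - s" "s \<noteq> 0"
  shows "(\<Sum>t\<in>UNIV. \<phi> (\<gamma> * (t * t ^ q * s))) = - of_nat q"
proof -
  let ?S = "{n::'a. n ^ q = n} - {0}"
  let ?f = "\<lambda>c. card {t::'a. t * t ^ q = c}"
  let ?g = "\<lambda>n. \<phi> (\<gamma> * (n * s))"
  have cS: "card ?S \<le> q - 1" using power_fixed_points(2)[OF q_gt_1, where 'a = 'a] q_gt_1 by (simp add: card_Diff_singleton)
  have inS: "t * t ^ q \<in> ?S" if "t \<noteq> 0" for t :: 'a using that by (simp add: power_mult_distrib mult.commute)
  have un: "(\<Union>c\<in>?S. {t. t * t ^ q = c}) = UNIV - {0}"
  proof (rule Set.set_eqI, rule iffI)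
    fix t :: 'a assume "t \<in> (\<Union>c\<in>?S. {t. t * t ^ q = c})"
    then have "t * t ^ q \<noteq> 0" by blast
    then show "t \<in> UNIV - {0}" by auto
  next
    fix t :: 'a assume "t \<in> UNIV - {0}"
    then show "t \<in> (\<Union>c\<in>?S. {t. t * t ^ q = c})" using inS[of t] by blast
  qed
  have "(\<Sum>c\<in>?S. ?f c) = card (UNIV - {0::'a})"
    unfolding un[symmetric] by (rule card_UN_disjoint[symmetric]) auto
  then have sf: "(\<Sum>c\<in>?S. ?f c) = (q + 1) * (q - 1)"
    using q_gt_1 by (simp add: card_Diff_subset card_field power2_eq_square algebra_simps)
  \<comment> \<open>At most q - 1 fibres with at most q + 1 elements each cover all q^2 - 1 nonzero
    t, so every fibre is full.\<close>
  have "(\<Sum>c\<in>?S. ?f c) + (\<Sum>c\<in>?S. q + 1 - ?f c) = (\<Sum>c\<in>?S. q + 1)"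
    unfolding sum.distrib[symmetric] using card_norm_fibre by (intro sum.cong refl) (simp add: add.commute)
  also have "\<dots> = (q + 1) * card ?S" by simp
  also have "\<dots> \<le> (q + 1) * (q - 1)" by (rule mult_left_mono[OF cS]) simp
  finally have "(\<Sum>c\<in>?S. q + 1 - ?f c) = 0" using sf by simp
  then have fib: "?f c = q + 1" if "c \<in> ?S" for c
  proof -
    have "finite ?S" by simp
    then have "q + 1 - ?f c = 0" using \<open>(\<Sum>c\<in>?S. q + 1 - ?f c) = 0\<close> that by (meson sum_eq_0_iff)
    then show ?thesis using card_norm_fibre[of c] by linarith
  qed
  have g0: "(\<Sum>n\<in>{n. n ^ q = n}. ?g n) = 0"
  proof -
    obtain u where u: "\<phi> u \<noteq> 1" using phi_nontrivial by blast
    let ?a = "(\<gamma> - \<gamma> ^ q) * s"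
    have a0: "?a \<noteq> 0" using gamma s by simp
    have aq: "?a ^ q = ?a" using s by (simp add: power_mult_distrib frob_diff algebra_simps)
    obtain \<theta> :: 'a where \<theta>: "\<theta> + \<theta> ^ q = 1" using trace_one by blast
    \<comment> \<open>Chosen so that x = \<gamma> n s has x + x^q = u + u^q. Then x - u is skew, and
      \<phi> takes the same value at x as at u, which is not 1.\<close>
    let ?n = "(u + u ^ q) / ?a"
    have uq: "(u + u ^ q) ^ q = u + u ^ q" by (simp add: frob_add add.commute)
    have nq: "?n ^ q = ?n" unfolding power_divide aq uq ..
    let ?x = "\<gamma> * (?n * s)"
    have "?x + ?x ^ q = ?n * ?a"
    proof -
      have "\<gamma> * (n * s) + \<gamma> ^ q * (n * - s) = n * ((\<gamma> - \<gamma> ^ q) * s)" for n by (simp add: algebra_simps)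
      then show ?thesis unfolding power_mult_distrib nq s(1) .
    qed
    then have xq: "?x + ?x ^ q = u + u ^ q" using a0 by simp
    let ?d = "?x - u"
    have "?d ^ q = - ?d" using xq by (simp add: frob_diff algebra_simps)
    then have "\<phi> (1 * ?d) = 1" by (rule phi_skew) simp
    then have "\<phi> ?x * cnj (\<phi> u) = 1" by (simp add: phi_diff)
    then have "\<phi> ?x * (cnj (\<phi> u) * \<phi> u) = \<phi> u" by (metis mult.assoc mult_1_left)
    then have "?g ?n \<noteq> 1" using u by simp
    then show ?thesis
      by (intro sum_character_zero[of _ _ ?n]) (use nq in \<open>auto simp: frob_add frob_diff phi_add distrib_left distrib_right\<close>)
  qed
  have "(\<Sum>t\<in>UNIV. \<phi> (\<gamma> * (t * t ^ q * s))) = 1 + (\<Sum>t\<in>UNIV - {0}. ?g (t * t ^ q))"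
    by (subst sum.remove[of _ 0]) (simp_all add: mult.assoc)
  also have "(\<Sum>t\<in>UNIV - {0}. ?g (t * t ^ q)) = (\<Sum>c\<in>?S. \<Sum>t\<in>{t. t * t ^ q = c}. ?g (t * t ^ q))"
    unfolding un[symmetric] by (rule sum.UNION_disjoint) auto
  also have "\<dots> = (\<Sum>c\<in>?S. of_nat (q + 1) * ?g c)"
  proof (rule sum.cong[OF refl])
    fix c assume c: "c \<in> ?S"
    have "(\<Sum>t\<in>{t. t * t ^ q = c}. ?g (t * t ^ q)) = (\<Sum>t\<in>{t. t * t ^ q = c}. ?g c)"
      by (rule sum.cong) auto
    also have "\<dots> = of_nat (q + 1) * ?g c" by (simp only: sum_constant fib[OF c])
    finally show "(\<Sum>t\<in>{t. t * t ^ q = c}. ?g (t * t ^ q)) = of_nat (q + 1) * ?g c" .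
  qed
  also have "\<dots> = of_nat (q + 1) * (\<Sum>c\<in>?S. ?g c)" by (rule sum_distrib_left[symmetric])
  also have "(\<Sum>c\<in>?S. ?g c) = - 1"
    using g0 by (subst (asm) sum.remove[of _ 0]) (auto simp: add_eq_0_iff)
  finally show ?thesis by simp
qed

end

context unitary_char
begin

text \<open>A vector x0 with s(x0,x0) nonzero splits off and contributes the factor -q of
  \<open>gauss_sum_line\<close>; a space on which all s(x,x) vanish contributes its order q^(2n) =
  (-q)^(2n). That the value is a power of -q, sign included, is what later fixes the scalar in
  products of Weil elements.\<close>

lemma gauss_sum_subspace:
  assumes I: "is_subspace I" "I \<subseteq> vecs N"
    and s: "\<And>u v w. s (u + v) w = s u w + s v w" "\<And>c u w. s (smul c u) w = c * s u w"
    and skew: "\<And>u w. u \<in> I \<Longrightarrow> w \<in> I \<Longrightarrow> s w u = - ((s u w) ^ q)"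
  shows "\<exists>e. (\<Sum>x\<in>I. \<phi> (\<gamma> * s x x)) = (- of_nat q) ^ e"
  using I skew
proof (induction "card I" arbitrary: I rule: less_induct)
  case less
  note I = less.prems(1,2) and skew = less.prems(3)
  have fin: "finite I" by (rule finite_subspace[OF I(2)])
  show ?case
  proof (cases "\<forall>x\<in>I. s x x = 0")
    case True
    obtain n y where y: "indep n y" "lspan n y = I" by (rule subspace_basis[OF I(1) fin])
    have "(\<Sum>x\<in>I. \<phi> (\<gamma> * s x x)) = of_nat (card I)" using True by simp
    also have "card I = q ^ (2 * n)" using card_lspan_indep[OF y(1)] y(2) card_field by (simp add: power_mult)
    also have "of_nat (q ^ (2 * n)) = (- of_nat q :: complex) ^ (2 * n)" by simp
    finally show ?thesis by blast
  next
    case False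
    then obtain x0 where x0: "x0 \<in> I" "s x0 x0 \<noteq> 0" by blast
    let ?I = "{x \<in> I. s x x0 = 0}"
    have s0: "s 0 w = 0" for w using s(2)[of 0 0 w] by simp
    have "is_subspace ?I" using is_subspaceD[OF I(1)] s s0 by (simp add: is_subspace_def)
    moreover have "card ?I < card I" by (rule psubset_card_mono[OF fin]) (use x0 in auto)
    ultimately obtain e where e: "(\<Sum>x\<in>?I. \<phi> (\<gamma> * s x x)) = (- of_nat q) ^ e"
      using less.hyps[of ?I] I(2) skew by blast
    have ex: "s (smul t x0 + x) (smul t x0 + x) = t * t ^ q * s x0 x0 + s x x" if x: "x \<in> ?I" for t x
    proof -
      have xI: "x \<in> I" "s x x0 = 0" and tI: "smul t x0 \<in> I" "smul t x0 + x \<in> I"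
        using x is_subspaceD[OF I(1)] x0 by auto
      have x0x: "s x0 x = 0" using skew[OF xI(1) x0(1)] xI(2) by simp
      have "s (smul t x0 + x) (smul t x0 + x) = t * s x0 (smul t x0 + x) + s x (smul t x0 + x)"
        by (simp only: s)
      also have "s x0 (smul t x0 + x) = - ((t * s x0 x0 + s x x0) ^ q)"
        using skew[OF tI(2) x0(1)] by (simp only: s)
      also have "\<dots> = t ^ q * (- ((s x0 x0) ^ q))" using xI(2) by (simp add: power_mult_distrib)
      also have "- ((s x0 x0) ^ q) = s x0 x0" using skew[OF x0(1) x0(1)] by simp
      also have "s x (smul t x0 + x) = - ((t * s x0 x + s x x) ^ q)"
        using skew[OF tI(2) xI(1)] by (simp only: s)
      also have "\<dots> = - ((s x x) ^ q)" using x0x by simp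
      also have "\<dots> = s x x" using skew[OF xI(1) xI(1)] by simp
      finally show ?thesis by (simp only: mult.assoc)
    qed
    have "(\<Sum>x\<in>I. \<phi> (\<gamma> * s x x)) = (\<Sum>(t, x)\<in>UNIV \<times> ?I. \<phi> (\<gamma> * s (smul t x0 + x) (smul t x0 + x)))"
    proof (rule sum.reindex_bij_witness[of _ "\<lambda>(t, x). smul t x0 + x" "\<lambda>x. (s x x0 / s x0 x0, x - smul (s x x0 / s x0 x0) x0)"])
      fix x assume x: "x \<in> I"
      let ?t = "s x x0 / s x0 x0"
      have "x + smul (- ?t) x0 = x - smul ?t x0" by (simp add: smul_def fun_eq_iff)
      then have "s (x - smul ?t x0) x0 = s x x0 + - ?t * s x0 x0" using s by metis
      then have "s (x - smul ?t x0) x0 = 0" using x0(2) by simp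
      then show "(?t, x - smul ?t x0) \<in> UNIV \<times> ?I"
        using is_subspaceD(5)[OF I(1) x is_subspaceD(3)[OF I(1) x0(1)]] by blast
    next
      fix b :: "'a \<times> (nat \<Rightarrow> 'a)" assume "b \<in> UNIV \<times> ?I"
      then obtain t x where b: "b = (t, x)" "x \<in> I" "s x x0 = 0" by auto
      then show "(\<lambda>(t, x). smul t x0 + x) b \<in> I"
        using is_subspaceD(2)[OF I(1) is_subspaceD(3)[OF I(1) x0(1)]] by simp
      have "s (smul t x0 + x) x0 / s x0 x0 = t" using b x0(2) s by simp
      then show "(s ((\<lambda>(t, x). smul t x0 + x) b) x0 / s x0 x0, (\<lambda>(t, x). smul t x0 + x) b - smul (s ((\<lambda>(t, x). smul t x0 + x) b) x0 / s x0 x0) x0) = b"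
        using b by simp
    qed auto
    also have "\<dots> = (\<Sum>t\<in>UNIV. \<Sum>x\<in>?I. \<phi> (\<gamma> * (t * t ^ q * s x0 x0)) * \<phi> (\<gamma> * s x x))"
      unfolding sum.cartesian_product[symmetric] using ex
      by (intro sum.cong refl) (simp add: phi_add distrib_left)
    also have "\<dots> = (\<Sum>t\<in>UNIV. \<phi> (\<gamma> * (t * t ^ q * s x0 x0))) * (- of_nat q) ^ e"
      unfolding sum_distrib_left[symmetric] e by (rule sum_distrib_right[symmetric])
    also have "(\<Sum>t\<in>UNIV. \<phi> (\<gamma> * (t * t ^ q * s x0 x0))) = - of_nat q"
    proof (rule gauss_sum_line)
      show "(s x0 x0) ^ q = - s x0 x0" using skew[OF x0(1) x0(1)] by (metis minus_minus)
    qed (rule x0)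
    finally have "(\<Sum>x\<in>I. \<phi> (\<gamma> * s x x)) = (- of_nat q) ^ Suc e" by (simp only: power_Suc)
    then show ?thesis by blast
  qed
qed

end

section \<open>Twisted group algebras\<close>

lemma Cauchy_Schwarz_sum:
  fixes a b :: "'i \<Rightarrow> real"
  shows "(\<Sum>i\<in>I. a i * b i)\<^sup>2 \<le> (\<Sum>i\<in>I. (a i)\<^sup>2) * (\<Sum>i\<in>I. (b i)\<^sup>2)"
proof -
  have "0 \<le> (\<Sum>i\<in>I. \<Sum>k\<in>I. (a i * b k - a k * b i)\<^sup>2)" by (intro sum_nonneg) simp
  also have "\<dots> = (\<Sum>i\<in>I. \<Sum>k\<in>I. (a i)\<^sup>2 * (b k)\<^sup>2 + (b i)\<^sup>2 * (a k)\<^sup>2 - 2 * ((a i * b i) * (a k * b k)))"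
    by (simp add: power2_diff power_mult_distrib mult_ac)
  also have "\<dots> = (\<Sum>i\<in>I. (a i)\<^sup>2) * (\<Sum>i\<in>I. (b i)\<^sup>2) + (\<Sum>i\<in>I. (b i)\<^sup>2) * (\<Sum>i\<in>I. (a i)\<^sup>2)
      - 2 * ((\<Sum>i\<in>I. a i * b i) * (\<Sum>i\<in>I. a i * b i))"
    unfolding sum_product by (simp add: sum.distrib sum_subtractf sum_distrib_left)
  finally show ?thesis by (simp add: power2_eq_square mult.commute)
qed

text \<open>A bicharacter is a 2-cocycle, so \<open>conv\<close> makes the functions on
  \<open>A\<close> an associative algebra with involution \<open>star\<close>. Evaluation at 0 is a
  trace, and \<open>conv f (star f) 0\<close> is the squared norm.\<close>

locale twisted =
  fixes A :: "'v::ab_group_add set" and \<beta> :: "'v \<Rightarrow> 'v \<Rightarrow> complex"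
  assumes finA: "finite A" and A_0: "0 \<in> A" and A_add: "u \<in> A \<Longrightarrow> v \<in> A \<Longrightarrow> u + v \<in> A"
    and A_minus: "u \<in> A \<Longrightarrow> - u \<in> A"
    and beta_add: "\<beta> (u + v) w = \<beta> u w * \<beta> v w" "\<beta> w (u + v) = \<beta> w u * \<beta> w v"
    and beta_norm: "cmod (\<beta> u v) = 1"
begin

lemma A_diff: "u \<in> A \<Longrightarrow> v \<in> A \<Longrightarrow> u - v \<in> A"
  using A_add[OF _ A_minus, of u v] by simp

lemma beta_nonzero [simp]: "\<beta> u v \<noteq> 0"
  using beta_norm[of u v] by auto

lemma beta_0 [simp]: "\<beta> 0 w = 1" "\<beta> w 0 = 1"
  using beta_add(1)[of 0 0 w] beta_add(2)[of w 0 0] by auto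

lemma beta_cnj [simp]: "\<beta> u v * cnj (\<beta> u v) = 1" "cnj (\<beta> u v) * \<beta> u v = 1"
  using beta_norm[of u v] by (simp_all add: complex_norm_square[symmetric] mult.commute)

lemma beta_cnj_inverse: "cnj (\<beta> u v) = inverse (\<beta> u v)"
  using beta_cnj(1)[of u v] by (simp add: field_simps)

lemma beta_minus: "\<beta> (- u) w = cnj (\<beta> u w)" "\<beta> w (- u) = cnj (\<beta> w u)"
proof -
  have "\<beta> u w * \<beta> (- u) w = \<beta> u w * cnj (\<beta> u w)" using beta_add(1)[of u "- u" w] by simp
  then show "\<beta> (- u) w = cnj (\<beta> u w)" by (rule mult_left_cancel[OF beta_nonzero, THEN iffD1])
  have "\<beta> w u * \<beta> w (- u) = \<beta> w u * cnj (\<beta> w u)" using beta_add(2)[of w u "- u"] by simp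
  then show "\<beta> w (- u) = cnj (\<beta> w u)" by (rule mult_left_cancel[OF beta_nonzero, THEN iffD1])
qed

lemma beta_diff: "\<beta> (u - v) w = \<beta> u w * cnj (\<beta> v w)" "\<beta> w (u - v) = \<beta> w u * cnj (\<beta> w v)"
  using beta_add[of u "- v" w] beta_add(2)[of w u "- v"] by (simp_all add: beta_minus)

definition conv :: "('v \<Rightarrow> complex) \<Rightarrow> ('v \<Rightarrow> complex) \<Rightarrow> 'v \<Rightarrow> complex" where
  "conv f g z = (\<Sum>x\<in>A. f x * g (z - x) * \<beta> x (z - x))"

definition star :: "('v \<Rightarrow> complex) \<Rightarrow> 'v \<Rightarrow> complex" where
  "star f x = cnj (f (- x)) * \<beta> x x"

definition pt :: "'v \<Rightarrow> 'v \<Rightarrow> complex" where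
  "pt a x = (if x = a then 1 else 0)"

lemma conv_cong:
  assumes "z \<in> A" "\<And>x. x \<in> A \<Longrightarrow> f x = f' x" "\<And>x. x \<in> A \<Longrightarrow> g x = g' x"
  shows "conv f g z = conv f' g' z"
  unfolding conv_def using assms by (intro sum.cong refl) (simp add: A_diff)

lemma conv_assoc: "conv (conv f g) k z = conv f (conv g k) z"
proof -
  have "conv (conv f g) k z = (\<Sum>y\<in>A. \<Sum>x\<in>A. f x * g (y - x) * \<beta> x (y - x) * k (z - y) * \<beta> y (z - y))"
    unfolding conv_def by (simp only: sum_distrib_right)
  also have "\<dots> = (\<Sum>x\<in>A. \<Sum>y\<in>A. f x * g (y - x) * \<beta> x (y - x) * k (z - y) * \<beta> y (z - y))"
    by (rule sum.swap)
  also have "\<dots> = (\<Sum>x\<in>A. \<Sum>y\<in>A. f x * g y * \<beta> x y * k (z - (y + x)) * \<beta> (y + x) (z - (y + x)))"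
  proof (rule sum.cong[OF refl])
    fix x assume x: "x \<in> A"
    show "(\<Sum>y\<in>A. f x * g (y - x) * \<beta> x (y - x) * k (z - y) * \<beta> y (z - y)) =
        (\<Sum>y\<in>A. f x * g y * \<beta> x y * k (z - (y + x)) * \<beta> (y + x) (z - (y + x)))"
      using sum_translate[OF A_add A_diff x, of "\<lambda>y. f x * g (y - x) * \<beta> x (y - x) * k (z - y) * \<beta> y (z - y)"]
      by simp
  qed
  also have "\<dots> = (\<Sum>x\<in>A. \<Sum>y\<in>A. f x * (g y * k (z - x - y) * \<beta> y (z - x - y)) * \<beta> x (z - x))"
  proof (intro sum.cong refl)
    fix x y
    have e: "z - (y + x) = z - x - y" by (simp add: algebra_simps)
    have "\<beta> x (z - x) = \<beta> x y * \<beta> x (z - x - y)" using beta_add(2)[of x y "z - x - y"] by simp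
    then show "f x * g y * \<beta> x y * k (z - (y + x)) * \<beta> (y + x) (z - (y + x)) =
        f x * (g y * k (z - x - y) * \<beta> y (z - x - y)) * \<beta> x (z - x)"
      unfolding e beta_add(1) by (simp only: mult_ac)
  qed
  also have "\<dots> = conv f (conv g k) z"
    unfolding conv_def by (simp only: sum_distrib_right sum_distrib_left)
  finally show ?thesis .
qed

lemma conv_assoc_fun: "conv (conv f g) k = conv f (conv g k)"
  by (rule ext) (rule conv_assoc)

lemma conv_star:
  assumes z: "z \<in> A"
  shows "star (conv f g) z = conv (star g) (star f) z"
proof -
  have "conv (star g) (star f) z = (\<Sum>y\<in>A. star g (y + z) * star f (z - (y + z)) * \<beta> (y + z) (z - (y + z)))"
    unfolding conv_def by (rule sum_translate[OF A_add A_diff z, symmetric])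
  also have "\<dots> = (\<Sum>x\<in>A. cnj (f x * g (- z - x) * \<beta> x (- z - x)) * \<beta> z z)"
  proof (intro sum.cong refl)
    fix x
    have e: "z - (x + z) = - x" "- (x + z) = - z - x" by simp_all
    have "\<beta> (x + z) (x + z) * \<beta> x x * \<beta> (x + z) (- x) = cnj (\<beta> x (- z - x)) * \<beta> z z"
      by (simp add: beta_add beta_minus beta_diff beta_cnj_inverse field_simps)
    then show "star g (x + z) * star f (z - (x + z)) * \<beta> (x + z) (z - (x + z)) =
        cnj (f x * g (- z - x) * \<beta> x (- z - x)) * \<beta> z z"
      unfolding e star_def by (simp add: beta_minus) (simp add: mult_ac)
  qed
  also have "\<dots> = star (conv f g) z"
    unfolding star_def conv_def by (simp add: sum_distrib_right)
  finally show ?thesis by simp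
qed

lemma conv_at_0: "conv f g 0 = (\<Sum>x\<in>A. f x * g (- x) * cnj (\<beta> x x))"
  unfolding conv_def by (simp add: beta_minus)

lemma conv_commute_0: "conv f g 0 = conv g f 0"
  unfolding conv_at_0
  by (rule sum.reindex_bij_witness[of _ uminus uminus]) (auto simp: A_minus beta_minus)

lemma conv_star_0: "conv f (star f) 0 = of_real (\<Sum>x\<in>A. (cmod (f x))\<^sup>2)"
  unfolding conv_at_0 of_real_sum complex_norm_square star_def
  by (intro sum.cong refl) (simp add: beta_minus)

lemma conv_pt: "z \<in> A \<Longrightarrow> a \<in> A \<Longrightarrow> conv f (pt a) z = f (z - a) * \<beta> (z - a) a"
  "a \<in> A \<Longrightarrow> conv (pt a) f z = f (z - a) * \<beta> a (z - a)"
proof -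
  assume z: "z \<in> A" "a \<in> A"
  have "conv f (pt a) z = (\<Sum>x\<in>A. if x = z - a then f (z - a) * \<beta> (z - a) a else 0)"
    unfolding conv_def pt_def by (intro sum.cong refl) (auto simp: algebra_simps)
  then show "conv f (pt a) z = f (z - a) * \<beta> (z - a) a" using A_diff z finA by simp
next
  assume a: "a \<in> A"
  have "conv (pt a) f z = (\<Sum>x\<in>A. if x = a then f (z - a) * \<beta> a (z - a) else 0)"
    unfolding conv_def pt_def by (intro sum.cong refl) auto
  then show "conv (pt a) f z = f (z - a) * \<beta> a (z - a)" using a finA by simp
qed

lemma conv_linear:
  "conv (\<lambda>x. \<Sum>i\<in>I. a i * f i x) g z = (\<Sum>i\<in>I. a i * conv (f i) g z)"
  "conv g (\<lambda>x. \<Sum>i\<in>I. a i * f i x) z = (\<Sum>i\<in>I. a i * conv g (f i) z)"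
  unfolding conv_def sum_distrib_left sum_distrib_right
  by (subst sum.swap, simp add: mult_ac)+

lemma conv_scale: "conv (\<lambda>x. c * f x) g z = c * conv f g z" "conv g (\<lambda>x. c * f x) z = c * conv g f z"
  unfolding conv_def sum_distrib_left by (simp_all add: mult_ac)

lemma conv_scale_fun: "conv (\<lambda>x. c * f x) g = (\<lambda>z. c * conv f g z)"
  by (rule ext) (rule conv_scale)

lemma trace_product_bound:
  "(cmod (conv f g 0))\<^sup>2 \<le> (\<Sum>x\<in>A. (cmod (f x))\<^sup>2) * (\<Sum>x\<in>A. (cmod (g x))\<^sup>2)"
proof -
  have "cmod (conv f g 0) \<le> (\<Sum>x\<in>A. cmod (f x) * cmod (g (- x)))"
    unfolding conv_at_0 by (rule sum_norm_le) (simp add: norm_mult beta_norm)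
  then have "(cmod (conv f g 0))\<^sup>2 \<le> (\<Sum>x\<in>A. cmod (f x) * cmod (g (- x)))\<^sup>2" by (rule power_mono) simp
  also have "\<dots> \<le> (\<Sum>x\<in>A. (cmod (f x))\<^sup>2) * (\<Sum>x\<in>A. (cmod (g (- x)))\<^sup>2)" by (rule Cauchy_Schwarz_sum)
  also have "(\<Sum>x\<in>A. (cmod (g (- x)))\<^sup>2) = (\<Sum>x\<in>A. (cmod (g x))\<^sup>2)"
    by (rule sum.reindex_bij_witness[of _ uminus uminus]) (auto simp: A_minus)
  finally show ?thesis .
qed

lemma conv_zero_iff_norm:
  assumes "conv f (star f) 0 = 0" "x \<in> A"
  shows "f x = 0"
proof -
  have "(\<Sum>x\<in>A. (cmod (f x))\<^sup>2) = 0" using assms(1) unfolding conv_star_0 of_real_eq_0_iff .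
  then have "(cmod (f x))\<^sup>2 = 0" using finA assms(2) by (subst (asm) sum_nonneg_eq_0_iff) auto
  then show ?thesis by simp
qed

end

section \<open>The Weil representation in a twisted group algebra\<close>

locale unitary_weil = unitary_char q field_type \<phi> \<gamma> + mat_irr_char "GU_mat q N" \<chi> N
  for q :: nat and field_type :: "'a::{field,finite} itself" and \<phi> \<gamma> and \<chi> :: "'a mat \<Rightarrow> complex" and N
begin

abbreviation "GG \<equiv> GU_mat q N :: 'a mat monoid"

definition b1 :: "(nat \<Rightarrow> 'a) \<Rightarrow> (nat \<Rightarrow> 'a) \<Rightarrow> complex" where
  "b1 u v = \<phi> (\<gamma> * h N u v)"

lemma b1_add: "b1 (u + v) w = b1 u w * b1 v w" "b1 w (u + v) = b1 w u * b1 w v"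
  by (simp_all add: b1_def h_add distrib_left phi_add)

sublocale V: twisted "vecs N" b1
  by unfold_locales (auto simp: card_vecs b1_add, auto simp: b1_def phi_norm)

definition kk :: "'a mat \<Rightarrow> nat" where "kk x = kernel_dim (x - 1\<^sub>m N)"

text \<open>This is tau(x)/tau(1), the normalised trace of the Weil operator of x.\<close>

definition w1 :: "'a mat \<Rightarrow> complex" where
  "w1 x = (- of_nat q) ^ kk x / (- of_nat q) ^ N"

definition pre :: "'a mat \<Rightarrow> (nat \<Rightarrow> 'a) \<Rightarrow> nat \<Rightarrow> 'a" where
  "pre x y = (SOME v. v \<in> vecs N \<and> y = v - mv x v)"

text \<open>Coefficients of the Weil operator of x. The phase at y = v - x v is independent of the
  choice of v (\<open>W1_val\<close>), because vectors fixed by x are orthogonal to the image of 1 -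
  x.\<close>

definition W1 :: "'a mat \<Rightarrow> (nat \<Rightarrow> 'a) \<Rightarrow> complex" where
  "W1 x y = (if y \<in> imn x then w1 x * b1 y (pre x y) else 0)"

lemma q_pos [simp]: "q > 0" using q_gt_1 by simp

lemma q2_power_inject: "(q\<^sup>2) ^ a = (q\<^sup>2) ^ b \<longleftrightarrow> a = b"
  using q_gt_1 one_less_power[of q 2] by (simp only: power_inject_exp zero_less_numeral)

lemma w1_nonzero [simp]: "w1 x \<noteq> 0" by (simp add: w1_def)

lemma w1_cnj [simp]: "cnj (w1 x) = w1 x" by (simp add: w1_def)

lemma fixn_kk: "x \<in> carrier GG \<Longrightarrow> fixn x = (q\<^sup>2) ^ kk x"
  by (simp add: fixn_power card_field kk_def)

lemma kk_class:
  assumes "x \<in> carrier GG" "y \<in> carrier GG"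
  shows "kk (x \<otimes>\<^bsub>GG\<^esub> y) = kk (y \<otimes>\<^bsub>GG\<^esub> x)"
proof -
  have "(q\<^sup>2) ^ kk (x \<otimes>\<^bsub>GG\<^esub> y) = (q\<^sup>2) ^ kk (y \<otimes>\<^bsub>GG\<^esub> x)"
    using fixn_class[OF assms] assms by (simp add: fixn_kk)
  then show ?thesis by (simp only: q2_power_inject)
qed

lemma kk_inv:
  assumes x: "x \<in> carrier GG"
  shows "kk (inv\<^bsub>GG\<^esub> x) = kk x"
proof -
  have "{v \<in> vecs N. mv (inv\<^bsub>GG\<^esub> x) v = v} = {v \<in> vecs N. mv x v = v}"
    using mvG_inv[OF x] by (auto, metis, metis)
  then have "(q\<^sup>2) ^ kk (inv\<^bsub>GG\<^esub> x) = (q\<^sup>2) ^ kk x"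
    using x by (simp add: fixn_kk[symmetric]) (simp add: fixn_def)
  then show ?thesis by (simp only: q2_power_inject)
qed

lemma GG_h: "x \<in> carrier GG \<Longrightarrow> h N (mv x u) (mv x v) = h N u v"
  by (rule GU_preserves)

lemma preD:
  assumes "y \<in> imn x"
  shows "pre x y \<in> vecs N" "y = pre x y - mv x (pre x y)"
proof -
  have "\<exists>v. v \<in> vecs N \<and> y = v - mv x v" using assms by (auto simp: imn_def)
  then have "pre x y \<in> vecs N \<and> y = pre x y - mv x (pre x y)" unfolding pre_def by (rule someI_ex)
  then show "pre x y \<in> vecs N" "y = pre x y - mv x (pre x y)" by blast+
qed

lemma W1_val:
  assumes x: "x \<in> carrier GG" and v: "v \<in> vecs N"
  shows "W1 x (v - mv x v) = w1 x * b1 (v - mv x v) v"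
proof -
  let ?y = "v - mv x v"
  have y: "?y \<in> imn x" by (rule imnI[OF v])
  let ?d = "pre x ?y - v"
  have d: "mv x ?d = ?d" using preD(2)[OF y] by (simp add: mv_diff algebra_simps)
  have "h N ?y ?d = h N v ?d - h N (mv x v) (mv x ?d)" by (simp only: h_diff(1) d)
  then have "h N ?y ?d = 0" by (simp only: GG_h[OF x] diff_self)
  then have "h N ?y (pre x ?y) = h N ?y v" by (simp add: h_diff(2))
  then show ?thesis using y by (simp add: W1_def b1_def)
qed

lemma W1_0: "x \<in> carrier GG \<Longrightarrow> W1 x 0 = w1 x"
  using W1_val[of x 0] by (simp add: b1_def)

lemma W1_outside: "y \<notin> imn x \<Longrightarrow> W1 x y = 0"
  by (simp add: W1_def)

text \<open>The relation that characterises the Weil operator of x up to a scalar: it carries the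
  point a of the algebra to the point x a.\<close>

definition intertwines :: "'a mat \<Rightarrow> ((nat \<Rightarrow> 'a) \<Rightarrow> complex) \<Rightarrow> bool" where
  "intertwines x f \<longleftrightarrow> (\<forall>a\<in>vecs N. \<forall>z\<in>vecs N. V.conv f (V.pt a) z = V.conv (V.pt (mv x a)) f z)"

lemma intertwinesD:
  assumes "x \<in> carrier GG" "intertwines x f" "a \<in> vecs N" "z \<in> vecs N"
  shows "f (z - a) * b1 (z - a) a = f (z - mv x a) * b1 (mv x a) (z - mv x a)"
  using assms V.conv_pt(1)[OF assms(4,3), of f] V.conv_pt(2)[OF mvG_in[OF assms(1)], of a f z]
  by (simp add: intertwines_def)

lemma W1_intertwines:
  assumes x: "x \<in> carrier GG"
  shows "intertwines x (W1 x)"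
  unfolding intertwines_def
proof (intro ballI)
  fix a z :: "nat \<Rightarrow> 'a" assume a: "a \<in> vecs N" and z: "z \<in> vecs N"
  have xa: "mv x a \<in> vecs N" using x by (rule mvG_in)
  have e: "z - mv x a = (z - a) + (a - mv x a)" by simp
  have "W1 x (z - a) * b1 (z - a) a = W1 x (z - mv x a) * b1 (mv x a) (z - mv x a)"
  proof (cases "z - a \<in> imn x")
    case False
    moreover have "z - mv x a \<notin> imn x"
    proof
      assume "z - mv x a \<in> imn x"
      then have "(z - mv x a) - (a - mv x a) \<in> imn x" by (rule is_subspaceD(5)[OF is_subspace_imn _ imnI[OF a]])
      then show False using False by simp
    qed
    ultimately show ?thesis by (simp add: W1_outside)
  next
    case True
    then obtain v where v: "v \<in> vecs N" "z - a = v - mv x v" by (auto simp: imn_def)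
    have va: "v + a \<in> vecs N" using v a by blast
    have e2: "z - mv x a = (v + a) - mv x (v + a)" using v(2) by (simp add: mv_add algebra_simps)
    have "h N (v - mv x v) v + h N (v - mv x v) a = h N ((v + a) - mv x (v + a)) (v + a) + h N (mv x a) ((v + a) - mv x (v + a))"
    proof -
      have "h N (mv x a) (mv x v) = h N a v" "h N (mv x a) (mv x a) = h N a a" by (simp_all only: GG_h[OF x])
      then show ?thesis by (simp add: mv_add h_add h_diff algebra_simps)
    qed
    then have "b1 (v - mv x v) v * b1 (v - mv x v) a = b1 ((v + a) - mv x (v + a)) (v + a) * b1 (mv x a) ((v + a) - mv x (v + a))"
      unfolding b1_def phi_add[symmetric] distrib_left[symmetric] by simp
    then show ?thesis
      unfolding v(2) e2 W1_val[OF x v(1)] W1_val[OF x va] by (simp only: mult.assoc)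
  qed
  then show "V.conv (W1 x) (V.pt a) z = V.conv (V.pt (mv x a)) (W1 x) z"
    using V.conv_pt(1)[OF z a] V.conv_pt(2)[OF xa] by simp
qed

text \<open>By unitarity, vectors orthogonal to the image of 1 - x are fixed by x; by nondegeneracy
  they detect everything outside that image.\<close>

lemma fixed_perp_imn:
  assumes x: "x \<in> carrier GG" and y: "y \<in> vecs N" "y \<notin> imn x"
  shows "\<exists>w\<in>vecs N. mv x w = w \<and> h N y w \<noteq> 0"
proof -
  have fin: "finite (imn x)" by (rule finite_subspace[OF imn_sub[OF x]])
  obtain n u where u: "lspan n u = imn x" using subspace_basis[OF is_subspace_imn fin] by metis
  have uv: "u a \<in> vecs N" if "a < n" for a using lspan_member[OF that, of u] u imn_sub[OF x] by auto
  have ns: "\<nexists>b. y = lc n u b" using y(2) unfolding u[symmetric] lspan_iff by blast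
  have "\<exists>w\<in>perp N n u. h N w y \<noteq> 0" by (rule perp_detects[OF y(1) _ ns]) (rule uv)
  then obtain w where w: "w \<in> perp N n u" "h N w y \<noteq> 0" by (rule bexE)
  have wN: "w \<in> vecs N" and wu: "\<And>a. a < n \<Longrightarrow> h N w (u a) = 0" using w by auto
  have hl: "h N w (lc n u b) = 0" for b
    using wu
  proof (induction n)
    case 0
    have e: "lc 0 u b = 0" by (simp add: lc_def zero_fun_def)
    show ?case unfolding e by (rule h_0)
  next
    case (Suc n)
    have e: "lc (Suc n) u b = lc n u b + smul (b n) (u n)" by (simp add: lc_def smul_def fun_eq_iff)
    show ?case unfolding e h_add(2) h_smul(2) using Suc by simp
  qed
  have perp: "h N w (v - mv x v) = 0" if vN: "v \<in> vecs N" for v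
  proof -
    obtain b where "v - mv x v = lc n u b" using imnI[OF vN, of x] unfolding u[symmetric] lspan_iff by (rule exE)
    then show ?thesis by (simp only: hl)
  qed
  have "mv (inv\<^bsub>GG\<^esub> x) w - w = 0"
  proof (rule h_nondeg)
    show "mv (inv\<^bsub>GG\<^esub> x) w - w \<in> vecs N" using wN mvG_in[OF inv_closed[OF x]] by (intro vecs_diff)
    fix v :: "nat \<Rightarrow> 'a" assume v: "v \<in> vecs N"
    have "h N (mv (inv\<^bsub>GG\<^esub> x) w) v = h N (mv x (mv (inv\<^bsub>GG\<^esub> x) w)) (mv x v)" by (rule GG_h[OF x, symmetric])
    also have "\<dots> = h N w (mv x v)" by (simp only: mvG_inv(2)[OF x wN])
    also have "\<dots> = h N w v" using perp[OF v] by (simp add: h_diff)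
    finally show "h N (mv (inv\<^bsub>GG\<^esub> x) w - w) v = 0" by (simp add: h_diff)
  qed
  then have "mv x w = w" using mvG_inv(2)[OF x wN] by simp
  moreover have "h N y w \<noteq> 0" using w(2) h_sym[of N w y] by auto
  ultimately show ?thesis using wN by blast
qed

text \<open>Outside the image of 1 - x there is a fixed vector not orthogonal to z; a suitable
  multiple of it, found with \<open>phi_separates\<close>, does not commute with z in the algebra
  and forces f z = 0. On the image, the relation at a = v expresses f 0 through f z for z = v - x
  v.\<close>

lemma intertwiner_unique:
  assumes x: "x \<in> carrier GG" and f: "intertwines x f" and z: "z \<in> vecs N"
  shows "f z * w1 x = f 0 * W1 x z"
proof (cases "z \<in> imn x")
  case False
  obtain w where w: "w \<in> vecs N" "mv x w = w" "h N z w \<noteq> 0" using fixed_perp_imn[OF x z False] by blast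
  let ?s = "h N z w"
  obtain u where u: "\<phi> ((\<gamma> - \<gamma> ^ q) * ?s * u) \<noteq> 1"
    using phi_separates[of "(\<gamma> - \<gamma> ^ q) * ?s"] gamma w(3) by auto
  let ?w = "smul (u ^ q) w"
  have wv: "?w \<in> vecs N" using w(1) by blast
  have "f (z + ?w - ?w) * b1 (z + ?w - ?w) ?w = f (z + ?w - mv x ?w) * b1 (mv x ?w) (z + ?w - mv x ?w)"
    by (rule intertwinesD[OF x f wv]) (use z wv in blast)
  then have "f z * b1 z ?w = f z * b1 ?w z" by (simp add: mv_smul w(2))
  moreover have "b1 z ?w \<noteq> b1 ?w z"
  proof
    assume eq: "b1 z ?w = b1 ?w z"
    have z1: "h N z ?w = ?s * u" by (simp add: h_smul mult.commute)
    have z2: "h N ?w z = (?s * u) ^ q" using h_sym[of N ?w z] z1 by simp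
    have "\<phi> (\<gamma> * (?s * u) - \<gamma> * (?s * u) ^ q) = 1"
      using eq unfolding b1_def z1 z2 phi_diff by simp
    then show False using u unfolding phi_gamma_sym by (simp add: mult.assoc)
  qed
  ultimately have "f z = 0" by simp
  then show ?thesis using False by (simp add: W1_outside)
next
  case True
  then obtain v where v: "v \<in> vecs N" "z = v - mv x v" by (auto simp: imn_def)
  have "f (v - v) * b1 (v - v) v = f z * b1 (mv x v) z"
    unfolding v(2) by (rule intertwinesD[OF x f v(1) v(1)])
  then have e: "f 0 = f z * b1 (mv x v) z" by simp
  have "h N (mv x v) z + h N z v = 0"
  proof -
    have "h N (mv x v) (mv x v) = h N v v" by (rule GG_h[OF x])
    then show ?thesis by (simp add: v(2) h_diff)
  qed
  then have "b1 (mv x v) z * b1 z v = 1" unfolding b1_def phi_add[symmetric] distrib_left[symmetric] by simp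
  then show ?thesis using W1_val[OF x v(1)] unfolding v(2)[symmetric] e
    by (simp add: mult.assoc mult.left_commute[of "b1 (mv x v) z"])
qed

lemma intertwines_conv:
  assumes x: "x \<in> carrier GG" and y: "y \<in> carrier GG" and f: "intertwines x f" and g: "intertwines y g"
  shows "intertwines (x \<otimes>\<^bsub>GG\<^esub> y) (V.conv f g)"
  unfolding intertwines_def
proof (intro ballI)
  fix a z :: "nat \<Rightarrow> 'a" assume a: "a \<in> vecs N" and z: "z \<in> vecs N"
  have ya: "mv y a \<in> vecs N" using y by (rule mvG_in)
  have "V.conv (V.conv f g) (V.pt a) z = V.conv f (V.conv g (V.pt a)) z" by (rule V.conv_assoc)
  also have "\<dots> = V.conv f (V.conv (V.pt (mv y a)) g) z"
    by (rule V.conv_cong[OF z]) (use g a in \<open>simp_all add: intertwines_def\<close>)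
  also have "\<dots> = V.conv (V.conv f (V.pt (mv y a))) g z" by (rule V.conv_assoc[symmetric])
  also have "\<dots> = V.conv (V.conv (V.pt (mv x (mv y a))) f) g z"
    by (rule V.conv_cong[OF z]) (use f ya in \<open>simp_all add: intertwines_def\<close>)
  also have "\<dots> = V.conv (V.pt (mv (x \<otimes>\<^bsub>GG\<^esub> y) a)) (V.conv f g) z"
    by (simp only: V.conv_assoc mvG_mult[OF x y])
  finally show "V.conv (V.conv f g) (V.pt a) z = V.conv (V.pt (mv (x \<otimes>\<^bsub>GG\<^esub> y) a)) (V.conv f g) z" .
qed

lemma W1_star:
  assumes x: "x \<in> carrier GG" and z: "z \<in> vecs N"
  shows "V.star (W1 x) z = W1 (inv\<^bsub>GG\<^esub> x) z"
proof -
  let ?i = "inv\<^bsub>GG\<^esub> x"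
  have i: "?i \<in> carrier GG" using x by simp
  have w: "w1 ?i = w1 x" by (simp add: w1_def kk_inv[OF x])
  have im: "z \<in> imn ?i \<longleftrightarrow> - z \<in> imn x"
  proof
    assume "z \<in> imn ?i"
    then obtain v where v: "v \<in> vecs N" "z = v - mv ?i v" by (auto simp: imn_def)
    have "- z = mv ?i v - mv x (mv ?i v)" using v mvG_inv(2)[OF x v(1)] by simp
    then show "- z \<in> imn x" using imnI[OF mvG_in[OF i]] by metis
  next
    assume "- z \<in> imn x"
    then obtain v where v: "v \<in> vecs N" "- z = v - mv x v" by (auto simp: imn_def)
    have "z = mv x v - v" using v(2) by (metis minus_diff_eq minus_minus)
    then have "z = mv x v - mv ?i (mv x v)" using mvG_inv(1)[OF x v(1)] by simp
    then show "z \<in> imn ?i" using imnI[OF mvG_in[OF x]] by metis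
  qed
  show ?thesis
  proof (cases "- z \<in> imn x")
    case False
    then show ?thesis using im by (simp add: V.star_def W1_outside)
  next
    case True
    then obtain v where v: "v \<in> vecs N" "- z = v - mv x v" by (auto simp: imn_def)
    have z': "z = mv x v - mv ?i (mv x v)"
      using v(2) mvG_inv(1)[OF x v(1)] by (metis minus_diff_eq minus_minus)
    have "W1 ?i z = w1 x * b1 z (mv x v)"
      using W1_val[OF i mvG_in[OF x], of v] unfolding z'[symmetric] w .
    moreover have "V.star (W1 x) z = w1 x * (cnj (b1 (- z) v) * b1 z z)"
      using W1_val[OF x v(1)] unfolding V.star_def v(2)[symmetric] by (simp add: mult.assoc)
    moreover have "cnj (b1 (- z) v) * b1 z z = b1 z (mv x v)"
    proof -
      have "mv x v = v + z" using v(2) by (simp add: algebra_simps)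
      then show ?thesis by (simp add: b1_add V.beta_minus)
    qed
    ultimately show ?thesis by simp
  qed
qed

lemma norm_w1: "x \<in> carrier GG \<Longrightarrow> (cmod (w1 x))\<^sup>2 * real (card (imn x)) = 1"
proof -
  assume x: "x \<in> carrier GG"
  have c: "card (imn x) * (q\<^sup>2) ^ kk x = (q\<^sup>2) ^ N" using card_imn[OF x] by (simp add: fixn_kk[OF x] card_field)
  have "(cmod (w1 x))\<^sup>2 = real ((q\<^sup>2) ^ kk x) / real ((q\<^sup>2) ^ N)"
    by (simp add: w1_def norm_divide norm_power power_divide) (simp add: power_mult[symmetric] mult.commute)
  moreover have "card (imn x) > 0" by (rule ccontr) (use c q_gt_1 in simp)
  ultimately show ?thesis unfolding c[symmetric] by simp
qed

lemma W1_norm: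
  assumes x: "x \<in> carrier GG"
  shows "(\<Sum>z\<in>vecs N. (cmod (W1 x z))\<^sup>2) = 1"
proof -
  have "(\<Sum>z\<in>vecs N. (cmod (W1 x z))\<^sup>2) = (\<Sum>z\<in>imn x. (cmod (w1 x))\<^sup>2)"
    by (rule sum.mono_neutral_cong_right)
      (auto simp: card_vecs W1_outside imn_sub[OF x] W1_def norm_mult V.beta_norm dest: subsetD[OF imn_sub[OF x]])
  then show ?thesis using norm_w1[OF x] by (simp add: mult.commute)
qed

text \<open>A Gauss sum over the intersection of the images of 1 - x and 1 - y. The Wall form h(w,
  \<open>pre\<close> z) of either element and its conjugate transpose add up to h(w,z), by
  \<open>half\<close>; so the sum of the two Wall forms minus h, which is \<open>s\<close>, is
  skew-Hermitian there.\<close>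

lemma W1_conv_0:
  assumes x: "x \<in> carrier GG" and y: "y \<in> carrier GG"
  shows "\<exists>e. V.conv (W1 x) (W1 y) 0 = w1 x * w1 y * (- of_nat q) ^ e"
proof -
  let ?I = "imn x \<inter> imn y"
  have sub: "is_subspace ?I" using is_subspaceD[OF is_subspace_imn] by (auto simp: is_subspace_def)
  have IN: "?I \<subseteq> vecs N" using imn_sub[OF x] by blast
  define s where "s u z = h N u (pre x z + pre y z - z)" for u z
  have half: "h N w (pre g z) + (h N z (pre g w)) ^ q = h N w z"
    if g: "g \<in> carrier GG" "w \<in> imn g" "z \<in> imn g" for g w z
  proof -
    let ?u = "pre g w" and ?v = "pre g z"
    have e: "h N w ?v = h N (?u - mv g ?u) ?v" "(h N z ?u) ^ q = h N ?u (?v - mv g ?v)"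
      "h N w z = h N (?u - mv g ?u) (?v - mv g ?v)"
      using preD(2)[OF g(2)] preD(2)[OF g(3)] h_sym[of N ?u z] by simp_all
    have "h N (mv g ?u) (mv g ?v) = h N ?u ?v" by (rule GG_h[OF g(1)])
    then show ?thesis unfolding e by (simp add: h_diff)
  qed
  have "\<exists>e. (\<Sum>z\<in>?I. \<phi> (\<gamma> * s z z)) = (- of_nat q) ^ e"
  proof (rule gauss_sum_subspace[OF sub IN, where s = s])
    fix u w assume u: "u \<in> ?I" and w: "w \<in> ?I"
    have a: "h N w (pre x u) + (h N u (pre x w)) ^ q = h N w u"
      and b: "h N w (pre y u) + (h N u (pre y w)) ^ q = h N w u" using half x y u w by blast+
    have c: "h N w u = (h N u w) ^ q" by (rule h_sym)
    show "s w u = - (s u w ^ q)"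
      using a b unfolding s_def h_add h_diff frob_add frob_diff c[symmetric] by (simp add: algebra_simps)
  qed (simp_all add: s_def h_add h_smul)
  then obtain e where e: "(\<Sum>z\<in>?I. \<phi> (\<gamma> * s z z)) = (- of_nat q) ^ e" by blast
  have "V.conv (W1 x) (W1 y) 0 = (\<Sum>z\<in>?I. w1 x * w1 y * \<phi> (\<gamma> * s z z))"
    unfolding V.conv_at_0
  proof (rule sum.mono_neutral_cong_right)
    show "\<forall>z\<in>vecs N - ?I. W1 x z * W1 y (- z) * cnj (b1 z z) = 0"
    proof
      fix z assume "z \<in> vecs N - ?I"
      then have "z \<notin> imn x \<or> - z \<notin> imn y" using is_subspaceD(4)[OF is_subspace_imn, of "- z" y] by auto
      then show "W1 x z * W1 y (- z) * cnj (b1 z z) = 0" by (auto simp: W1_outside)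
    qed
    fix z assume z: "z \<in> ?I"
    have vy: "pre y z \<in> vecs N" "z = pre y z - mv y (pre y z)" using preD z by blast+
    have "mv y (- pre y z) = - mv y (pre y z)"
      using mv_smul[of y "- 1" "pre y z"] by (simp only: smul_minus_one)
    then have "- z = - pre y z - mv y (- pre y z)" using vy(2) by (metis minus_diff_eq minus_diff_minus)
    then have "W1 y (- z) = w1 y * b1 (- z) (- pre y z)"
      using W1_val[OF y vecs_uminus[OF vy(1)]] by metis
    also have "b1 (- z) (- pre y z) = b1 z (pre y z)" by (simp add: V.beta_minus)
    finally have wy: "W1 y (- z) = w1 y * b1 z (pre y z)" .
    have wx: "W1 x z = w1 x * b1 z (pre x z)" using z by (simp add: W1_def)
    have "W1 x z * W1 y (- z) * cnj (b1 z z) = w1 x * w1 y * (b1 z (pre x z) * b1 z (pre y z) * cnj (b1 z z))"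
      unfolding wx wy by (simp only: mult_ac)
    also have "b1 z (pre x z) * b1 z (pre y z) * cnj (b1 z z) = \<phi> (\<gamma> * s z z)"
      by (simp add: s_def b1_def[symmetric] V.beta_diff b1_add)
    finally show "W1 x z * W1 y (- z) * cnj (b1 z z) = w1 x * w1 y * \<phi> (\<gamma> * s z z)" .
  qed (use IN in \<open>auto simp: card_vecs\<close>)
  also have "\<dots> = w1 x * w1 y * (- of_nat q) ^ e" unfolding sum_distrib_left[symmetric] e ..
  finally show ?thesis by blast
qed

text \<open>The product intertwines the identity and is thus a multiple of \<open>pt 0\<close>;
  \<open>W1_norm\<close> fixes the multiple.\<close>

lemma W1_inverse:
  assumes y: "y \<in> carrier GG" and z: "z \<in> vecs N"
  shows "V.conv (W1 y) (V.star (W1 y)) z = V.pt 0 z"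
proof -
  let ?i = "inv\<^bsub>GG\<^esub> y"
  have i: "?i \<in> carrier GG" using y by simp
  have eq: "V.conv (W1 y) (V.star (W1 y)) u = V.conv (W1 y) (W1 ?i) u" if "u \<in> vecs N" for u
    by (rule V.conv_cong[OF that]) (simp_all add: W1_star[OF y])
  have int: "intertwines (y \<otimes>\<^bsub>GG\<^esub> ?i) (V.conv (W1 y) (W1 ?i))"
    by (intro intertwines_conv y i W1_intertwines)
  have one: "y \<otimes>\<^bsub>GG\<^esub> ?i = \<one>\<^bsub>GG\<^esub>" using y by simp
  have at0: "V.conv (W1 y) (W1 ?i) 0 = 1"
    using V.conv_star_0[of "W1 y"] W1_norm[OF y] eq[of 0] by simp
  have "V.conv (W1 y) (W1 ?i) z * w1 \<one>\<^bsub>GG\<^esub> = W1 \<one>\<^bsub>GG\<^esub> z"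
    using intertwiner_unique[OF one_closed _ z, of "V.conv (W1 y) (W1 ?i)"] int unfolding one at0 by simp
  moreover have "W1 \<one>\<^bsub>GG\<^esub> z = w1 \<one>\<^bsub>GG\<^esub> * V.pt 0 z"
  proof -
    have "imn \<one>\<^bsub>GG\<^esub> = {0}" unfolding imn_def using vecs_0(1)[of N] by (auto simp: mvG_one)
    then show ?thesis using W1_0[OF one_closed] W1_outside[of z "\<one>\<^bsub>GG\<^esub>"] by (cases "z = 0") (auto simp: V.pt_def)
  qed
  ultimately show ?thesis using eq[OF z] by simp
qed

text \<open>Both sides intertwine the same translations, so they are proportional. The factor has modulus one,
  and comparing coefficients at zero (a Gauss sum) it is a power of \<open>- q\<close>; hence it is one.\<close>

lemma W1_mult:
  assumes x: "x \<in> carrier GG" and y: "y \<in> carrier GG" and z: "z \<in> vecs N"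
  shows "V.conv (W1 x) (W1 y) z = W1 (x \<otimes>\<^bsub>GG\<^esub> y) z"
proof -
  let ?f = "V.conv (W1 x) (W1 y)"
  let ?xy = "x \<otimes>\<^bsub>GG\<^esub> y"
  have xy: "?xy \<in> carrier GG" using x y by simp
  obtain e where e: "?f 0 = w1 x * w1 y * (- of_nat q) ^ e" using W1_conv_0[OF x y] by blast
  have un: "?f u * w1 ?xy = ?f 0 * W1 ?xy u" if "u \<in> vecs N" for u
    by (rule intertwiner_unique[OF xy intertwines_conv[OF x y W1_intertwines[OF x] W1_intertwines[OF y]] that])
  have "V.conv ?f (V.star ?f) 0 = 1"
  proof -
    have "V.conv ?f (V.star ?f) 0 = V.conv ?f (V.conv (V.star (W1 y)) (V.star (W1 x))) 0"
      by (rule V.conv_cong) (simp_all add: V.conv_star)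
    also have "\<dots> = V.conv (W1 x) (V.conv (V.conv (W1 y) (V.star (W1 y))) (V.star (W1 x))) 0"
      by (simp only: V.conv_assoc_fun)
    also have "\<dots> = V.conv (W1 x) (V.conv (V.pt 0) (V.star (W1 x))) 0"
      by (intro V.conv_cong) (simp_all add: W1_inverse[OF y])
    also have "\<dots> = V.conv (W1 x) (V.star (W1 x)) 0"
      by (rule V.conv_cong) (simp_all add: V.conv_pt(2))
    also have "\<dots> = 1" using W1_inverse[OF x, of 0] by (simp add: V.pt_def)
    finally show ?thesis .
  qed
  then have nf: "(\<Sum>u\<in>vecs N. (cmod (?f u))\<^sup>2) = 1" unfolding V.conv_star_0 by (simp only: of_real_eq_1_iff)
  have "(\<Sum>u\<in>vecs N. (cmod (?f u))\<^sup>2) * (cmod (w1 ?xy))\<^sup>2 = (cmod (?f 0))\<^sup>2 * (\<Sum>u\<in>vecs N. (cmod (W1 ?xy u))\<^sup>2)"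
    unfolding sum_distrib_left sum_distrib_right power_mult_distrib[symmetric] norm_mult[symmetric]
    by (intro sum.cong refl) (simp add: un)
  then have "(cmod (w1 ?xy))\<^sup>2 = (cmod (?f 0))\<^sup>2" by (simp only: nf W1_norm[OF xy] mult_1_left mult_1_right)
  then have nn: "cmod (w1 ?xy) = cmod (?f 0)" by simp
  let ?q = "- of_nat q :: complex"
  have f0: "?f 0 * (?q ^ N * ?q ^ N) = ?q ^ (kk x + kk y + e)"
    unfolding e w1_def by (simp add: power_add)
  have w0: "w1 ?xy * (?q ^ N * ?q ^ N) = ?q ^ (kk ?xy + N)"
    unfolding w1_def by (simp add: power_add)
  have "cmod (?q ^ (kk x + kk y + e)) = cmod (?q ^ (kk ?xy + N))"
    unfolding f0[symmetric] w0[symmetric] norm_mult nn ..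
  then have "real q ^ (kk x + kk y + e) = real q ^ (kk ?xy + N)" by (simp add: norm_power)
  \<comment> \<open>Equal moduli give equal exponents of -q, and so equal signs as well.\<close>
  then have "kk x + kk y + e = kk ?xy + N" using q_gt_1 by (simp add: power_inject_exp)
  then have "?f 0 * (?q ^ N * ?q ^ N) = w1 ?xy * (?q ^ N * ?q ^ N)" using f0 w0 by simp
  then have "?f 0 = w1 ?xy" using q_gt_1 by simp
  then show ?thesis using un[OF z] by simp
qed

lemma W1_conj:
  assumes g: "g \<in> carrier GG" and x: "x \<in> carrier GG" and y: "y \<in> vecs N"
  shows "W1 (g \<otimes>\<^bsub>GG\<^esub> x \<otimes>\<^bsub>GG\<^esub> inv\<^bsub>GG\<^esub> g) (mv g y) = W1 x y"
proof -
  let ?x = "g \<otimes>\<^bsub>GG\<^esub> x \<otimes>\<^bsub>GG\<^esub> inv\<^bsub>GG\<^esub> g"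
  have xc: "?x \<in> carrier GG" using g x by simp
  have act: "mv ?x (mv g v) = mv g (mv x v)" if "v \<in> vecs N" for v
    using that g x by (simp only: mvG_mult mvG_inv m_closed inv_closed)
  have "kk ?x = kk (inv\<^bsub>GG\<^esub> g \<otimes>\<^bsub>GG\<^esub> (g \<otimes>\<^bsub>GG\<^esub> x))" using g x by (intro kk_class) auto
  then have w: "w1 ?x = w1 x" using g x by (simp add: w1_def m_assoc[symmetric])
  show ?thesis
  proof (cases "y \<in> imn x")
    case True
    then obtain v where v: "v \<in> vecs N" "y = v - mv x v" by (auto simp: imn_def)
    have gy: "mv g y = mv g v - mv ?x (mv g v)" by (simp add: v(2) mv_diff act[OF v(1)])
    have "W1 ?x (mv g y) = w1 ?x * b1 (mv g y) (mv g v)"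
      using W1_val[OF xc mvG_in[OF g], of v] unfolding gy[symmetric] .
    also have "\<dots> = W1 x y" using W1_val[OF x v(1)] unfolding v(2)[symmetric] by (simp add: w b1_def GG_h[OF g])
    finally show ?thesis .
  next
    case False
    have "mv g y \<notin> imn ?x"
    proof
      assume "mv g y \<in> imn ?x"
      then obtain v where v: "v \<in> vecs N" "mv g y = v - mv ?x v" by (auto simp: imn_def)
      let ?v = "mv (inv\<^bsub>GG\<^esub> g) v"
      have vv: "?v \<in> vecs N" using g by (intro mvG_in) simp
      have "mv g y = mv g ?v - mv ?x (mv g ?v)" using v by (simp only: mvG_inv(2)[OF g v(1)])
      then have "mv g y = mv g (?v - mv x ?v)" by (simp only: act[OF vv] mv_diff)
      then have "y = ?v - mv x ?v"
        using mvG_inv(1)[OF g y] mvG_inv(1)[OF g vecs_diff[OF vv mvG_in[OF x]]] by metis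
      then show False using imnI[OF vv, of x] False by simp
    qed
    then show ?thesis using False by (simp add: W1_outside)
  qed
qed

end

section \<open>Tensor powers of the Weil representation\<close>

lemma sum_prod_tuples:
  fixes f :: "nat \<Rightarrow> (nat \<Rightarrow> 'a::{field,finite}) \<Rightarrow> complex"
  shows "(\<Sum>X\<in>tuples N j. \<Prod>a<j. f a (X a)) = (\<Prod>a<j. \<Sum>x\<in>vecs N. f a x)"
proof -
  have "(\<Prod>a<j. \<Sum>x\<in>vecs N. f a x) = (\<Sum>g\<in>{..<j} \<rightarrow>\<^sub>E vecs N. \<Prod>a<j. f a (g a))"
    by (rule prod_sum_PiE) (auto simp: card_vecs)
  also have "\<dots> = (\<Sum>X\<in>tuples N j. \<Prod>a<j. f a (X a))"
  proof (rule sum.reindex_bij_witness[of _ "\<lambda>X. restrict X {..<j}" "\<lambda>g a. if a < j then g a else (\<lambda>_. 0)"])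
    fix g :: "nat \<Rightarrow> nat \<Rightarrow> 'a" assume g: "g \<in> {..<j} \<rightarrow>\<^sub>E vecs N"
    show "restrict (\<lambda>a. if a < j then g a else (\<lambda>_. 0)) {..<j} = g"
    proof
      fix a show "restrict (\<lambda>a. if a < j then g a else (\<lambda>_. 0)) {..<j} a = g a"
        using PiE_arb[OF g, of a] by (simp add: restrict_def)
    qed
    show "(\<lambda>a. if a < j then g a else (\<lambda>_. 0)) \<in> tuples N j"
      using PiE_mem[OF g] by (simp add: tuples_alt)
    show "(\<Prod>a<j. f a ((\<lambda>a. if a < j then g a else (\<lambda>_. 0)) a)) = (\<Prod>a<j. f a (g a))"
      by (rule prod.cong) auto
  next
    fix X :: "nat \<Rightarrow> nat \<Rightarrow> 'a" assume X: "X \<in> tuples N j"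
    show "(\<lambda>a. if a < j then restrict X {..<j} a else (\<lambda>_. 0)) = X"
    proof
      fix a show "(if a < j then restrict X {..<j} a else (\<lambda>_. 0)) = X a"
        using tuplesD(2)[OF X, of a] by simp
    qed
    show "restrict X {..<j} \<in> {..<j} \<rightarrow>\<^sub>E vecs N" using tuplesD(1)[OF X] by auto
  qed
  finally show ?thesis by simp
qed

lemma tuples_eval: "(X + Y) a = X a + Y a" "(X - Y) a = X a - Y a" "(- X) a = - X a" "(0 :: nat \<Rightarrow> nat \<Rightarrow> 'a) a = 0"
  for X Y :: "nat \<Rightarrow> nat \<Rightarrow> 'a::field"
  by simp_all

text \<open>The constant sign of a power of tau is stripped off. The relation for j - 2 is asked for
  when j \<ge> 2, the case in which F^j can contain nonzero isotropic vectors.\<close>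

locale unitary_level = unitary_weil q field_type \<phi> \<gamma> \<chi> N
  for q :: nat and field_type :: "'a::{field,finite} itself" and \<phi> \<gamma> and \<chi> :: "'a mat \<Rightarrow> complex" and N +
  fixes j :: nat
  assumes j_pos: "j > 0"
    and level_nonzero: "(\<Sum>x\<in>carrier (GU_mat q N). cnj (\<chi> x) * (- of_nat q) ^ (kernel_dim (x - 1\<^sub>m N) * j)) \<noteq> 0"
    and level_below: "j \<ge> 2 \<Longrightarrow> (\<Sum>x\<in>carrier (GU_mat q N). cnj (\<chi> x) * (- of_nat q) ^ (kernel_dim (x - 1\<^sub>m N) * (j - 2))) = 0"
begin

abbreviation "VV \<equiv> tuples N j :: (nat \<Rightarrow> nat \<Rightarrow> 'a) set"

definition bT :: "(nat \<Rightarrow> nat \<Rightarrow> 'a) \<Rightarrow> (nat \<Rightarrow> nat \<Rightarrow> 'a) \<Rightarrow> complex" where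
  "bT X Y = (\<Prod>a<j. b1 (X a) (Y a))"

sublocale T: twisted VV bT
proof
  show "bT (u + v) w = bT u w * bT v w" "bT w (u + v) = bT w u * bT w v" for u v w
    unfolding bT_def tuples_eval b1_add by (rule prod.distrib)+
  show "cmod (bT u v) = 1" for u v
    unfolding bT_def by (simp add: prod_norm[symmetric] V.beta_norm)
qed (auto simp: card_tuples)

definition WW :: "'a mat \<Rightarrow> (nat \<Rightarrow> nat \<Rightarrow> 'a) \<Rightarrow> complex" where
  "WW x X = (\<Prod>a<j. W1 x (X a))"

text \<open>The image in the twisted group algebra of \<open>V\<^sup>j\<close> of \<open>\<Sum>x. cnj (\<chi> x) x\<close>.\<close>

definition cc :: "(nat \<Rightarrow> nat \<Rightarrow> 'a) \<Rightarrow> complex" where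
  "cc X = (\<Sum>x\<in>carrier GG. cnj (\<chi> x) * WW x X)"

lemma WW_mult:
  assumes x: "x \<in> carrier GG" and y: "y \<in> carrier GG" and Z: "Z \<in> VV"
  shows "T.conv (WW x) (WW y) Z = WW (x \<otimes>\<^bsub>GG\<^esub> y) Z"
proof -
  have "T.conv (WW x) (WW y) Z = (\<Sum>X\<in>VV. \<Prod>a<j. W1 x (X a) * W1 y (Z a - X a) * b1 (X a) (Z a - X a))"
    unfolding T.conv_def WW_def bT_def tuples_eval by (simp only: prod.distrib)
  also have "\<dots> = (\<Prod>a<j. V.conv (W1 x) (W1 y) (Z a))"
    unfolding V.conv_def by (rule sum_prod_tuples)
  also have "\<dots> = WW (x \<otimes>\<^bsub>GG\<^esub> y) Z"
    unfolding WW_def by (intro prod.cong refl W1_mult x y tuplesD(1)[OF Z])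
  finally show ?thesis .
qed

lemma WW_star:
  assumes x: "x \<in> carrier GG" and Z: "Z \<in> VV"
  shows "T.star (WW x) Z = WW (inv\<^bsub>GG\<^esub> x) Z"
proof -
  have "T.star (WW x) Z = (\<Prod>a<j. V.star (W1 x) (Z a))"
    unfolding T.star_def V.star_def WW_def bT_def tuples_eval by (simp add: prod.distrib)
  also have "\<dots> = WW (inv\<^bsub>GG\<^esub> x) Z"
    unfolding WW_def by (intro prod.cong refl W1_star x tuplesD(1)[OF Z])
  finally show ?thesis .
qed

lemma WW_0: "x \<in> carrier GG \<Longrightarrow> WW x 0 = w1 x ^ j"
  unfolding WW_def tuples_eval by (simp add: W1_0)

lemma cc_conv:
  assumes Z: "Z \<in> VV"
  shows "T.conv cc cc Z = of_real \<kappa> * cc Z"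
proof -
  have "T.conv cc cc Z = (\<Sum>x\<in>carrier GG. cnj (\<chi> x) * (\<Sum>y\<in>carrier GG. cnj (\<chi> y) * WW (x \<otimes>\<^bsub>GG\<^esub> y) Z))"
    unfolding cc_def[abs_def] T.conv_linear using WW_mult[OF _ _ Z]
    by (intro sum.cong refl arg_cong2[of _ _ _ _ "(*)"]) simp
  also have "\<dots> = (\<Sum>x\<in>carrier GG. \<Sum>y\<in>carrier GG. cnj (\<chi> x) * cnj (\<chi> (inv\<^bsub>GG\<^esub> x \<otimes>\<^bsub>GG\<^esub> y)) * WW y Z)"
  proof (rule sum.cong[OF refl])
    fix x assume x: "x \<in> carrier GG"
    have "(\<Sum>y\<in>carrier GG. cnj (\<chi> y) * WW (x \<otimes>\<^bsub>GG\<^esub> y) Z) =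
        (\<Sum>y\<in>carrier GG. cnj (\<chi> (inv\<^bsub>GG\<^esub> x \<otimes>\<^bsub>GG\<^esub> (x \<otimes>\<^bsub>GG\<^esub> y))) * WW (x \<otimes>\<^bsub>GG\<^esub> y) Z)"
      using x by (intro sum.cong refl) (simp add: m_assoc[symmetric])
    also have "\<dots> = (\<Sum>y\<in>carrier GG. cnj (\<chi> (inv\<^bsub>GG\<^esub> x \<otimes>\<^bsub>GG\<^esub> y)) * WW y Z)"
      by (rule sum_left[OF x])
    finally show "cnj (\<chi> x) * (\<Sum>y\<in>carrier GG. cnj (\<chi> y) * WW (x \<otimes>\<^bsub>GG\<^esub> y) Z) =
        (\<Sum>y\<in>carrier GG. cnj (\<chi> x) * cnj (\<chi> (inv\<^bsub>GG\<^esub> x \<otimes>\<^bsub>GG\<^esub> y)) * WW y Z)"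
      by (simp only: sum_distrib_left mult.assoc)
  qed
  also have "\<dots> = (\<Sum>y\<in>carrier GG. \<Sum>x\<in>carrier GG. cnj (\<chi> x) * cnj (\<chi> (inv\<^bsub>GG\<^esub> x \<otimes>\<^bsub>GG\<^esub> y)) * WW y Z)"
    by (rule sum.swap)
  also have "\<dots> = (\<Sum>y\<in>carrier GG. of_real \<kappa> * cnj (\<chi> y) * WW y Z)"
    unfolding sum_distrib_right[symmetric] by (intro sum.cong refl) (simp only: chi_conv)
  finally show ?thesis by (simp only: cc_def sum_distrib_left mult.assoc)
qed

lemma cc_star:
  assumes Z: "Z \<in> VV"
  shows "T.star cc Z = cc Z"
proof -
  have "T.star cc Z = (\<Sum>x\<in>carrier GG. \<chi> x * T.star (WW x) Z)"
    unfolding T.star_def cc_def by (simp add: sum_distrib_right mult.assoc)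
  also have "\<dots> = (\<Sum>x\<in>carrier GG. cnj (\<chi> (inv\<^bsub>GG\<^esub> x)) * WW (inv\<^bsub>GG\<^esub> x) Z)"
    by (intro sum.cong refl) (simp add: WW_star[OF _ Z] chi_inv)
  also have "\<dots> = cc Z" unfolding cc_def by (rule sum_inv)
  finally show ?thesis .
qed

lemma cc_act:
  assumes g: "g \<in> carrier GG" and X: "X \<in> VV"
  shows "cc (act g X) = cc X"
proof -
  have "cc (act g X) = (\<Sum>x\<in>carrier GG. cnj (\<chi> (g \<otimes>\<^bsub>GG\<^esub> x \<otimes>\<^bsub>GG\<^esub> inv\<^bsub>GG\<^esub> g)) * WW (g \<otimes>\<^bsub>GG\<^esub> x \<otimes>\<^bsub>GG\<^esub> inv\<^bsub>GG\<^esub> g) (act g X))"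
    unfolding cc_def by (rule sum_conj[OF g, symmetric])
  also have "\<dots> = cc X"
    unfolding cc_def
  proof (intro sum.cong refl)
    fix x assume x: "x \<in> carrier GG"
    have "WW (g \<otimes>\<^bsub>GG\<^esub> x \<otimes>\<^bsub>GG\<^esub> inv\<^bsub>GG\<^esub> g) (act g X) = WW x X"
      unfolding WW_def act_def by (intro prod.cong refl W1_conj g x tuplesD(1)[OF X])
    then show "cnj (\<chi> (g \<otimes>\<^bsub>GG\<^esub> x \<otimes>\<^bsub>GG\<^esub> inv\<^bsub>GG\<^esub> g)) * WW (g \<otimes>\<^bsub>GG\<^esub> x \<otimes>\<^bsub>GG\<^esub> inv\<^bsub>GG\<^esub> g) (act g X) = cnj (\<chi> x) * WW x X"
      using g x by (simp add: chi_conj)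
  qed
  finally show ?thesis .
qed

definition c0 :: real where "c0 = Re (cc 0)"

text \<open>\<open>cc\<close> is self-adjoint with square \<kappa> \<open>cc\<close>, so its
  coefficient at zero is its squared norm divided by \<kappa>; it is nonzero because \<chi> occurs
  in tau^j.\<close>

lemma cc_0: "cc 0 = of_real c0" "c0 > 0" "(\<Sum>X\<in>VV. (cmod (cc X))\<^sup>2) = \<kappa> * c0"
proof -
  have "(\<Sum>x\<in>carrier GG. cnj (\<chi> x) * w1 x ^ j) = (\<Sum>x\<in>carrier GG. cnj (\<chi> x) * (- of_nat q) ^ (kk x * j)) / (- of_nat q) ^ (N * j)"
    unfolding sum_divide_distrib by (simp add: w1_def power_divide power_mult)
  then have "cc 0 = (\<Sum>x\<in>carrier GG. cnj (\<chi> x) * (- of_nat q) ^ (kk x * j)) / (- of_nat q) ^ (N * j)"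
    unfolding cc_def by (simp add: WW_0)
  then have nz: "cc 0 \<noteq> 0" using level_nonzero q_gt_1 by (simp add: kk_def)
  have "of_real (\<Sum>X\<in>VV. (cmod (cc X))\<^sup>2) = T.conv cc (T.star cc) 0" by (rule T.conv_star_0[symmetric])
  also have "\<dots> = T.conv cc cc 0" by (rule T.conv_cong) (simp_all add: cc_star)
  also have "\<dots> = of_real \<kappa> * cc 0" by (rule cc_conv) simp
  finally have e: "of_real (\<Sum>X\<in>VV. (cmod (cc X))\<^sup>2) = of_real \<kappa> * cc 0" .
  then have "cc 0 = of_real ((\<Sum>X\<in>VV. (cmod (cc X))\<^sup>2) / \<kappa>)" using kappa_pos by (simp add: field_simps)
  then have c0: "c0 = (\<Sum>X\<in>VV. (cmod (cc X))\<^sup>2) / \<kappa>" and 1: "cc 0 = of_real c0" by (simp_all add: c0_def)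
  show "cc 0 = of_real c0" by (rule 1)
  show "(\<Sum>X\<in>VV. (cmod (cc X))\<^sup>2) = \<kappa> * c0" using c0 kappa_pos by simp
  have "c0 \<ge> 0" unfolding c0 using kappa_pos by (intro divide_nonneg_pos sum_nonneg) auto
  moreover have "c0 \<noteq> 0" using nz 1 by auto
  ultimately show "c0 > 0" by simp
qed

lemma cmod_WW:
  assumes "x \<in> carrier GG"
  shows "cmod (WW x X) = (if \<forall>a<j. X a \<in> imn x then cmod (w1 x) ^ j else 0)"
proof (cases "\<forall>a<j. X a \<in> imn x")
  case True
  then have "cmod (WW x X) = (\<Prod>a<j. cmod (w1 x))"
    unfolding WW_def prod_norm[symmetric] by (intro prod.cong refl) (simp add: W1_def norm_mult V.beta_norm)
  then show ?thesis using True by simp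
next
  case False
  then obtain a where "a < j" "X a \<notin> imn x" by blast
  then have "WW x X = 0" unfolding WW_def by (intro prod_zero bexI[of _ a]) (simp_all add: W1_outside)
  then show ?thesis by (simp add: False)
qed

text \<open>Take the coefficient at zero of c times the Weil element of g. By
  \<open>chi_shift\<close> it is \<chi>(g)/\<chi>(1) times c(0). In its expansion over X, the term X
  = 0 is c(0) times the j-th power of \<open>w1 g\<close>; the others live on tuples with columns in
  the image of 1 - g and carry weights of the same modulus.\<close>

lemma ratio_error:
  assumes h: "g \<in> carrier GG"
  shows "cmod (\<chi> g / \<chi> \<one>\<^bsub>GG\<^esub> / w1 g ^ j - 1) * c0 \<le> (\<Sum>X\<in>{X \<in> VV. X \<noteq> 0 \<and> (\<forall>a<j. X a \<in> imn g)}. cmod (cc X))"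
proof -
  let ?I = "{X \<in> VV. X \<noteq> 0 \<and> (\<forall>a<j. X a \<in> imn g)}"
  have "T.conv cc (WW g) 0 = (\<Sum>x\<in>carrier GG. cnj (\<chi> x) * T.conv (WW x) (WW g) 0)"
    unfolding cc_def[abs_def] by (rule T.conv_linear)
  also have "\<dots> = (\<Sum>x\<in>carrier GG. cnj (\<chi> x) * w1 (x \<otimes>\<^bsub>GG\<^esub> g) ^ j)"
    using h by (intro sum.cong refl) (simp add: WW_mult WW_0)
  also have "\<dots> = \<chi> g / \<chi> \<one>\<^bsub>GG\<^esub> * (\<Sum>x\<in>carrier GG. cnj (\<chi> x) * w1 x ^ j)"
    using h by (intro chi_shift) (simp_all add: w1_def kk_class)
  also have "(\<Sum>x\<in>carrier GG. cnj (\<chi> x) * w1 x ^ j) = cc 0" unfolding cc_def by (simp add: WW_0)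
  finally have e1: "T.conv cc (WW g) 0 = \<chi> g / \<chi> \<one>\<^bsub>GG\<^esub> * of_real c0" by (simp only: cc_0(1))
  have "T.conv cc (WW g) 0 = of_real c0 * w1 g ^ j + (\<Sum>X\<in>VV - {0}. cc X * WW g (- X) * cnj (bT X X))"
    unfolding T.conv_at_0 by (subst sum.remove[of _ 0]) (simp_all add: card_tuples cc_0 WW_0[OF h])
  then have "(\<chi> g / \<chi> \<one>\<^bsub>GG\<^esub> / w1 g ^ j - 1) * of_real c0 * w1 g ^ j = (\<Sum>X\<in>VV - {0}. cc X * WW g (- X) * cnj (bT X X))"
    unfolding e1 by (simp add: field_simps)
  note eq = this
  have "cmod (A * of_real c0 * w1 g ^ j) = cmod A * c0 * cmod (w1 g) ^ j" for A
    using cc_0(2) by (simp add: norm_mult norm_power)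
  from this[of "\<chi> g / \<chi> \<one>\<^bsub>GG\<^esub> / w1 g ^ j - 1", unfolded eq, symmetric]
  have "cmod (\<chi> g / \<chi> \<one>\<^bsub>GG\<^esub> / w1 g ^ j - 1) * c0 * cmod (w1 g) ^ j = cmod (\<Sum>X\<in>VV - {0}. cc X * WW g (- X) * cnj (bT X X))"
    .
  also have "\<dots> \<le> (\<Sum>X\<in>VV - {0}. cmod (cc X) * cmod (WW g (- X)))"
    by (rule sum_norm_le) (simp add: norm_mult T.beta_norm)
  also have "\<dots> = (\<Sum>X\<in>?I. cmod (cc X) * cmod (w1 g) ^ j)"
  proof (rule sum.mono_neutral_cong_right)
    have mem: "(- X) a \<in> imn g \<longleftrightarrow> X a \<in> imn g" for X :: "nat \<Rightarrow> nat \<Rightarrow> 'a" and a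
      using is_subspaceD(4)[OF is_subspace_imn, of "X a" g] is_subspaceD(4)[OF is_subspace_imn, of "- X a" g]
      unfolding tuples_eval minus_minus by blast
    show "\<forall>X\<in>VV - {0} - ?I. cmod (cc X) * cmod (WW g (- X)) = 0"
      unfolding cmod_WW[OF h] mem by auto
    show "cmod (cc X) * cmod (WW g (- X)) = cmod (cc X) * cmod (w1 g) ^ j" if "X \<in> ?I" for X
      using that unfolding cmod_WW[OF h] mem by auto
  qed (auto simp: card_tuples)
  also have "\<dots> = (\<Sum>X\<in>?I. cmod (cc X)) * cmod (w1 g) ^ j" by (rule sum_distrib_right[symmetric])
  finally show ?thesis by simp
qed

text \<open>For isotropic \<open>z\<close> the points of \<open>V \<otimes> z\<close> span a commutative subalgebra. The trace of \<open>c\<close> against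
  the idempotent \<open>PP z\<close> is the inner product of \<open>\<tau>\<^sup>j\<^sup>-\<^sup>2\<close> and \<open>\<chi>\<close>, so \<open>c\<close> kills this idempotent.\<close>

lemma WW_tens:
  assumes x: "x \<in> carrier GG" and z: "z \<in> vecs j" "z \<noteq> 0" "h j z z = 0"
  shows "WW x (tens y z) = (if y \<in> imn x then w1 x ^ j else 0)"
proof (cases "y \<in> imn x")
  case True
  then obtain v where v: "v \<in> vecs N" "y = v - mv x v" by (auto simp: imn_def)
  have "W1 x (smul c y) = w1 x * \<phi> (\<gamma> * h N y v * (c * c ^ q))" for c
  proof -
    have e: "smul c y = smul c v - mv x (smul c v)" by (simp only: v(2) smul_diff mv_smul)
    have "W1 x (smul c y) = w1 x * b1 (smul c y) (smul c v)"
      using W1_val[OF x, of "smul c v"] v(1) unfolding e[symmetric] by blast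
    then show ?thesis by (simp add: b1_def h_smul mult_ac)
  qed
  then have "WW x (tens y z) = (\<Prod>a<j. w1 x * \<phi> (\<gamma> * h N y v * (z a * z a ^ q)))"
    by (simp add: WW_def tens_def)
  also have "\<dots> = w1 x ^ j * (\<Prod>a<j. \<phi> (\<gamma> * h N y v * (z a * z a ^ q)))" by (simp add: prod.distrib)
  also have "(\<Prod>a<j. \<phi> (\<gamma> * h N y v * (z a * z a ^ q))) = \<phi> (\<Sum>a<j. \<gamma> * h N y v * (z a * z a ^ q))"
    by (rule phi_sum[symmetric])
  also have "(\<Sum>a<j. \<gamma> * h N y v * (z a * z a ^ q)) = \<gamma> * h N y v * h j z z"
    by (simp add: herm_def sum_distrib_left)
  finally show ?thesis using True z(3) by simp
next
  case False
  obtain a where a: "z a \<noteq> 0" using z(2) by (auto simp: fun_eq_iff)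
  then have "a < j" using z(1) by (auto simp: vecs_def not_less[symmetric])
  moreover have "smul (z a) y \<notin> imn x"
  proof
    assume "smul (z a) y \<in> imn x"
    then have "smul (inverse (z a)) (smul (z a) y) \<in> imn x" by (rule is_subspaceD(3)[OF is_subspace_imn])
    then show False using False a by simp
  qed
  ultimately have "WW x (tens y z) = 0" unfolding WW_def by (intro prod_zero bexI[of _ a]) (simp_all add: W1_outside tens_def)
  then show ?thesis using False by simp
qed

text \<open>This is |V| times the idempotent; the coefficient 1 brings the sum into the shape of
  \<open>T.conv_linear\<close>.\<close>

definition PP :: "(nat \<Rightarrow> 'a) \<Rightarrow> (nat \<Rightarrow> nat \<Rightarrow> 'a) \<Rightarrow> complex" where
  "PP z X = (\<Sum>y\<in>vecs N. 1 * T.pt (tens y z) X)"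

context
  fixes z :: "nat \<Rightarrow> 'a"
  assumes z: "z \<in> vecs j" "z \<noteq> 0" "h j z z = 0"
begin

lemma isotropic_j: "j \<ge> 2"
proof (rule ccontr)
  assume "\<not> ?thesis"
  then have "j = 1" using j_pos by simp
  then have "h j z z = z 0 * z 0 ^ q" by (simp add: herm_def)
  then have "z 0 = 0" using z(3) by simp
  then have "z = 0" using z(1) \<open>j = 1\<close> by (intro vecs_eqI[of z 1]) auto
  then show False using z(2) by simp
qed

text \<open>Summing \<open>WW_tens\<close> over y multiplies w1(x)^j by the size of the image of 1 -
  x, which is w1(x)^-2; what remains is the vanishing sum for tau^(j-2).\<close>

lemma cc_tens_sum: "(\<Sum>y\<in>vecs N. cc (tens y z)) = 0"
proof -
  have w2: "of_nat (card (imn x)) * w1 x ^ j = w1 x ^ (j - 2)" if x: "x \<in> carrier GG" for x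
  proof -
    have "w1 x * w1 x = of_real ((cmod (w1 x))\<^sup>2)"
      unfolding complex_norm_square by simp
    then have "of_nat (card (imn x)) * (w1 x * w1 x) = of_real ((cmod (w1 x))\<^sup>2 * real (card (imn x)))" by simp
    also have "\<dots> = 1" using norm_w1[OF x] by simp
    finally have "of_nat (card (imn x)) * (w1 x * w1 x) = 1" .
    moreover have "w1 x ^ j = w1 x * w1 x * w1 x ^ (j - 2)"
      using isotropic_j by (metis le_add_diff_inverse power2_eq_square power_add)
    ultimately show ?thesis by (simp add: mult.assoc[symmetric])
  qed
  have "(\<Sum>y\<in>vecs N. cc (tens y z)) = (\<Sum>x\<in>carrier GG. \<Sum>y\<in>vecs N. cnj (\<chi> x) * WW x (tens y z))"
    unfolding cc_def by (rule sum.swap)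
  also have "\<dots> = (\<Sum>x\<in>carrier GG. cnj (\<chi> x) * w1 x ^ (j - 2))"
  proof (rule sum.cong[OF refl])
    fix x assume x: "x \<in> carrier GG"
    have "(\<Sum>y\<in>vecs N. cnj (\<chi> x) * WW x (tens y z)) = (\<Sum>y\<in>imn x. cnj (\<chi> x) * w1 x ^ j)"
      by (rule sum.mono_neutral_cong_right) (use imn_sub[OF x] in \<open>auto simp: card_vecs WW_tens[OF x z]\<close>)
    also have "\<dots> = cnj (\<chi> x) * (of_nat (card (imn x)) * w1 x ^ j)" by simp
    finally show "(\<Sum>y\<in>vecs N. cnj (\<chi> x) * WW x (tens y z)) = cnj (\<chi> x) * w1 x ^ (j - 2)" by (simp only: w2[OF x])
  qed
  also have "\<dots> = (\<Sum>x\<in>carrier GG. cnj (\<chi> x) * (- of_nat q) ^ (kk x * (j - 2))) / (- of_nat q) ^ (N * (j - 2))"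
    unfolding sum_divide_distrib by (simp add: w1_def power_divide power_mult)
  also have "\<dots> = 0" using level_below[OF isotropic_j] by (simp add: kk_def)
  finally show ?thesis .
qed

lemma tens_VV: "y \<in> vecs N \<Longrightarrow> tens y z \<in> VV"
  using z(1) by (rule tens_in[rotated])

lemma bT_tens: "bT (tens y z) (tens y' z) = 1"
proof -
  have "bT (tens y z) (tens y' z) = (\<Prod>a<j. \<phi> (\<gamma> * h N y y' * (z a * z a ^ q)))"
    unfolding bT_def b1_def tens_def by (simp add: h_smul mult_ac)
  also have "\<dots> = \<phi> (\<Sum>a<j. \<gamma> * h N y y' * (z a * z a ^ q))"
    by (rule phi_sum[symmetric])
  also have "(\<Sum>a<j. \<gamma> * h N y y' * (z a * z a ^ q)) = \<gamma> * h N y y' * h j z z"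
    by (simp add: herm_def sum_distrib_left)
  finally show ?thesis using z(3) by simp
qed

lemma tens_uminus: "- tens y z = tens (- y) z"
  by (simp add: tens_def smul_def fun_eq_iff)

lemma conv_PP:
  assumes "Z \<in> VV"
  shows "T.conv (PP z) f Z = (\<Sum>y\<in>vecs N. f (Z - tens y z) * bT (tens y z) (Z - tens y z))"
  unfolding PP_def[abs_def] T.conv_linear
  by (intro sum.cong refl) (simp add: T.conv_pt(2) tens_VV)

lemma PP_shift: "y \<in> vecs N \<Longrightarrow> PP z (Z - tens y z) = PP z Z"
proof -
  assume y: "y \<in> vecs N"
  have "PP z (Z - tens y z) = (\<Sum>y'\<in>vecs N. 1 * T.pt (tens (y' + y) z) Z)"
    unfolding PP_def T.pt_def tens_add by (intro sum.cong refl) (simp add: diff_eq_eq)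
  also have "\<dots> = PP z Z"
    unfolding PP_def by (rule sum_translate) (use y in blast)+
  finally show ?thesis .
qed

lemma PP_outside: "PP z Z \<noteq> 0 \<Longrightarrow> \<exists>y\<in>vecs N. Z = tens y z"
proof (rule ccontr)
  assume "PP z Z \<noteq> 0" "\<not> (\<exists>y\<in>vecs N. Z = tens y z)"
  then show False by (simp add: PP_def T.pt_def)
qed

lemma PP_idem:
  assumes Z: "Z \<in> VV"
  shows "T.conv (PP z) (PP z) Z = of_nat (q\<^sup>2 ^ N) * PP z Z"
proof -
  have "T.conv (PP z) (PP z) Z = (\<Sum>y\<in>(vecs N :: (nat \<Rightarrow> 'a) set). PP z Z)"
    unfolding conv_PP[OF Z]
  proof (rule sum.cong[OF refl])
    fix y :: "nat \<Rightarrow> 'a" assume y: "y \<in> vecs N"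
    show "PP z (Z - tens y z) * bT (tens y z) (Z - tens y z) = PP z Z"
    proof (cases "PP z Z = 0")
      case False
      then obtain y' where "Z = tens y' z" using PP_outside by blast
      then have "Z - tens y z = tens (y' - y) z" by (simp only: tens_diff)
      then show ?thesis using PP_shift[OF y, of Z] bT_tens by simp
    qed (use PP_shift[OF y, of Z] in simp)
  qed
  then show ?thesis by (simp add: card_vecs card_field)
qed

lemma PP_star:
  assumes Z: "Z \<in> VV"
  shows "T.star (PP z) Z = PP z Z"
proof -
  have "PP z (- Z) = PP z Z"
    unfolding PP_def
  proof (rule sum.reindex_bij_witness[of _ uminus uminus])
    fix y :: "nat \<Rightarrow> 'a"
    have "- Z = tens y z \<longleftrightarrow> Z = tens (- y) z" unfolding tens_uminus[symmetric] by (metis minus_minus)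
    then show "1 * T.pt (tens (- y) z) Z = 1 * T.pt (tens y z) (- Z)" by (simp only: T.pt_def)
  qed auto
  moreover have "cnj (PP z Z) = PP z Z" unfolding PP_def T.pt_def by (simp add: if_distrib[of cnj] cong: if_cong)
  moreover have "PP z Z * bT Z Z = PP z Z"
  proof (cases "PP z Z = 0")
    case False
    then obtain y' where "Z = tens y' z" using PP_outside by blast
    then show ?thesis using bT_tens by simp
  qed simp
  ultimately show ?thesis by (simp add: T.star_def)
qed

lemma cc_PP_trace: "T.conv (PP z) cc 0 = 0"
proof -
  have "T.conv (PP z) cc 0 = (\<Sum>y\<in>vecs N. cc (tens (- y) z))"
    unfolding conv_PP[OF tuples_0]
  proof (rule sum.cong[OF refl])
    fix y :: "nat \<Rightarrow> 'a"
    have e: "0 - tens y z = tens (- y) z" by (simp only: diff_0 tens_uminus)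
    show "cc (0 - tens y z) * bT (tens y z) (0 - tens y z) = cc (tens (- y) z)"
      unfolding e bT_tens by simp
  qed
  also have "\<dots> = (\<Sum>y\<in>vecs N. cc (tens y z))"
    by (rule sum.reindex_bij_witness[of _ uminus uminus]) auto
  finally show ?thesis by (simp only: cc_tens_sum)
qed

text \<open>With P = \<open>PP z\<close>, the squared norm of c P is the trace of c P P c, a
  multiple of tr(c P c) = \<kappa> tr(P c), which is zero by \<open>cc_PP_trace\<close>.\<close>

lemma cc_PP:
  assumes Z: "Z \<in> VV"
  shows "T.conv cc (PP z) Z = 0"
proof (rule T.conv_zero_iff_norm[OF _ Z])
  have "T.conv (T.conv cc (PP z)) (T.star (T.conv cc (PP z))) 0 = T.conv (T.conv cc (PP z)) (T.conv (PP z) cc) 0"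
  proof (rule T.conv_cong[OF tuples_0 refl])
    fix X assume X: "X \<in> VV"
    have "T.star (T.conv cc (PP z)) X = T.conv (T.star (PP z)) (T.star cc) X" by (rule T.conv_star[OF X])
    also have "\<dots> = T.conv (PP z) cc X" by (rule T.conv_cong[OF X]) (simp_all add: PP_star cc_star)
    finally show "T.star (T.conv cc (PP z)) X = T.conv (PP z) cc X" .
  qed
  also have "\<dots> = T.conv cc (T.conv (T.conv (PP z) (PP z)) cc) 0" by (simp only: T.conv_assoc_fun)
  also have "\<dots> = T.conv cc (T.conv (\<lambda>Z. of_nat (q\<^sup>2 ^ N) * PP z Z) cc) 0"
    by (intro T.conv_cong tuples_0 refl) (simp_all add: PP_idem)
  also have "\<dots> = of_nat (q\<^sup>2 ^ N) * T.conv cc (T.conv (PP z) cc) 0"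
    by (simp only: T.conv_scale_fun T.conv_scale)
  also have "T.conv cc (T.conv (PP z) cc) 0 = T.conv (PP z) (T.conv cc cc) 0"
    unfolding T.conv_commute_0[of cc] by (simp only: T.conv_assoc_fun)
  also have "\<dots> = T.conv (PP z) (\<lambda>Z. of_real \<kappa> * cc Z) 0"
    by (intro T.conv_cong tuples_0 refl cc_conv)
  also have "\<dots> = 0" by (simp only: T.conv_scale cc_PP_trace mult_zero_right)
  finally show "T.conv (T.conv cc (PP z)) (T.star (T.conv cc (PP z))) 0 = 0" by (simp only: mult_zero_right)
qed

end

end

section \<open>Sums over tuples with prescribed rows and Gram matrix\<close>

definition row :: "(nat \<Rightarrow> nat \<Rightarrow> 'a) \<Rightarrow> nat \<Rightarrow> nat \<Rightarrow> 'a" where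
  "row X i = (\<lambda>a. X a i)"

lemma row_simps:
  fixes X Y :: "nat \<Rightarrow> nat \<Rightarrow> 'a::field"
  shows "row (X + Y) i = row X i + row Y i" "row (X - Y) i = row X i - row Y i" "row (- X) i = - row X i"
    "row 0 i = (0 :: nat \<Rightarrow> 'a)" "row (tens u f) i = smul (u i) f"
  by (simp_all add: row_def fun_eq_iff tens_def smul_def mult.commute)

lemma row_eqI: "(\<And>i. row X i = row Y i) \<Longrightarrow> X = Y"
  unfolding row_def by (intro ext) meson

context unitary_level
begin

text \<open>For varying D the values \<open>dd D X X\<close> give all linear functionals of the Gram
  matrix of X. The form also splits as a sum of \<open>dr D\<close> over the rows of X
  (\<open>dd_row\<close>), which turns conditions on it into conditions on single rows.\<close>

definition dd :: "(nat \<Rightarrow> nat \<Rightarrow> 'a) \<Rightarrow> (nat \<Rightarrow> nat \<Rightarrow> 'a) \<Rightarrow> (nat \<Rightarrow> nat \<Rightarrow> 'a) \<Rightarrow> 'a" where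
  "dd D X Y = (\<Sum>a<j. \<Sum>b<j. D a b * h N (X a) (Y b))"

definition dr :: "(nat \<Rightarrow> nat \<Rightarrow> 'a) \<Rightarrow> (nat \<Rightarrow> 'a) \<Rightarrow> (nat \<Rightarrow> 'a) \<Rightarrow> 'a" where
  "dr D x y = (\<Sum>a<j. \<Sum>b<j. D a b * (x a * y b ^ q))"

definition hT :: "(nat \<Rightarrow> nat \<Rightarrow> 'a) \<Rightarrow> (nat \<Rightarrow> nat \<Rightarrow> 'a) \<Rightarrow> 'a" where
  "hT X Y = (\<Sum>a<j. h N (X a) (Y a))"

definition VR :: "(nat \<Rightarrow> 'a) set \<Rightarrow> (nat \<Rightarrow> nat \<Rightarrow> 'a) set" where
  "VR R = {X \<in> VV. \<forall>i. row X i \<in> R}"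

text \<open>\<open>U U\<^sup>*\<close> is supported on the tuples with rows in the radical of this form; every vector in that
  radical is isotropic because \<open>\<gamma>\<close> is not fixed by Frobenius.\<close>

definition kr :: "(nat \<Rightarrow> nat \<Rightarrow> 'a) \<Rightarrow> (nat \<Rightarrow> 'a) \<Rightarrow> (nat \<Rightarrow> 'a) \<Rightarrow> 'a" where
  "kr D z y = dr D z y + (dr D y z) ^ q - \<gamma> * h j z y"

lemma bT_hT: "bT X Y = \<phi> (\<gamma> * hT X Y)"
  unfolding bT_def b1_def hT_def by (simp add: sum_distrib_left phi_sum)

lemma dd_row: "dd D X Y = (\<Sum>i<N. dr D (row X i) (row Y i))"
proof -
  have "dd D X Y = (\<Sum>a<j. \<Sum>b<j. \<Sum>i<N. D a b * (X a i * (Y b i) ^ q))"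
    unfolding dd_def herm_def by (simp only: sum_distrib_left)
  also have "\<dots> = (\<Sum>i<N. \<Sum>a<j. \<Sum>b<j. D a b * (X a i * (Y b i) ^ q))"
    by (rule sum_swap3[symmetric])
  finally show ?thesis by (simp only: dr_def row_def)
qed

lemma hT_row: "hT X Y = (\<Sum>i<N. h j (row X i) (row Y i))"
  unfolding hT_def herm_def row_def by (rule sum.swap)

lemma dd_add: "dd D (X + Y) Z = dd D X Z + dd D Y Z" "dd D Z (X + Y) = dd D Z X + dd D Z Y"
  unfolding dd_def tuples_eval h_add distrib_left sum.distrib by simp_all

lemma hT_add: "hT (X + Y) Z = hT X Z + hT Y Z" "hT Z (X + Y) = hT Z X + hT Z Y"
  unfolding hT_def tuples_eval h_add sum.distrib by simp_all

lemma dd_minus: "dd D (- X) Z = - dd D X Z" "dd D Z (- X) = - dd D Z X"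
  unfolding dd_def tuples_eval h_minus by (simp_all add: sum_negf)

lemma hT_minus: "hT (- X) Z = - hT X Z" "hT Z (- X) = - hT Z X"
  unfolding hT_def tuples_eval h_minus by (simp_all add: sum_negf)

lemma dr_smul: "dr D (smul c x) y = c * dr D x y" "dr D x (smul c y) = c ^ q * dr D x y"
  unfolding dr_def smul_def sum_distrib_left by (simp_all add: power_mult_distrib mult_ac)

lemma kr_smul: "kr D (smul c z) y = c * kr D z y" "kr D z (smul c y) = c ^ q * kr D z y"
  by (simp_all add: kr_def dr_smul h_smul power_mult_distrib algebra_simps)

lemma kr_row: "dd D Z Y + (dd D Y Z) ^ q - \<gamma> * hT Z Y = (\<Sum>i<N. kr D (row Z i) (row Y i))"
  unfolding dd_row hT_row kr_def frob_sum sum_distrib_left by (simp add: sum.distrib sum_subtractf)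

context
  fixes R :: "(nat \<Rightarrow> 'a) set" and D :: "nat \<Rightarrow> nat \<Rightarrow> 'a"
  assumes R: "is_subspace R" "R \<subseteq> vecs j"
begin

lemma VR_in: "X \<in> VR R \<Longrightarrow> X \<in> VV" by (simp add: VR_def)

lemma VR_row: "X \<in> VR R \<Longrightarrow> row X i \<in> R" by (simp add: VR_def)

lemma VR_add: "X \<in> VR R \<Longrightarrow> Y \<in> VR R \<Longrightarrow> X + Y \<in> VR R"
  using is_subspaceD(2)[OF R(1)] unfolding VR_def mem_Collect_eq row_simps by blast

lemma VR_diff: "X \<in> VR R \<Longrightarrow> Y \<in> VR R \<Longrightarrow> X - Y \<in> VR R"
  using is_subspaceD(5)[OF R(1)] unfolding VR_def mem_Collect_eq row_simps by blast

lemma VR_minus: "X \<in> VR R \<Longrightarrow> - X \<in> VR R"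
  using is_subspaceD(4)[OF R(1)] unfolding VR_def mem_Collect_eq row_simps by blast

lemma VR_0: "0 \<in> VR R"
  using is_subspaceD(1)[OF R(1)] tuples_0 unfolding VR_def mem_Collect_eq row_simps by blast

lemma VR_tens: "y \<in> vecs N \<Longrightarrow> z \<in> R \<Longrightarrow> tens y z \<in> VR R"
  using is_subspaceD(3)[OF R(1)] R(2) tens_in[of y N z j] unfolding VR_def mem_Collect_eq row_simps by blast

lemma finVR: "finite (VR R)"
  by (rule finite_subset[of _ VV]) (auto simp: VR_in card_tuples)

text \<open>A quadratic phase on \<open>VR R\<close>. Either it is killed by c
  (\<open>UU_radical\<close>), or it is a unitary element times the square root of |VR R|
  (\<open>UU_star\<close>).\<close>

definition UU :: "(nat \<Rightarrow> nat \<Rightarrow> 'a) \<Rightarrow> complex" where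
  "UU X = (if X \<in> VR R then \<phi> (dd D X X) else 0)"

text \<open>A radical vector z is isotropic, and \<open>UU\<close> is invariant under multiplication
  by the points of V \<otimes> z. Hence \<open>PP z\<close> times \<open>UU\<close> is |V|
  \<open>UU\<close>, while c times \<open>PP z\<close> is zero.\<close>

lemma UU_radical:
  assumes z: "z \<in> R" "z \<noteq> 0" and rad: "\<And>y. y \<in> R \<Longrightarrow> kr D z y = 0"
  shows "T.conv cc UU 0 = 0"
proof -
  have zj: "z \<in> vecs j" using z R by blast
  have k0: "dr D z z + (dr D z z) ^ q = \<gamma> * h j z z" using rad[OF z(1)] by (simp add: kr_def)
  have "(dr D z z + (dr D z z) ^ q) ^ q = dr D z z + (dr D z z) ^ q" by (simp add: frob_add add.commute)
  then have "(\<gamma> * h j z z) ^ q = \<gamma> * h j z z" unfolding k0 .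
  then have "(\<gamma> ^ q - \<gamma>) * h j z z = 0" by (simp add: power_mult_distrib h_self left_diff_distrib)
  then have iso: "h j z z = 0" using gamma by simp
  have skew: "(dr D z z) ^ q = - dr D z z" using k0 iso by (simp add: add_eq_0_iff)
  note zz = zj z(2) iso
  have key: "UU (Z - tens y z) * bT (tens y z) (Z - tens y z) = UU Z" if Z: "Z \<in> VV" and y: "y \<in> vecs N" for Z y
  proof -
    let ?t = "tens y z"
    have t: "?t \<in> VR R" by (rule VR_tens[OF y z(1)])
    have mem: "Z - ?t \<in> VR R \<longleftrightarrow> Z \<in> VR R"
      using VR_diff[OF _ t, of Z] VR_add[OF _ t, of "Z - ?t"] by auto
    show ?thesis
    proof (cases "Z \<in> VR R")
      case False
      then show ?thesis by (simp only: UU_def mem if_False mult_zero_left)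
    next
      case True
      have "(\<Sum>i<N. kr D (row ?t i) (row Z i)) = 0"
        unfolding row_simps kr_smul using rad[OF VR_row[OF True]] by simp
      then have e1: "\<gamma> * hT ?t Z = dd D ?t Z + (dd D Z ?t) ^ q" unfolding kr_row[symmetric] by simp
      have e2: "hT ?t ?t = 0" unfolding hT_row row_simps h_smul iso by simp
      have "dd D ?t ?t = (\<Sum>i<N. y i * y i ^ q) * dr D z z"
        unfolding dd_row row_simps dr_smul by (simp only: sum_distrib_left mult_ac)
      moreover have "\<phi> ((\<Sum>i<N. y i * y i ^ q) * dr D z z) = 1"
        by (rule phi_skew[OF skew]) (simp add: frob_sum power_mult_distrib mult.commute)
      ultimately have e3: "\<phi> (dd D ?t ?t) = 1" by simp
      have dz: "dd D (Z - ?t) (Z - ?t) = dd D Z Z + dd D ?t ?t - dd D Z ?t - dd D ?t Z"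
        unfolding diff_conv_add_uminus dd_add dd_minus by simp
      have hz: "hT ?t (Z - ?t) = hT ?t Z" unfolding diff_conv_add_uminus hT_add hT_minus e2 by simp
      have "dd D (Z - ?t) (Z - ?t) + \<gamma> * hT ?t (Z - ?t) = dd D Z Z + dd D ?t ?t + ((dd D Z ?t) ^ q - dd D Z ?t)"
        unfolding dz hz e1 by simp
      then have "\<phi> (dd D (Z - ?t) (Z - ?t)) * \<phi> (\<gamma> * hT ?t (Z - ?t)) = \<phi> (dd D Z Z) * \<phi> (dd D ?t ?t) * \<phi> ((dd D Z ?t) ^ q - dd D Z ?t)"
        unfolding phi_add[symmetric] by simp
      also have "\<dots> = \<phi> (dd D Z Z)" unfolding e3 phi_diff phi_frob by simp
      finally show ?thesis using True by (simp only: UU_def mem if_True bT_hT)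
    qed
  qed
  have PU: "T.conv (PP z) UU Z = of_nat (q\<^sup>2 ^ N) * UU Z" if Z: "Z \<in> VV" for Z
  proof -
    have "T.conv (PP z) UU Z = (\<Sum>y\<in>(vecs N :: (nat \<Rightarrow> 'a) set). UU Z)"
      unfolding conv_PP[OF zz Z] by (rule sum.cong[OF refl]) (rule key[OF Z])
    then show ?thesis by (simp add: card_vecs card_field)
  qed
  have "of_nat (q\<^sup>2 ^ N) * T.conv cc UU 0 = T.conv cc (\<lambda>Z. of_nat (q\<^sup>2 ^ N) * UU Z) 0"
    by (simp only: T.conv_scale)
  also have "\<dots> = T.conv cc (T.conv (PP z) UU) 0"
    by (rule T.conv_cong[OF tuples_0 refl]) (rule PU[symmetric])
  also have "\<dots> = T.conv (T.conv cc (PP z)) UU 0" by (simp only: T.conv_assoc)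
  also have "\<dots> = T.conv (\<lambda>Z. 0 * cc Z) UU 0"
    by (rule T.conv_cong[OF tuples_0 _ refl]) (simp add: cc_PP[OF zz])
  also have "\<dots> = 0 * T.conv cc UU 0" by (rule T.conv_scale)
  also have "\<dots> = 0" by (rule mult_zero_left)
  finally show ?thesis using q_gt_1 by (simp only: mult_eq_0_iff of_nat_eq_0_iff power_eq_0_iff) simp
qed

text \<open>For Z in \<open>VR R\<close> the coefficient is, up to a phase, the sum of a character
  over \<open>VR R\<close>; nondegeneracy of \<open>kr\<close> makes this character nontrivial
  unless Z = 0.\<close>

lemma UU_star:
  assumes nrad: "\<And>z. z \<in> R \<Longrightarrow> z \<noteq> 0 \<Longrightarrow> \<exists>y\<in>R. kr D z y \<noteq> 0" and Z: "Z \<in> VV"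
  shows "T.conv UU (T.star UU) Z = of_nat (card (VR R)) * T.pt 0 Z"
proof (cases "Z \<in> VR R")
  case False
  have "UU X * T.star UU (Z - X) * bT X (Z - X) = 0" for X
  proof (cases "X \<in> VR R")
    case True
    then have "- (Z - X) \<notin> VR R" using False VR_diff[OF True, of "- (Z - X)"] by auto
    then show ?thesis by (simp only: T.star_def UU_def if_False complex_cnj_zero mult_zero_left mult_zero_right)
  qed (simp only: UU_def if_False mult_zero_left)
  then have "T.conv UU (T.star UU) Z = 0" unfolding T.conv_def by (simp only: sum.neutral_const)
  moreover have "Z \<noteq> 0" using False VR_0 by blast
  ultimately show ?thesis by (simp only: T.pt_def if_False mult_zero_right)
next
  case True
  define f where "f Y = \<phi> (dd D Z Y + (dd D Y Z) ^ q - \<gamma> * hT Z Y)" for Y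
  have trm: "UU (Y + Z) * T.star UU (Z - (Y + Z)) * bT (Y + Z) (Z - (Y + Z)) = \<phi> (dd D Z Z) * f Y"
    if Y: "Y \<in> VR R" for Y
  proof -
    have e: "Z - (Y + Z) = - Y" by simp
    have "UU (Y + Z) * T.star UU (- Y) * bT (Y + Z) (- Y) =
      \<phi> (dd D (Y + Z) (Y + Z)) * (cnj (\<phi> (dd D Y Y)) * \<phi> (\<gamma> * hT Y Y)) * cnj (\<phi> (\<gamma> * hT (Y + Z) Y))"
      using Y VR_add[OF Y True]
      by (simp only: T.star_def UU_def if_True minus_minus bT_hT hT_minus minus_mult_minus mult_minus_right phi_minus[symmetric])
    also have "\<dots> = \<phi> (dd D (Y + Z) (Y + Z) - dd D Y Y + \<gamma> * hT Y Y - \<gamma> * hT (Y + Z) Y)"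
      by (simp only: phi_diff phi_add mult_ac)
    also have "dd D (Y + Z) (Y + Z) - dd D Y Y + \<gamma> * hT Y Y - \<gamma> * hT (Y + Z) Y =
      dd D Z Z + (dd D Z Y + dd D Y Z - \<gamma> * hT Z Y)"
      by (simp add: dd_add hT_add distrib_left)
    also have "\<phi> (dd D Z Z + (dd D Z Y + dd D Y Z - \<gamma> * hT Z Y)) = \<phi> (dd D Z Z) * f Y"
      by (simp only: f_def phi_add phi_diff phi_frob)
    finally show ?thesis unfolding e .
  qed
  have "T.conv UU (T.star UU) Z = (\<Sum>X\<in>VR R. UU X * T.star UU (Z - X) * bT X (Z - X))"
    unfolding T.conv_def
    by (rule sum.mono_neutral_right) (auto simp: card_tuples VR_in UU_def)
  also have "\<dots> = (\<Sum>Y\<in>VR R. UU (Y + Z) * T.star UU (Z - (Y + Z)) * bT (Y + Z) (Z - (Y + Z)))"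
    by (rule sum_translate[OF VR_add VR_diff True, symmetric])
  also have "\<dots> = (\<Sum>Y\<in>VR R. \<phi> (dd D Z Z) * f Y)" by (rule sum.cong[OF refl]) (rule trm)
  also have "\<dots> = \<phi> (dd D Z Z) * (\<Sum>Y\<in>VR R. f Y)" by (rule sum_distrib_left[symmetric])
  finally have e: "T.conv UU (T.star UU) Z = \<phi> (dd D Z Z) * (\<Sum>Y\<in>VR R. f Y)" .
  show ?thesis
  proof (cases "Z = 0")
    case True
    have "dd D 0 Y = 0" "dd D Y 0 = 0" "hT 0 Y = 0" for Y
      unfolding dd_def hT_def tuples_eval by simp_all
    then have "f Y = 1" "dd D Z Z = 0" for Y unfolding f_def True by simp_all
    then show ?thesis unfolding e T.pt_def using True by simp
  next
    case False
    then obtain i where i: "row Z i \<noteq> 0" using row_eqI[of Z 0] unfolding row_simps by blast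
    then have iN: "i < N" using tuplesD(1)[OF Z] by (auto simp: row_def vecs_def fun_eq_iff not_less[symmetric])
    obtain y where y: "y \<in> R" "kr D (row Z i) y \<noteq> 0" using nrad[OF VR_row[OF True] i] by blast
    obtain u where u: "\<phi> (kr D (row Z i) y * u) \<noteq> 1" using phi_separates[OF y(2)] by blast
    define e' where "e' = (\<lambda>k. if k = i then u ^ q else (0::'a))"
    have ev: "e' \<in> vecs N" using iN by (auto simp: e'_def vecs_def)
    have s: "tens e' y \<in> VR R" by (rule VR_tens[OF ev y(1)])
    have "(\<Sum>k<N. kr D (row Z k) (row (tens e' y) k)) = (\<Sum>k<N. if k = i then u * kr D (row Z i) y else 0)"
      unfolding row_simps kr_smul by (intro sum.cong refl) (simp add: e'_def)
    then have "f (tens e' y) = \<phi> (kr D (row Z i) y * u)"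
      unfolding f_def kr_row using iN by (simp add: mult.commute)
    then have ne: "f (tens e' y) \<noteq> 1" using u by simp
    have fadd: "f (X + Y) = f X * f Y" for X Y
      unfolding f_def dd_add hT_add frob_add phi_add[symmetric] by (simp add: algebra_simps)
    have "(\<Sum>Y\<in>VR R. f Y) = 0"
      using VR_add VR_diff s ne by (intro sum_character_zero[of "VR R" f "tens e' y"] fadd) blast+
    then show ?thesis unfolding e T.pt_def using False by simp
  qed
qed

text \<open>In the nondegenerate case, multiplying c by U scales its norm by the square root of |VR
  R|. As \<kappa> tr(c U) = tr(c c U) and the squared norm of c is \<kappa> c0, Cauchy-Schwarz gives
  the bound.\<close>

lemma UU_bound: "cmod (T.conv cc UU 0) \<le> sqrt (card (VR R)) * c0"
proof (cases "\<exists>z\<in>R. z \<noteq> 0 \<and> (\<forall>y\<in>R. kr D z y = 0)")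
  case True
  then have "T.conv cc UU 0 = 0" using UU_radical by blast
  then show ?thesis using cc_0(2) by simp
next
  case False
  then have nrad: "\<exists>y\<in>R. kr D z y \<noteq> 0" if "z \<in> R" "z \<noteq> 0" for z using that by blast
  let ?U = "T.conv cc UU" and ?c = "real (card (VR R))"
  have cs: "T.conv cc (T.star cc) 0 = of_real (\<kappa> * c0)"
    unfolding T.conv_star_0 cc_0(3) ..
  have "T.conv ?U (T.star ?U) 0 = T.conv ?U (T.conv (T.star UU) (T.star cc)) 0"
    by (rule T.conv_cong[OF tuples_0 refl]) (rule T.conv_star)
  also have "\<dots> = T.conv cc (T.conv (T.conv UU (T.star UU)) (T.star cc)) 0" by (simp only: T.conv_assoc_fun)
  also have "\<dots> = T.conv cc (T.conv (\<lambda>Z. of_nat (card (VR R)) * T.pt 0 Z) (T.star cc)) 0"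
    by (intro T.conv_cong tuples_0 refl UU_star nrad)
  also have "\<dots> = of_nat (card (VR R)) * T.conv cc (T.conv (T.pt 0) (T.star cc)) 0"
    by (simp only: T.conv_scale_fun T.conv_scale)
  also have "T.conv cc (T.conv (T.pt 0) (T.star cc)) 0 = T.conv cc (T.star cc) 0"
    by (rule T.conv_cong[OF tuples_0 refl]) (simp only: T.conv_pt(2)[OF tuples_0] diff_0_right T.beta_0 mult_1_right)
  finally have "T.conv ?U (T.star ?U) 0 = complex_of_real (?c * (\<kappa> * c0))"
    unfolding cs by (simp only: of_real_mult of_real_of_nat_eq)
  then have nU: "(\<Sum>X\<in>VV. (cmod (?U X))\<^sup>2) = ?c * (\<kappa> * c0)"
    unfolding T.conv_star_0 of_real_eq_iff .
  have "of_real \<kappa> * ?U 0 = T.conv (\<lambda>Z. of_real \<kappa> * cc Z) UU 0" by (simp only: T.conv_scale)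
  also have "\<dots> = T.conv (T.conv cc cc) UU 0"
    by (rule T.conv_cong[OF tuples_0 _ refl]) (rule cc_conv[symmetric])
  also have "\<dots> = T.conv cc ?U 0" by (rule T.conv_assoc)
  finally have "(cmod (of_real \<kappa> * ?U 0))\<^sup>2 = (cmod (T.conv cc ?U 0))\<^sup>2" by simp
  also have "\<dots> \<le> (\<Sum>X\<in>VV. (cmod (cc X))\<^sup>2) * (\<Sum>X\<in>VV. (cmod (?U X))\<^sup>2)" by (rule T.trace_product_bound)
  also have "\<dots> = (\<kappa> * c0) * (?c * (\<kappa> * c0))" unfolding nU cc_0(3) ..
  also have "\<dots> = (\<kappa> * (sqrt ?c * c0))\<^sup>2" by (simp add: power_mult_distrib power2_eq_square)
  finally have "cmod (of_real \<kappa> * ?U 0) \<le> \<kappa> * (sqrt ?c * c0)"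
    by (rule power2_le_imp_le) (use kappa_pos cc_0(2) in simp)
  then have "\<kappa> * cmod (?U 0) \<le> \<kappa> * (sqrt ?c * c0)" using kappa_pos by (simp add: norm_mult)
  then show ?thesis using kappa_pos by simp
qed

end

text \<open>Evaluating the product at zero introduces the phase cnj (bT X X); adding \<gamma> on the
  diagonal of D cancels it.\<close>

lemma weighted_sum_bound:
  assumes R: "is_subspace R" "R \<subseteq> vecs j"
  shows "cmod (\<Sum>X\<in>VR R. cc X * \<phi> (dd D X X)) \<le> sqrt (card (VR R)) * c0"
proof -
  define D' where "D' a b = D a b + (if a = b then \<gamma> else 0)" for a b
  have "(if a = b then \<gamma> else 0) * x = (if b = a then \<gamma> * x else 0)" for a b :: nat and x by simp
  then have d': "dd D' X X = dd D X X + \<gamma> * hT X X" for X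
    unfolding dd_def hT_def D'_def distrib_right sum.distrib by (simp add: sum_distrib_left)
  have "T.conv cc (UU R D') 0 = (\<Sum>X\<in>VR R. cc X * UU R D' (- X) * cnj (bT X X))"
    unfolding T.conv_at_0
  proof (rule sum.mono_neutral_right)
    show "\<forall>X\<in>VV - VR R. cc X * UU R D' (- X) * cnj (bT X X) = 0"
    proof
      fix X assume "X \<in> VV - VR R"
      then have "- X \<notin> VR R" using VR_minus[OF R, of "- X"] by auto
      then show "cc X * UU R D' (- X) * cnj (bT X X) = 0" by (simp add: UU_def[OF R])
    qed
  qed (auto simp: card_tuples VR_in[OF R])
  also have "\<dots> = (\<Sum>X\<in>VR R. cc X * \<phi> (dd D X X))"
  proof (rule sum.cong[OF refl])
    fix X assume X: "X \<in> VR R"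
    have "UU R D' (- X) = \<phi> (dd D' X X)"
      using VR_minus[OF R X] by (simp only: UU_def[OF R] if_True dd_minus minus_minus)
    then show "cc X * UU R D' (- X) * cnj (bT X X) = cc X * \<phi> (dd D X X)"
      by (simp add: d' bT_hT phi_add mult.assoc)
  qed
  finally show ?thesis using UU_bound[OF R, of D'] by simp
qed

text \<open>Fourier inversion over the j x j matrices D detects the Gram condition. Every frequency
  obeys the bound of \<open>weighted_sum_bound\<close>, so averaging over them costs
  nothing.\<close>

lemma gram_sum_bound:
  assumes R: "is_subspace R" "R \<subseteq> vecs j"
  shows "cmod (\<Sum>X\<in>{X \<in> VR R. \<forall>a<j. \<forall>b<j. h N (X a) (X b) = \<Gamma> a b}. cc X) \<le> sqrt (card (VR R)) * c0"
proof -
  let ?S = "{X \<in> VR R. \<forall>a<j. \<forall>b<j. h N (X a) (X b) = \<Gamma> a b}"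
  let ?T = "tuples j j :: (nat \<Rightarrow> nat \<Rightarrow> 'a) set"
  let ?g = "\<lambda>D. \<Sum>a<j. \<Sum>b<j. D a b * \<Gamma> a b"
  define E where "E X D = (\<Sum>a<j. \<Sum>b<j. D a b * (h N (X a) (X b) - \<Gamma> a b))" for X D
  have E: "E X D = dd D X X - ?g D" for X D
    unfolding E_def dd_def right_diff_distrib sum_subtractf ..
  have ind: "(\<Sum>D\<in>?T. \<phi> (E X D)) = (if \<forall>a<j. \<forall>b<j. h N (X a) (X b) = \<Gamma> a b then of_nat (card ?T) else 0)" for X
  proof (cases "\<forall>a<j. \<forall>b<j. h N (X a) (X b) = \<Gamma> a b")
    case True
    then have "E X D = 0" for D unfolding E_def by (intro sum.neutral ballI) simp
    then show ?thesis using True by simp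
  next
    case False
    then obtain a b where ab: "a < j" "b < j" "h N (X a) (X b) - \<Gamma> a b \<noteq> 0" by auto
    obtain u where u: "\<phi> ((h N (X a) (X b) - \<Gamma> a b) * u) \<noteq> 1" using phi_separates[OF ab(3)] by blast
    let ?D = "\<lambda>a' b'. if a' = a \<and> b' = b then u else 0"
    have DT: "?D \<in> ?T" using ab by (auto simp: tuples_alt vecs_def fun_eq_iff)
    have inner: "(\<Sum>b'<j. (if a' = a \<and> b' = b then u else 0) * F b') = (if a' = a then u * F b else 0)" for a' F
      using ab(2) by (cases "a' = a") (simp_all add: mult_delta_left)
    have "E X ?D = (h N (X a) (X b) - \<Gamma> a b) * u"
      unfolding E_def inner using ab(1) by (simp add: mult.commute)
    then have "\<phi> (E X ?D) \<noteq> 1" using u by simp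
    moreover have "\<phi> (E X (D + D')) = \<phi> (E X D) * \<phi> (E X D')" for D D'
      unfolding E_def by (simp add: distrib_right sum.distrib phi_add[symmetric])
    ultimately have "(\<Sum>D\<in>?T. \<phi> (E X D)) = 0"
      by (intro sum_character_zero[of ?T _ ?D]) (use DT in auto)
    then show ?thesis by (simp only: False if_False)
  qed
  have "of_nat (card ?T) * (\<Sum>X\<in>?S. cc X) = (\<Sum>X\<in>VR R. cc X * (if \<forall>a<j. \<forall>b<j. h N (X a) (X b) = \<Gamma> a b then of_nat (card ?T) else 0))"
    unfolding sum_distrib_left
    by (rule sum.mono_neutral_cong_left) (auto simp: finVR[OF R])
  also have "\<dots> = (\<Sum>X\<in>VR R. \<Sum>D\<in>?T. cc X * \<phi> (E X D))"
    unfolding ind[symmetric] by (simp only: sum_distrib_left)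
  also have "\<dots> = (\<Sum>D\<in>?T. \<Sum>X\<in>VR R. cc X * \<phi> (E X D))" by (rule sum.swap)
  also have "\<dots> = (\<Sum>D\<in>?T. cnj (\<phi> (?g D)) * (\<Sum>X\<in>VR R. cc X * \<phi> (dd D X X)))"
    unfolding E phi_diff sum_distrib_left by (intro sum.cong refl) (simp only: mult_ac)
  finally have "cmod (of_nat (card ?T) * (\<Sum>X\<in>?S. cc X)) = cmod (\<Sum>D\<in>?T. cnj (\<phi> (?g D)) * (\<Sum>X\<in>VR R. cc X * \<phi> (dd D X X)))"
    by simp
  also have "\<dots> \<le> (\<Sum>D\<in>?T. sqrt (card (VR R)) * c0)"
    by (rule sum_norm_le) (use weighted_sum_bound[OF R] in \<open>simp add: norm_mult phi_norm\<close>)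
  finally have "real (card ?T) * cmod (\<Sum>X\<in>?S. cc X) \<le> real (card ?T) * (sqrt (card (VR R)) * c0)"
    by (simp add: norm_mult)
  moreover have "card ?T > 0" by (simp add: card_tuples card_field)
  ultimately show ?thesis by simp
qed

end

section \<open>Decay in the rank\<close>

text \<open>The matrix product of an N x r and an r x j matrix; Y is stored by columns and Z by
  rows.\<close>

definition prodt :: "nat \<Rightarrow> nat \<Rightarrow> (nat \<Rightarrow> nat \<Rightarrow> 'a::field) \<Rightarrow> (nat \<Rightarrow> nat \<Rightarrow> 'a) \<Rightarrow> nat \<Rightarrow> nat \<Rightarrow> 'a" where
  "prodt j r Y Z = (\<lambda>a. if a < j then lc r Y (\<lambda>i. Z i a) else (\<lambda>_. 0))"

text \<open>Independence of the rows of Z in dual form: b -> (b . Z_i) maps F^j onto F^r. This is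
  what is used when cancelling Z and when composing factorizations.\<close>

definition full_rows :: "nat \<Rightarrow> nat \<Rightarrow> (nat \<Rightarrow> nat \<Rightarrow> 'a::field) \<Rightarrow> bool" where
  "full_rows j r Z \<longleftrightarrow> (\<forall>c\<in>vecs r. \<exists>b\<in>vecs j. \<forall>i<r. dot j b (Z i) = c i)"

definition has_rank :: "nat \<Rightarrow> nat \<Rightarrow> (nat \<Rightarrow> nat \<Rightarrow> 'a::field) \<Rightarrow> nat \<Rightarrow> bool" where
  "has_rank N j X r \<longleftrightarrow> (\<exists>Y\<in>tuples N r. \<exists>Z\<in>tuples j r. indep r Y \<and> full_rows j r Z \<and> X = prodt j r Y Z)"

lemma prodt_in: "Y \<in> tuples N r \<Longrightarrow> prodt j r Y Z \<in> tuples N j"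
  by (auto simp: prodt_def tuples_alt dest: tuplesD(1))

lemma lc_prodt: "lc j (prodt j r Y Z) b = lc r Y (\<lambda>i. dot j b (Z i))"
proof
  fix x
  have "lc j (prodt j r Y Z) b x = (\<Sum>a<j. \<Sum>i<r. b a * (Z i a * Y i x))"
    by (simp add: lc_def prodt_def sum_distrib_left)
  also have "\<dots> = (\<Sum>i<r. \<Sum>a<j. b a * (Z i a * Y i x))" by (rule sum.swap)
  finally show "lc j (prodt j r Y Z) b x = lc r Y (\<lambda>i. dot j b (Z i)) x"
    by (simp add: lc_def dot_def sum_distrib_right mult.assoc)
qed

lemma row_prodt: "Z \<in> tuples j r \<Longrightarrow> row (prodt j r Y Z) x = lc r Z (\<lambda>l. Y l x)"
  using tuplesD(1)[of Z j r] by (auto simp: row_def prodt_def lc_def fun_eq_iff vecs_def mult.commute)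

lemma prodt_lc:
  assumes "Y = prodt r s P Q"
  shows "prodt j r Y Z = prodt j s P (\<lambda>i. lc r Z (Q i))"
proof
  fix a
  show "prodt j r Y Z a = prodt j s P (\<lambda>i. lc r Z (Q i)) a"
  proof (cases "a < j")
    case True
    have "lc r Y (\<lambda>i. Z i a) = lc s P (\<lambda>i. dot r (\<lambda>i. Z i a) (Q i))" unfolding assms by (rule lc_prodt)
    then show ?thesis using True by (simp add: prodt_def dot_def lc_def mult.commute)
  qed (simp add: prodt_def)
qed

lemma dot_lc_right: "dot j b (lc r Z c) = dot r c (\<lambda>l. dot j b (Z l))"
proof -
  have "dot j b (lc r Z c) = (\<Sum>i<j. \<Sum>a<r. b i * (c a * Z a i))"
    by (simp add: dot_def lc_def sum_distrib_left)
  also have "\<dots> = (\<Sum>a<r. \<Sum>i<j. b i * (c a * Z a i))" by (rule sum.swap)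
  finally show ?thesis by (simp add: dot_def sum_distrib_left mult.left_commute)
qed

lemma full_rows_comp:
  assumes Z: "full_rows j r Z" and Q: "full_rows r s Q"
  shows "full_rows j s (\<lambda>i. lc r Z (Q i))"
  unfolding full_rows_def
proof
  fix c :: "nat \<Rightarrow> 'a" assume "c \<in> vecs s"
  then obtain b where b: "b \<in> vecs r" "\<forall>i<s. dot r b (Q i) = c i" using Q unfolding full_rows_def by blast
  obtain b' where b': "b' \<in> vecs j" "\<forall>l<r. dot j b' (Z l) = b l" using Z b(1) unfolding full_rows_def by blast
  have "dot j b' (lc r Z (Q i)) = dot r b (Q i)" for i
    unfolding dot_lc_right dot_commute[of r "Q i"] using b'(2) by (simp add: dot_def)
  then show "\<exists>b\<in>vecs j. \<forall>i<s. dot j b (lc r Z (Q i)) = c i" using b b' by (intro bexI[of _ b']) simp_all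
qed

lemma lc_unit: "i < r \<Longrightarrow> lc r Y (\<lambda>k. if k = i then 1 else 0) = Y i"
  by (simp add: lc_def mult_delta_left)

lemma prodt_inj:
  fixes Y Y' Z :: "nat \<Rightarrow> nat \<Rightarrow> 'a::field"
  assumes Z: "full_rows j r Z" and Y: "Y \<in> tuples N r" "Y' \<in> tuples N r" and eq: "prodt j r Y Z = prodt j r Y' Z"
  shows "Y = Y'"
proof
  fix i
  show "Y i = Y' i"
  proof (cases "i < r")
    case True
    have "(\<lambda>k. if k = i then 1 else (0::'a)) \<in> vecs r" using True by (auto simp: vecs_def)
    then have "\<exists>b\<in>vecs j. \<forall>k<r. dot j b (Z k) = (if k = i then 1 else 0)"
      using Z unfolding full_rows_def by (rule bspec[rotated])
    then obtain b where b: "\<forall>k<r. dot j b (Z k) = (if k = i then 1 else 0)" by (rule bexE)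
    have "lc r V (\<lambda>k. dot j b (Z k)) = V i" for V :: "nat \<Rightarrow> nat \<Rightarrow> 'a"
      using b lc_unit[OF True, of V] by (simp cong: lc_cong)
    then show ?thesis using arg_cong[OF eq, of "\<lambda>X. lc j X b"] unfolding lc_prodt by simp
  next
    case False
    then show ?thesis using tuplesD(2)[OF Y(1), of i] tuplesD(2)[OF Y(2), of i] by simp
  qed
qed

text \<open>The case S = 0 of \<open>adapted_factorization\<close>, where d = 0 because a basis
  contains no zero vector.\<close>

lemma rank_factorization:
  fixes X :: "nat \<Rightarrow> nat \<Rightarrow> 'a::{field,finite}"
  assumes X: "X \<in> tuples N j"
  obtains r Y Z where "r \<le> j" "Y \<in> tuples N r" "Z \<in> tuples j r" "indep r Y" "full_rows j r Z"
    "X = prodt j r Y Z" "\<And>i. i < r \<Longrightarrow> Y i \<in> lspan j X"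
    "card {b \<in> vecs j. lc j X b = 0} * CARD('a) ^ r = CARD('a) ^ j"
proof -
  have S: "is_subspace {0 :: nat \<Rightarrow> 'a}" by (simp add: is_subspace_def)
  obtain r d Y Z where D: "d \<le> r" "r \<le> j" "indep r Y" "\<And>i. i < r \<Longrightarrow> Y i \<in> lspan j X"
    "\<And>i. i < d \<Longrightarrow> Y i \<in> {0}" "\<And>i. i < r \<Longrightarrow> Z i \<in> vecs j"
    "\<And>a. a < j \<Longrightarrow> X a = lc r Y (\<lambda>i. Z i a)"
    "\<And>c. c \<in> vecs r \<Longrightarrow> \<exists>b\<in>vecs j. \<forall>i<r. dot j b (Z i) = c i"
    "card {b \<in> vecs j. lc j X b \<in> {0}} * CARD('a) ^ (r - d) = CARD('a) ^ j"
    by (rule adapted_factorization[of j X N "{0}", OF tuplesD(1)[OF X] S]) blast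
  have "d = 0"
  proof (rule ccontr)
    assume "d \<noteq> 0"
    then have "0 < r" "Y 0 = 0" using D(1) D(5)[of 0] by auto
    then have "lc r Y (\<lambda>k. if k = 0 then 1 else 0) = 0" by (simp only: lc_unit)
    moreover have "(\<lambda>k. if k = 0 then 1 else (0::'a)) \<in> vecs r" using \<open>0 < r\<close> by (auto simp: vecs_def)
    ultimately have "(\<lambda>k::nat. if k = 0 then 1 else (0::'a)) = 0"
      using D(3)[unfolded indep_def, rule_format] by metis
    from fun_cong[OF this, of 0] show False by simp
  qed
  define Y' where "Y' i = (if i < r then Y i else (\<lambda>_. 0))" for i
  define Z' where "Z' i = (if i < r then Z i else (\<lambda>_. 0))" for i
  have lcY: "lc r Y' c = lc r Y c" for c by (simp add: Y'_def lc_def)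
  have sub: "lspan j X \<subseteq> vecs N" by (rule lspan_vecs) (rule tuplesD(1)[OF X])
  show ?thesis
  proof (rule that[of r Y' Z'])
    show "Y' \<in> tuples N r" using D(4) sub by (auto simp: tuples_alt Y'_def)
    show "Z' \<in> tuples j r" using D(6) by (auto simp: tuples_alt Z'_def)
    show "indep r Y'" using D(3) by (simp add: indep_def lcY)
    show "full_rows j r Z'" using D(8) by (simp add: full_rows_def Z'_def)
    have "lc r Y (\<lambda>i. Z' i a) = lc r Y (\<lambda>i. Z i a)" for a by (rule lc_cong) (simp_all add: Z'_def)
    then show "X = prodt j r Y' Z'" using D(7) tuplesD(2)[OF X] by (intro ext) (simp add: prodt_def lcY)
    show "Y' i \<in> lspan j X" if "i < r" for i using D(4)[OF that] that by (simp add: Y'_def)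
    show "card {b \<in> vecs j. lc j X b = 0} * CARD('a) ^ r = CARD('a) ^ j" using D(9) \<open>d = 0\<close> by simp
  qed (rule D(2))
qed

lemma sum_UN_le:
  fixes f :: "'b \<Rightarrow> real"
  assumes "finite I" "\<And>i. i \<in> I \<Longrightarrow> finite (L i)" "\<And>x. f x \<ge> 0"
  shows "(\<Sum>x\<in>(\<Union>i\<in>I. L i). f x) \<le> (\<Sum>i\<in>I. \<Sum>x\<in>L i. f x)"
  using assms(1,2)
proof (induction I)
  case (insert i I)
  have fin: "finite (L i)" "finite (\<Union>i\<in>I. L i)" using insert.prems insert.hyps by auto
  have "(\<Sum>x\<in>(\<Union>i\<in>insert i I. L i). f x) = (\<Sum>x\<in>L i. f x) + (\<Sum>x\<in>(\<Union>i\<in>I. L i). f x) - (\<Sum>x\<in>L i \<inter> (\<Union>i\<in>I. L i). f x)"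
    using sum_Un[OF fin, of f] by simp
  moreover have "(\<Sum>x\<in>L i \<inter> (\<Union>i\<in>I. L i). f x) \<ge> 0" by (rule sum_nonneg) (rule assms(3))
  moreover have "(\<Sum>x\<in>(\<Union>i\<in>I. L i). f x) \<le> (\<Sum>i\<in>I. \<Sum>x\<in>L i. f x)" using insert by simp
  ultimately show ?case using insert.hyps by simp
qed simp

context unitary_level
begin

lemma prodt_VR:
  assumes "Y \<in> tuples N r" "Z \<in> tuples j r"
  shows "prodt j r Y Z \<in> VR (lspan r Z)"
  using assms prodt_in[OF assms(1)] row_prodt[OF assms(2)] unfolding VR_def mem_Collect_eq lspan_iff by blast

lemma VR_prodt:
  assumes Z: "Z \<in> tuples j r" and X: "X \<in> VR (lspan r Z)"
  shows "\<exists>Y\<in>tuples N r. X = prodt j r Y Z"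
proof -
  have XV: "X \<in> VV" and rw: "\<And>i. row X i \<in> lspan r Z" using X by (auto simp: VR_def)
  then obtain c where c: "\<And>i. row X i = lc r Z (c i)" unfolding lspan_iff by metis
  define Y where "Y l = (\<lambda>i. if l < r \<and> i < N then c i l else 0)" for l
  have Y: "Y \<in> tuples N r" by (auto simp: tuples_alt Y_def vecs_def)
  have "row (prodt j r Y Z) i = row X i" for i
  proof (cases "i < N")
    case True
    then have "lc r Z (\<lambda>l. Y l i) = lc r Z (c i)" by (intro lc_cong) (simp_all add: Y_def)
    then show ?thesis by (simp only: row_prodt[OF Z] c)
  next
    case False
    then have "row X i = 0" using tuplesD(1)[OF XV] by (auto simp: row_def vecs_def fun_eq_iff)
    moreover have "row (prodt j r Y Z) i = 0" using False tuplesD(1)[OF prodt_in[OF Y, of j Z]]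
      by (auto simp: row_def vecs_def fun_eq_iff)
    ultimately show ?thesis by simp
  qed
  then have "X = prodt j r Y Z" by (intro row_eqI) simp
  then show ?thesis using Y by blast
qed

lemma card_VR_le:
  assumes Z: "Z \<in> tuples j r"
  shows "card (VR (lspan r Z)) \<le> (q\<^sup>2) ^ (N * r)"
proof -
  let ?T = "tuples N r :: (nat \<Rightarrow> nat \<Rightarrow> 'a) set"
  have "VR (lspan r Z) \<subseteq> (\<lambda>Y. prodt j r Y Z) ` ?T" using VR_prodt[OF Z] by blast
  then have "card (VR (lspan r Z)) \<le> card ((\<lambda>Y. prodt j r Y Z) ` ?T)"
    by (intro card_mono) (simp_all add: card_tuples)
  also have "\<dots> \<le> card ?T" by (rule card_image_le) (simp add: card_tuples)
  finally show ?thesis by (simp add: card_tuples card_field)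
qed

text \<open>As Y and Y' are independent, both products satisfy exactly the relations b with b . Z_i
  = 0 for all i. With equal Gram matrices, Witt's theorem applies, and c is invariant under the
  group.\<close>

lemma same_orbit:
  assumes Y: "Y \<in> tuples N r" "indep r Y" and Y': "Y' \<in> tuples N r" "indep r Y'"
    and gram: "\<And>a b. a < j \<Longrightarrow> b < j \<Longrightarrow> h N (prodt j r Y Z a) (prodt j r Y Z b) = h N (prodt j r Y' Z a) (prodt j r Y' Z b)"
  shows "cc (prodt j r Y' Z) = cc (prodt j r Y Z)"
proof -
  let ?X = "prodt j r Y Z" and ?X' = "prodt j r Y' Z"
  have X: "?X \<in> VV" "?X' \<in> VV" using Y(1) Y'(1) by (simp_all add: prodt_in)
  have k: "lc j (prodt j r V Z) b = 0 \<longleftrightarrow> (\<forall>i<r. dot j b (Z i) = 0)" if "indep r V" for V b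
  proof -
    have "lc r V (cut r (\<lambda>i. dot j b (Z i))) = 0 \<longleftrightarrow> cut r (\<lambda>i. dot j b (Z i)) = 0"
      using that lc_0[of r V] unfolding indep_def by (metis cut_in)
    moreover have "cut r c = 0 \<longleftrightarrow> (\<forall>i<r. c i = 0)" for c :: "nat \<Rightarrow> 'a"
      by (auto simp: cut_def fun_eq_iff)
    ultimately show ?thesis unfolding lc_prodt lc_cut by simp
  qed
  have "\<exists>g\<in>carrier GG. \<forall>a<j. mv g (?X a) = ?X' a"
    by (rule witt) (use X tuplesD(1) k[OF Y(2)] k[OF Y'(2)] gram in auto)
  then obtain g where g: "g \<in> carrier GG" "\<forall>a<j. mv g (?X a) = ?X' a" by blast
  have "act g ?X = ?X'"
  proof
    fix a show "act g ?X a = ?X' a" using g(2) by (cases "a < j") (simp_all add: act_def prodt_def zero_fun_def)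
  qed
  then show ?thesis using cc_act[OF g(1) X(1)] by simp
qed

text \<open>At most q^(2Ns+2rs) tuples of rank s, each with c of size q^(s^2+s-Ns), must stay below
  q^(Nr) with r + 2 powers of q to spare. The worst case is s = r - 1, and there 3r^2 + r + 10 \<le>
  N suffices.\<close>

lemma rank_numeric:
  assumes "s < r" "r \<le> j" "N \<ge> 3 * j\<^sup>2 + j + 2 * m + 10"
  shows "N * s + 2 * (r * s) + s\<^sup>2 + s + (r + 2) \<le> N * r"
proof -
  obtain t where t: "r = Suc t" using assms(1) by (cases r) auto
  have s: "s \<le> t" using assms(1) t by simp
  have "N * s + 2 * (r * s) + s * s + s \<le> N * t + 2 * (r * t) + t * t + t"
    using s by (intro add_mono mult_mono) auto
  moreover have "2 * (r * t) + t * t + t + (r + 2) \<le> N"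
  proof -
    have "3 * (r * r) \<le> 3 * (j * j)" using assms(2) by (intro mult_mono) auto
    then have "3 * (r * r) + r + 10 \<le> N" using assms(2,3) by (simp add: power2_eq_square)
    then show ?thesis by (simp add: t algebra_simps)
  qed
  ultimately show ?thesis by (simp add: t power2_eq_square)
qed

text \<open>By Witt's theorem \<open>c\<close> is constant on the tuples of full rank with the rows and Gram matrix of \<open>X\<close>;
  these are numerous, the sum over all tuples with these rows and Gram matrix is small, and tuples of
  smaller rank are controlled by induction.\<close>

lemma cc_rank_bound:
  assumes N: "N \<ge> 3 * j\<^sup>2 + j + 2 * m + 10"
  shows "r \<le> j \<Longrightarrow> has_rank N j X r \<Longrightarrow> cmod (cc X) * real q ^ (N * r) \<le> 3 / 2 * real q ^ (r\<^sup>2 + r) * c0"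
proof (induction r arbitrary: X rule: less_induct)
  case (less r)
  obtain Y Z where Y: "Y \<in> tuples N r" "indep r Y" and Z: "Z \<in> tuples j r" "full_rows j r Z" and X: "X = prodt j r Y Z"
    using less.prems(2) unfolding has_rank_def by blast
  let ?R = "lspan r Z"
  have R: "is_subspace ?R" "?R \<subseteq> vecs j"
    using is_subspace_lspan lspan_vecs[of r Z j] tuplesD(1)[OF Z(1)] by blast+
  define S where "S = {W \<in> VR ?R. \<forall>a<j. \<forall>b<j. h N (W a) (W b) = h N (X a) (X b)}"
  define S1 where "S1 = {W \<in> S. \<exists>V\<in>tuples N r. indep r V \<and> W = prodt j r V Z}"
  have finS: "finite S" "finite S1" using finVR[OF R] by (simp_all add: S_def S1_def)
  have S1S: "S1 \<subseteq> S" by (auto simp: S1_def)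
  have cS1: "cc W = cc X" if WS: "W \<in> S1" for W
  proof -
    obtain V where V: "V \<in> tuples N r" "indep r V" "W = prodt j r V Z" using WS unfolding S1_def by blast
    have "cc (prodt j r V Z) = cc (prodt j r Y Z)"
      by (rule same_orbit[OF Y V(1,2)]) (use WS in \<open>simp add: S1_def S_def V(3) X\<close>)
    then show ?thesis by (simp only: V(3) X)
  qed
  \<comment> \<open>Right multiplication by Z embeds the unitary orbit of the independent tuple Y
    into \<open>S1\<close>.\<close>
  have orb: "(q\<^sup>2) ^ (N * r) \<le> card S1 * q ^ (r\<^sup>2 + r)"
  proof -
    let ?t = "\<lambda>g a. if a < r then mv g (Y a) else (\<lambda>_. 0)"
    have tin: "?t g \<in> tuples N r" if "g \<in> carrier GG" for g
      using mvG_in[OF that] by (auto simp: tuples_alt)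
    have pt: "prodt j r (?t g) Z = act g X" for g
    proof
      fix a
      have "lc r (?t g) c = mv g (lc r Y c)" for c
        unfolding mv_lc by (rule lc_cong) (simp_all add: act_def)
      then show "prodt j r (?t g) Z a = act g X a" by (simp add: X prodt_def act_def zero_fun_def)
    qed
    have "card (?t ` carrier GG) \<le> card S1"
    proof (rule card_inj_on_le[of "\<lambda>V. prodt j r V Z"])
      show "inj_on (\<lambda>V. prodt j r V Z) (?t ` carrier GG)"
        by (rule inj_onI) (use tin prodt_inj[OF Z(2)] in blast)
      show "(\<lambda>V. prodt j r V Z) ` ?t ` carrier GG \<subseteq> S1"
      proof
        fix W assume "W \<in> (\<lambda>V. prodt j r V Z) ` ?t ` carrier GG"
        then obtain g where g: "g \<in> carrier GG" "W = prodt j r (?t g) Z" by blast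
        have "indep r (?t g)"
          unfolding indep_def
        proof (intro ballI impI)
          fix b :: "nat \<Rightarrow> 'a" assume b: "b \<in> vecs r" "lc r (?t g) b = 0"
          have "lc r (?t g) b = mv g (lc r Y b)"
            unfolding mv_lc by (rule lc_cong) (simp_all add: act_def)
          then have "mv g (lc r Y b) = mv g 0" using b(2) by simp
          moreover have "lc r Y b \<in> vecs N" by (rule vecs_lc) (rule tuplesD(1)[OF Y(1)])
          ultimately have "lc r Y b = 0" using mvG_inv(1)[OF g(1)] vecs_0(1) by metis
          then show "b = 0" using Y(2) b(1) by (simp add: indep_def)
        qed
        moreover have "W \<in> S"
          unfolding S_def using prodt_VR[OF tin[OF g(1)] Z(1)] GG_h[OF g(1)] by (simp add: g(2) pt act_def)
        ultimately show "W \<in> S1" unfolding S1_def using g tin by blast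
      qed
    qed (rule finS)
    moreover have "(q\<^sup>2) ^ (N * r) \<le> card (?t ` carrier GG) * q ^ (r\<^sup>2 + r)"
      by (rule card_orbit[OF _ Y(2) order_refl]) (rule tuplesD(1)[OF Y(1)])
    ultimately show ?thesis by (meson le_trans mult_le_mono1)
  qed
  \<comment> \<open>If V has rank s < r and V = P Q, then V Z = P (Q Z), which leaves at most
    q^(2Ns+2rs) products. The rank condition is included so that the induction hypothesis
    applies.\<close>
  define L where "L s = {W \<in> (\<lambda>(P, Q). prodt j s P (\<lambda>i. lc r Z (Q i))) ` (tuples N s \<times> tuples r s). has_rank N j W s}" for s
  have fL: "finite (L s)" for s by (simp add: L_def card_tuples)
  have cL: "card (L s) \<le> q ^ (2 * (N * s) + 2 * (r * s))" for s
  proof -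
    let ?PQ = "(tuples N s :: (nat \<Rightarrow> nat \<Rightarrow> 'a) set) \<times> (tuples r s :: (nat \<Rightarrow> nat \<Rightarrow> 'a) set)"
    have "card (L s) \<le> card ((\<lambda>(P, Q). prodt j s P (\<lambda>i. lc r Z (Q i))) ` ?PQ)"
      by (rule card_mono) (auto simp: L_def card_tuples)
    also have "\<dots> \<le> card ?PQ" by (rule card_image_le) (simp add: card_tuples)
    also have "\<dots> = q ^ (2 * (N * s) + 2 * (r * s))"
      by (simp add: card_cartesian_product card_tuples card_field power_add power_mult)
    finally show ?thesis .
  qed
  have low: "S - S1 \<subseteq> (\<Union>s<r. L s)"
  proof
    fix W assume W: "W \<in> S - S1"
    then obtain V where V: "V \<in> tuples N r" "W = prodt j r V Z" using VR_prodt[OF Z(1), of W] by (auto simp: S_def)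
    have nind: "\<not> indep r V" using W V by (auto simp: S1_def)
    obtain s P Q where D: "s \<le> r" "P \<in> tuples N s" "Q \<in> tuples r s" "indep s P" "full_rows r s Q"
      "V = prodt r s P Q" "card {b \<in> vecs r. lc r V b = 0} * CARD('a) ^ s = CARD('a) ^ r"
      by (rule rank_factorization[OF V(1)]) blast
    have We: "W = prodt j s P (\<lambda>i. lc r Z (Q i))" unfolding V(2) by (rule prodt_lc[OF D(6)])
    have "s \<noteq> r"
    proof
      assume "s = r"
      then have "card {b \<in> vecs r. lc r V b = 0} = 1" using D(7) q_gt_1 by (simp add: card_field)
      then obtain x where x: "{b \<in> vecs r. lc r V b = 0} = {x}" by (auto simp: card_1_singleton_iff)
      have "0 \<in> {b \<in> vecs r. lc r V b = 0}" by (simp only: mem_Collect_eq vecs_0 lc_0)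
      then have "x = 0" unfolding x by simp
      then have "indep r V" unfolding indep_def using x by blast
      then show False using nind by simp
    qed
    then have sr: "s < r" using D(1) by simp
    have QZ: "(\<lambda>i. lc r Z (Q i)) \<in> tuples j s"
    proof -
      have "lc r Z (Q i) \<in> vecs j" for i by (rule vecs_lc) (rule tuplesD(1)[OF Z(1)])
      moreover have "lc r Z (Q i) = (\<lambda>_. 0)" if "i \<ge> s" for i
        using tuplesD(2)[OF D(3) that] by (simp add: lc_def zero_fun_def)
      ultimately show ?thesis by (simp add: tuples_def)
    qed
    have "has_rank N j W s"
      unfolding has_rank_def using D(2,4) QZ full_rows_comp[OF Z(2) D(5)] We by blast
    then have "W \<in> L s" unfolding L_def using We D(2,3) by auto
    then show "W \<in> (\<Union>s<r. L s)" using sr by blast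
  qed
  have term_s: "(\<Sum>W\<in>L s. cmod (cc W)) * real q ^ (r + 2) \<le> 3 / 2 * real q ^ (N * r) * c0" if s: "s < r" for s
  proof -
    have "cmod (cc W) * real q ^ (N * s) \<le> 3 / 2 * real q ^ (s\<^sup>2 + s) * c0" if "W \<in> L s" for W
      by (rule less.IH[OF s]) (use that s less.prems(1) in \<open>auto simp: L_def\<close>)
    then have "(\<Sum>W\<in>L s. cmod (cc W) * real q ^ (N * s)) \<le> real (card (L s)) * (3 / 2 * real q ^ (s\<^sup>2 + s) * c0)"
      by (rule sum_bounded_above)
    also have "\<dots> \<le> real (q ^ (2 * (N * s) + 2 * (r * s))) * (3 / 2 * real q ^ (s\<^sup>2 + s) * c0)"
      using cL[of s] cc_0(2) by (intro mult_right_mono) (simp_all only: of_nat_le_iff, simp)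
    also have "\<dots> = real q ^ (N * s) * (3 / 2 * real q ^ (N * s + 2 * (r * s) + s\<^sup>2 + s) * c0)"
    proof -
      have e: "real (q ^ (2 * (N * s) + 2 * (r * s))) * real q ^ (s\<^sup>2 + s) = real q ^ (N * s) * real q ^ (N * s + 2 * (r * s) + s\<^sup>2 + s)"
        unfolding of_nat_power power_add[symmetric] by (rule arg_cong[of _ _ "power (real q)"]) simp
      have e': "A * (3 / 2 * B * c0) = 3 / 2 * c0 * (A * B)" for A B :: real by simp
      show ?thesis unfolding e' e ..
    qed
    finally have "real q ^ (N * s) * (\<Sum>W\<in>L s. cmod (cc W)) \<le> real q ^ (N * s) * (3 / 2 * real q ^ (N * s + 2 * (r * s) + s\<^sup>2 + s) * c0)"
      by (simp only: sum_distrib_left mult.commute[of "real q ^ (N * s)"] sum_distrib_right)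
    then have "(\<Sum>W\<in>L s. cmod (cc W)) \<le> 3 / 2 * real q ^ (N * s + 2 * (r * s) + s\<^sup>2 + s) * c0"
      by (rule mult_left_le_imp_le) simp
    then have "(\<Sum>W\<in>L s. cmod (cc W)) * real q ^ (r + 2) \<le> 3 / 2 * real q ^ (N * s + 2 * (r * s) + s\<^sup>2 + s) * c0 * real q ^ (r + 2)"
      by (rule mult_right_mono) simp
    also have "\<dots> = 3 / 2 * c0 * real q ^ (N * s + 2 * (r * s) + s\<^sup>2 + s + (r + 2))"
      by (simp add: power_add mult_ac)
    also have "\<dots> \<le> 3 / 2 * c0 * real q ^ (N * r)"
      using rank_numeric[OF s less.prems(1) N] q_gt_1 cc_0(2) by (intro mult_left_mono power_increasing) auto
    finally show ?thesis by (simp only: mult_ac)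
  qed
  \<comment> \<open>In units of q^(Nr) c0 the r lower ranks contribute at most (3r/2) q^-(r+2) \<le>
    1/2, by 3r \<le> 2^(r+2). Together with the bound 1 for the full sum this reproduces the
    constant 3/2.\<close>
  have lowsum: "(\<Sum>W\<in>S - S1. cmod (cc W)) \<le> 1 / 2 * real q ^ (N * r) * c0"
  proof -
    have "(\<Sum>W\<in>S - S1. cmod (cc W)) \<le> (\<Sum>W\<in>(\<Union>s<r. L s). cmod (cc W))"
      by (rule sum_mono2[OF _ low]) (auto simp: fL)
    also have "\<dots> \<le> (\<Sum>s<r. \<Sum>W\<in>L s. cmod (cc W))"
      by (rule sum_UN_le) (auto simp: fL)
    finally have "(\<Sum>W\<in>S - S1. cmod (cc W)) * real q ^ (r + 2) \<le> (\<Sum>s<r. \<Sum>W\<in>L s. cmod (cc W)) * real q ^ (r + 2)"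
      by (rule mult_right_mono) simp
    also have "\<dots> \<le> (\<Sum>s<r. 3 / 2 * real q ^ (N * r) * c0)"
      by (subst sum_distrib_right, rule sum_mono, rule term_s) simp
    also have "\<dots> = (3 * real r) * (1 / 2 * real q ^ (N * r) * c0)" by simp
    also have "\<dots> \<le> real q ^ (r + 2) * (1 / 2 * real q ^ (N * r) * c0)"
    proof (rule mult_right_mono)
      have "(2::nat) ^ (r + 2) = 4 * 2 ^ r" by simp
      then have "3 * r \<le> 2 ^ (r + 2)" using less_exp[of r] by linarith
      also have "(2::nat) ^ (r + 2) \<le> q ^ (r + 2)" using q_gt_1 by (intro power_mono) auto
      finally have "real (3 * r) \<le> real (q ^ (r + 2))" by (simp only: of_nat_le_iff)
      then show "3 * real r \<le> real q ^ (r + 2)" by simp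
    qed (use cc_0(2) in simp)
    finally have "real q ^ (r + 2) * (\<Sum>W\<in>S - S1. cmod (cc W)) \<le> real q ^ (r + 2) * (1 / 2 * real q ^ (N * r) * c0)"
      by (simp only: mult_ac)
    then show ?thesis by (rule mult_left_le_imp_le) simp
  qed
  have gs: "cmod (\<Sum>W\<in>S. cc W) \<le> real q ^ (N * r) * c0"
  proof -
    have "sqrt (real (card (VR ?R))) \<le> sqrt (real ((q\<^sup>2) ^ (N * r)))"
      using card_VR_le[OF Z(1)] by (intro real_sqrt_le_mono) (simp only: of_nat_le_iff)
    also have "real ((q\<^sup>2) ^ (N * r)) = (real q ^ (N * r))\<^sup>2" by (simp add: power_mult[symmetric] mult.commute)
    also have "sqrt \<dots> = real q ^ (N * r)" by simp
    finally have "sqrt (real (card (VR ?R))) * c0 \<le> real q ^ (N * r) * c0"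
      using cc_0(2) by (intro mult_right_mono) auto
    then show ?thesis using gram_sum_bound[OF R, of "\<lambda>a b. h N (X a) (X b)"] unfolding S_def by (rule order_trans[rotated])
  qed
  have "(\<Sum>W\<in>S. cc W) = (\<Sum>W\<in>S - S1. cc W) + (\<Sum>W\<in>S1. cc W)" by (rule sum.subset_diff[OF S1S finS(1)])
  also have "(\<Sum>W\<in>S1. cc W) = of_nat (card S1) * cc X" using cS1 by simp
  finally have "of_nat (card S1) * cc X = (\<Sum>W\<in>S. cc W) - (\<Sum>W\<in>S - S1. cc W)" by simp
  then have "real (card S1) * cmod (cc X) = cmod ((\<Sum>W\<in>S. cc W) - (\<Sum>W\<in>S - S1. cc W))"
    by (metis norm_mult norm_of_nat)
  also have "\<dots> \<le> cmod (\<Sum>W\<in>S. cc W) + cmod (\<Sum>W\<in>S - S1. cc W)" by (rule norm_triangle_ineq4)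
  also have "\<dots> \<le> real q ^ (N * r) * c0 + 1 / 2 * real q ^ (N * r) * c0"
    by (rule add_mono[OF gs order_trans[OF norm_sum lowsum]])
  finally have main: "real (card S1) * cmod (cc X) \<le> 3 / 2 * real q ^ (N * r) * c0" by simp
  have "real q ^ (N * r) * (cmod (cc X) * real q ^ (N * r)) = real ((q\<^sup>2) ^ (N * r)) * cmod (cc X)"
    by (simp add: power2_eq_square power_mult_distrib)
  also have "\<dots> \<le> real (card S1 * q ^ (r\<^sup>2 + r)) * cmod (cc X)"
    using orb by (intro mult_right_mono) (simp_all only: of_nat_le_iff, simp)
  also have "\<dots> = real q ^ (r\<^sup>2 + r) * (real (card S1) * cmod (cc X))" by simp
  also have "\<dots> \<le> real q ^ (r\<^sup>2 + r) * (3 / 2 * real q ^ (N * r) * c0)" using main by (rule mult_left_mono) simp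
  also have "\<dots> = real q ^ (N * r) * (3 / 2 * real q ^ (r\<^sup>2 + r) * c0)" by simp
  finally show ?case by (rule mult_left_le_imp_le) simp
qed

end

text \<open>A rank one tuple has \<open>|F| - 1\<close> representations as \<open>y \<otimes> z\<close>.\<close>

lemma card_rank_one:
  fixes I J :: "(nat \<Rightarrow> 'a::{field,finite}) set"
  assumes I: "is_subspace I" "finite I" and J: "is_subspace J" "finite J"
  shows "card {tens y z |y z. y \<in> I - {0} \<and> z \<in> J - {0}} * (CARD('a) - 1) \<le> card I * card J"
proof -
  let ?L = "{tens y z |y z. y \<in> I - {0} \<and> z \<in> J - {0}}"
  have "\<forall>X\<in>?L. \<exists>p. fst p \<in> I - {0} \<and> snd p \<in> J - {0} \<and> X = tens (fst p) (snd p)"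
    by fastforce
  from bchoice[OF this] obtain f where
    f': "\<forall>X\<in>?L. fst (f X) \<in> I - {0} \<and> snd (f X) \<in> J - {0} \<and> X = tens (fst (f X)) (snd (f X))" ..
  have f: "fst (f X) \<in> I - {0} \<and> snd (f X) \<in> J - {0} \<and> X = tens (fst (f X)) (snd (f X))" if "X \<in> ?L" for X
    using f' that by (rule bspec)
  have scale: "tens (smul t y) (smul (inverse t) z) = tens y z" if "t \<noteq> 0" for t :: 'a and y z
    using that by (simp add: tens_def smul_def fun_eq_iff)
  let ?g = "\<lambda>(X, t). (smul t (fst (f X)), smul (inverse t) (snd (f X)))"
  have "card (?L \<times> (UNIV - {0::'a})) \<le> card (I \<times> J)"
  proof (rule card_inj_on_le[of ?g])
    show "inj_on ?g (?L \<times> (UNIV - {0}))"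
    proof (rule inj_onI)
      fix p p' assume p: "p \<in> ?L \<times> (UNIV - {0})" "p' \<in> ?L \<times> (UNIV - {0})" and eq: "?g p = ?g p'"
      obtain X t X' t' where pp: "p = (X, t)" "p' = (X', t')" by (cases p, cases p')
      have m: "X \<in> ?L" "X' \<in> ?L" "t \<noteq> 0" "t' \<noteq> 0" using p pp by auto
      have e: "smul t (fst (f X)) = smul t' (fst (f X'))" "smul (inverse t) (snd (f X)) = smul (inverse t') (snd (f X'))"
        using eq pp by simp_all
      have "X = tens (smul t (fst (f X))) (smul (inverse t) (snd (f X)))"
        unfolding scale[OF m(3)] using f[OF m(1)] by (elim conjE)
      also have "\<dots> = tens (fst (f X')) (snd (f X'))" unfolding e by (rule scale[OF m(4)])
      also have "\<dots> = X'" using f[OF m(2)] by (elim conjE) (rule sym)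
      finally have XX: "X = X'" .
      have "smul (t - t') (fst (f X)) = 0" using e(1) XX by (simp only: smul_diff diff_self)
      moreover have "fst (f X) \<noteq> 0" using f[OF m(1)] by blast
      ultimately have "t = t'" by (simp add: smul_eq_0_iff)
      then show "p = p'" using XX pp by simp
    qed
    show "?g ` (?L \<times> (UNIV - {0})) \<subseteq> I \<times> J"
    proof
      fix w assume "w \<in> ?g ` (?L \<times> (UNIV - {0}))"
      then obtain X t where w: "X \<in> ?L" "w = (smul t (fst (f X)), smul (inverse t) (snd (f X)))" by auto
      then show "w \<in> I \<times> J"
        using f[OF w(1)] is_subspaceD(3)[OF I(1)] is_subspaceD(3)[OF J(1)] by blast
    qed
  qed (use I J in simp)
  then show ?thesis by (simp add: card_cartesian_product card_Diff_subset)
qed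

text \<open>The squared form of the claim that q^(2mr+2jr) tuples of rank r with decay q^(r^2+r-Nr)
  contribute at most q^(-N/2), with r + 3 powers of q to spare.\<close>

lemma high_rank_numeric:
  fixes r j m N :: nat
  assumes "2 \<le> r" "r \<le> j" "N \<ge> 3 * j\<^sup>2 + j + 2 * m + 10" "N \<ge> 2 * j\<^sup>2 + 4 * m + 5"
  shows "2 * (2 * (m * r) + 2 * (j * r) + r\<^sup>2 + r) + (2 * r + 6) + N \<le> 2 * (N * r)"
proof -
  obtain t where t: "r = Suc t" "t \<ge> 1" using assms(1) by (cases r) auto
  define M where "M = N * t"
  have Nr: "N * r = N + M" using t(1) by (simp add: M_def)
  have f1: "N * 1 \<le> M" unfolding M_def using t(2) by (intro mult_left_mono) auto
  have f2: "r * 5 + (m * (r * 4) + j * (j * (r * 2))) \<le> N + M"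
    using mult_right_mono[OF assms(4), of r] unfolding Nr by (simp add: power2_eq_square algebra_simps)
  have "r * 4 \<le> j * (r * 2)" using assms(1,2) by (simp add: mult.commute)
  then have f3: "j * (r * 4) \<le> j * (j * (r * 2))" by (rule mult_left_mono) simp
  have f4: "r * (r * 2) \<le> j * (j * 3)" using assms(2) by (intro mult_mono) auto
  have f5: "j * (j * 3) + 10 \<le> N" using assms(3) by (simp add: power2_eq_square algebra_simps)
  have "6 + (r * 4 + (r * (r * 2) + (j * (r * 4) + m * (r * 4)))) \<le> N + M * 2"
    using f1 f2 f3 f4 f5 by linarith
  then show ?thesis unfolding Nr by (simp add: power2_eq_square algebra_simps)
qed

context unitary_level
begin

text \<open>Rank one is kept apart because it dominates; there the overcounting of factorizations by
  scalars has to be exploited.\<close>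

lemma rank_cover:
  assumes g: "g \<in> carrier GG" and X: "X \<in> VV" "X \<noteq> 0" "\<forall>a<j. X a \<in> imn g"
  shows "(X \<in> {tens y z |y z. y \<in> imn g - {0} \<and> z \<in> vecs j - {0}} \<and> has_rank N j X 1) \<or>
    (\<exists>r\<in>{2..j}. X \<in> (\<lambda>(P, Q). prodt j r P Q) ` (tups (imn g) r \<times> tuples j r) \<and> has_rank N j X r)"
proof -
  obtain r Y Z where D: "r \<le> j" "Y \<in> tuples N r" "Z \<in> tuples j r" "indep r Y" "full_rows j r Z"
    "X = prodt j r Y Z" "\<And>i. i < r \<Longrightarrow> Y i \<in> lspan j X"
    by (rule rank_factorization[OF X(1)]) blast
  have sub: "lspan j X \<subseteq> imn g" by (rule lspan_subset[OF is_subspace_imn]) (use X(3) in blast)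
  have hr: "has_rank N j X r" unfolding has_rank_def using D by blast
  have r0: "r \<noteq> 0"
  proof
    assume "r = 0"
    then have "X = 0" unfolding D(6) prodt_def by (simp add: lc_def fun_eq_iff)
    then show False using X(2) by simp
  qed
  show ?thesis
  proof (cases "r = 1")
    case True
    have e: "X = tens (Y 0) (Z 0)"
    proof
      fix a
      have "Z 0 a = 0" if "\<not> a < j" using tuplesD(1)[OF D(3), of 0] that by (simp add: vecs_def)
      then show "X a = tens (Y 0) (Z 0) a"
        unfolding D(6) True by (cases "a < j") (simp_all add: prodt_def lc_def tens_def smul_def)
    qed
    have Y0: "Y 0 \<in> imn g" using D(7)[of 0] sub True by auto
    have Z0: "Z 0 \<in> vecs j" by (rule tuplesD(1)[OF D(3)])
    have "Y 0 \<noteq> 0" using X(2) unfolding e by auto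
    moreover have "Z 0 \<noteq> 0"
    proof
      assume "Z 0 = 0"
      then have "X = 0" unfolding e by (simp add: tens_def fun_eq_iff)
      then show False using X(2) by simp
    qed
    ultimately show ?thesis using hr[unfolded True] e Y0 Z0 by blast
  next
    case False
    have "Y \<in> tups (imn g) r" unfolding tups_def
      using D(7) sub tuplesD(2)[OF D(2)] by blast
    then have "X \<in> (\<lambda>(P, Q). prodt j r P Q) ` (tups (imn g) r \<times> tuples j r)"
      using D(3,6) by (intro image_eqI[of _ _ "(Y, Z)"]) simp_all
    then show ?thesis using hr False r0 D(1) by (intro disjI2 bexI[of _ r] conjI) simp_all
  qed
qed

text \<open>In units of q^(-N/2), rank one contributes at most 72/100 and rank r \<ge> 2 at most
  3/16 times 2^-r, in total less than one.\<close>

lemma U_estimate: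
  assumes g: "g \<in> carrier GG" and kg: "kk g = N - m"
    and N: "N \<ge> 3 * j\<^sup>2 + j + 2 * m + 10" "N \<ge> 2 * j\<^sup>2 + 4 * m + 5"
  shows "cmod ((- of_nat q) ^ (m * j) * (\<chi> g / \<chi> (1\<^sub>m N)) - 1) < real q powr (- (real N / 2))"
proof -
  have q2: "q \<ge> 2" using q_gt_1 by simp
  have mN: "m \<le> N" using N(1) by linarith
  define s where "s = real q powr (- (real N / 2))"
  have s0: "s > 0" using q2 by (simp add: s_def)
  have s2: "s\<^sup>2 = 1 / real (q ^ N)" unfolding s_def by (rule powr_neg_half_square[OF q2])
  have cI: "card (imn g) = (q\<^sup>2) ^ m"
  proof -
    have "card (imn g) * (q\<^sup>2) ^ (N - m) = (q\<^sup>2) ^ m * (q\<^sup>2) ^ (N - m)"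
      using card_imn[OF g] mN by (simp add: fixn_kk[OF g] kg card_field flip: power_add)
    then show ?thesis using q_gt_1 by simp
  qed
  have finI: "finite (imn g)" by (rule finite_subspace[OF imn_sub[OF g]])
  define L1 where "L1 = {X \<in> {tens y z |y z. y \<in> imn g - {0} \<and> z \<in> vecs j - {0}}. has_rank N j X 1}"
  define L where "L r = {X \<in> (\<lambda>(P, Q). prodt j r P Q) ` (tups (imn g) r \<times> tuples j r). has_rank N j X r}" for r
  let ?I = "{X \<in> VV. X \<noteq> 0 \<and> (\<forall>a<j. X a \<in> imn g)}"
  have finT: "finite (tups (imn g) r)" "card (tups (imn g) r) = (q\<^sup>2) ^ (m * r)" for r
    unfolding tups_def using card_PiE_vecs_like[OF finI, of r] by (simp_all add: cI power_mult)
  have tensfin: "finite {tens y z |y z. y \<in> imn g - {0} \<and> z \<in> vecs j - {0}}"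
  proof -
    have "{tens y z |y z. y \<in> imn g - {0} \<and> z \<in> vecs j - {0}} \<subseteq> (\<lambda>(y, z). tens y z) ` (imn g \<times> vecs j)" by auto
    then show ?thesis by (rule finite_subset) (simp add: finI card_vecs)
  qed
  have fin: "finite L1" "finite (L r)" for r
    using tensfin by (simp_all add: L1_def L_def finT card_tuples)
  have cover: "?I \<subseteq> L1 \<union> (\<Union>r\<in>{2..j}. L r)"
  proof
    fix X assume "X \<in> ?I"
    then show "X \<in> L1 \<union> (\<Union>r\<in>{2..j}. L r)" using rank_cover[OF g, of X] unfolding L1_def L_def by blast
  qed
  have S1: "(\<Sum>X\<in>L1. cmod (cc X)) \<le> 72 / 100 * s * c0"
  proof -
    define A where "A = real (q ^ (2 * m + 2 * j)) / real (q ^ N)"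
    have A: "A \<le> 36 / 100 * s"
    proof (rule le_from_squares)
      have "int (2 * j) \<le> int (j\<^sup>2 + 1)"
        using zero_le_power2[of "int j - 1"] by (simp add: power2_eq_square algebra_simps)
      then have "2 * j \<le> j\<^sup>2 + 1" by (simp only: of_nat_le_iff)
      then show "A\<^sup>2 \<le> 1 / 2 ^ 3 * s\<^sup>2" unfolding A_def s2
        by (intro power_ratio_le[OF q2]) (use N(2) in \<open>simp add: algebra_simps\<close>)
    qed (use s0 in \<open>auto simp: power2_eq_square\<close>)
    have "cmod (cc X) * real q ^ N \<le> 3 / 2 * real q ^ 2 * c0" if "X \<in> L1" for X
      using cc_rank_bound[OF N(1), of 1 X] j_pos that by (simp add: L1_def power2_eq_square)
    then have "(\<Sum>X\<in>L1. cmod (cc X) * real q ^ N) \<le> real (card L1) * (3 / 2 * real q ^ 2 * c0)"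
      by (rule sum_bounded_above)
    then have a: "(\<Sum>X\<in>L1. cmod (cc X)) * real q ^ N \<le> real (card L1) * (3 / 2 * real q ^ 2 * c0)"
      by (simp only: sum_distrib_right)
    have "card L1 \<le> card {tens y z |y z. y \<in> imn g - {0} \<and> z \<in> vecs j - {0}}"
      unfolding L1_def by (rule card_mono[OF tensfin]) blast
    then have "card L1 * (q\<^sup>2 - 1) \<le> card {tens y z |y z. y \<in> imn g - {0} \<and> z \<in> vecs j - {0}} * (q\<^sup>2 - 1)"
      by (rule mult_right_mono) simp
    also have "\<dots> \<le> card (imn g) * card (vecs j :: (nat \<Rightarrow> 'a) set)"
      using card_rank_one[OF is_subspace_imn finI is_subspace_vecs card_vecs(1), of j] by (simp only: card_field)
    also have "\<dots> = q ^ (2 * m + 2 * j)" by (simp add: cI card_vecs card_field power_add power_mult)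
    finally have b: "real (card L1 * (q\<^sup>2 - 1)) \<le> real (q ^ (2 * m + 2 * j))" by (simp only: of_nat_le_iff)
    have q4: "4 \<le> q\<^sup>2" using power_mono[OF q2, of 2] by simp
    then have rq: "real (q\<^sup>2 - 1) = real q ^ 2 - 1" by (simp add: of_nat_diff)
    have "real q ^ 2 \<ge> 4" using q4 by (metis of_nat_le_iff of_nat_numeral of_nat_power)
    \<comment> \<open>The q^2 - 1 representations of a rank one tuple make up for the loss q^2 in
      the orbit bound; equality holds at q = 2.\<close>
    then have "3 / 2 * real q ^ 2 \<le> 2 * real (q\<^sup>2 - 1)" unfolding rq by argo
    then have "real (card L1) * (3 / 2 * real q ^ 2 * c0) \<le> real (card L1) * (2 * real (q\<^sup>2 - 1) * c0)"
      using cc_0(2) by (intro mult_left_mono mult_right_mono) auto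
    also have "\<dots> = 2 * c0 * real (card L1 * (q\<^sup>2 - 1))" by simp
    also have "\<dots> \<le> 2 * c0 * real (q ^ (2 * m + 2 * j))" using b cc_0(2) by (intro mult_left_mono) auto
    finally have "(\<Sum>X\<in>L1. cmod (cc X)) * real q ^ N \<le> 2 * c0 * real (q ^ (2 * m + 2 * j))" using a by linarith
    then have "(\<Sum>X\<in>L1. cmod (cc X)) \<le> 2 * c0 * A" unfolding A_def using q2 by (simp add: field_simps)
    also have "\<dots> \<le> 2 * c0 * (36 / 100 * s)" using A cc_0(2) by (intro mult_left_mono) auto
    finally show ?thesis by (simp add: mult_ac)
  qed
  have Sr: "(\<Sum>X\<in>L r. cmod (cc X)) \<le> (1 / 2) ^ r * (3 / 16 * s * c0)" if r: "r \<in> {2..j}" for r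
  proof -
    define a where "a = 2 * (m * r) + 2 * (j * r) + r\<^sup>2 + r"
    define B where "B = real (q ^ a) / real (q ^ (N * r))"
    have rr: "2 \<le> r" "r \<le> j" using r by auto
    have B: "B \<le> 1 / 2 ^ (r + 3) * s"
    proof (rule le_from_squares)
      have "real (q ^ (2 * a)) * 2 ^ (2 * r + 6) * real (q ^ N) \<le> real q ^ (2 * a) * real q ^ (2 * r + 6) * real q ^ N"
        using q2 by (intro mult_mono power_mono) auto
      also have "\<dots> = real q ^ (2 * a + (2 * r + 6) + N)" by (simp only: power_add)
      also have "\<dots> \<le> real q ^ (2 * (N * r))"
        using q2 high_rank_numeric[OF rr N] by (intro power_increasing) (simp_all add: a_def)
      finally have "real q ^ (2 * a) * 2 ^ (2 * r + 6) * real q ^ N \<le> real q ^ (2 * (N * r))" by simp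
      moreover have "B\<^sup>2 = real q ^ (2 * a) / real q ^ (2 * (N * r))"
        by (simp add: B_def power_divide power_mult[symmetric] mult.commute)
      moreover have "x / w \<le> 1 / p * (1 / y)" if "x * p * y \<le> w" "p > 0" "y > 0" "w > 0" for x w p y :: real
        using that by (simp add: field_simps)
      ultimately show "B\<^sup>2 \<le> 1 / 2 ^ (2 * r + 6) * s\<^sup>2" unfolding s2 of_nat_power using q2 by simp
      have "(1 / 2 ^ (r + 3))\<^sup>2 = 1 / (2::real) ^ ((r + 3) * 2)" by (simp only: power_divide power_mult power_one)
      also have "(r + 3) * 2 = 2 * r + 6" by simp
      finally show "1 / 2 ^ (2 * r + 6) \<le> (1 / (2::real) ^ (r + 3))\<^sup>2" by simp
    qed (use s0 in auto)
    have "cmod (cc X) * real q ^ (N * r) \<le> 3 / 2 * real q ^ (r\<^sup>2 + r) * c0" if "X \<in> L r" for X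
      using cc_rank_bound[OF N(1) rr(2), of X] that by (simp add: L_def)
    then have "(\<Sum>X\<in>L r. cmod (cc X) * real q ^ (N * r)) \<le> real (card (L r)) * (3 / 2 * real q ^ (r\<^sup>2 + r) * c0)"
      by (rule sum_bounded_above)
    also have "\<dots> \<le> real (q ^ (2 * (m * r) + 2 * (j * r))) * (3 / 2 * real q ^ (r\<^sup>2 + r) * c0)"
    proof (rule mult_right_mono)
      let ?PQ = "tups (imn g) r \<times> (tuples j r :: (nat \<Rightarrow> nat \<Rightarrow> 'a) set)"
      have "card (L r) \<le> card ((\<lambda>(P, Q). prodt j r P Q) ` ?PQ)"
        by (rule card_mono) (auto simp: L_def finT card_tuples)
      also have "\<dots> \<le> card ?PQ" by (rule card_image_le) (simp add: finT card_tuples)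
      also have "\<dots> = q ^ (2 * (m * r) + 2 * (j * r))"
        by (simp add: card_cartesian_product finT card_tuples card_field power_add power_mult)
      finally show "real (card (L r)) \<le> real (q ^ (2 * (m * r) + 2 * (j * r)))" by (simp only: of_nat_le_iff)
    qed (use cc_0(2) in simp)
    also have "\<dots> = 3 / 2 * c0 * real (q ^ a)" by (simp add: a_def power_add mult_ac)
    finally have "(\<Sum>X\<in>L r. cmod (cc X)) * real (q ^ (N * r)) \<le> 3 / 2 * c0 * real (q ^ a)"
      by (simp only: sum_distrib_right of_nat_power)
    then have "(\<Sum>X\<in>L r. cmod (cc X)) \<le> 3 / 2 * c0 * B" unfolding B_def using q2 by (simp add: field_simps)
    also have "\<dots> \<le> 3 / 2 * c0 * (1 / 2 ^ (r + 3) * s)" using B cc_0(2) by (intro mult_left_mono) auto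
    also have "\<dots> = (1 / 2) ^ r * (3 / 16 * s * c0)" by (simp add: power_add power_divide mult_ac)
    finally show ?thesis .
  qed
  have "(\<Sum>X\<in>?I. cmod (cc X)) \<le> (\<Sum>X\<in>L1 \<union> (\<Union>r\<in>{2..j}. L r). cmod (cc X))"
    by (rule sum_mono2[OF _ cover]) (auto simp: fin)
  also have "\<dots> \<le> (\<Sum>X\<in>L1. cmod (cc X)) + (\<Sum>X\<in>(\<Union>r\<in>{2..j}. L r). cmod (cc X))"
  proof -
    have "(\<Sum>X\<in>L1 \<inter> (\<Union>r\<in>{2..j}. L r). cmod (cc X)) \<ge> 0" by (rule sum_nonneg) simp
    moreover have "finite (\<Union>r\<in>{2..j}. L r)" using fin(2) by blast
    ultimately show ?thesis using sum_Un[OF fin(1), of "\<Union>r\<in>{2..j}. L r" "\<lambda>X. cmod (cc X)"] by simp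
  qed
  also have "\<dots> \<le> 72 / 100 * s * c0 + (\<Sum>r\<in>{2..j}. (1 / 2) ^ r * (3 / 16 * s * c0))"
  proof (rule add_mono[OF S1])
    have "(\<Sum>X\<in>(\<Union>r\<in>{2..j}. L r). cmod (cc X)) \<le> (\<Sum>r\<in>{2..j}. \<Sum>X\<in>L r. cmod (cc X))"
      by (rule sum_UN_le) (auto simp: fin)
    also have "\<dots> \<le> (\<Sum>r\<in>{2..j}. (1 / 2) ^ r * (3 / 16 * s * c0))" by (rule sum_mono) (rule Sr)
    finally show "(\<Sum>X\<in>(\<Union>r\<in>{2..j}. L r). cmod (cc X)) \<le> (\<Sum>r\<in>{2..j}. (1 / 2) ^ r * (3 / 16 * s * c0))" .
  qed
  also have "\<dots> \<le> 72 / 100 * s * c0 + 1 * (3 / 16 * s * c0)"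
  proof (rule add_left_mono)
    have "(\<Sum>r\<in>{2..j}. (1 / 2 :: real) ^ r) \<le> (\<Sum>r=1..j. (1 / 2) ^ r)"
      by (rule sum_mono2) auto
    also have "\<dots> \<le> 2 * (1 / 2)" by (rule sum_powers_le) auto
    finally have "(\<Sum>r\<in>{2..j}. (1 / 2 :: real) ^ r) \<le> 1" by simp
    then show "(\<Sum>r\<in>{2..j}. (1 / 2) ^ r * (3 / 16 * s * c0)) \<le> 1 * (3 / 16 * s * c0)"
      unfolding sum_distrib_right[symmetric] using s0 cc_0(2) by (intro mult_right_mono) auto
  qed
  also have "\<dots> < s * c0" 
  proof -
    have "0 < s * c0" using s0 cc_0(2) by simp
    then show ?thesis by simp
  qed
  finally have "cmod (\<chi> g / \<chi> \<one>\<^bsub>GG\<^esub> / w1 g ^ j - 1) * c0 < s * c0" using ratio_error[OF g] by linarith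
  then have "cmod (\<chi> g / \<chi> \<one>\<^bsub>GG\<^esub> / w1 g ^ j - 1) < s" using cc_0(2) by simp
  moreover have "\<chi> g / \<chi> \<one>\<^bsub>GG\<^esub> / w1 g ^ j = (- of_nat q) ^ (m * j) * (\<chi> g / \<chi> (1\<^sub>m N))"
  proof -
    have "(- of_nat q :: complex) ^ N = (- of_nat q) ^ m * (- of_nat q) ^ (N - m)"
      using mN by (simp flip: power_add)
    then have "w1 g * (- of_nat q) ^ m = 1" unfolding w1_def kg using q_gt_1 by simp
    then have "w1 g ^ j * (- of_nat q) ^ (m * j) = 1" by (metis power_mult power_mult_distrib power_one)
    then have "inverse (w1 g ^ j) = (- of_nat q) ^ (m * j)" by (rule inverse_unique)
    then show ?thesis unfolding one_eq divide_inverse[of _ "w1 g ^ j"] by (simp only: mult.commute)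
  qed
  ultimately show ?thesis unfolding s_def by simp
qed

end

section \<open>Reduction to primary eigenvalue one\<close>

lemma finite_carrier_mat: "finite (carrier_mat n m :: 'a::finite mat set)"
proof (rule finite_subset)
  let ?F = "({..<n} \<times> {..<m}) \<rightarrow>\<^sub>E (UNIV :: 'a set)"
  show "carrier_mat n m \<subseteq> (\<lambda>f. mat n m f) ` ?F"
  proof
    fix A :: "'a mat" assume A: "A \<in> carrier_mat n m"
    have "A = mat n m (restrict (\<lambda>(i, k). A $$ (i, k)) ({..<n} \<times> {..<m}))"
      using A by (intro eq_matI) auto
    moreover have "restrict (\<lambda>(i, k). A $$ (i, k)) ({..<n} \<times> {..<m}) \<in> ?F"
      by (simp only: restrict_PiE_iff) simp
    ultimately show "A \<in> (\<lambda>f. mat n m f) ` ?F" by (rule image_eqI)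
  qed
  show "finite ((\<lambda>f. mat n m f) ` ?F)" by (intro finite_imageI finite_PiE) auto
qed

lemma (in irr_char) char_inner_zero_iff:
  "char_inner G \<theta> \<chi> = 0 \<longleftrightarrow> (\<Sum>x\<in>carrier G. cnj (\<chi> x) * \<theta> x) = 0"
proof -
  have "Coset.order G > 0" using fin order_gt_0_iff_finite by blast
  then show ?thesis by (simp add: char_inner_def mult.commute)
qed

lemma (in mat_irr_char) true_level_sums:
  assumes "has_true_level \<epsilon> q n \<chi> j" "G = GL_eps \<epsilon> q n"
  shows "(\<Sum>x\<in>carrier G. cnj (\<chi> x) * weil_char \<epsilon> q n x ^ j) \<noteq> 0"
    and "i < j \<Longrightarrow> (\<Sum>x\<in>carrier G. cnj (\<chi> x) * weil_char \<epsilon> q n x ^ i) = 0"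
  using assms(1) irr unfolding has_true_level_def irreducible_constituent_def assms(2)[symmetric] char_inner_zero_iff
  by simp_all

lemma mv_scalar: "u \<in> vecs N \<Longrightarrow> mv (l \<cdot>\<^sub>m 1\<^sub>m N) u = smul l u"
  by (rule vecs_eqI[of _ N]) (auto simp: mv_def smul_def vecs_def if_distrib[of "\<lambda>x. x * _"] if_distrib[of "times l"] cong: if_cong)

text \<open>Take for \<open>h\<close> the matrix g divided by l: it is the product of g with the
  inverse of a central element, so \<open>chi_central\<close> applies, and h - 1 is a nonzero
  multiple of g - l.\<close>

lemma (in mat_irr_char) scalar_reduction:
  assumes z: "l \<cdot>\<^sub>m 1\<^sub>m N \<in> carrier G" and l: "l \<noteq> 0" and g: "g \<in> carrier G"
    and kd: "kernel_dim (g - l \<cdot>\<^sub>m 1\<^sub>m N) = k"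
  obtains h where "h \<in> carrier G" "kernel_dim (h - 1\<^sub>m N) = k"
    "\<chi> g / \<chi> (1\<^sub>m N) * (cnj (\<chi> (l \<cdot>\<^sub>m 1\<^sub>m N)) / \<chi> (1\<^sub>m N)) = \<chi> h / \<chi> (1\<^sub>m N)"
proof -
  let ?z = "l \<cdot>\<^sub>m 1\<^sub>m N" and ?h = "inverse l \<cdot>\<^sub>m g"
  have sm: "c \<cdot>\<^sub>m 1\<^sub>m N * x = c \<cdot>\<^sub>m x" "x * (c \<cdot>\<^sub>m 1\<^sub>m N) = c \<cdot>\<^sub>m x" if "x \<in> carrier_mat N N" for c and x :: "'a mat"
    using that by (simp_all add: mult_smult_assoc_mat[of "1\<^sub>m N" N N x N] mult_smult_distrib[of x N N "1\<^sub>m N" N])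
  have gc: "g \<in> carrier_mat N N" by (rule carrier_matG[OF g])
  have "?z \<otimes> (inv ?z \<otimes> g) = g" using z g by (simp add: m_assoc[symmetric])
  moreover have ic: "inv ?z \<otimes> g \<in> carrier_mat N N" using carrier_matG z g by simp
  ultimately have e: "l \<cdot>\<^sub>m (inv ?z \<otimes> g) = g" by (simp add: mult_eq sm)
  have "inverse l \<cdot>\<^sub>m (l \<cdot>\<^sub>m (inv ?z \<otimes> g)) = inv ?z \<otimes> g"
    using l ic by (intro eq_matI) auto
  then have h: "inv ?z \<otimes> g = ?h" unfolding e ..
  have "?h - 1\<^sub>m N = inverse l \<cdot>\<^sub>m (g - ?z)" using gc l by (intro eq_matI) (auto simp: algebra_simps)
  then have "kernel_dim (?h - 1\<^sub>m N) = k"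
    using kernel_dim_smult[of "g - ?z" N "inverse l"] l kd by (simp add: minus_carrier_mat)
  moreover have "\<chi> g / \<chi> \<one> * (cnj (\<chi> ?z) / \<chi> \<one>) = \<chi> (inv ?z \<otimes> g) / \<chi> \<one>"
    using sm carrier_matG by (intro chi_central z g) (simp add: mult_eq)
  ultimately show ?thesis using that[of ?h] z g unfolding one_eq h by (metis inv_closed m_closed h)
qed

context unitary_field
begin

text \<open>Both \<open>g\<^sup>T - l\<close> and \<open>g\<^sup>-\<^sup>T - l\<^sup>q\<close> have small rank, so that \<open>1 - l l\<^sup>q\<close> does.\<close>

lemma GU_eigenvalue:
  fixes g :: "'a mat"
  assumes g: "g \<in> carrier (GU_mat q N)" and kd: "kernel_dim (g - l \<cdot>\<^sub>m 1\<^sub>m N) = N - m" and m: "2 * m < N"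
  shows "l * l ^ q = 1"
proof -
  let ?A = "g - l \<cdot>\<^sub>m 1\<^sub>m N" and ?f = "\<lambda>x :: 'a. x ^ q"
  have gc: "g \<in> carrier_mat N N" and eq: "transpose_mat g * map_mat ?f g = 1\<^sub>m N"
    using g by (auto simp: carrier_GU carrier_GL_mat)
  have A: "?A \<in> carrier_mat N N" by (rule minus_carrier_mat) simp
  have fA: "factors_through N ?A m" using factors_through_kernel_dim[OF A] kd m by simp
  have "factors_through N (map_mat ?f ?A) m"
    by (rule factors_through_map[OF fA A]) (simp_all only: frob_0 frob_add power_mult_distrib)
  then have fB: "factors_through N (transpose_mat g * map_mat ?f ?A) m"
    by (rule factors_through_mult_left) (use A gc in auto)
  have fC: "factors_through N (((- (l ^ q)) \<cdot>\<^sub>m 1\<^sub>m N) * transpose_mat ?A) m"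
    by (rule factors_through_mult_left[OF factors_through_transpose[OF fA A]]) (use A in auto)
  have B: "transpose_mat g * map_mat ?f ?A = 1\<^sub>m N - l ^ q \<cdot>\<^sub>m transpose_mat g"
  proof -
    have "map_mat ?f ?A = map_mat ?f g - l ^ q \<cdot>\<^sub>m 1\<^sub>m N"
      using gc by (intro eq_matI) (auto simp: frob_diff)
    then have "transpose_mat g * map_mat ?f ?A = transpose_mat g * map_mat ?f g - transpose_mat g * (l ^ q \<cdot>\<^sub>m 1\<^sub>m N)"
      using gc by (simp add: mult_minus_distrib_mat[of _ N N])
    then show ?thesis using gc by (simp add: eq mult_smult_distrib[of _ N N "1\<^sub>m N" N])
  qed
  have C: "((- (l ^ q)) \<cdot>\<^sub>m 1\<^sub>m N) * transpose_mat ?A = (- (l ^ q)) \<cdot>\<^sub>m transpose_mat ?A"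
    using A by (simp add: mult_smult_assoc_mat[of "1\<^sub>m N" N N _ N])
  have "1 - l * l ^ q = 0"
  proof (rule factors_through_scalar_diff[OF _ _ fB fC])
    show "transpose_mat g * map_mat ?f ?A - ((- (l ^ q)) \<cdot>\<^sub>m 1\<^sub>m N) * transpose_mat ?A = (1 - l * l ^ q) \<cdot>\<^sub>m 1\<^sub>m N"
      unfolding B C using gc by (intro eq_matI) (auto simp: algebra_simps)
  qed (use A gc m in auto)
  then show ?thesis by simp
qed

lemma GU_scalar:
  assumes "l * l ^ q = 1"
  shows "l \<cdot>\<^sub>m 1\<^sub>m N \<in> carrier (GU_mat q N :: 'a mat monoid)"
proof (rule GU_I)
  fix u v :: "nat \<Rightarrow> 'a" assume "u \<in> vecs N" "v \<in> vecs N"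
  then show "h N (mv (l \<cdot>\<^sub>m 1\<^sub>m N) u) (mv (l \<cdot>\<^sub>m 1\<^sub>m N) v) = h N u v"
    using assms by (simp add: mv_scalar h_smul mult.assoc[symmetric]) (simp add: mult.commute)
qed simp

end

theorem theorem1:
  fixes \<epsilon> :: int and q N m j :: nat
    and \<chi> :: "'a::{field,finite} mat \<Rightarrow> complex"
    and g :: "'a mat" and lam :: "'a alg_closure"
  assumes "primepow q" and "\<epsilon> = 1 \<or> \<epsilon> = -1"
    and "CARD('a) = (if \<epsilon> = 1 then q else q\<^sup>2)"
    and "m > 0" and "j > 0"
    and "N \<ge> max (3 * j\<^sup>2 + j + 2 * m + 10) (2 * j\<^sup>2 + 4 * m + 5)"
    and "irreducible_character (GL_eps \<epsilon> q N) \<chi>"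
    and "has_true_level \<epsilon> q N \<chi> j"
    and "g \<in> carrier (GL_eps \<epsilon> q N)"
    and "mat_support g = m" and "primary_eigenvalue g lam"
  shows "\<exists>l :: 'a. to_ac l = lam \<and> l \<cdot>\<^sub>m 1\<^sub>m N \<in> carrier (GL_eps \<epsilon> q N) \<and>
    cmod (of_int (\<epsilon> * int q) ^ (m * j) * \<chi> g / \<chi> (1\<^sub>m N)
          * (cnj (\<chi> (l \<cdot>\<^sub>m 1\<^sub>m N)) / \<chi> (1\<^sub>m N)) - 1)
      < real q powr (- (real N / 2))"
proof -
  have N: "N \<ge> 3 * j\<^sup>2 + j + 2 * m + 10" "N \<ge> 2 * j\<^sup>2 + 4 * m + 5" using assms(6) by simp_all
  then have m: "2 * m < N" by linarith
  have subGL: "carrier (GL_eps \<epsilon> q N) \<subseteq> carrier (GL_mat N :: 'a mat monoid)"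
    by (auto simp: GL_eps_def GU_mat_def)
  then have gGL: "g \<in> carrier (GL_mat N)" using assms(9) by blast
  then have gc: "g \<in> carrier_mat N N" by (simp add: carrier_GL_mat)
  have finG: "finite (carrier (GL_eps \<epsilon> q N :: 'a mat monoid))"
    by (rule finite_subset[OF _ finite_carrier_mat[of N N]]) (use subGL in \<open>auto simp: carrier_GL_mat\<close>)
  have dim: "eigenspace_dim g lam = N - m" using assms(10,11) gc by (simp add: primary_eigenvalue_def)
  obtain p e where pe: "prime p" "q = p ^ e" using assms(1) by (auto simp: primepow_def)
  have "CARD('a) = p ^ (if \<epsilon> = 1 then e else e * 2)" using assms(3) pe(2) by (simp add: power_mult)
  then have "CARD('a) = CHAR('a) ^ (if \<epsilon> = 1 then e else e * 2)" using CHAR_eq_of_card pe(1) by metis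
  then obtain l where l: "to_ac l = lam" "kernel_dim (g - l \<cdot>\<^sub>m 1\<^sub>m N) = N - m"
    by (rule large_eigenvalue_in_base[OF gc _ dim m])
  have l0: "l \<noteq> 0" by (rule large_eigenvalue_nonzero[OF gGL l(2)]) (use m in simp)
  have goal: ?thesis if z: "l \<cdot>\<^sub>m 1\<^sub>m N \<in> carrier (GL_eps \<epsilon> q N)"
    and h: "\<chi> g / \<chi> (1\<^sub>m N) * (cnj (\<chi> (l \<cdot>\<^sub>m 1\<^sub>m N)) / \<chi> (1\<^sub>m N)) = x"
    and est: "cmod (of_int (\<epsilon> * int q) ^ (m * j) * x - 1) < real q powr (- (real N / 2))" for x
  proof -
    have "of_int (\<epsilon> * int q) ^ (m * j) * \<chi> g / \<chi> (1\<^sub>m N) * (cnj (\<chi> (l \<cdot>\<^sub>m 1\<^sub>m N)) / \<chi> (1\<^sub>m N)) =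
        of_int (\<epsilon> * int q) ^ (m * j) * x" unfolding h[symmetric] by simp
    then show ?thesis using l(1) z est by (intro exI[of _ l]) simp
  qed
  show ?thesis
  proof (cases "\<epsilon> = 1")
    case True
    have G: "GL_eps \<epsilon> q N = (GL_mat N :: 'a mat monoid)" using True by (simp add: GL_eps_def)
    have card: "CARD('a) = q" using assms(3) True by simp
    interpret mat_irr_char "GL_mat N" \<chi> N
      using group_GL_mat finG assms(7) unfolding G
      by (intro mat_irr_char.intro irr_char.intro mat_irr_char_axioms.intro) (simp_all add: GL_mat_simps)
    \<comment> \<open>For \<epsilon> = 1 the Weil character is the permutation character on
      V.\<close>
    have w: "weil_char \<epsilon> q N x ^ i = of_nat (fixn x ^ i)" if "x \<in> carrier (GL_mat N)" for x :: "'a mat" and i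
      using that by (simp add: weil_char_def True fixn_power card)
    have "(\<Sum>x\<in>carrier (GL_mat N). cnj (\<chi> x) * of_nat (fixn x ^ j)) \<noteq> 0"
      using true_level_sums(1)[OF assms(8) G[symmetric]] by (simp add: w)
    moreover have "(\<Sum>x\<in>carrier (GL_mat N). cnj (\<chi> x) * of_nat (fixn x ^ (j - 1))) = 0"
      using true_level_sums(2)[OF assms(8) G[symmetric], of "j - 1"] assms(5) by (simp add: w)
    ultimately interpret GL_level \<chi> N j using assms(5) by unfold_locales
    have z: "l \<cdot>\<^sub>m 1\<^sub>m N \<in> carrier (GL_mat N)" using l0 by (simp add: carrier_GL_mat)
    obtain h where h: "h \<in> carrier (GL_mat N)" "kernel_dim (h - 1\<^sub>m N) = N - m"
      "\<chi> g / \<chi> (1\<^sub>m N) * (cnj (\<chi> (l \<cdot>\<^sub>m 1\<^sub>m N)) / \<chi> (1\<^sub>m N)) = \<chi> h / \<chi> (1\<^sub>m N)"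
      by (rule scalar_reduction[OF z l0 gGL l(2)])
    have "cmod (of_nat (CARD('a) ^ (m * j)) * (\<chi> h / \<chi> (1\<^sub>m N)) - 1) < real CARD('a) powr (- (real N / 2))"
      by (rule GL_estimate[OF h(1) _ assms(4) N]) (use h in \<open>simp add: fixn_power\<close>)
    then show ?thesis by (intro goal[OF _ h(3)]) (use z G in \<open>simp_all add: card True\<close>)
  next
    case False
    then have eps: "\<epsilon> = - 1" using assms(2) by simp
    have G: "GL_eps \<epsilon> q N = (GU_mat q N :: 'a mat monoid)" using False by (simp add: GL_eps_def)
    have card: "CARD('a) = q\<^sup>2" using assms(3) False by simp
    interpret unitary_field q "TYPE('a)" using assms(1) card by unfold_locales
    obtain \<phi> :: "'a \<Rightarrow> complex" and \<gamma> where "unitary_char q \<phi> \<gamma>" using unitary_char_exists by blast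
    then interpret unitary_char q "TYPE('a)" \<phi> \<gamma> .
    interpret mat_irr_char "GU_mat q N" \<chi> N
      using group_GU finG assms(7) subGL unfolding G
      by (intro mat_irr_char.intro irr_char.intro mat_irr_char_axioms.intro) (simp_all add: GU_simps)
    interpret unitary_weil q "TYPE('a)" \<phi> \<gamma> \<chi> N ..
    \<comment> \<open>The sign does not depend on x, so it does not affect whether the sums against
      \<chi> vanish.\<close>
    have w: "weil_char \<epsilon> q N x ^ i = (- 1) ^ (N * i) * (- of_nat q) ^ (kernel_dim (x - 1\<^sub>m N) * i)" for x :: "'a mat" and i
      by (simp add: weil_char_def eps power_mult_distrib power_mult)
    have s: "(\<Sum>x\<in>carrier (GU_mat q N). cnj (\<chi> x) * weil_char \<epsilon> q N x ^ i) =
        (- 1) ^ (N * i) * (\<Sum>x\<in>carrier (GU_mat q N). cnj (\<chi> x) * (- of_nat q) ^ (kernel_dim (x - 1\<^sub>m N) * i))" for i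
      unfolding w sum_distrib_left by (simp only: mult.left_commute)
    have "(\<Sum>x\<in>carrier (GU_mat q N). cnj (\<chi> x) * (- of_nat q) ^ (kernel_dim (x - 1\<^sub>m N) * j)) \<noteq> 0"
      using true_level_sums(1)[OF assms(8) G[symmetric]] unfolding s by simp
    \<comment> \<open>For j = 1 the truncated j - 2 is 0, which is still below j.\<close>
    moreover have "(\<Sum>x\<in>carrier (GU_mat q N). cnj (\<chi> x) * (- of_nat q) ^ (kernel_dim (x - 1\<^sub>m N) * (j - 2))) = 0"
      using true_level_sums(2)[OF assms(8) G[symmetric], of "j - 2"] assms(5) unfolding s by simp
    ultimately interpret unitary_level q "TYPE('a)" \<phi> \<gamma> \<chi> N j using assms(5) by unfold_locales
    have gU: "g \<in> carrier (GU_mat q N)" using assms(9) unfolding G .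
    have z: "l \<cdot>\<^sub>m 1\<^sub>m N \<in> carrier (GU_mat q N)"
      by (rule GU_scalar[OF GU_eigenvalue[OF gU l(2) m]])
    obtain h where h: "h \<in> carrier (GU_mat q N)" "kernel_dim (h - 1\<^sub>m N) = N - m"
      "\<chi> g / \<chi> (1\<^sub>m N) * (cnj (\<chi> (l \<cdot>\<^sub>m 1\<^sub>m N)) / \<chi> (1\<^sub>m N)) = \<chi> h / \<chi> (1\<^sub>m N)"
      by (rule scalar_reduction[OF z l0 gU l(2)])
    have "cmod ((- of_nat q) ^ (m * j) * (\<chi> h / \<chi> (1\<^sub>m N)) - 1) < real q powr (- (real N / 2))"
      by (rule U_estimate[OF h(1) _ N]) (simp add: kk_def h(2))
    then show ?thesis by (intro goal[OF _ h(3)]) (use z G in \<open>simp_all add: eps\<close>)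
  qed
qed

end
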